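(* There is an algorithm which, given an $n$-vertex graph $G$ of maximum degree at most $\Delta$ and an $m$-vertex graph $H$, computes $\mathrm{ind}(H,G)$ in time $\tilde{O}\big(n(4\Delta)^{2m}+2^{10m}\big)$, where the $\tilde{O}$-notation means that polynomial factors in $m$ are suppressed.
   Context: For graphs $H$ and $G$, $\mathrm{ind}(H,G)$ denotes the number of subsets $S\subseteq V(G)$ such that the induced subgraph $G[S]$ is isomorphic to $H$. The computational model is the standard word-RAM model with logarithmic-sized words. *)

theory Defs
  imports Complex_Main
begin

section \<open>Finite simple graphs and induced subgraph counts\<close>

type_synonym 'a graph = "'a set \<times> 'a set set"

abbreviation verts :: "'a graph \<Rightarrow> 'a set" where "verts \<equiv> fst"
abbreviation edges :: "'a graph \<Rightarrow> 'a set set" where "edges \<equiv> snd"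

definition simple_graph :: "'a graph \<Rightarrow> bool" where
  "simple_graph G \<longleftrightarrow>
     finite (verts G) \<and> (\<forall>e \<in> edges G. e \<subseteq> verts G \<and> card e = 2)"

definition nbrs :: "'a graph \<Rightarrow> 'a \<Rightarrow> 'a set" where
  "nbrs G v = {u. {u, v} \<in> edges G}"

definition max_degree_at_most :: "'a graph \<Rightarrow> nat \<Rightarrow> bool" where
  "max_degree_at_most G \<Delta> \<longleftrightarrow> (\<forall>v \<in> verts G. card (nbrs G v) \<le> \<Delta>)"

definition induced_subgraph :: "'a graph \<Rightarrow> 'a set \<Rightarrow> 'a graph" where
  "induced_subgraph G S = (S, {e \<in> edges G. e \<subseteq> S})"

definition isomorphic :: "'a graph \<Rightarrow> 'b graph \<Rightarrow> bool" where
  "isomorphic G H \<longleftrightarrow>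
     (\<exists>f. bij_betw f (verts G) (verts H) \<and>
        (\<forall>u \<in> verts G. \<forall>v \<in> verts G. {u, v} \<in> edges G \<longleftrightarrow> {f u, f v} \<in> edges H))"

definition ind :: "'b graph \<Rightarrow> 'a graph \<Rightarrow> nat" where
  "ind H G = card {S. S \<subseteq> verts G \<and> isomorphic (induced_subgraph G S) H}"

section \<open>The word RAM\<close>

text \<open>
  A word of length w is a natural number below 2 ^ w. The word length depends on the input
  while the program does not, so it is a parameter of the semantics rather than a type.
  A program mentions only finitely many registers. The memory consists of the cells whose
  address is a word. Every instruction takes one unit of time.
\<close>

datatype binop = Add | Sub | Mul | Div | Mod | And | Or | Xor | Shl | Shr

datatype instr =
    Const nat nat           \<comment> \<open>destination register, literal\<close>
  | Op binop nat nat nat    \<comment> \<open>operation, destination register, two source registers\<close>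
  | Load nat nat            \<comment> \<open>destination register, register holding the address\<close>
  | Store nat nat           \<comment> \<open>register holding the address, source register\<close>
  | Jump nat                \<comment> \<open>absolute target\<close>
  | JumpZero nat nat        \<comment> \<open>tested register, target\<close>
  | JumpLess nat nat nat    \<comment> \<open>two compared registers, target\<close>

type_synonym program = "instr list"

record config =
  pc :: nat
  reg :: "nat \<Rightarrow> nat"
  mem :: "nat \<Rightarrow> nat"

text \<open>All results are reduced modulo 2 ^ w by take_bit; Sub wraps around.\<close>

fun binop_val :: "nat \<Rightarrow> binop \<Rightarrow> nat \<Rightarrow> nat \<Rightarrow> nat" where
  "binop_val w Add x y = take_bit w (x + y)"
| "binop_val w Sub x y = take_bit w (x + 2 ^ w - y)"
| "binop_val w Mul x y = take_bit w (x * y)"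
| "binop_val w Div x y = take_bit w (x div y)"
| "binop_val w Mod x y = take_bit w (x mod y)"
| "binop_val w And x y = take_bit w (Bit_Operations.and x y)"
| "binop_val w Or x y = take_bit w (Bit_Operations.or x y)"
| "binop_val w Xor x y = take_bit w (Bit_Operations.xor x y)"
| "binop_val w Shl x y = take_bit w (push_bit y x)"
| "binop_val w Shr x y = take_bit w (drop_bit y x)"

fun exec :: "nat \<Rightarrow> instr \<Rightarrow> config \<Rightarrow> config" where
  "exec w (Const r c) s =
     s\<lparr>pc := Suc (pc s), reg := (reg s)(r := take_bit w c)\<rparr>"
| "exec w (Op f r a b) s =
     s\<lparr>pc := Suc (pc s), reg := (reg s)(r := binop_val w f (reg s a) (reg s b))\<rparr>"
| "exec w (Load r a) s =
     s\<lparr>pc := Suc (pc s), reg := (reg s)(r := mem s (reg s a))\<rparr>"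
| "exec w (Store a r) s =
     s\<lparr>pc := Suc (pc s), mem := (mem s)(reg s a := reg s r)\<rparr>"
| "exec w (Jump l) s = s\<lparr>pc := l\<rparr>"
| "exec w (JumpZero r l) s = s\<lparr>pc := (if reg s r = 0 then l else Suc (pc s))\<rparr>"
| "exec w (JumpLess a b l) s = s\<lparr>pc := (if reg s a < reg s b then l else Suc (pc s))\<rparr>"

text \<open>A program halts by leaving its code; halted configurations are fixed points of step.\<close>

definition halted :: "program \<Rightarrow> config \<Rightarrow> bool" where
  "halted P s \<longleftrightarrow> length P \<le> pc s"

definition step :: "nat \<Rightarrow> program \<Rightarrow> config \<Rightarrow> config" where
  "step w P s = (if halted P s then s else exec w (P ! pc s) s)"

text \<open>
  The input occupies the memory from address 0 on, all other cells are 0, and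
  register 0 holds the word length.
\<close>

definition initial :: "nat \<Rightarrow> nat list \<Rightarrow> config" where
  "initial w xs =
     \<lparr>pc = 0,
      reg = (\<lambda>r. if r = 0 then w else 0),
      mem = (\<lambda>a. if a < length xs then xs ! a else 0)\<rparr>"

text \<open>
  An output number may need several words. It is stored in base 2 ^ w, least significant word
  first; registers 0 and 1 hold its address and its number of words.
\<close>

definition output_value :: "nat \<Rightarrow> config \<Rightarrow> nat" where
  "output_value w s = (\<Sum>i < reg s 1. mem s (reg s 0 + i) * 2 ^ (w * i))"

definition computes_within :: "nat \<Rightarrow> program \<Rightarrow> nat list \<Rightarrow> nat \<Rightarrow> nat \<Rightarrow> bool" where
  "computes_within w P xs t y \<longleftrightarrow>
     (let s = (step w P ^^ t) (initial w xs) in halted P s \<and> output_value w s = y)"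

section \<open>Graphs as inputs\<close>

text \<open>The neighbours of a vertex may be listed in any order.\<close>

definition adjacency_lists :: "nat graph \<Rightarrow> nat list list \<Rightarrow> bool" where
  "adjacency_lists G A \<longleftrightarrow>
     verts G = {..<length A} \<and>
     (\<forall>v < length A. distinct (A ! v) \<and> set (A ! v) = nbrs G v)"

text \<open>
  Adjacency array: the number n of vertices, then n + 1 offsets, then the concatenated adjacency
  lists. The neighbours of v are the entries from offset v up to (excluding) offset v + 1 of the
  concatenation; the last offset is the total length.
\<close>

definition encode :: "nat list list \<Rightarrow> nat list" where
  "encode A =
     length A # map (\<lambda>v. length (concat (take v A))) [0..<Suc (length A)] @ concat A"

end

theory Submission
  imports Defs "HOL-Library.FuncSet" "HOL-Library.Nat_Bijection" "HOL-Combinatorics.Permutations" "HOL-Computational_Algebra.Primes"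
begin

text \<open>
  A subset T of G induces a copy of H iff some bijection from T onto the vertices of H preserves adjacency and
  degrees inside T. For a set X of vertices of H let hw X T count the maps from T to X that preserve adjacency and
  carry degrees in G[T] to degrees in H; the bijections are recovered from the numbers hw X T by inclusion-exclusion
  over X. Since hw X is multiplicative over disjoint sets without edges between them, the generating function
  of hw X over the subsets of G can be built one vertex at a time, each step involving only a search over small
  connected sets, of which there are few in a graph of bounded degree. The generating function is kept as a single
  number in place of a polynomial, by substituting a large power of the digit base for its variable and truncating.
  Running the same algorithm on H itself counts the automorphisms of H, and the quotient is ind H G.
\<close>


text \<open>Requiring non-edges to go to non-edges would couple distant vertices and destroy
  multiplicativity; equality of degrees is a local substitute, and for edge-preserving bijections it
  amounts to the same. Put g(I,U) for the sum of hw X T z^|T| over I \<subseteq> T \<subseteq> I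
  \<union> U. As g({},U) is 1 modulo z, the ratio R(I,U) = -g(I,U) / g({},U) makes sense modulo
  powers of z. Splitting both sums at a neighbour x of I, with V = U - {x}, gives R(I,U) = (R(I+x,V)
  + R(I,V)) / (1 - R(x,V)), a geometric series because z divides R(x,V). If I has no neighbour in U,
  then R(I,U) = -hw X I z^|I| whatever U is. The generating function of the whole graph is the
  product of all 1 - R(i, {i+1, ...}). Everything is computed modulo z^(m+1), so intermediate
  coefficients may overflow; only the final coefficient of z^m must be below z. Per start vertex
  there are about (6D)^m recursive calls and D^m maps at a leaf, and there are 2^m sets X: (12
  D^2)^m is at most (4D)^(2m). For \<Delta> = 0 and m > 0 the time bound does not grow with n, so G
  must not even be read; falling factorials or the answer 0 settle that case.\<close>

section \<open>A structured language with explicit time bounds\<close>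

datatype exp = Num nat | Var nat | Bin binop exp exp | Arr nat exp exp | Inp exp

datatype com =
    Asg nat exp
  | Put nat exp exp exp
  | Seq com com (infixr \<open>;;\<close> 60)
  | Cond exp exp com com  \<comment> \<open>executes the first branch if the first value is less than the second\<close>
  | For nat nat com

text \<open>\<open>com\<close> contains only counted loops, whose time is known on entry. Loops with
  a data-dependent number of rounds, as in the searches, need \<open>While\<close> and are timed
  along the run.\<close>

datatype prog = Do com | Then prog prog (infixr \<open>\<then>\<close> 55) | While nat prog

record st =
  vr :: "nat \<Rightarrow> nat"
  ar :: "nat \<Rightarrow> nat \<Rightarrow> nat \<Rightarrow> nat"

definition setv :: "nat \<Rightarrow> nat \<Rightarrow> st \<Rightarrow> st" where
  "setv x v s = \<lparr>vr = (vr s)(x := v), ar = ar s\<rparr>"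

definition seta :: "nat \<Rightarrow> nat \<Rightarrow> nat \<Rightarrow> nat \<Rightarrow> st \<Rightarrow> st" where
  "seta a i j v s = \<lparr>vr = vr s, ar = (ar s)(a := (ar s a)(i := (ar s a i)(j := v)))\<rparr>"

lemma setv_simps [simp]: "vr (setv x v s) = (vr s)(x := v)" "ar (setv x v s) = ar s"
  by (simp_all add: setv_def)

lemma seta_simps [simp]: "vr (seta a i j v s) = vr s"
  "ar (seta a i j v s) = (ar s)(a := (ar s a)(i := (ar s a i)(j := v)))"
  by (simp_all add: seta_def)

text \<open>Registers below this number are program variables; the compiler evaluates expressions in
  the registers from it on.\<close>

abbreviation (input) nvars :: nat where "nvars \<equiv> 100"
abbreviation (input) narrs :: nat where "narrs \<equiv> 20"

primrec floop :: "(nat \<Rightarrow> 's \<Rightarrow> 's) \<Rightarrow> nat \<Rightarrow> 's \<Rightarrow> 's" where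
  "floop f 0 s = s"
| "floop f (Suc k) s = f k (floop f k s)"

fun wfe :: "exp \<Rightarrow> bool" where
  "wfe (Num c) = True"
| "wfe (Var x) = (x < nvars)"
| "wfe (Bin f a b) = (wfe a \<and> wfe b)"
| "wfe (Arr a i j) = (a < narrs \<and> wfe i \<and> wfe j)"
| "wfe (Inp e) = wfe e"

fun writes :: "com \<Rightarrow> nat list" where
  "writes (Asg x e) = [x]"
| "writes (Put a i j e) = []"
| "writes (c1 ;; c2) = writes c1 @ writes c2"
| "writes (Cond a b c1 c2) = writes c1 @ writes c2"
| "writes (For i p c) = i # writes c"

fun awrites :: "com \<Rightarrow> nat list" where
  "awrites (Asg x e) = []"
| "awrites (Put a i j e) = [a]"
| "awrites (c1 ;; c2) = awrites c1 @ awrites c2"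
| "awrites (Cond a b c1 c2) = awrites c1 @ awrites c2"
| "awrites (For i p c) = awrites c"

fun lvars :: "com \<Rightarrow> nat list" where
  "lvars (Asg x e) = []"
| "lvars (Put a i j e) = []"
| "lvars (c1 ;; c2) = lvars c1 @ lvars c2"
| "lvars (Cond a b c1 c2) = lvars c1 @ lvars c2"
| "lvars (For i p c) = p # lvars c"

text \<open>Registers 0 to 3 are reserved: 0 holds the word length, 2 and 3 hold the side S of the
  arrays and the size B of the input region, which the address computations read.\<close>

fun wfc :: "com \<Rightarrow> bool" where
  "wfc (Asg x e) = (3 < x \<and> x < nvars \<and> wfe e)"
| "wfc (Put a i j e) = (a < narrs \<and> wfe i \<and> wfe j \<and> wfe e)"
| "wfc (c1 ;; c2) = (wfc c1 \<and> wfc c2)"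
| "wfc (Cond a b c1 c2) = (wfe a \<and> wfe b \<and> wfc c1 \<and> wfc c2)"
| "wfc (For i p c) = (3 < i \<and> i < nvars \<and> p < nvars \<and> i \<notin> set (writes c) \<and> wfc c)"

text \<open>Loop bounds are never assigned inside a block, so the running time of a block is a function
  of the values of these variables on entry.\<close>

definition okc :: "com \<Rightarrow> bool" where
  "okc c \<longleftrightarrow> wfc c \<and> list_all (\<lambda>p. p \<notin> set (writes c)) (lvars c)"

locale lang =
  fixes w S B :: nat and inp :: "nat \<Rightarrow> nat"
begin

text \<open>Indices are reduced modulo S and input addresses modulo B, and the compiled code does
  the same. No access can then leave its region, whatever the values are.\<close>

fun ev :: "st \<Rightarrow> exp \<Rightarrow> nat" where
  "ev s (Num c) = c mod 2 ^ w"
| "ev s (Var x) = vr s x"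
| "ev s (Bin f a b) = binop_val w f (ev s a) (ev s b)"
| "ev s (Arr a i j) = ar s a (ev s i mod S) (ev s j mod S)"
| "ev s (Inp e) = inp (ev s e mod B)"

fun sem :: "com \<Rightarrow> st \<Rightarrow> st" where
  "sem (Asg x e) s = setv x (ev s e) s"
| "sem (Put a i j e) s = seta a (ev s i mod S) (ev s j mod S) (ev s e) s"
| "sem (c1 ;; c2) s = sem c2 (sem c1 s)"
| "sem (Cond a b c1 c2) s = (if ev s a < ev s b then sem c1 s else sem c2 s)"
| "sem (For i p c) s = setv i (vr s p) (floop (\<lambda>k s. sem c (setv i k s)) (vr s p) s)"

definition bnd :: "st \<Rightarrow> bool" where
  "bnd s \<longleftrightarrow> (\<forall>x. vr s x < 2 ^ w) \<and> (\<forall>a i j. ar s a i j < 2 ^ w)"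

lemma vr_frame: "x \<notin> set (writes c) \<Longrightarrow> vr (sem c s) x = vr s x"
proof (induction c arbitrary: s)
  case (For i p c)
  have "vr (floop (\<lambda>k s. sem c (setv i k s)) n s) x = vr s x" for n
    using For by (induction n) auto
  then show ?case using For.prems by simp
qed auto

lemma ar_frame: "a \<notin> set (awrites c) \<Longrightarrow> ar (sem c s) a = ar s a"
proof (induction c arbitrary: s)
  case (For i p c)
  have "ar (floop (\<lambda>k s. sem c (setv i k s)) n s) a = ar s a" for n
    using For by (induction n) auto
  then show ?case using For.prems by simp
qed auto

lemma binop_bound: "binop_val w f x y < 2 ^ w"
  by (cases f) (simp_all add: take_bit_eq_mod)

lemma ev_bound: "bnd s \<Longrightarrow> \<forall>a<B. inp a < 2 ^ w \<Longrightarrow> 0 < B \<Longrightarrow> ev s e < 2 ^ w"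
  by (induction e) (auto simp: bnd_def binop_bound)

lemma bnd_upd: "bnd s \<Longrightarrow> v < 2 ^ w \<Longrightarrow> bnd (setv x v s)"
  by (simp add: bnd_def)

lemma bnd_sem:
  assumes i: "\<forall>a<B. inp a < 2 ^ w" "0 < B"
  shows "bnd s \<Longrightarrow> bnd (sem c s)"
proof (induction c arbitrary: s)
  case (Asg x e)
  then show ?case using ev_bound[OF Asg i] by (simp add: bnd_def)
next
  case (Put a i' j e)
  then show ?case using ev_bound[OF Put i] by (simp add: bnd_def)
next
  case (For i p c)
  have p: "vr s p < 2 ^ w" using For.prems by (simp add: bnd_def)
  have "n \<le> vr s p \<Longrightarrow> bnd (floop (\<lambda>k s. sem c (setv i k s)) n s)" for n
  proof (induction n)
    case 0 then show ?case using For.prems by simp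
  next
    case (Suc n)
    have "n < 2 ^ w" using Suc.prems p by linarith
    then show ?case using For.IH bnd_upd Suc by simp
  qed
  from this[OF order_refl] show ?case using bnd_upd p by simp
qed auto

subsection \<open>Compilation\<close>

text \<open>Address B + (a S + i) S + j, with i in register r and j in r + 1: the arrays lie behind
  the input one after the other, each stored row by row.\<close>

definition adr :: "nat \<Rightarrow> nat \<Rightarrow> nat \<Rightarrow> instr list" where
  "adr a r t = [Op Mod r r 2, Op Mod (r+1) (r+1) 2, Const t a, Op Mul t t 2, Op Add r r t,
     Op Mul r r 2, Op Add r r (r+1), Op Add r r 3]"

fun ecode :: "exp \<Rightarrow> nat \<Rightarrow> instr list" where
  "ecode (Num c) r = [Const r c]"
| "ecode (Var x) r = [Op Or r x x]"
| "ecode (Bin f a b) r = ecode a r @ ecode b (r+1) @ [Op f r r (r+1)]"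
| "ecode (Arr a i j) r = ecode i r @ ecode j (r+1) @ adr a r (r+2) @ [Load r r]"
| "ecode (Inp e) r = ecode e r @ [Op Mod r r 3, Load r r]"

fun elen :: "exp \<Rightarrow> nat" where
  "elen (Num c) = 1"
| "elen (Var x) = 1"
| "elen (Bin f a b) = elen a + elen b + 1"
| "elen (Arr a i j) = elen i + elen j + 9"
| "elen (Inp e) = elen e + 2"

lemma length_ecode [simp]: "length (ecode e r) = elen e"
  by (induction e arbitrary: r) (simp_all add: adr_def)

text \<open>The number \<open>l\<close> is the position at which the code will stand, since jump
  targets are absolute.\<close>

fun ccode :: "com \<Rightarrow> nat \<Rightarrow> instr list" where
  "ccode (Asg x e) l = ecode e nvars @ [Op Or x nvars nvars]"
| "ccode (Put a i j e) l =
     ecode i nvars @ ecode j (nvars+1) @ ecode e (nvars+2) @ adr a nvars (nvars+3) @ [Store nvars (nvars+2)]"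
| "ccode (c1 ;; c2) l = (let x = ccode c1 l in x @ ccode c2 (l + length x))"
| "ccode (Cond a b c1 c2) l =
     (let x = ecode a nvars @ ecode b (nvars+1); l1 = l + length x + 1; y = ccode c2 l1;
        l2 = l1 + length y + 1; z = ccode c1 l2
      in x @ [JumpLess nvars (nvars+1) l2] @ y @ [Jump (l2 + length z)] @ z)"
| "ccode (For i p c) l =
     (let x = ccode c (l+3) in
      [Const i 0, JumpLess i p (l+3), Jump (l + 6 + length x)] @ x @
      [Const nvars 1, Op Add i i nvars, Jump (l+1)])"

fun pcode :: "prog \<Rightarrow> nat \<Rightarrow> instr list" where
  "pcode (Do c) l = ccode c l"
| "pcode (p \<then> q) l = (let x = pcode p l in x @ pcode q (l + length x))"
| "pcode (While v p) l = (let x = pcode p (l+1) in [JumpZero v (l + 2 + length x)] @ x @ [Jump l])"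

text \<open>Both branches of a conditional are charged. The bound then depends on the state only
  through the loop bounds \<open>env\<close>.\<close>

fun cb :: "(nat \<Rightarrow> nat) \<Rightarrow> com \<Rightarrow> nat" where
  "cb env (Asg x e) = elen e + 1"
| "cb env (Put a i j e) = elen i + elen j + elen e + 9"
| "cb env (c1 ;; c2) = cb env c1 + cb env c2"
| "cb env (Cond a b c1 c2) = elen a + elen b + 2 + cb env c1 + cb env c2"
| "cb env (For i p c) = 3 + env p * (4 + cb env c)"

text \<open>The time index is an upper bound, with slack in every rule, so costs can be rounded up
  anywhere in a derivation.\<close>

inductive runs :: "prog \<Rightarrow> st \<Rightarrow> nat \<Rightarrow> st \<Rightarrow> bool" where
  runs_Do: "okc c \<Longrightarrow> cb (vr s) c \<le> t \<Longrightarrow> runs (Do c) s t (sem c s)"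
| runs_Then: "runs p s t s' \<Longrightarrow> runs q s' t' s'' \<Longrightarrow> t + t' \<le> T \<Longrightarrow> runs (p \<then> q) s T s''"
| runs_While0: "vr s x = 0 \<Longrightarrow> x < nvars \<Longrightarrow> 1 \<le> t \<Longrightarrow> runs (While x p) s t s"
| runs_While1: "vr s x \<noteq> 0 \<Longrightarrow> x < nvars \<Longrightarrow> runs p s t s' \<Longrightarrow> runs (While x p) s' t' s'' \<Longrightarrow> t + t' + 2 \<le> T
    \<Longrightarrow> runs (While x p) s T s''"

text \<open>Progress inside a loop that is not yet finished. Quantifying over all completions lets
  the phases of one long loop be composed although no single phase is a run of the loop.\<close>

definition loopto :: "nat \<Rightarrow> prog \<Rightarrow> st \<Rightarrow> nat \<Rightarrow> st \<Rightarrow> bool" where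
  "loopto x p s t s' \<longleftrightarrow> (\<forall>t2 s2. runs (While x p) s' t2 s2 \<longrightarrow> runs (While x p) s (t + t2) s2)"

lemma loopto_refl: "loopto x p s 0 s" by (simp add: loopto_def)

lemma loopto_trans:
  "loopto x p s t s' \<Longrightarrow> loopto x p s' t' s'' \<Longrightarrow> loopto x p s (t + t') s''"
  by (auto simp: loopto_def add.assoc)

lemma loopto_step: "vr s x \<noteq> 0 \<Longrightarrow> x < nvars \<Longrightarrow> runs p s t s' \<Longrightarrow> loopto x p s (t + 2) s'"
  unfolding loopto_def by (auto intro: runs_While1)

lemma runs_mono: "runs p s t s' \<Longrightarrow> t \<le> t' \<Longrightarrow> runs p s t' s'"
proof (induction arbitrary: t' rule: runs.induct)
  case (runs_Do c s t) then show ?case by (meson order_trans runs.runs_Do)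
next
  case (runs_Then p s t s' q t' s'' T) then show ?case by (meson order_trans runs.runs_Then)
next
  case (runs_While0 s x t p) then show ?case by (meson order_trans runs.runs_While0)
next
  case (runs_While1 s x p t s' t' s'' T) then show ?case by (meson order_trans runs.runs_While1)
qed

lemma loopto_mono: "loopto x p s t s' \<Longrightarrow> t \<le> t' \<Longrightarrow> loopto x p s t' s'"
  unfolding loopto_def by (meson runs_mono add_le_mono order_refl)

lemma runs_of_loopto: "loopto x p s t s' \<Longrightarrow> vr s' x = 0 \<Longrightarrow> x < nvars \<Longrightarrow> runs (While x p) s (t + 1) s'"
  unfolding loopto_def using runs_While0[of s' x 1 p] by (metis order_refl)

end


section \<open>Simulation of the language by the RAM\<close>

definition seg :: "program \<Rightarrow> nat \<Rightarrow> program \<Rightarrow> bool" where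
  "seg P b c \<longleftrightarrow> (\<exists>u v. P = u @ c @ v \<and> length u = b)"

lemma seg_append: "seg P b (c @ d) \<longleftrightarrow> seg P b c \<and> seg P (b + length c) d"
proof
  assume "seg P b (c @ d)"
  then obtain u v where "P = u @ (c @ d) @ v" "length u = b" by (auto simp: seg_def)
  then have "P = u @ c @ (d @ v)" "P = (u @ c) @ d @ v" "length (u @ c) = b + length c" by auto
  then show "seg P b c \<and> seg P (b + length c) d" using \<open>length u = b\<close> unfolding seg_def by blast
next
  assume "seg P b c \<and> seg P (b + length c) d"
  then obtain u v u' v' where *: "P = u @ c @ v" "length u = b" "P = u' @ d @ v'" "length u' = b + length c"
    unfolding seg_def by blast
  then have "take (b + length c) P = u @ c" by simp
  moreover have "take (b + length c) P = u'" unfolding *(3) using *(4) by simp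
  ultimately have "u' = u @ c" by simp
  then have "P = u @ (c @ d) @ v'" using * by simp
  then show "seg P b (c @ d)" using * unfolding seg_def by blast
qed

lemma seg_Cons: "seg P b (i # c) \<longleftrightarrow> seg P b [i] \<and> seg P (Suc b) c"
  using seg_append[of P b "[i]" c] by simp

lemma seg_nth: "seg P b [i] \<Longrightarrow> b < length P \<and> P ! b = i"
  by (auto simp: seg_def nth_append)

lemma step_seg: "seg P b [i] \<Longrightarrow> pc c = b \<Longrightarrow> step w P c = exec w i c"
  using seg_nth[of P b i] by (auto simp: step_def halted_def)

fun straight :: "instr \<Rightarrow> bool" where
  "straight (Jump l) = False"
| "straight (JumpZero r l) = False"
| "straight (JumpLess a b l) = False"
| "straight _ = True"

lemma exec_straight: "straight i \<Longrightarrow> pc (exec w i c) = Suc (pc c)"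
  by (cases i) auto

lemma steps_straight:
  "seg P b code \<Longrightarrow> pc c = b \<Longrightarrow> list_all straight code \<Longrightarrow>
   (step w P ^^ length code) c = fold (exec w) code c \<and> pc (fold (exec w) code c) = b + length code"
proof (induction code arbitrary: b c)
  case (Cons i code)
  from Cons.prems have s: "seg P b [i]" "seg P (Suc b) code" using seg_Cons by blast+
  have "step w P c = exec w i c" using step_seg[OF s(1)] Cons.prems by simp
  moreover have "pc (exec w i c) = Suc b" using Cons.prems exec_straight by simp
  ultimately show ?case using Cons.IH[OF s(2), of "exec w i c"] Cons.prems
    by (simp add: funpow_swap1)
qed simp

lemma pow_append: "(step w P ^^ a) c = c' \<Longrightarrow> (step w P ^^ b) c' = c'' \<Longrightarrow> (step w P ^^ (a + b)) c = c''"
  by (simp add: add.commute[of a b] funpow_add)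

context lang
begin

lemma length_adr [simp]: "length (adr a r t) = 8" by (simp add: adr_def)

lemma straight_ecode: "list_all straight (ecode e r)"
  by (induction e arbitrary: r) (simp_all add: adr_def)

text \<open>Registers from \<open>nvars\<close> on are left unconstrained, so evaluating an
  expression does not disturb the relation.\<close>

definition rel :: "st \<Rightarrow> config \<Rightarrow> bool" where
  "rel s c \<longleftrightarrow> (\<forall>x<nvars. reg c x = vr s x) \<and> vr s 2 = S \<and> vr s 3 = B \<and> bnd s \<and>
     (\<forall>a<B. mem c a = inp a) \<and>
     (\<forall>a<narrs. \<forall>i<S. \<forall>j<S. mem c (B + ((a * S + i) * S + j)) = ar s a i j)"

end

locale ram = lang +
  assumes S_pos: "0 < S" and B_pos: "0 < B" and inp_bound: "\<forall>a<B. inp a < 2 ^ w"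
    and space: "B + narrs * S * S \<le> 2 ^ w"
begin

lemma cell_bound: assumes "a < narrs" "i < S" "j < S" shows "B + ((a * S + i) * S + j) < 2 ^ w"
    "a * S + i < 2 ^ w" "(a * S + i) * S < 2 ^ w" "a * S < 2 ^ w" "(a * S + i) * S + j < 2 ^ w" "a < 2 ^ w"
    "S < 2 ^ w"
proof -
  have 1: "Suc a * S \<le> narrs * S" using assms by (intro mult_right_mono) auto
  then have 2: "Suc (a * S + i) \<le> narrs * S" using assms unfolding mult_Suc by linarith
  then have "Suc (a * S + i) * S \<le> narrs * S * S" by (intro mult_right_mono) auto
  then show *: "B + ((a * S + i) * S + j) < 2 ^ w" using assms space by simp
  have "a * S + i \<le> (a * S + i) * S" using S_pos by simp
  with * show "a * S + i < 2 ^ w" "(a * S + i) * S < 2 ^ w" "a * S < 2 ^ w" "(a * S + i) * S + j < 2 ^ w" by linarith+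
  have "a \<le> a * S" using S_pos by simp
  with \<open>a * S < 2 ^ w\<close> show "a < 2 ^ w" by linarith
  have "S \<le> S * S" using S_pos by simp
  moreover have "S * S \<le> narrs * S * S" by simp
  ultimately show "S < 2 ^ w" using space B_pos by linarith
qed

lemma S_bound: "S < 2 ^ w" "B < 2 ^ w" using cell_bound[of 0 0 0] S_pos by auto

lemma fold_adr:
  assumes "reg c 2 = S" "reg c 3 = B" "3 < r" "r + 1 < t" "a < narrs"
  shows "reg (fold (exec w) (adr a r t) c) r = B + ((a * S + reg c r mod S) * S + reg c (r+1) mod S)"
    "x < r \<or> (r + 1 < x \<and> x \<noteq> t) \<Longrightarrow> reg (fold (exec w) (adr a r t) c) x = reg c x"
    "mem (fold (exec w) (adr a r t) c) = mem c"
proof -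
  have 1: "reg c r mod S < S" "reg c (Suc r) mod S < S" using S_pos by auto
  note b = cell_bound[OF assms(5) 1]
  have b': "reg c r mod S < 2 ^ w" "reg c (Suc r) mod S < 2 ^ w" using 1 S_bound by linarith+
  show "reg (fold (exec w) (adr a r t) c) r = B + ((a * S + reg c r mod S) * S + reg c (r+1) mod S)"
    using assms b b' by (simp add: adr_def take_bit_nat_eq_self add.commute)
qed (use assms in \<open>auto simp: adr_def\<close>)

lemma ecode_correct:
  assumes "rel s c" "wfe e" "nvars \<le> r"
  shows "reg (fold (exec w) (ecode e r) c) r = ev s e \<and>
     (\<forall>x<r. reg (fold (exec w) (ecode e r) c) x = reg c x) \<and> mem (fold (exec w) (ecode e r) c) = mem c"
  using assms
proof (induction e arbitrary: r c)
  case (Num x) then show ?case by (simp add: take_bit_eq_mod)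
next
  case (Var x) then show ?case by (auto simp: rel_def bnd_def take_bit_nat_eq_self)
next
  case (Bin f e1 e2)
  let ?c1 = "fold (exec w) (ecode e1 r) c"
  let ?c2 = "fold (exec w) (ecode e2 (r+1)) ?c1"
  have 1: "reg ?c1 r = ev s e1" "\<forall>x<r. reg ?c1 x = reg c x" "mem ?c1 = mem c"
    using Bin.IH(1)[of c r] Bin.prems by auto
  then have "rel s ?c1" using Bin.prems by (auto simp: rel_def)
  then have 2: "reg ?c2 (r+1) = ev s e2" "\<forall>x<r+1. reg ?c2 x = reg ?c1 x" "mem ?c2 = mem ?c1"
    using Bin.IH(2)[of ?c1 "r+1"] Bin.prems by auto
  then show ?case using 1 by simp
next
  case (Arr a e1 e2)
  let ?c1 = "fold (exec w) (ecode e1 r) c"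
  let ?c2 = "fold (exec w) (ecode e2 (r+1)) ?c1"
  have 1: "reg ?c1 r = ev s e1" "\<forall>x<r. reg ?c1 x = reg c x" "mem ?c1 = mem c"
    using Arr.IH(1)[of c r] Arr.prems by auto
  then have "rel s ?c1" using Arr.prems by (auto simp: rel_def)
  then have 2: "reg ?c2 (r+1) = ev s e2" "\<forall>x<r+1. reg ?c2 x = reg ?c1 x" "mem ?c2 = mem ?c1"
    using Arr.IH(2)[of ?c1 "r+1"] Arr.prems by auto
  have 3: "reg ?c2 2 = S" "reg ?c2 3 = B" using 1 2 Arr.prems by (auto simp: rel_def)
  have 4: "reg (fold (exec w) (adr a r (r+2)) ?c2) r = B + ((a * S + ev s e1 mod S) * S + ev s e2 mod S)"
    using fold_adr(1)[of ?c2 r "r+2" a] 1 2 3 Arr.prems by simp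
  have 5: "mem c (B + ((a * S + ev s e1 mod S) * S + ev s e2 mod S)) = ar s a (ev s e1 mod S) (ev s e2 mod S)"
    using Arr.prems S_pos by (simp add: rel_def)
  have 6: "\<forall>x<r. reg (fold (exec w) (adr a r (r+2)) ?c2) x = reg c x"
    "mem (fold (exec w) (adr a r (r+2)) ?c2) = mem c"
    using fold_adr(2,3)[of ?c2 r "r+2" a] 1 2 3 Arr.prems by auto
  show ?case using 4 5 6 by simp
next
  case (Inp e)
  let ?c1 = "fold (exec w) (ecode e r) c"
  have 1: "reg ?c1 r = ev s e" "\<forall>x<r. reg ?c1 x = reg c x" "mem ?c1 = mem c"
    using Inp.IH[of c r] Inp.prems by auto
  have 2: "reg ?c1 3 = B" using 1 Inp.prems by (auto simp: rel_def)
  have "ev s e mod B < B" using B_pos by simp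
  moreover have "ev s e mod B < 2 ^ w" using calculation S_bound by linarith
  ultimately show ?case using 1 2 Inp.prems by (auto simp: rel_def take_bit_nat_eq_self)
qed

definition reach :: "program \<Rightarrow> config \<Rightarrow> nat \<Rightarrow> config \<Rightarrow> bool" where
  "reach P c T c' \<longleftrightarrow> (\<exists>t\<le>T. (step w P ^^ t) c = c')"

lemma reach_trans: "reach P c T c' \<Longrightarrow> reach P c' T' c'' \<Longrightarrow> reach P c (T + T') c''"
  unfolding reach_def using pow_append add_mono by metis

lemma reach_mono: "reach P c T c' \<Longrightarrow> T \<le> T' \<Longrightarrow> reach P c T' c'"
  unfolding reach_def using order_trans by blast

lemma reach_step: "seg P (pc c) [i] \<Longrightarrow> reach P c 1 (exec w i c)"
  unfolding reach_def by (rule exI[of _ 1]) (simp add: step_seg)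

lemma reach_step': "seg P l [i] \<Longrightarrow> pc c = l \<Longrightarrow> reach P c 1 (exec w i c)"
  using reach_step by blast

lemma reach_exp:
  assumes "seg P (pc c) (ecode e r)" "rel s c" "wfe e" "nvars \<le> r"
  obtains c' where "reach P c (elen e) c'" "rel s c'" "reg c' r = ev s e" "\<forall>x<r. reg c' x = reg c x"
    "pc c' = pc c + elen e" "mem c' = mem c"
proof -
  let ?c = "fold (exec w) (ecode e r) c"
  have "(step w P ^^ length (ecode e r)) c = ?c" "pc ?c = pc c + length (ecode e r)"
    using steps_straight[OF assms(1) refl straight_ecode] by auto
  moreover have "reg ?c r = ev s e" "\<forall>x<r. reg ?c x = reg c x" "mem ?c = mem c"
    using ecode_correct[OF assms(2-4)] by auto
  moreover have "rel s ?c" using calculation assms(2,4) by (auto simp: rel_def)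
  ultimately show ?thesis using that[of ?c] by (auto simp: reach_def)
qed

lemma rel_setv:
  assumes "rel s c" "x < nvars" "3 < x" "v < 2 ^ w" "\<forall>y<nvars. y \<noteq> x \<longrightarrow> reg c' y = reg c y" "reg c' x = v" "mem c' = mem c"
  shows "rel (setv x v s) c'"
  using assms by (auto simp: rel_def bnd_upd)

lemma rel_scratch:
  assumes "rel s c" "\<forall>y<nvars. reg c' y = reg c y" "mem c' = mem c"
  shows "rel s c'"
  using assms by (auto simp: rel_def)

lemma cell_inj:
  assumes "(a * S + i) * S + j = (a' * S + i') * S + (j' :: nat)" "i < S" "j < S" "i' < S" "j' < S"
  shows "a = a' \<and> i = i' \<and> j = j'"
proof -
  have "j = j'" using assms(1,3,5) by (metis mod_less mod_mult_self3)
  then have "a * S + i = a' * S + i'" using assms S_pos by simp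
  moreover from this have "i = i'" using assms(2,4) by (metis mod_less mod_mult_self3)
  ultimately show ?thesis using S_pos \<open>j = j'\<close> by simp
qed

lemma rel_ev: "rel s c \<Longrightarrow> ev s e < 2 ^ w"
  using ev_bound inp_bound B_pos by (simp add: rel_def)

lemma reach_Asg:
  assumes "seg P (pc c) (ccode (Asg x e) l)" "rel s c" "wfc (Asg x e)"
  shows "\<exists>c'. reach P c (elen e + 1) c' \<and> rel (sem (Asg x e) s) c' \<and> pc c' = pc c + elen e + 1"
proof -
  have sg: "seg P (pc c) (ecode e nvars)" "seg P (pc c + elen e) [Op Or x nvars nvars]"
    using assms(1) by (simp_all add: seg_append)
  obtain c1 where c1: "reach P c (elen e) c1" "rel s c1" "reg c1 nvars = ev s e" "pc c1 = pc c + elen e"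
    using reach_exp[OF sg(1) assms(2)] assms(3) by (auto simp: )
  have "reach P c1 1 (exec w (Op Or x nvars nvars) c1)" using reach_step sg(2) c1(4) by metis
  with c1(1) have 1: "reach P c (elen e + 1) (exec w (Op Or x nvars nvars) c1)" by (rule reach_trans)
  have "ev s e < 2 ^ w" using rel_ev assms(2) by blast
  then have "rel (setv x (ev s e) s) (exec w (Op Or x nvars nvars) c1)"
    using c1 assms(3) by (intro rel_setv[OF c1(2)]) (auto simp: take_bit_nat_eq_self)
  then show ?thesis using 1 c1(4) by (intro exI[of _ "exec w (Op Or x nvars nvars) c1"]) auto
qed

lemma reach_Put:
  assumes "seg P (pc c) (ccode (Put a i j e) l)" "rel s c" "wfc (Put a i j e)"
  shows "\<exists>c'. reach P c (elen i + elen j + elen e + 9) c' \<and> rel (sem (Put a i j e) s) c' \<and>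
     pc c' = pc c + (elen i + elen j + elen e + 9)"
proof -
  let ?r = "nvars :: nat"
  have sg: "seg P (pc c) (ecode i ?r)" "seg P (pc c + elen i) (ecode j (?r+1))"
    "seg P (pc c + elen i + elen j) (ecode e (?r+2))" "seg P (pc c + elen i + elen j + elen e) (adr a ?r (?r+3))"
    "seg P (pc c + elen i + elen j + elen e + 8) [Store ?r (?r+2)]"
    using assms(1) by (simp_all add: seg_append add.assoc)
  obtain c1 where c1: "reach P c (elen i) c1" "rel s c1" "reg c1 ?r = ev s i" "pc c1 = pc c + elen i"
    using reach_exp[OF sg(1) assms(2)] assms(3) by auto
  obtain c2 where c2: "reach P c1 (elen j) c2" "rel s c2" "reg c2 (?r+1) = ev s j" "\<forall>x<?r+1. reg c2 x = reg c1 x"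
    "pc c2 = pc c1 + elen j"
    using reach_exp[OF _ c1(2), of P j "?r+1"] sg(2) c1(4) assms(3) by auto
  obtain c3 where c3: "reach P c2 (elen e) c3" "rel s c3" "reg c3 (?r+2) = ev s e" "\<forall>x<?r+2. reg c3 x = reg c2 x"
    "pc c3 = pc c2 + elen e"
    using reach_exp[OF _ c2(2), of P e "?r+2"] sg(3) c1(4) c2(5) assms(3) by auto
  let ?c4 = "fold (exec w) (adr a ?r (?r+3)) c3"
  let ?c5 = "exec w (Store ?r (?r+2)) ?c4"
  have pc3: "pc c3 = pc c + elen i + elen j + elen e" using c1 c2 c3 by simp
  have st: "list_all straight (adr a ?r (?r+3))" by (simp add: adr_def)
  have "(step w P ^^ 8) c3 = ?c4" "pc ?c4 = pc c3 + 8"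
    using steps_straight[OF sg(4) _ st, of c3] pc3 by auto
  then have c4: "reach P c3 8 ?c4" "pc ?c4 = pc c3 + 8" by (auto simp: reach_def)
  have "reach P ?c4 1 ?c5" using reach_step[of P ?c4] sg(5) pc3 c4(2) by (metis add.assoc)
  then have R: "reach P c (elen i + (elen j + (elen e + (8 + 1)))) ?c5"
    using reach_trans[OF c1(1) reach_trans[OF c2(1) reach_trans[OF c3(1) reach_trans[OF c4(1)]]]] by blast
  have r3: "reg c3 ?r = ev s i" "reg c3 (?r+1) = ev s j" "reg c3 (?r+2) = ev s e" "reg c3 2 = S" "reg c3 3 = B"
    using c1 c2 c3 by (auto simp: rel_def)
  have a: "a < narrs" using assms(3) by simp
  let ?i = "ev s i mod S" and ?j = "ev s j mod S"
  have r4: "reg ?c4 ?r = B + ((a * S + ?i) * S + ?j)" "reg ?c4 (?r+2) = ev s e"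
     "mem ?c4 = mem c3" "\<forall>x<?r. reg ?c4 x = reg c3 x"
    using fold_adr[of c3 ?r "?r+3" a] r3 a by auto
  have ij: "?i < S" "?j < S" using S_pos by auto
  have m: "mem ?c5 = (mem c3)(B + ((a * S + ?i) * S + ?j) := ev s e)" using r4 by simp
  have "ev s e < 2 ^ w" using rel_ev assms(2) by blast
  then have bd: "bnd (seta a ?i ?j (ev s e) s)" using assms(2) by (auto simp: rel_def bnd_def)
  have "mem ?c5 (B + ((a' * S + i') * S + j')) = ar (seta a ?i ?j (ev s e) s) a' i' j'"
    if "a' < narrs" "i' < S" "j' < S" for a' i' j'
  proof (cases "a' = a \<and> i' = ?i \<and> j' = ?j")
    case True then show ?thesis using m by simp
  next
    case False
    then have "B + ((a' * S + i') * S + j') \<noteq> B + ((a * S + ?i) * S + ?j)" using cell_inj[OF _ that(2,3) ij] by (metis add_left_cancel)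
    then have "mem ?c5 (B + ((a' * S + i') * S + j')) = ar s a' i' j'" using m c3(2) that by (simp add: rel_def)
    then show ?thesis using False by auto
  qed
  moreover have "mem ?c5 x = inp x" if "x < B" for x using m c3(2) that by (simp add: rel_def)
  moreover have "reg ?c5 x = vr s x" if "x < nvars" for x using r4 c3(2) that by (simp add: rel_def)
  ultimately have "rel (seta a ?i ?j (ev s e) s) ?c5" using bd c3(2) unfolding rel_def by simp
  then show ?thesis using R pc3 c4(2) by (intro exI[of _ ?c5]) (simp add: add.assoc)
qed

text \<open>The time is expressed by the values \<open>env\<close> of the loop bounds on entry. As
  these variables are not written, \<open>env\<close> stays correct at every subcommand, which
  carries the induction.\<close>

lemma ccode_correct:
  assumes "wfc c" "set (lvars c) \<inter> set (writes c) = {}" "\<forall>p\<in>set (lvars c). vr s p = env p"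
    "rel s cf" "seg P (pc cf) (ccode c (pc cf))"
  shows "\<exists>cf'. reach P cf (cb env c) cf' \<and> rel (sem c s) cf' \<and> pc cf' = pc cf + length (ccode c (pc cf))"
  using assms
proof (induction c arbitrary: s cf)
  case (Asg x e)
  then show ?case using reach_Asg[of P cf x e "pc cf" s] by auto
next
  case (Put a i j e)
  then show ?case using reach_Put[of P cf a i j e "pc cf" s] by auto
next
  case (Seq c1 c2)
  let ?x = "ccode c1 (pc cf)"
  have sg: "seg P (pc cf) ?x" "seg P (pc cf + length ?x) (ccode c2 (pc cf + length ?x))"
    using Seq.prems(5) by (simp_all add: Let_def seg_append)
  obtain cf1 where 1: "reach P cf (cb env c1) cf1" "rel (sem c1 s) cf1" "pc cf1 = pc cf + length ?x"
    using Seq.IH(1)[of s cf] Seq.prems sg(1) by auto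
  have "\<forall>p\<in>set (lvars c2). vr (sem c1 s) p = env p" using Seq.prems(2,3) vr_frame by fastforce
  then obtain cf2 where 2: "reach P cf1 (cb env c2) cf2" "rel (sem c2 (sem c1 s)) cf2"
    "pc cf2 = pc cf1 + length (ccode c2 (pc cf1))"
    using Seq.IH(2)[of "sem c1 s" cf1] Seq.prems(1,2) sg(2) 1(2,3) by auto
  show ?case using reach_trans[OF 1(1) 2(1)] 2 1(3) by (auto simp: Let_def)
next
  case (Cond e1 e2 c1 c2)
  let ?x = "ecode e1 nvars" and ?x' = "ecode e2 (nvars+1)"
  let ?l1 = "pc cf + elen e1 + elen e2 + 1"
  let ?y = "ccode c2 ?l1"
  let ?l2 = "?l1 + length ?y + 1"
  let ?z = "ccode c1 ?l2"
  let ?J = "JumpLess nvars (nvars+1) ?l2"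
  have sg: "seg P (pc cf) ?x" "seg P (pc cf + elen e1) ?x'" "seg P (pc cf + elen e1 + elen e2) [?J]"
     "seg P ?l1 ?y" "seg P (?l1 + length ?y) [Jump (?l2 + length ?z)]" "seg P ?l2 ?z"
  proof -
    have "seg P (pc cf) (?x @ ?x' @ [?J] @ ?y @ [Jump (?l2 + length ?z)] @ ?z)"
      using Cond.prems(5) by (simp add: Let_def add.assoc)
    then show "seg P (pc cf) ?x" "seg P (pc cf + elen e1) ?x'" "seg P (pc cf + elen e1 + elen e2) [?J]"
     "seg P ?l1 ?y" "seg P (?l1 + length ?y) [Jump (?l2 + length ?z)]" "seg P ?l2 ?z"
      unfolding seg_append by simp_all
  qed
  obtain cf0 where c0: "reach P cf (elen e1) cf0" "rel s cf0" "reg cf0 nvars = ev s e1" "pc cf0 = pc cf + elen e1"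
    using reach_exp[OF sg(1) Cond.prems(4)] Cond.prems(1) by auto
  obtain cf1 where c1: "reach P cf0 (elen e2) cf1" "rel s cf1" "reg cf1 (nvars+1) = ev s e2"
    "\<forall>x<nvars+1. reg cf1 x = reg cf0 x" "pc cf1 = pc cf + elen e1 + elen e2"
    using reach_exp[OF _ c0(2), of P e2 "nvars+1"] sg(2) c0(4) Cond.prems(1) by auto
  have regs: "reg cf1 nvars = ev s e1" using c0 c1 by simp
  let ?cf2 = "exec w ?J cf1"
  have 2: "reach P cf1 1 ?cf2" by (rule reach_step'[OF sg(3) c1(5)])
  have r2: "rel s ?cf2" using rel_scratch[OF c1(2)] by simp
  have 3: "reach P cf (elen e1 + (elen e2 + 1)) ?cf2" by (rule reach_trans[OF c0(1) reach_trans[OF c1(1) 2]])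
  have len: "length (ccode (Cond e1 e2 c1 c2) (pc cf)) = elen e1 + elen e2 + 2 + length ?y + length ?z"
    by (simp add: Let_def add.assoc)
  show ?case
  proof (cases "ev s e1 < ev s e2")
    case True
    then have "pc ?cf2 = ?l2" using c1 regs by simp
    then obtain cf3 where "reach P ?cf2 (cb env c1) cf3" "rel (sem c1 s) cf3" "pc cf3 = ?l2 + length ?z"
      using Cond.IH(1)[OF _ _ _ r2] Cond.prems(1-3) sg(6) by auto
    then show ?thesis using reach_mono[OF reach_trans[OF 3]] True len
      by (intro exI[of _ cf3]) auto
  next
    case False
    then have pc2: "pc ?cf2 = ?l1" using c1 regs by simp
    then obtain cf3 where 4: "reach P ?cf2 (cb env c2) cf3" "rel (sem c2 s) cf3" "pc cf3 = ?l1 + length ?y"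
      using Cond.IH(2)[OF _ _ _ r2] Cond.prems(1-3) sg(4) by auto
    let ?cf4 = "exec w (Jump (?l2 + length ?z)) cf3"
    have 5: "reach P cf3 1 ?cf4" by (rule reach_step'[OF sg(5) 4(3)])
    have "rel (sem c2 s) ?cf4" using rel_scratch[OF 4(2)] by simp
    moreover have "reach P cf (cb env (Cond e1 e2 c1 c2)) ?cf4"
      using reach_mono[OF reach_trans[OF 3 reach_trans[OF 4(1) 5]]] by auto
    ultimately show ?thesis using False len by (intro exI[of _ ?cf4]) auto
  qed
next
  case (For i p c)
  let ?l = "pc cf"
  let ?x = "ccode c (?l + 3)"
  let ?f = "\<lambda>k s. sem c (setv i k s)"
  let ?J = "JumpLess i p (?l+3)" and ?E = "Jump (?l + 6 + length ?x)"
  have sg: "seg P ?l [Const i 0]" "seg P (?l+1) [?J]" "seg P (?l+2) [?E]"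
     "seg P (?l+3) ?x" "seg P (?l+3+length ?x) [Const nvars 1]" "seg P (?l+4+length ?x) [Op Add i i nvars]"
     "seg P (?l+5+length ?x) [Jump (?l+1)]"
  proof -
    have "seg P ?l ([Const i 0] @ [?J] @ [?E] @ ?x @ [Const nvars 1] @ [Op Add i i nvars] @ [Jump (?l+1)])"
      using For.prems(5) by (simp add: Let_def)
    then show "seg P ?l [Const i 0]" "seg P (?l+1) [?J]" "seg P (?l+2) [?E]"
     "seg P (?l+3) ?x" "seg P (?l+3+length ?x) [Const nvars 1]" "seg P (?l+4+length ?x) [Op Add i i nvars]"
     "seg P (?l+5+length ?x) [Jump (?l+1)]"
      unfolding seg_append by (simp_all add: numeral_eq_Suc)
  qed
  have ip: "i < nvars" "3 < i" "p < nvars" "i \<noteq> p" "i \<notin> set (writes c)" "wfc c" "p \<notin> set (writes c)"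
    using For.prems(1,2) by auto
  have pw: "vr s p < 2 ^ w" using For.prems(4) by (simp add: rel_def bnd_def)
  have fr: "vr (floop ?f n s) y = vr s y" if "y \<notin> set (writes c)" "y \<noteq> i" for n y
    using that by (induction n) (auto simp: vr_frame)
  let ?inv = "\<lambda>n cf'. rel (setv i n (floop ?f n s)) cf' \<and> pc cf' = ?l + 1"
  \<comment> \<open>\<open>?inv n\<close> describes the moment before the loop test with n rounds
    done. A round costs its body and four instructions: test, constant, increment, jump.\<close>
  have "n \<le> vr s p \<Longrightarrow> \<exists>cf'. reach P cf (1 + n * (4 + cb env c)) cf' \<and> ?inv n cf'" for n
  proof (induction n)
    case 0
    let ?cf = "exec w (Const i 0) cf"
    have "reach P cf 1 ?cf" using reach_step sg(1) by blast
    moreover have "rel (setv i 0 s) ?cf" using ip by (intro rel_setv[OF For.prems(4)]) auto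
    ultimately show ?case by (intro exI[of _ ?cf]) auto
  next
    case (Suc n)
    then obtain c0 where c0: "reach P cf (1 + n * (4 + cb env c)) c0" "?inv n c0" by auto
    let ?s = "setv i n (floop ?f n s)"
    let ?c1 = "exec w ?J c0"
    have regs: "reg c0 i = n" "reg c0 p = vr s p" using c0(2) ip fr[of p n] by (auto simp: rel_def)
    have 1: "reach P c0 1 ?c1" using reach_step[of P c0] sg(2) c0(2) by metis
    have p1: "pc ?c1 = ?l + 3" using regs Suc.prems by simp
    have r1: "rel ?s ?c1" using rel_scratch[of ?s c0] c0(2) by simp
    have "set (lvars c) \<inter> set (writes c) = {}" using For.prems(2) by auto
    moreover have "\<forall>q\<in>set (lvars c). vr ?s q = env q"
      using For.prems(2,3) fr by (auto simp: disjoint_iff)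
    ultimately obtain c2 where c2: "reach P ?c1 (cb env c) c2" "rel (sem c ?s) c2" "pc c2 = ?l + 3 + length ?x"
      using For.IH[OF ip(6) _ _ r1] sg(4) p1 by auto
    let ?c3 = "exec w (Const nvars 1) c2"
    let ?c4 = "exec w (Op Add i i nvars) ?c3"
    let ?c5 = "exec w (Jump (?l+1)) ?c4"
    have 3: "reach P c2 1 ?c3" using reach_step[of P c2] sg(5) c2(3) by metis
    have "pc ?c3 = ?l+4+length ?x" "pc ?c4 = ?l + 5 + length ?x" using c2(3) by auto
    then have 4: "reach P ?c3 1 ?c4" "reach P ?c4 1 ?c5"
      using reach_step'[OF sg(6)] reach_step'[OF sg(7)] by blast+
    have R: "reach P cf (1 + Suc n * (4 + cb env c)) ?c5"
      by (rule reach_mono[OF reach_trans[OF c0(1) reach_trans[OF 1 reach_trans[OF c2(1) reach_trans[OF 3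
          reach_trans[OF 4]]]]]]) simp
    have "reg c2 i = n" using c2(2) ip vr_frame[of i c ?s] by (auto simp: rel_def)
    moreover have "Suc n < 2 ^ w" "1 < (2::nat) ^ w" using Suc.prems pw by linarith+
    moreover have "0 < w" using \<open>Suc n < 2 ^ w\<close> by (cases w) auto
    ultimately have "reg ?c5 i = Suc n" using ip by (simp add: take_bit_nat_eq_self)
    then have "rel (setv i (Suc n) (sem c ?s)) ?c5"
      using ip \<open>Suc n < 2 ^ w\<close> by (intro rel_setv[OF c2(2)]) auto
    then show ?case using R by (intro exI[of _ ?c5]) simp
  qed
  from this[OF order_refl] obtain c1 where c1: "reach P cf (1 + vr s p * (4 + cb env c)) c1" "?inv (vr s p) c1" by blast
  let ?c2 = "exec w ?J c1" and ?c3 = "exec w ?E (exec w ?J c1)"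
  have regs: "reg c1 i = vr s p" "reg c1 p = vr s p" using c1(2) ip fr[of p] by (auto simp: rel_def)
  have 1: "reach P c1 1 ?c2" using reach_step[of P c1] sg(2) c1(2) by metis
  have "pc ?c2 = ?l + 2" using regs c1(2) by simp
  then have 2: "reach P ?c2 1 ?c3" using reach_step[of P ?c2] sg(3) by metis
  have "env p = vr s p" using For.prems(3) by simp
  then have "reach P cf (cb env (For i p c)) ?c3"
    by (intro reach_mono[OF reach_trans[OF c1(1) reach_trans[OF 1 2]]]) simp
  moreover have "rel (sem (For i p c) s) ?c3"
    using rel_scratch[of "sem (For i p c) s" c1 ?c3] c1(2) by simp
  ultimately show ?case by (intro exI[of _ ?c3]) (simp add: Let_def)
qed

lemma pcode_correct:
  assumes "runs p s t s'" "rel s cf" "seg P (pc cf) (pcode p (pc cf))"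
  shows "\<exists>cf'. reach P cf t cf' \<and> rel s' cf' \<and> pc cf' = pc cf + length (pcode p (pc cf))"
  using assms
proof (induction arbitrary: cf rule: runs.induct)
  case (runs_Do c s t)
  have "wfc c" "set (lvars c) \<inter> set (writes c) = {}"
    using runs_Do.hyps(1) by (auto simp: okc_def list_all_iff)
  from ccode_correct[OF this, of s "vr s" cf P] runs_Do show ?case using reach_mono by fastforce
next
  case (runs_Then p s t s' q t' s'' T)
  then have "seg P (pc cf) (pcode p (pc cf))"
    "seg P (pc cf + length (pcode p (pc cf))) (pcode q (pc cf + length (pcode p (pc cf))))"
    by (simp_all add: Let_def seg_append)
  then obtain cf1 where 1: "reach P cf t cf1" "rel s' cf1" "pc cf1 = pc cf + length (pcode p (pc cf))"
    using runs_Then.IH(1) runs_Then.prems by blast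
  then obtain cf2 where 2: "reach P cf1 t' cf2" "rel s'' cf2" "pc cf2 = pc cf1 + length (pcode q (pc cf1))"
    using runs_Then.IH(2)[OF 1(2)] \<open>seg P (pc cf + _) _\<close> by auto
  show ?case using reach_mono[OF reach_trans[OF 1(1) 2(1)] runs_Then.hyps(3)] 1 2
    by (intro exI[of _ cf2]) (simp add: Let_def)
next
  case (runs_While0 s x t p)
  let ?x = "pcode p (pc cf + 1)"
  have "seg P (pc cf) ([JumpZero x (pc cf + 2 + length ?x)] @ ?x @ [Jump (pc cf)])"
    using runs_While0.prems(2) by (simp add: Let_def)
  then have sg: "seg P (pc cf) [JumpZero x (pc cf + 2 + length ?x)]"
    unfolding seg_append by simp
  let ?c = "exec w (JumpZero x (pc cf + 2 + length (pcode p (pc cf + 1)))) cf"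
  have "reach P cf t ?c" using reach_mono[OF reach_step[OF sg]] runs_While0 by blast
  moreover have "reg cf x = 0" using runs_While0 by (simp add: rel_def)
  moreover have "rel s ?c" using rel_scratch[OF runs_While0.prems(1)] by simp
  ultimately show ?case by (intro exI[of _ ?c]) (simp add: Let_def)
next
  case (runs_While1 s x p t s' t' s'' T)
  let ?l = "pc cf"
  let ?x = "pcode p (?l + 1)"
  let ?J = "JumpZero x (?l + 2 + length ?x)"
  have "seg P ?l ([?J] @ ?x @ [Jump ?l])" using runs_While1.prems(2) by (simp add: Let_def)
  then have sg: "seg P ?l [?J]" "seg P (?l + 1) ?x" "seg P (?l + 1 + length ?x) [Jump ?l]"
    unfolding seg_append by simp_all
  let ?c1 = "exec w ?J cf"
  have 1: "reach P cf 1 ?c1" using reach_step[OF sg(1)] .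
  have "reg cf x \<noteq> 0" using runs_While1 by (simp add: rel_def)
  then have p1: "pc ?c1 = ?l + 1" by simp
  have "rel s ?c1" using rel_scratch[OF runs_While1.prems(1)] by simp
  then obtain c2 where 2: "reach P ?c1 t c2" "rel s' c2" "pc c2 = ?l + 1 + length ?x"
    using runs_While1.IH(1)[of ?c1] sg(2) p1 by auto
  let ?c3 = "exec w (Jump ?l) c2"
  have 3: "reach P c2 1 ?c3" using reach_step[of P c2] sg(3) 2(3) by metis
  have "rel s' ?c3" "pc ?c3 = ?l" using rel_scratch[OF 2(2)] by simp_all
  then obtain c4 where 4: "reach P ?c3 t' c4" "rel s'' c4" "pc c4 = ?l + length (pcode (While x p) ?l)"
    using runs_While1.IH(2)[of ?c3] runs_While1.prems(2) by auto
  have "reach P cf T c4"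
    by (rule reach_mono[OF reach_trans[OF 1 reach_trans[OF 2(1) reach_trans[OF 3 4(1)]]]])
      (use runs_While1.hyps in linarith)
  then show ?case using 4 by blast
qed

end


section \<open>Degree-preserving maps and their multiplicativity\<close>

definition locmaps ::
  "(nat \<Rightarrow> nat \<Rightarrow> bool) \<Rightarrow> (nat \<Rightarrow> nat \<Rightarrow> bool) \<Rightarrow> (nat \<Rightarrow> nat) \<Rightarrow> nat set \<Rightarrow> nat set \<Rightarrow> (nat \<Rightarrow> nat) set" where
  "locmaps adj hadj hdeg X T = {\<sigma> \<in> T \<rightarrow>\<^sub>E X. (\<forall>u\<in>T. \<forall>v\<in>T. adj u v \<longrightarrow> hadj (\<sigma> u) (\<sigma> v)) \<and>
     (\<forall>u\<in>T. card {v\<in>T. adj u v} = hdeg (\<sigma> u))}"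

definition hw where "hw adj hadj hdeg X T = card (locmaps adj hadj hdeg X T)"

lemma locmaps_restrict:
  assumes "\<sigma> \<in> locmaps adj hadj hdeg X (T1 \<union> T2)" and na: "\<And>u v. u \<in> T1 \<Longrightarrow> v \<in> T2 \<Longrightarrow> \<not> adj u v"
  shows "restrict \<sigma> T1 \<in> locmaps adj hadj hdeg X T1"
proof -
  have 1: "{v \<in> T1 \<union> T2. adj u v} = {v \<in> T1. adj u v}" if "u \<in> T1" for u using na that by blast
  have "card {v \<in> T1. adj u v} = hdeg (\<sigma> u)" if "u \<in> T1" for u
    using assms(1) that unfolding locmaps_def 1[OF that, symmetric] by blast
  then show ?thesis using assms(1) unfolding locmaps_def by auto
qed

text \<open>Restriction to the two parts is a bijection onto pairs of maps: with no edge between the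
  parts, neither the adjacency condition nor a degree inside the union notices the other
  part.\<close>

lemma hw_union:
  assumes disj: "T1 \<inter> T2 = {}" and sym: "\<And>u v. adj u v \<Longrightarrow> adj v u"
    and na: "\<And>u v. u \<in> T1 \<Longrightarrow> v \<in> T2 \<Longrightarrow> \<not> adj u v"
  shows "hw adj hadj hdeg X (T1 \<union> T2) = hw adj hadj hdeg X T1 * hw adj hadj hdeg X T2"
proof -
  let ?L = "locmaps adj hadj hdeg X"
  let ?f = "\<lambda>\<sigma>. (restrict \<sigma> T1, restrict \<sigma> T2)"
  let ?g = "\<lambda>(a, b). \<lambda>u. if u \<in> T1 then a u else if u \<in> T2 then b u else undefined"
  have 1: "{v \<in> T1 \<union> T2. adj u v} = {v \<in> T1. adj u v}" if "u \<in> T1" for u using na that by blast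
  have 2: "{v \<in> T1 \<union> T2. adj u v} = {v \<in> T2. adj u v}" if "u \<in> T2" for u using na sym that by blast
  have 3: "u \<notin> T1" if "u \<in> T2" for u using disj that by blast
  have "bij_betw ?f (?L (T1 \<union> T2)) (?L T1 \<times> ?L T2)"
  proof (rule bij_betw_byWitness[where f' = ?g])
    show "\<forall>\<sigma>\<in>?L (T1 \<union> T2). ?g (?f \<sigma>) = \<sigma>"
      by (auto simp: locmaps_def fun_eq_iff PiE_def extensional_def)
    show "\<forall>p\<in>?L T1 \<times> ?L T2. ?f (?g p) = p"
      using 3 by (auto simp: locmaps_def fun_eq_iff PiE_def extensional_def restrict_def)
    show "?f ` ?L (T1 \<union> T2) \<subseteq> ?L T1 \<times> ?L T2"
      using locmaps_restrict[of _ adj hadj hdeg X T1 T2] locmaps_restrict[of _ adj hadj hdeg X T2 T1] na sym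
      unfolding Un_commute[of T2 T1] by blast
    have "?g (a, b) \<in> ?L (T1 \<union> T2)" if a: "a \<in> ?L T1" and b: "b \<in> ?L T2" for a b
    proof -
      let ?h = "?g (a, b)"
      have h1: "?h u = a u" if "u \<in> T1" for u using that by simp
      have h2: "?h u = b u" if "u \<in> T2" for u using that 3 by simp
      have "?h \<in> T1 \<union> T2 \<rightarrow>\<^sub>E X" using a b 3 by (auto simp: locmaps_def PiE_def extensional_def)
      moreover have "hadj (?h u) (?h v)" if "u \<in> T1 \<union> T2" "v \<in> T1 \<union> T2" "adj u v" for u v
      proof (cases "u \<in> T1")
        case True
        then have "v \<in> T1" using that na by blast
        then show ?thesis using True a that h1 unfolding locmaps_def by simp
      next
        case False
        then have "u \<in> T2" "v \<in> T2" using that na sym by blast+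
        then show ?thesis using b that h2 unfolding locmaps_def by simp
      qed
      moreover have "card {v \<in> T1 \<union> T2. adj u v} = hdeg (?h u)" if "u \<in> T1 \<union> T2" for u
      proof (cases "u \<in> T1")
        case True then show ?thesis using a h1 1 unfolding locmaps_def by simp
      next
        case False
        then have "u \<in> T2" using that by blast
        then show ?thesis using b h2 2 unfolding locmaps_def by simp
      qed
      ultimately show ?thesis unfolding locmaps_def by blast
    qed
    then show "?g ` (?L T1 \<times> ?L T2) \<subseteq> ?L (T1 \<union> T2)" by auto
  qed
  then show ?thesis unfolding hw_def by (simp add: bij_betw_same_card card_cartesian_product)
qed

lemma hw_empty [simp]: "hw adj hadj hdeg X {} = 1"
  by (simp add: hw_def locmaps_def)

text \<open>Multiplicativity is all that the recursion knows about \<open>hw\<close>; z is the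
  number substituted for the variable of the generating function.\<close>

locale weights =
  fixes adj :: "nat \<Rightarrow> nat \<Rightarrow> bool" and f :: "nat set \<Rightarrow> int" and z :: int
  assumes adj_sym: "adj u v \<Longrightarrow> adj v u"
    and f_empty: "f {} = 1"
    and f_union: "T1 \<inter> T2 = {} \<Longrightarrow> (\<And>u v. u \<in> T1 \<Longrightarrow> v \<in> T2 \<Longrightarrow> \<not> adj u v) \<Longrightarrow> f (T1 \<union> T2) = f T1 * f T2"
begin

text \<open>The part of the generating function that comes from the sets containing I and otherwise
  lying in U.\<close>

definition gsum :: "nat set \<Rightarrow> nat set \<Rightarrow> int" where
  "gsum I U = (\<Sum>T\<in>Pow U. f (I \<union> T) * z ^ card (I \<union> T))"

lemma gsum_branch:
  assumes "finite U" "x \<in> U"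
  shows "gsum I U = gsum (insert x I) (U - {x}) + gsum I (U - {x})"
proof -
  have U: "U = insert x (U - {x})" using assms by blast
  have "Pow U = Pow (U - {x}) \<union> insert x ` Pow (U - {x})" by (subst U) (rule Pow_insert)
  moreover have "Pow (U - {x}) \<inter> insert x ` Pow (U - {x}) = {}" by blast
  moreover have "inj_on (insert x) (Pow (U - {x}))" by (auto simp: inj_on_def)
  ultimately show ?thesis unfolding gsum_def using assms
    by (simp add: sum.union_disjoint sum.reindex)
qed

lemma gsum_dvd: assumes "finite I" "finite U" shows "z ^ card I dvd gsum I U"
  unfolding gsum_def
proof (rule dvd_sum)
  fix T assume "T \<in> Pow U"
  then have "card I \<le> card (I \<union> T)" using assms by (intro card_mono) (auto intro: finite_subset)
  then show "z ^ card I dvd f (I \<union> T) * z ^ card (I \<union> T)" by (simp add: dvd_mult le_imp_power_dvd)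
qed

text \<open>Multiplicativity applies to every I \<union> T at once. This is where the recursion
  ends: the ratio to \<open>gsum {} U\<close> no longer depends on U.\<close>

lemma gsum_leaf:
  assumes "finite I" "finite U" "I \<inter> U = {}" "\<And>u v. u \<in> I \<Longrightarrow> v \<in> U \<Longrightarrow> \<not> adj u v"
  shows "gsum I U = f I * z ^ card I * gsum {} U"
  unfolding gsum_def sum_distrib_left
proof (rule sum.cong)
  fix T assume T: "T \<in> Pow U"
  then have "f (I \<union> T) = f I * f T" using assms by (intro f_union) auto
  moreover have "card (I \<union> T) = card I + card T" using assms T by (intro card_Un_disjoint) (auto intro: finite_subset)
  ultimately show "f (I \<union> T) * z ^ card (I \<union> T) = f I * z ^ card I * (f ({} \<union> T) * z ^ card ({} \<union> T))"
    by (simp add: power_add)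
qed simp

text \<open>The empty set is the only one whose term is not divisible by z. Hence
  \<open>gsum {} U\<close> is a unit modulo powers of z and ratios over it are meaningful.\<close>

lemma gsum_empty_mod: "finite U \<Longrightarrow> z dvd gsum {} U - 1"
proof (induction U rule: finite_induct)
  case empty then show ?case by (simp add: gsum_def f_empty)
next
  case (insert x U)
  have "gsum {} (insert x U) = gsum {x} U + gsum {} U"
    using gsum_branch[of "insert x U" x "{}"] insert by simp
  moreover have "z dvd gsum {x} U" using gsum_dvd[of "{x}" U] insert by simp
  ultimately show ?case using insert.IH by (metis add_diff_eq dvd_add)
qed

lemma gsum_coprime: "finite U \<Longrightarrow> coprime (gsum {} U) (z ^ k)"
proof -
  assume "finite U"
  from gsum_empty_mod[OF this] obtain c where "gsum {} U = 1 + z * c" by (metis dvdE eq_diff_eq add.commute)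
  then have "coprime (gsum {} U) z" 
    by (metis coprime_1_left coprime_iff_gcd_eq_1 gcd.commute gcd_add_mult mult.commute add.commute)
  then show ?thesis by simp
qed

end

section \<open>Inclusion-exclusion over the admissible images\<close>

text \<open>If some a of A is missing from R, adding or removing a pairs off the sets X with
  opposite signs.\<close>

lemma alternating_sum_supersets:
  assumes "finite A" "R \<subseteq> A"
  shows "(\<Sum>X\<in>Pow A. (-1) ^ card (A - X) * (if R \<subseteq> X then 1 else 0)) = (if R = A then 1 else (0::int))"
  using assms
proof (cases "R = A")
  case True
  have "(\<Sum>X\<in>Pow A. (-1) ^ card (A - X) * (if A \<subseteq> X then 1 else (0::int))) = (\<Sum>X\<in>Pow A. if X = A then 1 else 0)"
    by (intro sum.cong) (auto simp: subset_antisym)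
  then show ?thesis using True assms by simp
next
  case False
  then obtain a where a: "a \<in> A" "a \<notin> R" using assms by blast
  let ?A = "A - {a}"
  let ?h = "\<lambda>X. (-1) ^ card (A - X) * (if R \<subseteq> X then 1 else (0::int))"
  have A: "A = insert a ?A" using a by blast
  have "Pow A = Pow ?A \<union> insert a ` Pow ?A" by (subst A) (rule Pow_insert)
  moreover have "Pow ?A \<inter> insert a ` Pow ?A = {}" by blast
  moreover have "inj_on (insert a) (Pow ?A)" by (auto simp: inj_on_def)
  ultimately have "sum ?h (Pow A) = sum ?h (Pow ?A) + (\<Sum>X\<in>Pow ?A. ?h (insert a X))"
    using assms by (simp add: sum.union_disjoint sum.reindex)
  also have "\<dots> = (\<Sum>X\<in>Pow ?A. ?h X + ?h (insert a X))" by (simp add: sum.distrib)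
  also have "\<dots> = 0"
  proof (rule sum.neutral, rule ballI)
    fix X assume X: "X \<in> Pow ?A"
    have "A - X = insert a (A - insert a X)" using X a by blast
    moreover have "finite (A - insert a X)" "a \<notin> A - insert a X" using assms by auto
    ultimately have "card (A - X) = Suc (card (A - insert a X))" using card_insert_disjoint by metis
    moreover have "R \<subseteq> insert a X \<longleftrightarrow> R \<subseteq> X" using a by blast
    ultimately show "?h X + ?h (insert a X) = 0" by simp
  qed
  finally show ?thesis using False by simp
qed

definition isos :: "(nat \<Rightarrow> nat \<Rightarrow> bool) \<Rightarrow> (nat \<Rightarrow> nat \<Rightarrow> bool) \<Rightarrow> nat set \<Rightarrow> nat set \<Rightarrow> (nat \<Rightarrow> nat) set" where
  "isos adj hadj W T = {\<sigma> \<in> T \<rightarrow>\<^sub>E W. bij_betw \<sigma> T W \<and> (\<forall>u\<in>T. \<forall>v\<in>T. adj u v \<longleftrightarrow> hadj (\<sigma> u) (\<sigma> v))}"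

text \<open>A bijection that preserves adjacency maps the neighbours of u injectively into the
  neighbours of its image. Equal degrees make this surjective, so non-adjacency is preserved as
  well.\<close>

lemma locmaps_bij:
  assumes fin: "finite W" "finite T" and card: "card T = card W"
    and hdeg: "\<And>x. x \<in> W \<Longrightarrow> hdeg x = card {y \<in> W. hadj x y}"
  shows "{\<sigma> \<in> locmaps adj hadj hdeg W T. \<sigma> ` T = W} = isos adj hadj W T"
proof (intro set_eqI iffI)
  fix \<sigma> assume s: "\<sigma> \<in> {\<sigma> \<in> locmaps adj hadj hdeg W T. \<sigma> ` T = W}"
  then have inj: "inj_on \<sigma> T" using card fin by (simp add: eq_card_imp_inj_on)
  have "adj u v" if uv: "u \<in> T" "v \<in> T" "hadj (\<sigma> u) (\<sigma> v)" for u v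
  proof -
    have "\<sigma> ` {v\<in>T. adj u v} \<subseteq> {y \<in> W. hadj (\<sigma> u) y}" using s uv by (auto simp: locmaps_def)
    moreover have "card (\<sigma> ` {v\<in>T. adj u v}) = card {y \<in> W. hadj (\<sigma> u) y}"
      using s uv hdeg[of "\<sigma> u"] card_image[OF inj_on_subset[OF inj, of "{v\<in>T. adj u v}"]]
      by (auto simp: locmaps_def)
    ultimately have "\<sigma> ` {v\<in>T. adj u v} = {y \<in> W. hadj (\<sigma> u) y}"
      using fin by (intro card_subset_eq) auto
    then have "\<sigma> v \<in> \<sigma> ` {v\<in>T. adj u v}" using s uv by auto
    then show ?thesis using inj uv by (auto simp: inj_on_def)
  qed
  then show "\<sigma> \<in> isos adj hadj W T" using s inj by (auto simp: isos_def locmaps_def bij_betw_def)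
next
  fix \<sigma> assume s: "\<sigma> \<in> isos adj hadj W T"
  then have b: "bij_betw \<sigma> T W" by (simp add: isos_def)
  have "card {v \<in> T. adj u v} = hdeg (\<sigma> u)" if "u \<in> T" for u
  proof -
    have "bij_betw \<sigma> {v \<in> T. adj u v} {y \<in> W. hadj (\<sigma> u) y}"
      using s b that by (auto simp: bij_betw_def isos_def inj_on_def)
    moreover have "\<sigma> u \<in> W" using b that by (auto simp: bij_betw_def)
    ultimately show ?thesis using hdeg by (simp add: bij_betw_same_card)
  qed
  then show "\<sigma> \<in> {\<sigma> \<in> locmaps adj hadj hdeg W T. \<sigma> ` T = W}"
    using s b by (auto simp: isos_def locmaps_def bij_betw_def)
qed

lemma finite_locmaps: "finite X \<Longrightarrow> finite T \<Longrightarrow> finite (locmaps adj hadj hdeg X T)"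
  unfolding locmaps_def by (rule finite_subset[of _ "T \<rightarrow>\<^sub>E X"]) (auto intro: finite_PiE)

text \<open>The number of induced embeddings of the pattern, grouped by the vertex set of the
  copy.\<close>

definition emb :: "(nat \<Rightarrow> nat \<Rightarrow> bool) \<Rightarrow> (nat \<Rightarrow> nat \<Rightarrow> bool) \<Rightarrow> nat set \<Rightarrow> nat set \<Rightarrow> nat" where
  "emb adj hadj W U = (\<Sum>T | T \<subseteq> U \<and> card T = card W. card (isos adj hadj W T))"

text \<open>Summing over the sets of admissible images with signs leaves the maps onto W. A map onto W from a
  set with fewer elements than W does not exist, so the terms of lower order cancel.\<close>

lemma inclusion_exclusion_emb:
  fixes z :: int
  assumes fin: "finite W" "finite U"
    and hdeg: "\<And>x. x \<in> W \<Longrightarrow> hdeg x = card {y \<in> W. hadj x y}"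
  shows "\<exists>q. (\<Sum>X\<in>Pow W. (-1) ^ card (W - X) * (\<Sum>T\<in>Pow U. int (hw adj hadj hdeg X T) * z ^ card T))
       = int (emb adj hadj W U) * z ^ card W + q * z ^ Suc (card W)"
proof -
  let ?L = "\<lambda>X T. locmaps adj hadj hdeg X T"
  define su where "su T = card {\<sigma> \<in> ?L W T. \<sigma> ` T = W}" for T
  have finT: "finite T" if "T \<in> Pow U" for T using that fin by (auto intro: finite_subset)
  \<comment> \<open>Maps to X are the maps to W whose image lies in X, so the sum over X can be
    carried out for each map separately and sees only its image.\<close>
  have L: "?L X T = {\<sigma> \<in> ?L W T. \<sigma> ` T \<subseteq> X}" if "X \<subseteq> W" for X T
    using that unfolding locmaps_def PiE_def Pi_def by auto
  have su: "(\<Sum>X\<in>Pow W. (-1) ^ card (W - X) * int (hw adj hadj hdeg X T)) = int (su T)" if T: "T \<in> Pow U" for T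
  proof -
    have fl: "finite (?L W T)" using finite_locmaps fin finT[OF T] by blast
    have "(\<Sum>X\<in>Pow W. (-1) ^ card (W - X) * int (hw adj hadj hdeg X T)) =
      (\<Sum>X\<in>Pow W. (-1) ^ card (W - X) * (\<Sum>\<sigma>\<in>?L W T. if \<sigma> ` T \<subseteq> X then 1 else 0))"
    proof (intro sum.cong refl)
      fix X assume X: "X \<in> Pow W"
      have "int (hw adj hadj hdeg X T) = int (card {\<sigma> \<in> ?L W T. \<sigma> ` T \<subseteq> X})"
        unfolding hw_def by (subst L) (use X in auto)
      also have "\<dots> = (\<Sum>\<sigma>\<in>?L W T. if \<sigma> ` T \<subseteq> X then 1 else 0)"
        using fl by (simp add: sum.If_cases Int_def)
      finally show "(-1) ^ card (W - X) * int (hw adj hadj hdeg X T) =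
        (-1) ^ card (W - X) * (\<Sum>\<sigma>\<in>?L W T. if \<sigma> ` T \<subseteq> X then 1 else 0)" by simp
    qed
    also have "\<dots> = (\<Sum>\<sigma>\<in>?L W T. \<Sum>X\<in>Pow W. (-1) ^ card (W - X) * (if \<sigma> ` T \<subseteq> X then 1 else 0))"
      unfolding sum_distrib_left by (rule sum.swap)
    also have "\<dots> = (\<Sum>\<sigma>\<in>?L W T. if \<sigma> ` T = W then 1 else 0)"
    proof (rule sum.cong[OF refl])
      fix \<sigma> assume "\<sigma> \<in> ?L W T"
      then have "\<sigma> ` T \<subseteq> W" by (auto simp: locmaps_def)
      then show "(\<Sum>X\<in>Pow W. (-1) ^ card (W - X) * (if \<sigma> ` T \<subseteq> X then 1 else 0)) = (if \<sigma> ` T = W then 1 else (0::int))"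
        using alternating_sum_supersets[OF fin(1)] by blast
    qed
    also have "\<dots> = int (su T)" unfolding su_def using fl by (simp add: sum.If_cases Int_def)
    finally show ?thesis .
  qed
  have small: "su T = 0" if "T \<in> Pow U" "card T < card W" for T
  proof -
    have "\<sigma> ` T \<noteq> W" for \<sigma> using card_image_le[OF finT[OF that(1)], of \<sigma>] that(2) by auto
    then show ?thesis by (simp add: su_def)
  qed
  have eq: "su T = card (isos adj hadj W T)" if "T \<in> Pow U" "card T = card W" for T
    unfolding su_def using locmaps_bij[OF fin(1) finT[OF that(1)] that(2) hdeg] by simp
  have "(\<Sum>X\<in>Pow W. (-1) ^ card (W - X) * (\<Sum>T\<in>Pow U. int (hw adj hadj hdeg X T) * z ^ card T))
    = (\<Sum>T\<in>Pow U. (\<Sum>X\<in>Pow W. (-1) ^ card (W - X) * int (hw adj hadj hdeg X T)) * z ^ card T)"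
    unfolding sum_distrib_left sum_distrib_right by (subst sum.swap) (simp add: mult.assoc)
  also have "\<dots> = (\<Sum>T\<in>Pow U. int (su T) * z ^ card T)" using su by simp
  also have "\<dots> = (\<Sum>T\<in>Pow U. (if card T = card W then int (su T) * z ^ card W else 0) +
      (if card T > card W then int (su T) * z ^ (card T - Suc (card W)) else 0) * z ^ Suc (card W))"
  proof (intro sum.cong refl)
    fix T assume T: "T \<in> Pow U"
    consider "card T < card W" | "card T = card W" | "card W < card T" by linarith
    then show "int (su T) * z ^ card T = (if card T = card W then int (su T) * z ^ card W else 0) +
      (if card T > card W then int (su T) * z ^ (card T - Suc (card W)) else 0) * z ^ Suc (card W)"
    proof cases
      case 1 then show ?thesis using small[OF T] by simp
    next
      case 3
      then have "z ^ card T = z ^ (card T - Suc (card W)) * z ^ Suc (card W)"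
        by (metis Suc_leI le_add_diff_inverse2 power_add)
      then show ?thesis using 3 by (simp add: mult.assoc)
    qed simp
  qed
  also have "\<dots> = (\<Sum>T\<in>Pow U. if card T = card W then int (su T) * z ^ card W else 0) +
    (\<Sum>T\<in>Pow U. if card T > card W then int (su T) * z ^ (card T - Suc (card W)) else 0) * z ^ Suc (card W)"
    by (simp add: sum.distrib sum_distrib_right)
  also have "(\<Sum>T\<in>Pow U. if card T = card W then int (su T) * z ^ card W else 0) = int (emb adj hadj W U) * z ^ card W"
  proof -
    have "(\<Sum>T\<in>Pow U. if card T = card W then int (su T) * z ^ card W else 0) =
      (\<Sum>T | T \<subseteq> U \<and> card T = card W. int (su T) * z ^ card W)"
      using fin by (intro sum.mono_neutral_cong_right) auto
    also have "\<dots> = int (emb adj hadj W U) * z ^ card W"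
      unfolding emb_def of_nat_sum sum_distrib_right using eq by (intro sum.cong) auto
    finally show ?thesis .
  qed
  finally show ?thesis by blast
qed


section \<open>Copies, embeddings and automorphisms\<close>

text \<open>The automorphisms act simply transitively on the isomorphisms from T: each arises from
  the fixed \<tau> by composing with exactly one automorphism.\<close>

lemma isos_comp:
  assumes "\<tau> \<in> isos adj hadj W T"
  shows "bij_betw (\<lambda>\<alpha>. restrict (\<alpha> \<circ> \<tau>) T) (isos hadj hadj W W) (isos adj hadj W T)"
proof -
  have t: "bij_betw \<tau> T W" and ta: "\<And>u v. u \<in> T \<Longrightarrow> v \<in> T \<Longrightarrow> adj u v \<longleftrightarrow> hadj (\<tau> u) (\<tau> v)"
    using assms by (auto simp: isos_def)
  let ?i = "inv_into T \<tau>"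
  have i: "bij_betw ?i W T" using t by (rule bij_betw_inv_into)
  have it: "?i (\<tau> u) = u" "\<tau> u \<in> W" if "u \<in> T" for u using t that by (auto simp: bij_betw_def)
  have ti: "\<tau> (?i x) = x" "?i x \<in> T" if "x \<in> W" for x
    using t that bij_betw_inv_into_right i by (fastforce simp: bij_betw_def)+
  show ?thesis
  proof (rule bij_betw_byWitness[where f' = "\<lambda>\<sigma>. restrict (\<sigma> \<circ> ?i) W"])
    show "\<forall>\<alpha>\<in>isos hadj hadj W W. restrict (restrict (\<alpha> \<circ> \<tau>) T \<circ> ?i) W = \<alpha>"
      by (auto simp: isos_def fun_eq_iff PiE_def extensional_def ti)
    show "\<forall>\<sigma>\<in>isos adj hadj W T. restrict (restrict (\<sigma> \<circ> ?i) W \<circ> \<tau>) T = \<sigma>"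
      by (auto simp: isos_def fun_eq_iff PiE_def extensional_def it)
    have "restrict (\<alpha> \<circ> \<tau>) T \<in> isos adj hadj W T" if "\<alpha> \<in> isos hadj hadj W W" for \<alpha>
    proof -
      have "bij_betw (\<alpha> \<circ> \<tau>) T W" using that t by (auto simp: isos_def intro: bij_betw_trans)
      then have "bij_betw (restrict (\<alpha> \<circ> \<tau>) T) T W" by (simp cong: bij_betw_cong)
      then show ?thesis using that ta it(2) by (auto simp: isos_def bij_betw_def)
    qed
    then show "(\<lambda>\<alpha>. restrict (\<alpha> \<circ> \<tau>) T) ` isos hadj hadj W W \<subseteq> isos adj hadj W T" by blast
    have "restrict (\<sigma> \<circ> ?i) W \<in> isos hadj hadj W W" if "\<sigma> \<in> isos adj hadj W T" for \<sigma>
    proof -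
      have "bij_betw (\<sigma> \<circ> ?i) W W" using that i by (auto simp: isos_def intro: bij_betw_trans)
      then have "bij_betw (restrict (\<sigma> \<circ> ?i) W) W W" by (simp cong: bij_betw_cong)
      moreover have "hadj x y \<longleftrightarrow> hadj (\<sigma> (?i x)) (\<sigma> (?i y))" if "x \<in> W" "y \<in> W" for x y
        using \<open>\<sigma> \<in> _\<close> ti[OF that(1)] ti[OF that(2)] ta[of "?i x" "?i y"] by (auto simp: isos_def)
      ultimately show ?thesis by (auto simp: isos_def bij_betw_def)
    qed
    then show "(\<lambda>\<sigma>. restrict (\<sigma> \<circ> ?i) W) ` isos adj hadj W T \<subseteq> isos hadj hadj W W" by blast
  qed
qed

lemma card_isos:
  "card (isos adj hadj W T) = (if isos adj hadj W T = {} then 0 else card (isos hadj hadj W W))"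
  using isos_comp bij_betw_same_card by (metis card.empty equals0I)

text \<open>Every copy is counted once for each automorphism of the pattern, which is why a second
  count on the pattern itself is divided out.\<close>

lemma emb_eq:
  assumes "finite U"
  shows "emb adj hadj W U = card {T. T \<subseteq> U \<and> card T = card W \<and> isos adj hadj W T \<noteq> {}} * card (isos hadj hadj W W)"
proof -
  have "emb adj hadj W U = (\<Sum>T | T \<subseteq> U \<and> card T = card W \<and> isos adj hadj W T \<noteq> {}. card (isos hadj hadj W W))"
    unfolding emb_def using assms card_isos[of adj hadj W]
    by (intro sum.mono_neutral_cong_right) (auto simp: card_isos)
  then show ?thesis by simp
qed

lemma emb_self: assumes "finite W" shows "emb hadj hadj W W = card (isos hadj hadj W W)"
proof -
  have "{T. T \<subseteq> W \<and> card T = card W} = {W}" using assms card_subset_eq by blast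
  then show ?thesis by (simp add: emb_def)
qed

definition gadj :: "nat graph \<Rightarrow> nat \<Rightarrow> nat \<Rightarrow> bool" where
  "gadj G u v \<longleftrightarrow> {u, v} \<in> edges G"

lemma gadj_sym: "gadj G u v \<Longrightarrow> gadj G v u"
  by (simp add: gadj_def insert_commute)

lemma isos_nonempty_iff:
  "isos (gadj G) (gadj H) (verts H) T \<noteq> {} \<longleftrightarrow> isomorphic (induced_subgraph G T) H"
proof
  assume "isos (gadj G) (gadj H) (verts H) T \<noteq> {}"
  then show "isomorphic (induced_subgraph G T) H"
    by (auto simp: isos_def isomorphic_def induced_subgraph_def gadj_def)
next
  assume "isomorphic (induced_subgraph G T) H"
  then obtain f where f: "bij_betw f T (verts H)" "\<forall>u\<in>T. \<forall>v\<in>T. {u, v} \<in> edges G \<longleftrightarrow> {f u, f v} \<in> edges H"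
    by (auto simp: isomorphic_def induced_subgraph_def)
  then have "restrict f T \<in> isos (gadj G) (gadj H) (verts H) T"
    by (auto simp: isos_def gadj_def bij_betw_def)
  then show "isos (gadj G) (gadj H) (verts H) T \<noteq> {}" by blast
qed

lemma emb_ind:
  assumes "finite (verts G)"
  shows "emb (gadj G) (gadj H) (verts H) (verts G) = ind H G * card (isos (gadj H) (gadj H) (verts H) (verts H))"
proof -
  have "{T. T \<subseteq> verts G \<and> card T = card (verts H) \<and> isos (gadj G) (gadj H) (verts H) T \<noteq> {}} =
     {S. S \<subseteq> verts G \<and> isomorphic (induced_subgraph G S) H}"
    unfolding isos_nonempty_iff by (auto simp: isomorphic_def induced_subgraph_def bij_betw_same_card)
  then show ?thesis unfolding emb_eq[OF assms] ind_def by simp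
qed

lemma card_bijections:
  assumes "finite W"
  shows "card {\<sigma> \<in> W \<rightarrow>\<^sub>E W. bij_betw \<sigma> W W} = fact (card W)"
proof -
  have "bij_betw (\<lambda>p. restrict p W) {p. p permutes W} {\<sigma> \<in> W \<rightarrow>\<^sub>E W. bij_betw \<sigma> W W}"
  proof (rule bij_betw_byWitness[where f' = "\<lambda>\<sigma> x. if x \<in> W then \<sigma> x else x"])
    show "\<forall>p\<in>{p. p permutes W}. (\<lambda>x. if x \<in> W then restrict p W x else x) = p"
      by (auto simp: permutes_def fun_eq_iff)
    show "\<forall>\<sigma>\<in>{\<sigma> \<in> W \<rightarrow>\<^sub>E W. bij_betw \<sigma> W W}. restrict (\<lambda>x. if x \<in> W then \<sigma> x else x) W = \<sigma>"
      by (auto simp: fun_eq_iff PiE_def extensional_def)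
    show "(\<lambda>p. restrict p W) ` {p. p permutes W} \<subseteq> {\<sigma> \<in> W \<rightarrow>\<^sub>E W. bij_betw \<sigma> W W}"
      by (auto simp: permutes_in_image dest: permutes_imp_bij cong: bij_betw_cong)
    show "(\<lambda>\<sigma> x. if x \<in> W then \<sigma> x else x) ` {\<sigma> \<in> W \<rightarrow>\<^sub>E W. bij_betw \<sigma> W W} \<subseteq> {p. p permutes W}"
      by (auto intro!: bij_imp_permutes cong: bij_betw_cong)
  qed
  then show ?thesis using card_permutations[OF refl assms] bij_betw_same_card by fastforce
qed

text \<open>Two bijections pull the relation back to the same relation iff they differ by an automorphism.\<close>

lemma card_isos_dvd_fact:
  assumes fin: "finite W"
  shows "card (isos hadj hadj W W) dvd fact (card W)"
proof -
  let ?B = "{\<sigma> \<in> W \<rightarrow>\<^sub>E W. bij_betw \<sigma> W W}"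
  \<comment> \<open>\<open>R \<sigma>\<close> is the relation \<open>hadj\<close> pulled back along
    \<sigma>. A non-empty fibre of R is a set of isomorphisms from one fixed relation, so all fibres
    have the size of the automorphism group.\<close>
  define R where "R \<sigma> = {(x, y). x \<in> W \<and> y \<in> W \<and> hadj (\<sigma> x) (\<sigma> y)}" for \<sigma>
  have finB: "finite ?B" by (rule finite_subset[of _ "W \<rightarrow>\<^sub>E W"]) (auto intro: finite_PiE fin)
  have fib: "card {\<sigma> \<in> ?B. R \<sigma> = r} = card (isos hadj hadj W W)" if "r \<in> R ` ?B" for r
  proof -
    let ?r = "\<lambda>x y. (x, y) \<in> r"
    obtain \<tau> where t: "\<tau> \<in> ?B" "r = R \<tau>" using \<open>r \<in> _\<close> by (rule imageE) blast
    have r: "?r x y \<longleftrightarrow> x \<in> W \<and> y \<in> W \<and> hadj (\<tau> x) (\<tau> y)" for x y unfolding t(2) R_def by simp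
    have R: "R \<sigma> = r \<longleftrightarrow> (\<forall>u\<in>W. \<forall>v\<in>W. ?r u v \<longleftrightarrow> hadj (\<sigma> u) (\<sigma> v))" for \<sigma>
    proof
      assume "R \<sigma> = r"
      then show "\<forall>u\<in>W. \<forall>v\<in>W. ?r u v \<longleftrightarrow> hadj (\<sigma> u) (\<sigma> v)" by (auto simp: R_def)
    next
      assume "\<forall>u\<in>W. \<forall>v\<in>W. ?r u v \<longleftrightarrow> hadj (\<sigma> u) (\<sigma> v)"
      then have "p \<in> R \<sigma> \<longleftrightarrow> p \<in> r" for p using r by (cases p) (auto simp: R_def)
      then show "R \<sigma> = r" by blast
    qed
    have eq: "{\<sigma> \<in> ?B. R \<sigma> = r} = isos ?r hadj W W"
      unfolding isos_def R by blast
    have "\<tau> \<in> isos ?r hadj W W" using t(1) r by (simp add: isos_def)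
    then have "isos ?r hadj W W \<noteq> {}" by blast
    then show ?thesis unfolding eq card_isos[of ?r] by simp
  qed
  have "card ?B = (\<Sum>\<sigma>\<in>?B. 1)" by simp
  also have "\<dots> = (\<Sum>r\<in>R ` ?B. \<Sum>\<sigma> | \<sigma> \<in> ?B \<and> R \<sigma> = r. 1)" by (rule sum.image_gen[OF finB])
  also have "\<dots> = (\<Sum>r\<in>R ` ?B. card (isos hadj hadj W W))"
  proof (rule sum.cong[OF refl])
    fix r assume "r \<in> R ` ?B"
    from fib[OF this] show "(\<Sum>\<sigma> | \<sigma> \<in> ?B \<and> R \<sigma> = r. 1) = card (isos hadj hadj W W)" by simp
  qed
  finally have "card ?B = card (R ` ?B) * card (isos hadj hadj W W)" unfolding sum_constant by simp
  then show ?thesis unfolding card_bijections[OF fin] by (rule dvdI[OF trans]) (rule mult.commute)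
qed

lemma card_isos_pos: "finite W \<Longrightarrow> 0 < card (isos hadj hadj W W)"
  using card_isos_dvd_fact by (metis dvd_0_left_iff fact_nonzero gr0I)

text \<open>A set T with its bijection is recovered from the inverse map from W to U, whose range is
  T. The bound keeps the count below z, so that it can be read off as one coefficient.\<close>

lemma emb_le: assumes "finite U" "finite W" shows "emb adj hadj W U \<le> card U ^ card W"
proof (cases "card W = 0")
  case True
  then have "W = {}" using assms by simp
  then have "{T. T \<subseteq> U \<and> card T = card W} = {{}}" using assms by (auto dest: finite_subset)
  moreover have "card (isos adj hadj {} {}) \<le> card {\<lambda>_ :: nat. undefined :: nat}"
    by (rule card_mono) (auto simp: isos_def)
  ultimately show ?thesis by (simp add: emb_def True \<open>W = {}\<close>)
next
  case False
  let ?P = "Sigma {T. T \<subseteq> U \<and> card T = card W} (isos adj hadj W)"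
  let ?f = "\<lambda>(T, \<sigma>). restrict (inv_into T \<sigma>) W"
  have "inj_on ?f ?P"
  proof (rule inj_onI)
    fix p q assume p: "p \<in> ?P" and q: "q \<in> ?P" and e: "?f p = ?f q"
    obtain T \<sigma> T' \<sigma>' where [simp]: "p = (T, \<sigma>)" "q = (T', \<sigma>')" by (cases p, cases q) auto
    have b: "bij_betw \<sigma> T W" "bij_betw \<sigma>' T' W" using p q by (auto simp: isos_def)
    have "restrict (inv_into T \<sigma>) W = restrict (inv_into T' \<sigma>') W" using e by simp
    then have ii: "inv_into T \<sigma> x = inv_into T' \<sigma>' x" if "x \<in> W" for x
      using that by (metis restrict_apply')
    have "T = inv_into T \<sigma> ` W" "T' = inv_into T' \<sigma>' ` W"
      using b bij_betw_inv_into by (metis bij_betw_def)+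
    then have T: "T = T'" using ii by (metis image_cong)
    have "\<sigma> u = \<sigma>' u" for u
    proof (cases "u \<in> T")
      case True
      have "\<sigma> u \<in> W" using b(1) True by (auto simp: bij_betw_def)
      then have "inv_into T' \<sigma>' (\<sigma> u) = u" using ii[of "\<sigma> u"] b(1) True by (simp add: bij_betw_def)
      then show ?thesis using b(2) \<open>\<sigma> u \<in> W\<close> bij_betw_inv_into_right by metis
    next
      case False
      then show ?thesis using p q T by (auto simp: isos_def PiE_def extensional_def)
    qed
    then show "p = q" using T by auto
  qed
  moreover have "?f ` ?P \<subseteq> W \<rightarrow>\<^sub>E U"
  proof -
    have r: "restrict (inv_into T \<sigma>) W \<in> W \<rightarrow>\<^sub>E U" if "T \<subseteq> U" "\<sigma> \<in> isos adj hadj W T" for T \<sigma>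
      using that inv_into_into[of _ \<sigma> T] by (fastforce simp: isos_def bij_betw_def)
    show ?thesis
    proof (rule image_subsetI)
      fix p assume "p \<in> ?P"
      then obtain T \<sigma> where p: "p = (T, \<sigma>)" "T \<subseteq> U" "\<sigma> \<in> isos adj hadj W T" by blast
      show "?f p \<in> W \<rightarrow>\<^sub>E U" unfolding p(1) case_prod_conv using r[OF p(2,3)] .
    qed
  qed
  ultimately have "card ?P \<le> card (W \<rightarrow>\<^sub>E U)" using assms by (intro card_inj_on_le) (auto intro: finite_PiE)
  moreover have "card ?P = emb adj hadj W U" unfolding emb_def
  proof (rule card_SigmaI)
    show "finite {T. T \<subseteq> U \<and> card T = card W}" using assms by simp
    show "\<forall>T\<in>{T. T \<subseteq> U \<and> card T = card W}. finite (isos adj hadj W T)"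
    proof
      fix T assume "T \<in> {T. T \<subseteq> U \<and> card T = card W}"
      then have "finite (T \<rightarrow>\<^sub>E W)" using assms by (auto intro: finite_PiE finite_subset)
      then show "finite (isos adj hadj W T)" by (rule rev_finite_subset) (simp add: isos_def)
    qed
  qed
  ultimately show ?thesis using assms by (simp add: card_PiE)
qed

text \<open>The program runs through the sets X as the values of an m-bit binary counter.\<close>

lemma sum_Pow_set_decode: "(\<Sum>X\<in>Pow {..<m}. g X) = (\<Sum>t<2 ^ m. g (set_decode t :: nat set))"
proof -
  have "bij_betw set_decode {..<2 ^ m} (Pow {..<m})"
  proof (rule bij_betw_imageI)
    show "inj_on set_decode {..<2 ^ m}" by (rule inj_on_inverseI[where g = set_encode]) simp
    have "finite (set_decode ` {..<2 ^ m :: nat})" by simp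
    have sub: "set_decode ` {..<2 ^ m} \<subseteq> Pow {..<m}"
    proof clarsimp
      fix t x :: nat assume "t < 2 ^ m" "x \<in> set_decode t"
      then have "t div 2 ^ x \<noteq> 0" by (auto simp: set_decode_def elim: oddE)
      then have "2 ^ x \<le> t" by (simp add: div_eq_0_iff)
      then have "(2::nat) ^ x < 2 ^ m" using \<open>t < _\<close> by linarith
      then show "x < m" by simp
    qed
    moreover have "card (set_decode ` {..<2 ^ m :: nat}) = 2 ^ m"
      by (subst card_image) (auto intro: inj_on_inverseI[where g = set_encode])
    ultimately show "set_decode ` {..<2 ^ m} = Pow {..<m}"
      by (intro card_subset_eq) (auto simp: card_Pow)
  qed
  from sum.reindex_bij_betw[OF this, of g] show ?thesis by simp
qed


lemma floop_inv:
  assumes "P 0 s" "\<And>k t. k < n \<Longrightarrow> P k t \<Longrightarrow> P (Suc k) (f k t)"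
  shows "P n (floop f n s)"
proof -
  have "k \<le> n \<Longrightarrow> P k (floop f k s)" for k using assms by (induction k) auto
  then show ?thesis by simp
qed

lemma binop_simps:
  "binop_val w Add x y = (x + y) mod 2 ^ w" "binop_val w Mul x y = (x * y) mod 2 ^ w"
  "binop_val w Div x y = (x div y) mod 2 ^ w" "binop_val w Mod x y = (x mod y) mod 2 ^ w"
  by (simp_all add: take_bit_eq_mod)

lemma binop_sub: "y \<le> x \<Longrightarrow> x < 2 ^ w \<Longrightarrow> binop_val w Sub x y = x - y"
  by (simp add: take_bit_eq_mod) (metis Nat.add_diff_assoc2 diff_le_self le_less_trans mod_add_self2 mod_less)

declare binop_val.simps [simp del] binop_simps [simp]

subsection \<open>Numbers with several digits\<close>

text \<open>The contents of a row holding x: zero from position L on, so that rows represent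
  residues modulo b^L.\<close>

definition dig :: "nat \<Rightarrow> nat \<Rightarrow> nat \<Rightarrow> nat \<Rightarrow> nat" where
  "dig b L x j = (if j < L then x div b ^ j mod b else 0)"

definition val :: "nat \<Rightarrow> nat \<Rightarrow> (nat \<Rightarrow> nat) \<Rightarrow> nat" where
  "val b L r = (\<Sum>k<L. r k * b ^ k)"

lemma val_dig_mod: "j \<le> L \<Longrightarrow> (\<Sum>k<j. dig b L x k * b ^ k) = x mod b ^ j"
proof (induction j)
  case (Suc j)
  have "x mod b ^ Suc j = b ^ j * (x div b ^ j mod b) + x mod b ^ j"
    by (metis mod_mult2_eq power_Suc2)
  then show ?case using Suc by (simp add: dig_def mult.commute)
qed simp

lemma val_dig: "val b L (dig b L x) = x mod b ^ L"
  using val_dig_mod[of L L b x] by (simp add: val_def)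

lemma val_less: "0 < b \<Longrightarrow> (\<And>k. k < L \<Longrightarrow> r k < b) \<Longrightarrow> val b L r < b ^ L"
proof (induction L)
  case (Suc L)
  have "val b L r < b ^ L" using Suc by simp
  moreover have "r L \<le> b - 1" using Suc.prems(2)[of L] by simp
  ultimately have "val b L r + r L * b ^ L < b ^ L + (b - 1) * b ^ L" by (intro add_less_le_mono mult_right_mono) auto
  also have "\<dots> = b ^ Suc L" using \<open>0 < b\<close> by (cases b) auto
  finally show ?case by (simp add: val_def)
qed (simp add: val_def)

lemma val_upd: "p < L \<Longrightarrow> val b L (r(p := v)) + r p * b ^ p = val b L r + v * b ^ p"
proof -
  assume "p < L"
  then have "val b L f = f p * b ^ p + (\<Sum>k\<in>{..<L} - {p}. f k * b ^ k)" for f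
    unfolding val_def by (intro sum.remove) auto
  from this[of r] this[of "r(p := v)"] show ?thesis by simp
qed

text \<open>Uniqueness of digit expansions. It turns an invariant about the value of a row into the
  exact contents of the row.\<close>

lemma dig_val:
  assumes "\<And>k. k < L \<Longrightarrow> r k < b" "\<And>k. L \<le> k \<Longrightarrow> r k = 0"
  shows "r = dig b L (val b L r)"
proof
  fix j
  show "r j = dig b L (val b L r) j"
  proof (cases "j < L")
    case True
    then have b: "0 < b" using assms(1)[OF True] by linarith
    have *: "val b (Suc k) r div b ^ k mod b = r k \<and> val b (Suc k) r div b ^ k = r k" if "k < L" for k
    proof -
      have "val b k r < b ^ k" using val_less[OF b] assms(1) that by simp
      moreover have "val b (Suc k) r = val b k r + r k * b ^ k" by (simp add: val_def)
      ultimately show ?thesis using assms(1)[OF that] b by simp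
    qed
    have "\<exists>q. val b L r = val b (Suc j) r + q * b ^ Suc j"
    proof -
      have "val b L r = val b (Suc j) r + (\<Sum>k=Suc j..<L. r k * b ^ k)"
        unfolding val_def using True sum.atLeastLessThan_concat[of 0 "Suc j" L "\<lambda>k. r k * b ^ k"]
        by (simp only: lessThan_atLeast0 Suc_leI le0)
      also have "(\<Sum>k=Suc j..<L. r k * b ^ k) = (\<Sum>k=Suc j..<L. r k * b ^ (k - Suc j)) * b ^ Suc j"
        unfolding sum_distrib_right
      proof (rule sum.cong[OF refl])
        fix k assume "k \<in> {Suc j..<L}"
        then have "b ^ k = b ^ (k - Suc j) * b ^ Suc j" by (subst power_add[symmetric]) simp
        then show "r k * b ^ k = r k * b ^ (k - Suc j) * b ^ Suc j" by (simp only: mult.assoc)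
      qed
      finally show ?thesis by blast
    qed
    then obtain q where q: "val b L r = val b (Suc j) r + q * b ^ Suc j" ..
    have "val b L r div b ^ j = q * b + val b (Suc j) r div b ^ j"
    proof -
      have "q * b ^ Suc j = q * b * b ^ j" by simp
      then show ?thesis unfolding q using b by (metis add.commute div_mult_self1 less_numeral_extra(3) power_not_zero)
    qed
    then have "val b L r div b ^ j mod b = r j" using *[OF True] by (metis mod_mult_self3)
    then show ?thesis using True by (simp add: dig_def)
  qed (simp add: assms dig_def)
qed

lemma dig_mod: "0 < b \<Longrightarrow> dig b L (x mod b ^ L) = dig b L x"
proof -
  assume "0 < b"
  then have "dig b L x = dig b L (val b L (dig b L x))" by (intro dig_val) (auto simp: dig_def)
  then show ?thesis by (simp add: val_dig)
qed

lemma dig_0 [simp]: "dig b L 0 = (\<lambda>_. 0)" by (auto simp: dig_def)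

lemma dig_less: "0 < b \<Longrightarrow> dig b L x k < b" by (simp add: dig_def)


abbreviation add (infixl \<open>\<oplus>\<close> 65) where "x \<oplus> y \<equiv> Bin Add x y"
abbreviation mul (infixl \<open>\<otimes>\<close> 70) where "x \<otimes> y \<equiv> Bin Mul x y"

definition clear :: com where
  "clear = For 21 8 (Put 3 (Var 24) (Var 21) (Num 0))"

text \<open>Schoolbook multiplication: row 24 gains row 25 times row 26, with the carry in variable
  22. Positions from L on, and carries into them, are dropped; this is the reduction modulo
  b^L.\<close>

definition addmul :: com where
  "addmul = For 20 8 (Asg 22 (Num 0) ;;
     For 21 8 (Cond (Var 20 \<oplus> Var 21) (Var 8)
       (Asg 23 (Arr 3 (Var 24) (Var 20 \<oplus> Var 21) \<oplus>
           Arr 3 (Var 25) (Var 20) \<otimes> Arr 3 (Var 26) (Var 21) \<oplus> Var 22) ;;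
        Put 3 (Var 24) (Var 20 \<oplus> Var 21) (Bin Mod (Var 23) (Var 9)) ;;
        Asg 22 (Bin Div (Var 23) (Var 9)))
       (Asg 23 (Num 0))))"

definition bclear :: "exp \<Rightarrow> com" where "bclear d = Asg 24 d ;; clear"
text \<open>Row 4 will hold the number 1, so copying and adding are this operation with row 4 as one
  factor.\<close>

definition bmac :: "exp \<Rightarrow> exp \<Rightarrow> exp \<Rightarrow> com" where
  "bmac d x y = Asg 24 d ;; Asg 25 x ;; Asg 26 y ;; addmul"

locale big = ram +
  fixes b L :: nat
  assumes b2: "2 \<le> b" and bb: "b * b \<le> 2 ^ w" and L1: "1 \<le> L" and LS: "L \<le> S"
begin

lemma L_bound: "L + L < 2 ^ w" "L < 2 ^ w" "b < 2 ^ w"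
proof -
  have "S * S \<ge> S" using S_pos by simp
  moreover have "narrs * S * S = narrs * (S * S)" by simp
  ultimately show "L + L < 2 ^ w" using LS space B_pos by linarith
  then show "L < 2 ^ w" by linarith
  have "b * 2 \<le> b * b" using b2 by simp
  then show "b < 2 ^ w" using bb b2 by linarith
qed

abbreviation dg where "dg \<equiv> dig b L"

lemma clear_spec:
  assumes "vr s 8 = L" "vr s 24 = r" "r < S" "ar s 3 r = dg u"
  shows "ar (sem clear s) = (ar s)(3 := (ar s 3)(r := dg 0))"
proof -
  let ?f = "\<lambda>k s. sem (Put 3 (Var 24) (Var 21) (Num 0)) (setv 21 k s)"
  define J where "J j t \<longleftrightarrow> vr t 24 = r \<and> ar t = (ar s)(3 := (ar s 3)(r := (\<lambda>i. if i < j then 0 else ar s 3 r i)))" for j and t :: st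
  have "J L (floop ?f L s)"
  proof (rule floop_inv[where P = J])
    have "(\<lambda>i. if i < 0 then 0 else ar s 3 r i) = ar s 3 r" by simp
    then show "J 0 s" using assms(2) by (simp add: J_def del: not_less_zero)
  next
    fix j t assume j: "j < L" and "J j t"
    then have t: "vr t 24 = r" "ar t = (ar s)(3 := (ar s 3)(r := (\<lambda>i. if i < j then 0 else ar s 3 r i)))"
      by (simp_all add: J_def)
    have "(\<lambda>i. if i < j then 0 else ar s 3 r i)(j := 0) = (\<lambda>i. if i < Suc j then 0 else ar s 3 r i)"
      by (auto simp: fun_eq_iff)
    then show "J (Suc j) (?f j t)" using t j LS assms(3) by (simp add: J_def)
  qed
  then have "ar (floop ?f L s) = (ar s)(3 := (ar s 3)(r := (\<lambda>j. if j < L then 0 else ar s 3 r j)))"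
    by (simp add: J_def)
  moreover have "(\<lambda>j. if j < L then 0 else ar s 3 r j) = dg 0" using assms(4) by (auto simp: dig_def)
  ultimately show ?thesis using assms(1) by (simp add: clear_def)
qed

text \<open>(b - 1)^2 + 2 (b - 1) = b^2 - 1: a digit plus a product of digits plus a carry fits into
  one word because digits are half words.\<close>

lemma addmul_digit_bound:
  assumes "x < b" "y < b" "u < b" "c < b"
  shows "u + x * y + c < 2 ^ w" "x * y < 2 ^ w" "(u + x * y + c) div b < b" "u + x * y < 2 ^ w"
proof -
  obtain b' where b': "b = Suc b'" using b2 by (cases b) auto
  have "x * y \<le> b' * b'" using assms b' by (intro mult_mono) auto
  moreover have "b * b = b' * b' + 2 * b' + 1" by (simp add: b')
  ultimately have "u + x * y + c < b * b" using assms b' by linarith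
  then show "u + x * y + c < 2 ^ w" "x * y < 2 ^ w" "u + x * y < 2 ^ w" using bb by linarith+
  show "(u + x * y + c) div b < b" using \<open>u + x * y + c < b * b\<close> by (simp add: less_mult_imp_div_less)
qed

lemma addmul_spec:
  assumes v: "vr s 8 = L" "vr s 9 = b" "vr s 24 = rd" "vr s 25 = ra" "vr s 26 = rb"
    and r: "rd < S" "ra < S" "rb < S" "rd \<noteq> ra" "rd \<noteq> rb"
    and d: "ar s 3 rd = dg u" "ar s 3 ra = dg x" "ar s 3 rb = dg y"
  shows "ar (sem addmul s) = (ar s)(3 := (ar s 3)(rd := dg (u + x * y)))"
proof -
  define M where "M = b ^ L"
  define Pd where "Pd t q \<longleftrightarrow> ar t = (ar s)(3 := (ar s 3)(rd := q)) \<and> (\<forall>k. q k < b) \<and> (\<forall>k\<ge>L. q k = 0) \<and>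
    vr t 8 = L \<and> vr t 9 = b \<and> vr t 24 = rd \<and> vr t 25 = ra \<and> vr t 26 = rb" for t :: st and q
  define body where "body = Cond (Var 20 \<oplus> Var 21) (Var 8)
       (Asg 23 (Arr 3 (Var 24) (Var 20 \<oplus> Var 21) \<oplus>
           Arr 3 (Var 25) (Var 20) \<otimes> Arr 3 (Var 26) (Var 21) \<oplus> Var 22) ;;
        Put 3 (Var 24) (Var 20 \<oplus> Var 21) (Bin Mod (Var 23) (Var 9)) ;;
        Asg 22 (Bin Div (Var 23) (Var 9)))
       (Asg 23 (Num 0))"
  have b0: "0 < b" using b2 by simp
  have drop: "(a + c * e) mod M = a mod M" if "M dvd e" for a c e :: nat
    using that by (metis dvd_def mod_mult_self2 mult.left_commute)
  \<comment> \<open>One line of the schoolbook scheme. Equality can only hold modulo M = b^L,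
    because the carry that leaves the row is lost.\<close>
  have inner: "\<exists>q'. Pd (sem (Asg 22 (Num 0) ;; For 21 8 body) (setv 20 i t)) q' \<and>
      val b L q' mod M = (val b L q + dg x i * b ^ i * y) mod M"
    if P: "Pd t q" and i: "i < L" for i t q
  proof -
    let ?t0 = "sem (Asg 22 (Num 0)) (setv 20 i t)"
    let ?f = "\<lambda>k s. sem body (setv 21 k s)"
    \<comment> \<open>The pending carry counts with the weight of the position i + j at which it
      will be added.\<close>
    define J where "J j t' \<longleftrightarrow> (\<exists>q'. Pd t' q' \<and> vr t' 20 = i \<and> vr t' 22 < b \<and>
       (val b L q' + vr t' 22 * b ^ (i + j)) mod M = (val b L q + dg x i * b ^ i * (\<Sum>k<j. dg y k * b ^ k)) mod M)" for j and t' :: st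
    have "J L (floop ?f L ?t0)"
    proof (rule floop_inv[where P = J])
      have "Pd ?t0 q" using P by (simp add: Pd_def)
      then show "J 0 ?t0" using b0 unfolding J_def by (intro exI[of _ q]) simp
    next
      fix j t1 assume j: "j < L" and "J j t1"
      then obtain q1 where q1: "Pd t1 q1" "vr t1 20 = i" "vr t1 22 < b" and
        e: "(val b L q1 + vr t1 22 * b ^ (i + j)) mod M = (val b L q + dg x i * b ^ i * (\<Sum>k<j. dg y k * b ^ k)) mod M"
        by (auto simp: J_def)
      let ?c = "vr t1 22"
      have ij: "i + j < 2 ^ w" using i j L_bound by linarith
      have goal: "(val b L q + dg x i * b ^ i * (\<Sum>k<Suc j. dg y k * b ^ k)) mod M =
        (val b L q1 + ?c * b ^ (i + j) + dg x i * dg y j * b ^ (i + j)) mod M"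
      proof -
        have "val b L q + dg x i * b ^ i * (\<Sum>k<Suc j. dg y k * b ^ k) =
          (val b L q + dg x i * b ^ i * (\<Sum>k<j. dg y k * b ^ k)) + dg x i * dg y j * b ^ (i + j)"
          by (simp add: algebra_simps power_add)
        also have "\<dots> mod M = (val b L q1 + ?c * b ^ (i + j) + dg x i * dg y j * b ^ (i + j)) mod M"
          by (rule mod_add_cong[OF e[symmetric] refl])
        finally show ?thesis .
      qed
      show "J (Suc j) (?f j t1)"
      proof (cases "i + j < L")
        case True
        let ?t = "q1 (i + j) + dg x i * dg y j + ?c"
        have bd: "?t < 2 ^ w" "dg x i * dg y j < 2 ^ w" "?t div b < b" "q1 (i + j) + dg x i * dg y j < 2 ^ w"
          using addmul_digit_bound[of "dg x i" "dg y j" "q1 (i + j)" ?c] q1 b0 by (auto simp: Pd_def dig_less)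
        have small: "?t mod b < 2 ^ w" "?t div b < 2 ^ w" "i < S" "j < S" "i + j < S"
          using bd L_bound i j True LS mod_less_divisor[OF b0, of ?t] by linarith+
        let ?q = "q1(i + j := ?t mod b)"
        have st: "ar (?f j t1) = (ar s)(3 := (ar s 3)(rd := ?q))" "vr (?f j t1) 22 = ?t div b"
          "\<forall>v. v \<noteq> 21 \<longrightarrow> v \<noteq> 22 \<longrightarrow> v \<noteq> 23 \<longrightarrow> vr (?f j t1) v = vr t1 v"
          using q1 True ij bd small r d unfolding body_def by (auto simp: Pd_def)
        have "Pd (?f j t1) ?q" using q1 st True b0 by (auto simp: Pd_def)
        moreover have "val b L ?q + ?t div b * b ^ (i + Suc j) = val b L q1 + ?c * b ^ (i + j) + dg x i * dg y j * b ^ (i + j)"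
        proof -
          have "val b L ?q + q1 (i + j) * b ^ (i + j) = val b L q1 + ?t mod b * b ^ (i + j)"
            using val_upd[OF True] .
          moreover have "?t mod b * b ^ (i + j) + ?t div b * b ^ (i + Suc j) = ?t * b ^ (i + j)"
          proof -
            have "T mod b * p + T div b * (b * p) = T * p" for T p :: nat
            proof -
              have "T * p = (T mod b + T div b * b) * p" by simp
              also have "\<dots> = T mod b * p + T div b * (b * p)" by (simp only: distrib_right mult.assoc)
              finally show ?thesis by simp
            qed
            then show ?thesis unfolding add_Suc_right power_Suc by blast
          qed
          moreover have "?t * b ^ (i + j) = q1 (i + j) * b ^ (i + j) + ?c * b ^ (i + j) + dg x i * dg y j * b ^ (i + j)"
            by (simp add: algebra_simps)
          ultimately show ?thesis by linarith
        qed
        ultimately show ?thesis using goal st q1(2) bd(3) unfolding J_def by (intro exI[of _ ?q]) simp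
      next
        case False
        have st: "ar (?f j t1) = ar t1" "\<forall>v. v \<noteq> 21 \<longrightarrow> v \<noteq> 23 \<longrightarrow> vr (?f j t1) v = vr t1 v"
          using q1 False ij unfolding body_def by (auto simp: Pd_def)
        \<comment> \<open>From position L on both the carry and the product have weights divisible
          by M, so skipping the round changes nothing modulo M.\<close>
        have "M dvd b ^ (i + j)" "M dvd b ^ (i + Suc j)" using False unfolding M_def by (auto intro!: le_imp_power_dvd simp del: power_Suc add_Suc_right)
        then have "(val b L q1 + ?c * b ^ (i + Suc j)) mod M = val b L q1 mod M"
          "(val b L q1 + ?c * b ^ (i + j) + dg x i * dg y j * b ^ (i + j)) mod M = val b L q1 mod M"
          unfolding add.assoc distrib_right[symmetric] using drop by blast+
        then show ?thesis using goal st q1 unfolding J_def by (intro exI[of _ q1]) (simp add: Pd_def)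
      qed
    qed
    then obtain q' where q': "Pd (floop ?f L ?t0) q'" "(val b L q' + vr (floop ?f L ?t0) 22 * b ^ (i + L)) mod M =
        (val b L q + dg x i * b ^ i * (y mod M)) mod M"
      using val_dig_mod[of L L b y] by (auto simp: J_def M_def)
    have "M dvd b ^ (i + L)" by (simp add: M_def le_imp_power_dvd)
    then have "val b L q' mod M = (val b L q + dg x i * b ^ i * (y mod M)) mod M"
      using q'(2) drop by simp
    also have "\<dots> = (val b L q + dg x i * b ^ i * y) mod M" by (metis mod_add_right_eq mod_mult_right_eq)
    finally show ?thesis using q'(1) P by (intro exI[of _ q']) (auto simp: Pd_def)
  qed
  let ?g = "\<lambda>k s. sem (Asg 22 (Num 0) ;; For 21 8 body) (setv 20 k s)"
  define K where "K i t \<longleftrightarrow> (\<exists>q. Pd t q \<and> val b L q mod M = (val b L (dg u) + (\<Sum>k<i. dg x k * b ^ k) * y) mod M)" for i and t :: st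
  have "K L (floop ?g L s)"
  proof (rule floop_inv[where P = K])
    have "ar s = (ar s)(3 := (ar s 3)(rd := dg u))" using d(1) by (metis fun_upd_triv)
    moreover have "\<forall>k\<ge>L. dg u k = 0" by (simp add: dig_def)
    ultimately have "Pd s (dg u)" using v b0 unfolding Pd_def by (simp add: dig_less)
    then show "K 0 s" unfolding K_def by (intro exI[of _ "dg u"]) simp
  next
    fix i t assume i: "i < L" and "K i t"
    then obtain q where q: "Pd t q" "val b L q mod M = (val b L (dg u) + (\<Sum>k<i. dg x k * b ^ k) * y) mod M"
      by (auto simp: K_def)
    obtain q' where q': "Pd (?g i t) q'" "val b L q' mod M = (val b L q + dg x i * b ^ i * y) mod M"
      using inner[OF q(1) i] by blast
    have "val b L (dg u) + (\<Sum>k<Suc i. dg x k * b ^ k) * y = val b L (dg u) + (\<Sum>k<i. dg x k * b ^ k) * y + dg x i * b ^ i * y"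
      by (simp add: algebra_simps)
    then have "val b L q' mod M = (val b L (dg u) + (\<Sum>k<Suc i. dg x k * b ^ k) * y) mod M"
      using q'(2) mod_add_cong[OF q(2) refl, of "dg x i * b ^ i * y"] by (simp add: add.assoc)
    then show "K (Suc i) (?g i t)" using q'(1) unfolding K_def by blast
  qed
  then obtain q where q: "Pd (floop ?g L s) q" "val b L q mod M = (val b L (dg u) + (x mod M) * y) mod M"
    using val_dig_mod[of L L b x] by (auto simp: K_def M_def)
  have "(val b L (dg u) + (x mod M) * y) mod M = (u + x * y) mod M"
    unfolding val_dig M_def by (metis mod_add_left_eq mod_add_right_eq mod_mult_left_eq)
  moreover have "val b L q < M" using q(1) b0 unfolding M_def Pd_def by (intro val_less) auto
  ultimately have "val b L q = (u + x * y) mod M" using q(2) by simp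
  moreover have "q = dg (val b L q)" using q(1) unfolding Pd_def by (intro dig_val) auto
  ultimately have "q = dg (u + x * y)" using dig_mod[OF b0] unfolding M_def by metis
  then show ?thesis using q(1) v(1) unfolding addmul_def body_def[symmetric] by (simp add: Pd_def)
qed

end


subsection \<open>Running times of blocks\<close>

fun csize :: "com \<Rightarrow> nat" where
  "csize (Asg x e) = lang.elen e + 1"
| "csize (Put a i j e) = lang.elen i + lang.elen j + lang.elen e + 9"
| "csize (c1 ;; c2) = csize c1 + csize c2"
| "csize (Cond a b c1 c2) = lang.elen a + lang.elen b + 2 + csize c1 + csize c2"
| "csize (For i p c) = 7 + csize c"

text \<open>Loops whose bound satisfies R are counted apart, so that a factor D or n can be kept
  separate from factors polynomial in m.\<close>

fun nest :: "(nat \<Rightarrow> bool) \<Rightarrow> com \<Rightarrow> nat" where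
  "nest R (Asg x e) = 0"
| "nest R (Put a i j e) = 0"
| "nest R (c1 ;; c2) = max (nest R c1) (nest R c2)"
| "nest R (Cond a b c1 c2) = max (nest R c1) (nest R c2)"
| "nest R (For i p c) = (if R p then 1 else 0) + nest R c"

lemma cb_bound:
  assumes "1 \<le> q" "1 \<le> g" "\<forall>p\<in>set (lvars c). env p \<le> (if R p then g else q)"
  shows "lang.cb env c \<le> csize c * q ^ nest (\<lambda>p. \<not> R p) c * g ^ nest R c"
  using assms(3)
proof (induction c)
  case (Seq c1 c2)
  let ?n = "nest (\<lambda>p. \<not> R p)" and ?N = "nest R"
  have "csize c * q ^ ?n c * g ^ ?N c \<le> csize c * q ^ ?n (c1 ;; c2) * g ^ ?N (c1 ;; c2)" if "c = c1 \<or> c = c2" for c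
    using assms that by (intro mult_mono power_increasing) auto
  from this[of c1] this[of c2] Seq show ?case unfolding lang.cb.simps csize.simps distrib_right
    by (intro add_mono) (auto intro: order_trans)
next
  case (Cond a b c1 c2)
  let ?n = "nest (\<lambda>p. \<not> R p)" and ?N = "nest R"
  let ?X = "q ^ ?n (Cond a b c1 c2) * g ^ ?N (Cond a b c1 c2)"
  have "csize c * q ^ ?n c * g ^ ?N c \<le> csize c * ?X" if "c = c1 \<or> c = c2" for c
    using assms that unfolding mult.assoc by (intro mult_mono power_increasing) auto
  from this[of c1] this[of c2] Cond have "lang.cb env c1 \<le> csize c1 * ?X" "lang.cb env c2 \<le> csize c2 * ?X"
    by (auto intro: order_trans)
  moreover have "1 \<le> ?X" using assms by simp
  then have "lang.elen a + lang.elen b + 2 \<le> (lang.elen a + lang.elen b + 2) * ?X"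
    by (metis mult.right_neutral mult_le_mono2)
  ultimately show ?case unfolding lang.cb.simps csize.simps mult.assoc distrib_right by linarith
next
  case (For i p c)
  let ?n = "nest (\<lambda>p. \<not> R p)" and ?N = "nest R"
  define X where "X = q ^ ?n c * g ^ ?N c"
  define e where "e = (if R p then g else q)"
  have 1: "lang.cb env c \<le> csize c * X" using For by (simp add: mult.assoc X_def)
  have "1 \<le> X" using assms by (simp add: X_def)
  then have "4 + lang.cb env c \<le> (4 + csize c) * X" using 1 unfolding distrib_right by linarith
  then have "env p * (4 + lang.cb env c) \<le> e * ((4 + csize c) * X)" using For.prems unfolding e_def by (intro mult_mono) auto
  moreover have "1 \<le> e * X" using \<open>1 \<le> X\<close> assms by (auto simp: e_def)
  moreover have "e * ((4 + csize c) * X) = (4 + csize c) * (e * X)" by (simp only: mult.left_commute)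
  ultimately have "3 + env p * (4 + lang.cb env c) \<le> (7 + csize c) * (e * X)" unfolding distrib_right by linarith
  also have "e * X = q ^ ?n (For i p c) * g ^ ?N (For i p c)" by (simp add: e_def X_def)
  finally show ?case unfolding lang.cb.simps csize.simps mult.assoc .
qed (simp_all add: lang.cb.simps)

subsection \<open>The program\<close>

text \<open>Variable 27 is a dummy target and carries no information.\<close>

abbreviation skip :: com where "skip \<equiv> Asg 27 (Num 0)"

definition copyI :: com where
  "copyI = For 40 7 (Put 2 (Var 30 \<oplus> Num 1) (Num 4 \<oplus> Var 40) (Arr 2 (Var 30) (Num 4 \<oplus> Var 40)))"

text \<open>Variable 6 is where the encoding of the host starts in the input. The list of vertex 37
  gets its offset in 38 and its length, a difference of consecutive offsets, in 39.\<close>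

definition load_nbrs :: com where
  "load_nbrs = Asg 38 (Inp (Var 6 \<oplus> Num 1 \<oplus> Var 37)) ;; Asg 39 (Bin Sub (Inp (Var 6 \<oplus> Num 2 \<oplus> Var 37)) (Var 38))"

definition nbr :: exp where "nbr = Inp (Var 6 \<oplus> Var 5 \<oplus> Num 2 \<oplus> Var 38 \<oplus> Var 41)"

text \<open>Looks for an unmarked neighbour of I and leaves it plus one in 36; an initial 0 survives
  if there is none. The loops run to the bounds m and D with guards inside, because the true lengths
  are assigned in the same block and cannot serve as loop bounds.\<close>

definition scan :: com where
  "scan = For 40 7 (Cond (Var 40) (Var 34)
     (Asg 37 (Arr 2 (Var 30) (Num 4 \<oplus> Var 40)) ;; load_nbrs ;;
      For 41 10 (Cond (Var 41) (Var 39)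
        (Asg 42 nbr ;; Cond (Arr 4 (Num 0) (Var 42)) (Num 1) (Asg 36 (Var 42 \<oplus> Num 1)) skip) skip)) skip)"

definition leaf_adj :: com where
  "leaf_adj = For 40 7 (For 41 7 (Put 9 (Var 40) (Var 41) (Num 0))) ;;
   For 40 7 (Cond (Var 40) (Var 34)
     (Asg 37 (Arr 2 (Var 30) (Num 4 \<oplus> Var 40)) ;; load_nbrs ;;
      For 41 10 (Cond (Var 41) (Var 39)
        (Asg 42 nbr ;;
         For 43 7 (Cond (Var 43) (Var 34)
           (Asg 44 (Arr 2 (Var 30) (Num 4 \<oplus> Var 43)) ;;
            Cond (Var 44) (Var 42) skip (Cond (Var 42) (Var 44) skip (Put 9 (Var 40) (Var 43) (Num 1)))) skip))
        skip)) skip)"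

definition leaf_deg :: com where
  "leaf_deg = For 40 7 (Asg 44 (Num 0) ;; For 41 7 (Asg 44 (Var 44 \<oplus> Arr 9 (Var 40) (Var 41))) ;;
     Put 10 (Num 0) (Var 40) (Var 44))"

text \<open>The digits of b ^ L - z ^ s, which represents the negative of z ^ s.\<close>

definition neg_power :: "exp \<Rightarrow> exp \<Rightarrow> com" where
  "neg_power r p = Asg 24 r ;; Asg 46 p ;; For 45 8 (Cond (Var 45) (Var 46)
      (Put 3 (Var 24) (Var 45) (Num 0)) (Put 3 (Var 24) (Var 45) (Bin Sub (Var 9) (Num 1))))"

text \<open>Setting 33 makes \<open>step_prog\<close> run the backtracking search before the next
  step; 31 = 0 announces that the call then has returned.\<close>

definition leaf_init :: com where
  "leaf_init = leaf_adj ;; leaf_deg ;; neg_power (Num 3) (Var 34 \<otimes> Var 12) ;; bclear (Num 10) ;;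
     Asg 50 (Num 0) ;; Put 8 (Num 0) (Num 0) (Num 0) ;; Asg 33 (Num 1) ;; Asg 31 (Num 0)"

text \<open>Horner's scheme t := a + c t, repeated m + 1 times, gives a (1 + c + ... + c^m), the
  truncation of a / (1 - c). Here c is the value just returned in row 10 and a is the sum kept in
  row 16 + depth.\<close>

definition solve :: com where
  "solve = bclear (Num 11) ;; For 43 12 (bclear (Num 12) ;; bmac (Num 12) (Num 16 \<oplus> Var 30) (Num 4) ;;
     bmac (Num 12) (Num 10) (Num 11) ;; bclear (Num 11) ;; bmac (Num 11) (Num 12) (Num 4)) ;;
   bclear (Num 10) ;; bmac (Num 10) (Num 11) (Num 4)"

text \<open>A stack frame is a row of array 2: branching vertex, phase, k, length of I, and the
  vertices of I from column 4 on.\<close>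

definition frame :: "exp \<Rightarrow> exp \<Rightarrow> com" where
  "frame k s = Put 2 (Var 30 \<oplus> Num 1) (Num 2) k ;; Put 2 (Var 30 \<oplus> Num 1) (Num 3) s"

definition push_ext :: com where
  "push_ext = frame (Var 35) (Var 34 \<oplus> Num 1) ;; copyI ;;
     Put 2 (Var 30 \<oplus> Num 1) (Num 4 \<oplus> Var 34) (Var 37) ;; Asg 30 (Var 30 \<oplus> Num 1) ;; Asg 31 (Num 1)"

definition push_same :: com where
  "push_same = frame (Var 35) (Var 34) ;; copyI ;; Asg 30 (Var 30 \<oplus> Num 1) ;; Asg 31 (Num 1)"

definition push_single :: com where
  "push_single = frame (Bin Sub (Var 35) (Var 34)) (Num 1) ;;
     Put 2 (Var 30 \<oplus> Num 1) (Num 4) (Var 37) ;; Asg 30 (Var 30 \<oplus> Num 1) ;; Asg 31 (Num 1)"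

definition load_frame :: com where
  "load_frame = Asg 35 (Arr 2 (Var 30) (Num 2)) ;; Asg 34 (Arr 2 (Var 30) (Num 3))"

text \<open>A call with too long a list is pruned with value 0; otherwise it branches on a vertex
  next to I, which its mark in array 4 removes from U; if there is none, it is a leaf.\<close>

definition down :: com where
  "down = load_frame ;; Cond (Var 35) (Var 34) (bclear (Num 10) ;; Asg 31 (Num 0))
     (Asg 36 (Num 0) ;; scan ;; Cond (Num 0) (Var 36)
        (Asg 37 (Bin Sub (Var 36) (Num 1)) ;; Put 4 (Num 0) (Var 37) (Num 1) ;;
         Put 2 (Var 30) (Num 0) (Var 37) ;; Put 2 (Var 30) (Num 1) (Num 0) ;; push_ext)
        leaf_init)"

text \<open>The phase is the number of subcalls whose results have been taken up: after the first
  the same I is called again, after the second the single vertex x with k reduced by the length of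
  I, after the third the equation is solved and x returns to U.\<close>

definition up :: com where
  "up = Asg 30 (Bin Sub (Var 30) (Num 1)) ;; load_frame ;; Asg 37 (Arr 2 (Var 30) (Num 0)) ;;
     Asg 36 (Arr 2 (Var 30) (Num 1)) ;;
     Cond (Var 36) (Num 1)
       (bclear (Num 16 \<oplus> Var 30) ;; bmac (Num 16 \<oplus> Var 30) (Num 10) (Num 4) ;;
        Put 2 (Var 30) (Num 1) (Num 1) ;; push_same)
       (Cond (Var 36) (Num 2)
          (bmac (Num 16 \<oplus> Var 30) (Num 10) (Num 4) ;; Put 2 (Var 30) (Num 1) (Num 2) ;; push_single)
          (solve ;; Put 4 (Num 0) (Var 37) (Num 0)))"

text \<open>The recursion is finished when the depth 30 and the direction 31 are both 0.\<close>

definition stepA :: com where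
  "stepA = Cond (Num 0) (Var 31) down up ;;
     Cond (Num 0) (Var 30 \<oplus> Var 31) (Asg 32 (Num 1)) (Asg 32 (Num 0))"

text \<open>One move of the search for maps. Array 8 holds the images chosen so far, 50 is the
  level; a candidate equal to m means that the level is exhausted. A complete map adds row 3, which
  represents -z^|I|, to row 10.\<close>

definition dfs :: com where
  "dfs = Asg 51 (Arr 8 (Num 0) (Var 50)) ;;
   Cond (Var 51) (Var 7)
    (Asg 52 (Num 1) ;;
     Cond (Arr 7 (Num 0) (Var 51)) (Num 1) (Asg 52 (Num 0)) skip ;;
     Cond (Arr 6 (Num 0) (Var 51)) (Arr 10 (Num 0) (Var 50)) (Asg 52 (Num 0)) skip ;;
     Cond (Arr 10 (Num 0) (Var 50)) (Arr 6 (Num 0) (Var 51)) (Asg 52 (Num 0)) skip ;;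
     For 40 7 (Cond (Var 40) (Var 50)
       (Cond (Arr 5 (Arr 8 (Num 0) (Var 40)) (Var 51)) (Arr 9 (Var 40) (Var 50)) (Asg 52 (Num 0)) skip) skip) ;;
     Cond (Num 0) (Var 52)
       (Cond (Var 50 \<oplus> Num 1) (Var 34)
          (Asg 50 (Var 50 \<oplus> Num 1) ;; Put 8 (Num 0) (Var 50) (Num 0))
          (bmac (Num 10) (Num 3) (Num 4) ;; Put 8 (Num 0) (Var 50) (Var 51 \<oplus> Num 1)))
       (Put 8 (Num 0) (Var 50) (Var 51 \<oplus> Num 1)))
    (Cond (Num 0) (Var 50)
      (Asg 50 (Bin Sub (Var 50) (Num 1)) ;; Put 8 (Num 0) (Var 50) (Arr 8 (Num 0) (Var 50) \<oplus> Num 1))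
      (Asg 33 (Num 0)))"

definition step_prog :: prog where "step_prog = Do stepA \<then> While 33 (Do dfs)"

definition rec_prog :: prog where "rec_prog = While 32 step_prog"

lemmas block_defs = bclear_def bmac_def clear_def addmul_def copyI_def load_nbrs_def nbr_def scan_def
  leaf_adj_def leaf_deg_def neg_power_def leaf_init_def solve_def frame_def push_ext_def push_same_def
  push_single_def load_frame_def down_def up_def

lemma okc_stepA: "okc stepA" and okc_dfs: "okc dfs"
  unfolding okc_def stepA_def dfs_def block_defs by simp_all

lemma nest_stepA: "nest (\<lambda>p. p = 10) stepA = 1" and nest_dfs: "nest (\<lambda>p. p = 10) dfs = 0"
  unfolding stepA_def dfs_def block_defs by simp_all

lemma lvars_stepA: "set (lvars stepA) = {7, 8, 10, 12}" and lvars_dfs: "set (lvars dfs) = {7, 8}"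
  unfolding stepA_def dfs_def block_defs by auto

lemma writes_stepA: "set (writes stepA) \<subseteq> {20..<60}" and writes_dfs: "set (writes dfs) \<subseteq> {20..<60}"
  unfolding stepA_def dfs_def block_defs by simp_all

lemma awrites_stepA: "set (awrites stepA) \<subseteq> {2, 3, 4, 8, 9, 10}" and awrites_dfs: "set (awrites dfs) \<subseteq> {3, 8}"
  unfolding stepA_def dfs_def block_defs by simp_all


section \<open>A host graph and its representation in memory\<close>

text \<open>The host will be G and later H itself, its encoding starting at \<open>hb\<close>; m is
  the size of the pattern throughout, and D bounds the degrees of the host.\<close>

locale host = big +
  fixes m D hn hb :: nat and nb :: "nat \<Rightarrow> nat list"
  assumes L_eq: "L = (m + 1) * (m + 1)"
    and rows: "hn + 17 \<le> S" and cols: "m + 6 \<le> S" and D_bound: "D < 2 ^ w" and D1: "1 \<le> D"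
    and nb_len: "u < hn \<Longrightarrow> length (nb u) \<le> D" and nb_in: "u < hn \<Longrightarrow> set (nb u) \<subseteq> {..<hn}"
    and inp1: "hb + 2 + hn \<le> B"
    and inp2: "u < hn \<Longrightarrow> inp (hb + 2 + u) = inp (hb + 1 + u) + length (nb u)"
    and inp3: "u < hn \<Longrightarrow> hb + hn + 2 + inp (hb + 1 + u) + length (nb u) \<le> B"
    and inp4: "u < hn \<Longrightarrow> e < length (nb u) \<Longrightarrow> inp (hb + hn + 2 + inp (hb + 1 + u) + e) = nb u ! e"
    and nb_sym: "u < hn \<Longrightarrow> v \<in> set (nb u) \<Longrightarrow> u \<in> set (nb v)"
    and nb_irr: "u < hn \<Longrightarrow> u \<notin> set (nb u)" and nb_distinct: "u < hn \<Longrightarrow> distinct (nb u)"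
begin

definition adj :: "nat \<Rightarrow> nat \<Rightarrow> bool" where "adj u v \<longleftrightarrow> u < hn \<and> v < hn \<and> v \<in> set (nb u)"

lemma sizes: "S < 2 ^ w" "B < 2 ^ w" "hn + 17 < 2 ^ w" "m + 6 < 2 ^ w" "hb + 2 + hn < 2 ^ w" "L < 2 ^ w" "L + L < 2 ^ w"
    "b < 2 ^ w" "B + S < 2 ^ w"
proof -
  have "S * S \<ge> S" using S_pos by simp
  moreover have "narrs * S * S = narrs * (S * S)" by simp
  ultimately show "B + S < 2 ^ w" using space B_pos S_pos by linarith
qed (use S_bound rows cols inp1 L_bound in linarith)+

lemma w_pos [simp]: "0 < w" "w \<noteq> 0" using sizes(3) by (cases w; simp)+

lemma nums: "17 < (2 :: nat) ^ w" "1 < (2 :: nat) ^ w" "2 < (2 :: nat) ^ w" "4 < (2 :: nat) ^ w" using sizes(3) by linarith+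

lemma nums_mod [simp]: "Suc 0 mod 2 ^ w = Suc 0" "(1 :: nat) mod 2 ^ w = 1" "(2 :: nat) mod 2 ^ w = 2"
  "(3 :: nat) mod 2 ^ w = 3" "(4 :: nat) mod 2 ^ w = 4" "(5 :: nat) mod 2 ^ w = 5" "(6 :: nat) mod 2 ^ w = 6"
  "(7 :: nat) mod 2 ^ w = 7" "(8 :: nat) mod 2 ^ w = 8" "(9 :: nat) mod 2 ^ w = 9" "(10 :: nat) mod 2 ^ w = 10"
  "(11 :: nat) mod 2 ^ w = 11" "(12 :: nat) mod 2 ^ w = 12" "(16 :: nat) mod 2 ^ w = 16"
  using nums by simp_all

lemma S_gt [simp]: "S \<noteq> Suc 0" "Suc 0 < S" "1 < S" using rows by linarith+

lemma nums_modS [simp]: "Suc 0 mod S = Suc 0" "(1 :: nat) mod S = 1" "(2 :: nat) mod S = 2"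
  "(3 :: nat) mod S = 3" "(4 :: nat) mod S = 4" "(5 :: nat) mod S = 5" "(6 :: nat) mod S = 6"
  "(7 :: nat) mod S = 7" "(8 :: nat) mod S = 8" "(9 :: nat) mod S = 9" "(10 :: nat) mod S = 10"
  "(11 :: nat) mod S = 11" "(12 :: nat) mod S = 12" "(16 :: nat) mod S = 16"
  using rows by simp_all

text \<open>A mark means removal, so memory filled with zeros represents the full vertex
  set.\<close>

definition marked :: "st \<Rightarrow> nat set \<Rightarrow> bool" where
  "marked s U \<longleftrightarrow> (\<forall>y<hn. ar s 4 0 y = (if y \<in> U then 0 else 1))"

definition params :: "st \<Rightarrow> bool" where
  "params s \<longleftrightarrow> vr s 5 = hn \<and> vr s 6 = hb \<and> vr s 7 = m \<and> vr s 8 = L \<and> vr s 9 = b \<and> vr s 10 = D \<and> vr s 12 = m + 1"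

lemma params_frame: "params s \<Longrightarrow> \<forall>x\<in>set (writes c). x \<notin> {5..12} \<Longrightarrow> params (sem c s)"
  unfolding params_def by (subst vr_frame, fastforce)+ simp

lemma copyI_spec:
  assumes "vr s 7 = m" "vr s 30 = d" "d < hn"
  shows "ar (sem copyI s) = (ar s)(2 := (ar s 2)(Suc d := (\<lambda>j. if 4 \<le> j \<and> j < 4 + m then ar s 2 d j else ar s 2 (Suc d) j)))"
proof -
  let ?f = "\<lambda>k s. sem (Put 2 (Var 30 \<oplus> Num 1) (Num 4 \<oplus> Var 40) (Arr 2 (Var 30) (Num 4 \<oplus> Var 40))) (setv 40 k s)"
  let ?r = "\<lambda>k j. if 4 \<le> j \<and> j < 4 + k then ar s 2 d j else ar s 2 (Suc d) j"
  define J where "J k t \<longleftrightarrow> vr t 30 = d \<and> ar t = (ar s)(2 := (ar s 2)(Suc d := ?r k))" for k and t :: st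
  have "J m (floop ?f m s)"
  proof (rule floop_inv[where P = J])
    have "?r 0 = ar s 2 (Suc d)" by (rule ext) simp
    then show "J 0 s" using assms(2) by (simp add: J_def)
  next
    fix k t assume k: "k < m" and "J k t"
    then have t: "vr t 30 = d" "ar t = (ar s)(2 := (ar s 2)(Suc d := ?r k))" by (simp_all add: J_def)
    have "(?r k)(4 + k := ar s 2 d (4 + k)) = ?r (Suc k)" by (rule ext) auto
    then show "J (Suc k) (?f k t)" using t k assms(3) sizes rows cols by (simp add: J_def)
  qed
  then show ?thesis using assms(1) by (simp add: copyI_def J_def)
qed

lemma load_nbrs_spec:
  assumes "vr s 37 = u" "u < hn" "vr s 6 = hb"
  shows "sem load_nbrs s = setv 39 (length (nb u)) (setv 38 (inp (hb + 1 + u)) s)"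
proof -
  have 1: "hb + 1 + u < B" "hb + 2 + u < B" using assms(2) inp1 by linarith+
  have 2: "inp (hb + 1 + u) < 2 ^ w" "inp (hb + 2 + u) < 2 ^ w" using 1 inp_bound by auto
  have 3: "hb + 1 < 2 ^ w" "hb + 2 < 2 ^ w" "hb + 1 + u < 2 ^ w" "hb + 2 + u < 2 ^ w"
    using 1 sizes by linarith+
  have e1: "ev s (Inp (Var 6 \<oplus> Num 1 \<oplus> Var 37)) = inp (hb + 1 + u)" using assms 1 3 by simp
  have e2: "ev (setv 38 x s) (Inp (Var 6 \<oplus> Num 2 \<oplus> Var 37)) = inp (hb + 2 + u)" for x using assms 1 3 by simp
  show ?thesis unfolding load_nbrs_def sem.simps e1 ev.simps(3)
    using e2[of "inp (hb + 1 + u)"] inp2[OF assms(2)] 2 by (simp add: binop_sub del: ev.simps(5))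
qed

lemma nbr_spec:
  assumes "vr s 6 = hb" "vr s 5 = hn" "u < hn" "vr s 38 = inp (hb + 1 + u)" "vr s 41 = e" "e < length (nb u)"
  shows "ev s nbr = nb u ! e" "nb u ! e < hn" "nb u ! e < 2 ^ w"
proof -
  have "hb + hn + 2 + inp (hb + 1 + u) + e < B" using inp3[OF assms(3)] assms(6) by linarith
  moreover from this have "hb + hn < 2 ^ w" "hb + hn + 2 < 2 ^ w" "hb + hn + 2 + inp (hb + 1 + u) < 2 ^ w"
     "hb + hn + 2 + inp (hb + 1 + u) + e < 2 ^ w" using sizes by linarith+
  ultimately show "ev s nbr = nb u ! e" using assms inp4[OF assms(3,6)] by (simp add: nbr_def)
  show "nb u ! e < hn" using nb_in[OF assms(3)] assms(6) nth_mem by blast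
  then show "nb u ! e < 2 ^ w" using sizes by linarith
qed

definition frow :: "st \<Rightarrow> nat \<Rightarrow> nat list \<Rightarrow> bool" where
  "frow s d I \<longleftrightarrow> (\<forall>j<length I. ar s 2 d (4 + j) = I ! j)"

text \<open>A loop over the neighbours of the vertices of I visits exactly the pairs of an index and a neighbour.\<close>

lemma nbr_loop:
  fixes body :: com and P :: "nat \<Rightarrow> nat \<Rightarrow> st \<Rightarrow> bool"
  assumes s: "params s" "vr s 30 = d" "d \<le> hn" "vr s 34 = length I" "frow s d I" "length I \<le> m" "set I \<subseteq> {..<hn}"
    and w: "set (writes body) \<inter> ({5..12} \<union> {30, 34, 37, 38, 39, 40, 41}) = {}" "2 \<notin> set (awrites body)"
    and P0: "P 0 0 s"
    and Pv: "\<And>i e t x v. P i e t \<Longrightarrow> x \<in> {37, 38, 39, 40, 41, 42, 27} \<Longrightarrow> P i e (setv x v t)"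
    and Pe: "\<And>i e t. P i e t \<Longrightarrow> params t \<Longrightarrow> vr t 30 = d \<Longrightarrow> vr t 34 = length I \<Longrightarrow> frow t d I \<Longrightarrow>
       vr t 40 = i \<Longrightarrow> i < length I \<Longrightarrow> e < length (nb (I ! i)) \<Longrightarrow> vr t 42 = nb (I ! i) ! e \<Longrightarrow> P i (Suc e) (sem body t)"
    and Pi: "\<And>i t. P i (length (nb (I ! i))) t \<Longrightarrow> i < length I \<Longrightarrow> P (Suc i) 0 t"
  shows "P (length I) 0 (sem (For 40 7 (Cond (Var 40) (Var 34)
     (Asg 37 (Arr 2 (Var 30) (Num 4 \<oplus> Var 40)) ;; load_nbrs ;;
      For 41 10 (Cond (Var 41) (Var 39) (Asg 42 nbr ;; body) skip)) skip)) s)"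
proof -
  let ?inner = "Cond (Var 41) (Var 39) (Asg 42 nbr ;; body) skip"
  let ?f = "\<lambda>k s. sem (Cond (Var 40) (Var 34)
     (Asg 37 (Arr 2 (Var 30) (Num 4 \<oplus> Var 40)) ;; load_nbrs ;; For 41 10 ?inner) skip) (setv 40 k s)"
  define C where "C t \<longleftrightarrow> params t \<and> vr t 30 = d \<and> vr t 34 = length I \<and> frow t d I" for t
  have C_setv: "C (setv x v t)" if "C t" "x \<in> {37, 38, 39, 40, 41, 42, 27}" for x v t
    using that by (auto simp: C_def params_def frow_def)
  have C_body: "C (sem body t)" if "C t" for t
  proof -
    have "vr (sem body t) x = vr t x" if "x \<in> {5..12} \<union> {30, 34, 37, 38, 39, 40, 41}" for x using w that by (intro vr_frame) blast
    moreover have "ar (sem body t) 2 = ar t 2" using w(2) by (rule ar_frame)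
    ultimately show ?thesis using that by (simp add: C_def params_def frow_def)
  qed
  \<comment> \<open>Rounds beyond the length of I do nothing; the minimum makes the invariant stand
    still there.\<close>
  have "C (floop ?f m s) \<and> P (min m (length I)) 0 (floop ?f m s)"
  proof (rule floop_inv[where P = "\<lambda>k t. C t \<and> P (min k (length I)) 0 t"])
    show "C s \<and> P (min 0 (length I)) 0 s" using s P0 by (simp add: C_def)
  next
    fix k t assume k: "k < m" and t: "C t \<and> P (min k (length I)) 0 t"
    show "C (?f k t) \<and> P (min (Suc k) (length I)) 0 (?f k t)"
    proof (cases "k < length I")
      case False
      then show ?thesis using t Pv C_setv by (simp add: C_def)
    next
      case True
      let ?u = "I ! k"
      have u: "?u < hn" using s(7) True nth_mem by blast
      let ?t1 = "setv 39 (length (nb ?u)) (setv 38 (inp (hb + 1 + ?u)) (setv 37 ?u (setv 40 k t)))"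
      have "ev (setv 40 k t) (Arr 2 (Var 30) (Num 4 \<oplus> Var 40)) = ?u"
        using t True k s(3) sizes rows cols by (simp add: C_def frow_def)
      moreover have "sem load_nbrs (setv 37 ?u (setv 40 k t)) = ?t1"
        using t u by (intro load_nbrs_spec) (simp_all add: C_def params_def)
      ultimately have ft: "?f k t = sem (For 41 10 ?inner) ?t1"
        using True t by (simp add: C_def del: ev.simps(4))
      let ?g = "\<lambda>e t. sem ?inner (setv 41 e t)"
      define J where "J e t' \<longleftrightarrow> C t' \<and> vr t' 40 = k \<and> vr t' 39 = length (nb ?u) \<and> vr t' 38 = inp (hb + 1 + ?u) \<and>
         P k (min e (length (nb ?u))) t'" for e t'
      have "J D (floop ?g D ?t1)"
      proof (rule floop_inv[where P = J])
        have "C ?t1" using t C_setv by simp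
        moreover have "P k 0 ?t1" using t Pv True by (simp add: min_def)
        ultimately show "J 0 ?t1" by (simp add: J_def)
      next
        fix e t' assume e: "e < D" and t': "J e t'"
        show "J (Suc e) (?g e t')"
        proof (cases "e < length (nb ?u)")
          case False
          then show ?thesis using t' Pv C_setv by (simp add: J_def)
        next
          case True
          let ?t2 = "setv 42 (nb ?u ! e) (setv 41 e t')"
          have "ev (setv 41 e t') nbr = nb ?u ! e"
            using t' u True by (intro nbr_spec(1)) (simp_all add: J_def C_def params_def)
          then have g: "?g e t' = sem body ?t2" using True t' by (simp add: J_def)
          have C2: "C ?t2" using t' C_setv by (simp add: J_def)
          have "P k e ?t2" using t' Pv True by (simp add: J_def min_def)
          then have "P k (Suc e) (sem body ?t2)" using C2 t' True \<open>k < length I\<close> by (intro Pe) (simp_all add: C_def J_def)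
          moreover have "C (sem body ?t2)" using C_body C2 .
          moreover have "vr (sem body ?t2) x = vr ?t2 x" if "x \<in> {38, 39, 40}" for x
            using w that by (intro vr_frame) blast
          ultimately show ?thesis unfolding g using t' True by (simp add: J_def min_def)
        qed
      qed
      then have J: "J D (floop ?g D ?t1)" .
      have D: "vr ?t1 10 = D" using t by (simp add: C_def params_def)
      have "min D (length (nb ?u)) = length (nb ?u)" using nb_len[OF u] by simp
      then have "P (Suc k) 0 (floop ?g D ?t1)" using J Pi True by (simp add: J_def)
      then have "P (Suc k) 0 (setv 41 D (floop ?g D ?t1))" "C (setv 41 D (floop ?g D ?t1))" using J Pv C_setv by (simp_all add: J_def)
      moreover have "?f k t = setv 41 D (floop ?g D ?t1)" unfolding ft by (simp only: sem.simps(5) D)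
      ultimately have "P (Suc k) 0 (?f k t)" "C (?f k t)" by simp_all
      then show ?thesis using True by (simp add: min_def)
    qed
  qed
  moreover have "min m (length I) = length I" using s(6) by simp
  ultimately have "P (length I) 0 (floop ?f m s)" by metis
  then have "P (length I) 0 (setv 40 m (floop ?f m s))" by (rule Pv) simp
  then show ?thesis using s(1) by (simp add: params_def)
qed

lemma scan_spec:
  assumes s: "params s" "vr s 30 = d" "d \<le> hn" "vr s 34 = length I" "frow s d I" "length I \<le> m" "set I \<subseteq> {..<hn}"
    and mk: "marked s U" and z: "vr s 36 = 0"
  shows "vr (sem scan s) 36 = 0 \<Longrightarrow> \<forall>u\<in>set I. set (nb u) \<inter> U = {}"
    "vr (sem scan s) 36 \<noteq> 0 \<Longrightarrow> vr (sem scan s) 36 - 1 \<in> U \<and> vr (sem scan s) 36 - 1 < hn \<and> (\<exists>u\<in>set I. vr (sem scan s) 36 - 1 \<in> set (nb u))"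
proof -
  let ?body = "Cond (Arr 4 (Num 0) (Var 42)) (Num 1) (Asg 36 (Var 42 \<oplus> Num 1)) skip"
  define P where "P i e t \<longleftrightarrow> marked t U \<and>
     (vr t 36 = 0 \<longrightarrow> (\<forall>i'<i. set (nb (I ! i')) \<inter> U = {}) \<and> (\<forall>e'<e. nb (I ! i) ! e' \<notin> U)) \<and>
     (vr t 36 \<noteq> 0 \<longrightarrow> vr t 36 - 1 \<in> U \<and> vr t 36 - 1 < hn \<and> (\<exists>u\<in>set I. vr t 36 - 1 \<in> set (nb u)))" for i e t
  have "P (length I) 0 (sem scan s)" unfolding scan_def
  proof (rule nbr_loop[OF s])
    show "P 0 0 s" using mk z by (simp add: P_def)
    show "P i e (setv x v t)" if "P i e t" "x \<in> {37, 38, 39, 40, 41, 42, 27}" for i e t x v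
      using that by (auto simp: P_def marked_def)
    show "P i (Suc e) (sem ?body t)" if "P i e t" "i < length I" "e < length (nb (I ! i))" "vr t 42 = nb (I ! i) ! e" for i e t
    proof -
      let ?y = "nb (I ! i) ! e"
      have "I ! i < hn" using s(7) that(2) nth_mem by blast
      then have y: "?y < hn" "?y \<in> set (nb (I ! i))" using nb_in that(3) nth_mem by blast+
      have mk: "ar t 4 0 ?y = (if ?y \<in> U then 0 else 1)" using that(1) y(1) by (simp add: P_def marked_def)
      have "sem ?body t = (if ?y \<in> U then setv 36 (?y + 1) t else setv 27 0 t)"
        using y mk that(4) sizes rows by simp
      moreover have "P i (Suc e) (setv 36 (?y + 1) t)" if "?y \<in> U"
        using \<open>P i e t\<close> that y \<open>i < length I\<close> by (auto simp: P_def marked_def)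
      moreover have "P i (Suc e) (setv 27 0 t)" if "?y \<notin> U"
        using \<open>P i e t\<close> that by (auto simp: P_def marked_def less_Suc_eq)
      ultimately show ?thesis by simp
    qed
    show "P (Suc i) 0 t" if "P i (length (nb (I ! i))) t" "i < length I" for i t
      using that by (auto simp: P_def less_Suc_eq in_set_conv_nth)
  qed auto
  then have "vr (sem scan s) 36 = 0 \<Longrightarrow> \<forall>i<length I. set (nb (I ! i)) \<inter> U = {}" by (simp add: P_def)
  then show "vr (sem scan s) 36 = 0 \<Longrightarrow> \<forall>u\<in>set I. set (nb u) \<inter> U = {}" by (metis in_set_conv_nth)
  show "vr (sem scan s) 36 \<noteq> 0 \<Longrightarrow> vr (sem scan s) 36 - 1 \<in> U \<and> vr (sem scan s) 36 - 1 < hn \<and> (\<exists>u\<in>set I. vr (sem scan s) 36 - 1 \<in> set (nb u))"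
    using \<open>P (length I) 0 (sem scan s)\<close> by (simp add: P_def)
qed

section \<open>Arithmetic on rows of digits\<close>

lemma bclear_spec:
  assumes "vr s 8 = L" "ev s e = r" "r < S" "ar s 3 r = dg u"
  shows "ar (sem (bclear e) s) = (ar s)(3 := (ar s 3)(r := dg 0))"
  using clear_spec[of "setv 24 r s" r u] assms by (simp add: bclear_def)

lemma bmac_spec:
  assumes "vr s 8 = L" "vr s 9 = b" "ev s d = rd" "ev (setv 24 rd s) e1 = ra" "ev (setv 25 ra (setv 24 rd s)) e2 = rb"
    and "rd < S" "ra < S" "rb < S" "rd \<noteq> ra" "rd \<noteq> rb"
    and "ar s 3 rd = dg u" "ar s 3 ra = dg x" "ar s 3 rb = dg y"
  shows "ar (sem (bmac d e1 e2) s) = (ar s)(3 := (ar s 3)(rd := dg (u + x * y)))"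
  using addmul_spec[of "setv 26 rb (setv 25 ra (setv 24 rd s))" rd ra rb u x y] assms by (simp add: bmac_def)

lemma vr_bclear: "x \<noteq> 21 \<Longrightarrow> x \<noteq> 24 \<Longrightarrow> vr (sem (bclear e) s) x = vr s x"
  by (rule vr_frame) (simp add: bclear_def clear_def)

lemma vr_bmac: "x < 20 \<or> 26 < x \<Longrightarrow> vr (sem (bmac d e1 e2) s) x = vr s x"
  by (rule vr_frame) (auto simp: bmac_def addmul_def)

text \<open>Scratch rows hold numbers nobody keeps track of, but clearing only touches the first L
  positions and so relies on the remaining ones being zero already.\<close>

definition canon :: "st \<Rightarrow> bool" where "canon s \<longleftrightarrow> (\<forall>r. \<exists>x. ar s 3 r = dg x)"

lemma canonD: "canon s \<Longrightarrow> \<exists>x. ar s 3 r = dg x" by (simp add: canon_def)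

lemma canon_upd: "canon s \<Longrightarrow> ar t 3 = (ar s 3)(r := dg x) \<Longrightarrow> canon t" by (auto simp: canon_def)

lemma b_pos: "0 < b" using b2 by simp

text \<open>The expansion of b^L - b^p consists of zeros below position p and the digit b - 1 from p
  to L - 1.\<close>

lemma neg_power_spec:
  assumes "vr s 8 = L" "vr s 9 = b" "ev s e = r" "r < S" "ev (setv 24 r s) e' = p" "p \<le> L" "ar s 3 r = dg x"
  shows "ar (sem (neg_power e e') s) = (ar s)(3 := (ar s 3)(r := dg (b ^ L - b ^ p)))"
proof -
  let ?f = "\<lambda>k s. sem (Cond (Var 45) (Var 46)
      (Put 3 (Var 24) (Var 45) (Num 0)) (Put 3 (Var 24) (Var 45) (Bin Sub (Var 9) (Num 1)))) (setv 45 k s)"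
  let ?r = "\<lambda>k j. if j < k then (if j < p then 0 else b - 1) else ar s 3 r j"
  define J where "J k t \<longleftrightarrow> vr t 24 = r \<and> vr t 46 = p \<and> vr t 9 = b \<and> ar t = (ar s)(3 := (ar s 3)(r := ?r k))" for k and t :: st
  have "J L (floop ?f L (setv 46 p (setv 24 r s)))"
  proof (rule floop_inv[where P = J])
    have "?r 0 = ar s 3 r" by (rule ext) simp
    then have "(ar s)(3 := (ar s 3)(r := ?r 0)) = ar s" by (simp only: fun_upd_triv)
    then show "J 0 (setv 46 p (setv 24 r s))" using assms by (simp add: J_def)
  next
    fix k t assume k: "k < L" and "J k t"
    then have t: "vr t 24 = r" "vr t 46 = p" "vr t 9 = b" "ar t = (ar s)(3 := (ar s 3)(r := ?r k))"
      by (simp_all add: J_def)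
    have "(?r k)(k := (if k < p then 0 else b - 1)) = ?r (Suc k)" by (rule ext) auto
    then show "J (Suc k) (?f k t)" using t k assms(4) LS sizes(8) b_pos
      by (cases "k < p") (simp_all add: J_def binop_sub)
  qed
  then have "ar (sem (neg_power e e') s) = (ar s)(3 := (ar s 3)(r := ?r L))"
    using assms by (simp add: neg_power_def J_def)
  moreover have "?r L = dg (val b L (?r L))"
    using b_pos assms(7) by (intro dig_val) (auto simp: dig_def)
  moreover have "val b L (?r L) = b ^ L - b ^ p"
  proof -
    have "p \<le> l \<Longrightarrow> (\<Sum>j<l. (if j < p then 0 else b - 1) * b ^ j) + b ^ p = b ^ l" for l
    proof (induction l)
      case (Suc l)
      show ?case
      proof (cases "p = Suc l")
        case False
        then have "(\<Sum>j<l. (if j < p then 0 else b - 1) * b ^ j) + b ^ p = b ^ l" using Suc by simp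
        moreover have "(b - 1) * b ^ l + b ^ l = b ^ Suc l" using b_pos by (cases b) simp_all
        ultimately show ?thesis using False Suc.prems by simp
      qed (auto intro!: sum.neutral)
    qed simp
    from this[OF assms(6)] have "(\<Sum>j<L. (if j < p then 0 else b - 1) * b ^ j) = b ^ L - b ^ p" by simp
    moreover have "val b L (?r L) = (\<Sum>j<L. (if j < p then 0 else b - 1) * b ^ j)"
      unfolding val_def by (rule sum.cong) auto
    ultimately show ?thesis by simp
  qed
  ultimately show ?thesis by metis
qed

lemma solve_spec:
  assumes s: "vr s 8 = L" "vr s 9 = b" "vr s 12 = m + 1" "vr s 30 = d" "d < hn" "canon s"
    and r: "ar s 3 4 = dg 1" "ar s 3 10 = dg c" "ar s 3 (16 + d) = dg a"
  shows "\<exists>x y. ar (sem solve s) = (ar s)(3 := (ar s 3)(10 := dg (\<Sum>i<m+1. c ^ i * a), 11 := dg x, 12 := dg y))"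
proof -
  let ?body = "bclear (Num 12) ;; bmac (Num 12) (Num 16 \<oplus> Var 30) (Num 4) ;;
     bmac (Num 12) (Num 10) (Num 11) ;; bclear (Num 11) ;; bmac (Num 11) (Num 12) (Num 4)"
  let ?f = "\<lambda>k s. sem ?body (setv 43 k s)"
  let ?T = "\<lambda>k. \<Sum>i<k. c ^ i * a"
  define C where "C t \<longleftrightarrow> vr t 8 = L \<and> vr t 9 = b \<and> vr t 12 = m + 1 \<and> vr t 30 = d" for t :: st
  have C: "C (sem (bclear e) t)" "C (sem (bmac e e1 e2) t)" if "C t" for t e e1 e2
    using that by (simp_all add: C_def vr_bclear vr_bmac)
  define J where "J k t \<longleftrightarrow> C t \<and> (\<exists>y. ar t = (ar s)(3 := (ar s 3)(11 := dg (?T k), 12 := dg y)))" for k and t :: st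
  have d16: "16 + d < S" "16 + d < 2 ^ w" using s(5) rows sizes by linarith+
  obtain x11 where x11: "ar s 3 11 = dg x11" using canonD[OF s(6)] by blast
  obtain x12 where x12: "ar s 3 12 = dg x12" using canonD[OF s(6)] by blast
  let ?s0 = "sem (bclear (Num 11)) s"
  have s0: "ar ?s0 = (ar s)(3 := (ar s 3)(11 := dg 0))" using s x11 rows by (intro bclear_spec) auto
  have JL: "J (m + 1) (floop ?f (m + 1) ?s0)"
  proof (rule floop_inv[where P = J])
    have "(ar s 3)(11 := dg 0) = (ar s 3)(11 := dg (?T 0), 12 := dg x12)" using x12 by (auto simp: fun_eq_iff)
    moreover have "C ?s0" using C s by (simp add: C_def)
    ultimately show "J 0 ?s0" unfolding J_def s0 by metis
  next
    fix k t0 assume "J k t0"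
    then obtain y where t0: "C t0" "ar t0 = (ar s)(3 := (ar s 3)(11 := dg (?T k), 12 := dg y))" by (auto simp: J_def)
    let ?t = "setv 43 k t0"
    let ?t1 = "sem (bclear (Num 12)) ?t"
    let ?t2 = "sem (bmac (Num 12) (Num 16 \<oplus> Var 30) (Num 4)) ?t1"
    let ?t3 = "sem (bmac (Num 12) (Num 10) (Num 11)) ?t2"
    let ?t4 = "sem (bclear (Num 11)) ?t3"
    let ?t5 = "sem (bmac (Num 11) (Num 12) (Num 4)) ?t4"
    have C0: "C ?t" using t0 by (simp add: C_def)
    have a1: "ar ?t1 = (ar s)(3 := (ar s 3)(11 := dg (?T k), 12 := dg 0))"
      using C0 t0 rows by (subst bclear_spec[of _ _ 12 y]) (auto simp: C_def)
    have C1: "C ?t1" using C C0 by blast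
    have a2: "ar ?t2 = (ar s)(3 := (ar s 3)(11 := dg (?T k), 12 := dg a))"
      using C1 a1 rows r d16 by (subst bmac_spec[of _ _ 12 _ "16 + d" _ 4 0 a 1]) (auto simp: C_def)
    have C2: "C ?t2" using C C1 by blast
    have a3: "ar ?t3 = (ar s)(3 := (ar s 3)(11 := dg (?T k), 12 := dg (a + c * ?T k)))"
      using C2 a2 rows r by (subst bmac_spec[of _ _ 12 _ 10 _ 11 a c "?T k"]) (auto simp: C_def)
    have C3: "C ?t3" using C C2 by blast
    have a4: "ar ?t4 = (ar s)(3 := (ar s 3)(11 := dg 0, 12 := dg (a + c * ?T k)))"
      using C3 a3 rows by (subst bclear_spec[of _ _ 11 "?T k"]) (auto simp: C_def fun_eq_iff)
    have C4: "C ?t4" using C C3 by blast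
    have a5: "ar ?t5 = (ar s)(3 := (ar s 3)(11 := dg (a + c * ?T k), 12 := dg (a + c * ?T k)))"
      using C4 a4 rows r by (subst bmac_spec[of _ _ 11 _ 12 _ 4 0 "a + c * ?T k" 1]) (auto simp: C_def fun_eq_iff)
    have "a + c * ?T k = ?T (Suc k)"
      unfolding sum.lessThan_Suc_shift by (simp add: sum_distrib_left mult.assoc)
    then show "J (Suc k) (?f k t0)" using C[OF C4] a5 unfolding J_def by auto
  qed
  let ?s1 = "setv 43 (m + 1) (floop ?f (m + 1) ?s0)"
  obtain y where s1: "C ?s1" "ar ?s1 = (ar s)(3 := (ar s 3)(11 := dg (?T (m+1)), 12 := dg y))"
    using JL by (auto simp: J_def C_def)
  let ?s2 = "sem (bclear (Num 10)) ?s1"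
  have s2: "ar ?s2 = (ar s)(3 := (ar s 3)(11 := dg (?T (m+1)), 12 := dg y, 10 := dg 0))"
    using s1 rows r by (subst bclear_spec[of _ _ 10 c]) (auto simp: C_def)
  have C2: "C ?s2" using C s1 by blast
  have s3: "ar (sem (bmac (Num 10) (Num 11) (Num 4)) ?s2) =
     (ar s)(3 := (ar s 3)(11 := dg (?T (m+1)), 12 := dg y, 10 := dg (?T (m+1))))"
    using C2 s2 rows r by (subst bmac_spec[of _ _ 10 _ 11 _ 4 0 "?T (m+1)" 1]) (auto simp: C_def)
  have v12: "vr ?s0 12 = m + 1" using C s by (simp add: C_def)
  have "sem solve s = sem (bmac (Num 10) (Num 11) (Num 4)) ?s2"
    unfolding solve_def by (simp add: v12 del: One_nat_def add_Suc_right)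
  then show ?thesis using s3 by (intro exI[of _ "?T (m+1)"] exI[of _ y]) (auto simp: fun_eq_iff)
qed

end


section \<open>Adjacency and degrees within a short vertex list\<close>

context host
begin

lemma set_lt: "set I \<subseteq> {..<hn} \<Longrightarrow> i < length I \<Longrightarrow> I ! i < hn"
  using nth_mem by blast

lemma leaf_adj_spec:
  assumes s: "params s" "vr s 30 = d" "d \<le> hn" "vr s 34 = length I" "frow s d I" "length I \<le> m" "set I \<subseteq> {..<hn}"
  shows "\<forall>i<m. \<forall>j<m. ar (sem leaf_adj s) 9 i j =
     (if i < length I \<and> j < length I \<and> I ! j \<in> set (nb (I ! i)) then 1 else 0)"
proof -
  let ?body = "For 43 7 (Cond (Var 43) (Var 34)
           (Asg 44 (Arr 2 (Var 30) (Num 4 \<oplus> Var 43)) ;;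
            Cond (Var 44) (Var 42) skip (Cond (Var 42) (Var 44) skip (Put 9 (Var 40) (Var 43) (Num 1)))) skip)"
  let ?zero = "For 40 7 (For 41 7 (Put 9 (Var 40) (Var 41) (Num 0)))"
  define s1 where "s1 = sem ?zero s"
  have mS: "i < m \<Longrightarrow> i mod S = i" "i < m \<Longrightarrow> i mod 2 ^ w = i" for i using cols sizes by simp_all
  have z: "\<forall>i<m. \<forall>j<m. ar s1 9 i j = 0"
  proof -
    let ?g = "\<lambda>k s. sem (Put 9 (Var 40) (Var 41) (Num 0)) (setv 41 k s)"
    let ?f = "\<lambda>k s. sem (For 41 7 (Put 9 (Var 40) (Var 41) (Num 0))) (setv 40 k s)"
    define J where "J k t \<longleftrightarrow> vr t 7 = m \<and> (\<forall>i<k. \<forall>j<m. ar t 9 i j = 0)" for k and t :: st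
    have "J m (floop ?f m s)"
    proof (rule floop_inv[where P = J])
      show "J 0 s" using s by (simp add: J_def params_def)
    next
      fix k t assume k: "k < m" and t: "J k t"
      define J2 where "J2 l t' \<longleftrightarrow> vr t' 7 = m \<and> vr t' 40 = k \<and> (\<forall>i<k. \<forall>j<m. ar t' 9 i j = 0) \<and> (\<forall>j<l. ar t' 9 k j = 0)"
        for l and t' :: st
      have "J2 m (floop ?g m (setv 40 k t))"
        by (rule floop_inv[where P = J2]) (use t k mS in \<open>auto simp: J_def J2_def less_Suc_eq\<close>)
      then show "J (Suc k) (?f k t)" using t by (auto simp: J_def J2_def less_Suc_eq)
    qed
    then show ?thesis using s by (simp add: s1_def J_def params_def)
  qed
  have s1: "params s1" "vr s1 30 = d" "vr s1 34 = length I" "frow s1 d I"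
  proof -
    have "vr s1 x = vr s x" if "x \<noteq> 40" "x \<noteq> 41" for x unfolding s1_def by (rule vr_frame) (use that in simp)
    moreover have "ar s1 2 = ar s 2" unfolding s1_def by (rule ar_frame) simp
    ultimately show "params s1" "vr s1 30 = d" "vr s1 34 = length I" "frow s1 d I"
      using s by (simp_all add: params_def frow_def)
  qed
  define P where "P i e t \<longleftrightarrow> (\<forall>i'<m. \<forall>j<m. ar t 9 i' j = (if i' < length I \<and> j < length I \<and>
      ((i' < i \<and> I ! j \<in> set (nb (I ! i'))) \<or> (i' = i \<and> (\<exists>e'<e. nb (I ! i') ! e' = I ! j))) then 1 else 0))"
    for i e and t :: st
  have "P (length I) 0 (sem leaf_adj s)" unfolding leaf_adj_def sem.simps(3) s1_def[symmetric]
  proof (rule nbr_loop[OF s1(1,2) s(3) s1(3,4) s(6,7)])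
    show "P 0 0 s1" using z by (simp add: P_def)
    show "P i e (setv x v t)" if "P i e t" for i e t x v using that by (simp add: P_def)
    show "P i (Suc e) (sem ?body t)" if P: "P i e t" and t: "params t" "vr t 30 = d" "vr t 34 = length I" "frow t d I"
       "vr t 40 = i" and ie: "i < length I" "e < length (nb (I ! i))" and y: "vr t 42 = nb (I ! i) ! e" for i e t
    proof -
      let ?y = "nb (I ! i) ! e"
      let ?b = "Cond (Var 43) (Var 34)
           (Asg 44 (Arr 2 (Var 30) (Num 4 \<oplus> Var 43)) ;;
            Cond (Var 44) (Var 42) skip (Cond (Var 42) (Var 44) skip (Put 9 (Var 40) (Var 43) (Num 1)))) skip"
      let ?g = "\<lambda>k s. sem ?b (setv 43 k s)"
      define J where "J k t' \<longleftrightarrow> vr t' 30 = d \<and> vr t' 34 = length I \<and> frow t' d I \<and> vr t' 40 = i \<and> vr t' 42 = ?y \<and>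
        (\<forall>i' j. ar t' 9 i' j = (if i' = i \<and> j < k \<and> j < length I \<and> I ! j = ?y then 1 else ar t 9 i' j))" for k and t' :: st
      have "J m (floop ?g m t)"
      proof (rule floop_inv[where P = J])
        show "J 0 t" using t y by (simp add: J_def)
      next
        fix k t' assume k: "k < m" and J: "J k t'"
        show "J (Suc k) (?g k t')"
        proof (cases "k < length I")
          case False
          then show ?thesis using J by (auto simp: J_def frow_def less_Suc_eq)
        next
          case True
          have e: "ev (setv 43 k t') (Arr 2 (Var 30) (Num 4 \<oplus> Var 43)) = I ! k"
            using J True k s(3) sizes rows cols by (simp add: J_def frow_def)
          have "i < m" using ie s(6) by simp
          have "?g k t' = (if I ! k = ?y then seta 9 i k 1 (setv 44 (I ! k) (setv 43 k t'))
             else setv 27 0 (setv 44 (I ! k) (setv 43 k t')))"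
            using J True e mS[OF k] mS[OF \<open>i < m\<close>] by (simp add: J_def del: ev.simps(4))
          then show ?thesis using J True by (auto simp: J_def frow_def less_Suc_eq)
        qed
      qed
      then have "\<forall>i' j. ar (sem ?body t) 9 i' j = (if i' = i \<and> j < m \<and> j < length I \<and> I ! j = ?y then 1 else ar t 9 i' j)"
        using t(1) by (simp add: params_def J_def)
      then show ?thesis using P ie s(6) unfolding P_def by (auto simp: less_Suc_eq)
    qed
    show "P (Suc i) 0 t" if "P i (length (nb (I ! i))) t" "i < length I" for i t
      using that unfolding P_def by (auto simp: less_Suc_eq in_set_conv_nth)
  qed auto
  then show ?thesis by (auto simp: P_def)
qed

lemma leaf_deg_spec:
  assumes s: "vr s 7 = m" and a: "\<forall>i<m. \<forall>j<m. ar s 9 i j \<le> 1"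
  shows "\<forall>i<m. ar (sem leaf_deg s) 10 0 i = (\<Sum>j<m. ar s 9 i j)"
proof -
  let ?in = "Asg 44 (Var 44 \<oplus> Arr 9 (Var 40) (Var 41))"
  let ?f = "\<lambda>k s. sem (Asg 44 (Num 0) ;; For 41 7 ?in ;; Put 10 (Num 0) (Var 40) (Var 44)) (setv 40 k s)"
  let ?g = "\<lambda>k s. sem ?in (setv 41 k s)"
  have mS: "i < m \<Longrightarrow> i mod S = i" for i using cols by simp
  define J where "J k t \<longleftrightarrow> vr t 7 = m \<and> ar t 9 = ar s 9 \<and> (\<forall>i<k. ar t 10 0 i = (\<Sum>j<m. ar s 9 i j))" for k and t :: st
  have "J m (floop ?f m s)"
  proof (rule floop_inv[where P = J])
    show "J 0 s" using s by (simp add: J_def)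
  next
    fix k t assume k: "k < m" and t: "J k t"
    define J2 where "J2 l t' \<longleftrightarrow> ar t' = ar t \<and> vr t' 7 = m \<and> vr t' 40 = k \<and> vr t' 44 = (\<Sum>j<l. ar s 9 k j)" for l and t' :: st
    have "J2 m (floop ?g m (setv 44 0 (setv 40 k t)))"
    proof (rule floop_inv[where P = J2])
      show "J2 0 (setv 44 0 (setv 40 k t))" using t by (simp add: J2_def J_def)
    next
      fix l t' assume l: "l < m" and t': "J2 l t'"
      have "(\<Sum>j<Suc l. ar s 9 k j) \<le> (\<Sum>j<Suc l. 1)" using a k l by (intro sum_mono) auto
      then have "(\<Sum>j<l. ar s 9 k j) + ar s 9 k l < 2 ^ w" using l sizes by simp
      then show "J2 (Suc l) (?g l t')" using t' t l k mS by (simp add: J2_def J_def)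
    qed
    then show "J (Suc k) (?f k t)" using t k mS by (auto simp: J_def J2_def less_Suc_eq)
  qed
  then show ?thesis using s by (simp add: leaf_deg_def J_def)
qed

lemma sum_adj_card:
  assumes "distinct I" "length I \<le> m" "set I \<subseteq> {..<hn}" "i < length I"
  shows "(\<Sum>j<m. if i < length I \<and> j < length I \<and> I ! j \<in> set (nb (I ! i)) then 1 else 0) = card {v \<in> set I. adj (I ! i) v}"
proof -
  have "(\<Sum>j<m. if i < length I \<and> j < length I \<and> I ! j \<in> set (nb (I ! i)) then 1 else 0) =
    card {j. j < m \<and> j < length I \<and> I ! j \<in> set (nb (I ! i))}"
    using assms(4) by (simp add: sum.If_cases Int_def)
  also have "\<dots> = card ((!) I ` {j. j < m \<and> j < length I \<and> I ! j \<in> set (nb (I ! i))})"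
    using assms(1) by (subst card_image) (auto simp: inj_on_def nth_eq_iff_index_eq)
  also have "(!) I ` {j. j < m \<and> j < length I \<and> I ! j \<in> set (nb (I ! i))} = {v \<in> set I. adj (I ! i) v}"
  proof (intro set_eqI iffI)
    fix v assume "v \<in> (!) I ` {j. j < m \<and> j < length I \<and> I ! j \<in> set (nb (I ! i))}"
    then obtain j where "v = I ! j" "j < length I" "I ! j \<in> set (nb (I ! i))" by blast
    then show "v \<in> {v \<in> set I. adj (I ! i) v}" using set_lt[OF assms(3)] assms(4) by (simp add: adj_def)
  next
    fix v assume v: "v \<in> {v \<in> set I. adj (I ! i) v}"
    then obtain j where "v = I ! j" "j < length I" by (auto simp: in_set_conv_nth)
    then show "v \<in> (!) I ` {j. j < m \<and> j < length I \<and> I ! j \<in> set (nb (I ! i))}"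
      using v assms(2) by (auto simp: adj_def)
  qed
  finally show ?thesis .
qed

section \<open>The recursion as a stack machine\<close>

text \<open>A frame (I, k, x, ph, a) has taken up the results of ph subcalls, and a is their sum;
  before the first result row 16 + i contains nothing of value.\<close>

definition frame_ok :: "st \<Rightarrow> nat \<Rightarrow> nat list \<times> nat \<times> nat \<times> nat \<times> nat \<Rightarrow> bool" where
  "frame_ok s i = (\<lambda>(I, k, x, ph, a). ar s 2 i 0 = x \<and> ar s 2 i 1 = ph \<and> ar s 2 i 2 = k \<and> ar s 2 i 3 = length I \<and>
     frow s i I \<and> (0 < ph \<longrightarrow> ar s 3 (16 + i) = dg a))"

definition same :: "st \<Rightarrow> st \<Rightarrow> bool" where
  "same s0 s \<longleftrightarrow> (\<forall>x. x < 20 \<or> 60 \<le> x \<longrightarrow> vr s x = vr s0 x) \<and>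
     (\<forall>a. a \<notin> {2, 3, 4, 8, 9, 10} \<longrightarrow> ar s a = ar s0 a) \<and> (\<forall>r\<in>{4..9}. ar s 3 r = ar s0 3 r)"

text \<open>Each frame has removed its own vertex from U. Therefore
  \<open>length stk + card U\<close> stays bounded by hn, which bounds the depth and keeps row 16 +
  depth inside the array.\<close>

definition base :: "st \<Rightarrow> (nat list \<times> nat \<times> nat \<times> nat \<times> nat) list \<Rightarrow> nat set \<Rightarrow> st \<Rightarrow> bool" where
  "base s0 stk U s \<longleftrightarrow> same s0 s \<and> canon s \<and> vr s 33 = 0 \<and> vr s 30 = length stk \<and>
     (\<forall>i<length stk. frame_ok s i (stk ! i)) \<and> marked s U \<and> length stk + card U \<le> hn \<and> U \<subseteq> {..<hn}"

text \<open>A call is pending. Its arguments already occupy the row above the stack, but it does not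
  yet count as a frame.\<close>

definition Rdown where
  "Rdown s0 stk I k U s \<longleftrightarrow> base s0 stk U s \<and> vr s 31 = 1 \<and> vr s 32 = 1 \<and>
     ar s 2 (length stk) 2 = k \<and> ar s 2 (length stk) 3 = length I \<and> frow s (length stk) I"

text \<open>A call has just returned r; the loop flag 32 drops exactly when no caller is
  left.\<close>

definition Rup where
  "Rup s0 stk r U s \<longleftrightarrow> base s0 stk U s \<and> vr s 31 = 0 \<and> vr s 32 = (if stk = [] then 0 else 1) \<and> ar s 3 10 = dg r"

text \<open>Length m + 1 does occur: a list is extended first and pruned one step later.\<close>

definition okI :: "nat list \<Rightarrow> nat set \<Rightarrow> bool" where
  "okI I U \<longleftrightarrow> distinct I \<and> set I \<subseteq> {..<hn} \<and> set I \<inter> U = {} \<and> length I \<le> m + 1"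

definition ok0 :: "st \<Rightarrow> bool" where "ok0 s \<longleftrightarrow> params s \<and> ar s 3 4 = dg 1"

lemma same_params: "ok0 s0 \<Longrightarrow> same s0 s \<Longrightarrow> params s \<and> ar s 3 4 = dg 1"
  by (simp add: ok0_def same_def params_def)

lemma same_stepA:
  assumes "same s0 s" "\<forall>r\<in>{4..9}. ar (sem stepA s) 3 r = ar s 3 r"
  shows "same s0 (sem stepA s)"
proof -
  have "vr (sem stepA s) x = vr s x" if "x < 20 \<or> 60 \<le> x" for x using writes_stepA that by (intro vr_frame) auto
  moreover have "ar (sem stepA s) a = ar s a" if "a \<notin> {2, 3, 4, 8, 9, 10}" for a using awrites_stepA that by (intro ar_frame) auto
  ultimately show ?thesis using assms unfolding same_def by auto
qed

text \<open>A step never nests two loops over neighbours, hence the single factor D. All other loop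
  bounds, namely m, m + 1 and L, are at most L.\<close>

definition costA :: nat where "costA = csize stepA * L ^ nest (\<lambda>p. \<not> p = 10) stepA * D"
definition costF :: nat where "costF = csize dfs * L ^ nest (\<lambda>p. \<not> p = 10) dfs"

lemma m_le_L: "m \<le> L" "m + 1 \<le> L" by (simp_all add: L_eq)

lemma cb_stepA: "params s \<Longrightarrow> cb (vr s) stepA \<le> costA"
  using cb_bound[of L D stepA "vr s" "\<lambda>p. p = 10"] lvars_stepA L1 D1 m_le_L
  by (auto simp: params_def costA_def nest_stepA)

lemma cb_dfs: "params s \<Longrightarrow> cb (vr s) dfs \<le> costF"
  using cb_bound[of L D dfs "vr s" "\<lambda>p. p = 10"] lvars_dfs L1 D1 m_le_L
  by (auto simp: params_def costF_def nest_dfs)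

lemma runs_step0: "params s \<Longrightarrow> vr (sem stepA s) 33 = 0 \<Longrightarrow> runs step_prog s (costA + 1) (sem stepA s)"
  unfolding step_prog_def
  by (rule runs_Then[OF runs_Do[OF okc_stepA cb_stepA] runs_While0[of _ _ 1]]) auto

lemma stepA_eq:
  assumes "t = (if 0 < vr s 31 then sem down s else sem up s)" "vr t 30 + vr t 31 < 2 ^ w"
  shows "sem stepA s = setv 32 (if 0 < vr t 30 + vr t 31 then 1 else 0) t"
  using assms by (simp add: stepA_def)

lemma stepA_up:
  assumes "vr s 31 = 0" "sem up s = t" "vr t 30 = d" "vr t 31 = e" "d + e < 2 ^ w" "f = (if 0 < d + e then 1 else 0)"
  shows "setv 32 f t = sem stepA s"
  using stepA_eq[of t s] assms by simp

lemma stepA_down: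
  assumes "vr s 31 = 1" "sem down s = t" "vr t 30 = d" "vr t 31 = e" "d + e < 2 ^ w" "f = (if 0 < d + e then 1 else 0)"
  shows "sem stepA s = setv 32 f t"
  using stepA_eq[of t s] assms by simp

lemma step_prune:
  assumes o: "ok0 s0" and R: "Rdown s0 stk I k U s" and I: "okI I U" and km: "k \<le> m" and lt: "k < length I"
  shows "\<exists>s'. runs step_prog s (costA + 1) s' \<and> Rup s0 stk 0 U s'"
proof -
  let ?d = "length stk"
  have bs: "base s0 stk U s" using R by (simp add: Rdown_def)
  have p: "params s" "ar s 3 4 = dg 1" using same_params o bs by (simp_all add: base_def)
  have d: "?d \<le> hn" "?d < S" "?d < 2 ^ w" using bs rows sizes by (auto simp: base_def)
  let ?s1 = "setv 34 (length I) (setv 35 k s)"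
  have s1: "sem load_frame s = ?s1" using R d bs by (simp add: load_frame_def Rdown_def base_def)
  let ?s2 = "setv 31 0 (sem (bclear (Num 10)) ?s1)"
  have down: "sem down s = ?s2" unfolding down_def sem.simps(3) s1 using lt by simp
  obtain x where x: "ar s 3 10 = dg x" using canonD[of s 10] bs by (auto simp: base_def)
  have a: "ar ?s2 = (ar s)(3 := (ar s 3)(10 := dg 0))"
    using bclear_spec[of ?s1 "Num 10" 10 x] p x rows by (simp add: params_def)
  let ?s3 = "setv 32 (if ?d = 0 then 0 else 1) ?s2"
  have v: "vr ?s2 30 = ?d" "vr ?s2 31 = 0" using bs by (simp_all add: vr_bclear base_def)
  have s3: "sem stepA s = ?s3" using down v d R by (simp add: stepA_def Rdown_def)
  have "same s0 ?s3" using same_stepA[of s0 s] bs a unfolding s3 by (simp add: base_def)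
  moreover have "canon ?s3" by (rule canon_upd[of s _ 10 0]) (use bs a in \<open>auto simp: base_def\<close>)
  ultimately have "base s0 stk U ?s3" using bs a
    by (auto simp: base_def vr_bclear frame_ok_def frow_def marked_def split: prod.splits)
  then have "Rup s0 stk 0 U ?s3" using a by (simp add: Rup_def)
  moreover have "runs step_prog s (costA + 1) ?s3"
    using runs_step0[OF p(1)] bs unfolding s3 by (simp add: vr_bclear base_def)
  ultimately show ?thesis by blast
qed

lemma frame_ok_cong:
  "frame_ok s i fr \<Longrightarrow> ar t 2 i = ar s 2 i \<Longrightarrow> ar t 3 (16 + i) = ar s 3 (16 + i) \<Longrightarrow> frame_ok t i fr"
  by (auto simp: frame_ok_def frow_def)

lemma push_ext_spec:
  assumes "vr s 7 = m" "vr s 30 = d" "d < hn" "vr s 35 = k" "vr s 34 = l" "l \<le> m" "vr s 37 = x"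
  shows "\<exists>row. ar (sem push_ext s) = (ar s)(2 := (ar s 2)(Suc d := row)) \<and> row 2 = k \<and> row 3 = Suc l \<and>
     (\<forall>j<l. row (4 + j) = ar s 2 d (4 + j)) \<and> row (4 + l) = x"
    "vr (sem push_ext s) = (vr s)(40 := m, 30 := Suc d, 31 := 1)"
proof -
  have ds: "Suc d < S" "Suc d < 2 ^ w" "4 + l < 2 ^ w" "4 + l < S" "Suc l < 2 ^ w" using assms rows sizes cols by linarith+
  let ?s1 = "sem (frame (Var 35) (Var 34 \<oplus> Num 1)) s"
  have s1: "ar ?s1 = (ar s)(2 := (ar s 2)(Suc d := (ar s 2 (Suc d))(2 := k, 3 := Suc l)))" "vr ?s1 = vr s"
    using assms ds by (simp_all add: frame_def)
  have s2: "ar (sem copyI ?s1) = (ar ?s1)(2 := (ar ?s1 2)(Suc d := (\<lambda>j. if 4 \<le> j \<and> j < 4 + m then ar ?s1 2 d j else ar ?s1 2 (Suc d) j)))"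
    using assms s1 by (intro copyI_spec) simp_all
  have v2: "vr (sem copyI ?s1) = (vr s)(40 := m)"
  proof
    fix y show "vr (sem copyI ?s1) y = ((vr s)(40 := m)) y"
    proof (cases "y = 40")
      case True then show ?thesis using assms s1 by (simp add: copyI_def)
    next
      case False then show ?thesis using vr_frame[of y copyI ?s1] s1 by (simp add: copyI_def)
    qed
  qed
  let ?row = "(\<lambda>j. if 4 \<le> j \<and> j < 4 + m then ar ?s1 2 d j else ar ?s1 2 (Suc d) j)(4 + l := x)"
  have 3: "ar (sem push_ext s) = (ar s)(2 := (ar s 2)(Suc d := ?row))"
    unfolding push_ext_def sem.simps(3) using v2 s2 s1 assms ds by simp
  have "(\<forall>j<l. ?row (4 + j) = ar s 2 d (4 + j)) \<and> ?row (4 + l) = x \<and> ?row 2 = k \<and> ?row 3 = Suc l"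
    using s1 assms(6) by simp
  then show "\<exists>row. ar (sem push_ext s) = (ar s)(2 := (ar s 2)(Suc d := row)) \<and> row 2 = k \<and> row 3 = Suc l \<and>
     (\<forall>j<l. row (4 + j) = ar s 2 d (4 + j)) \<and> row (4 + l) = x" using 3 by blast
  show "vr (sem push_ext s) = (vr s)(40 := m, 30 := Suc d, 31 := 1)"
    unfolding push_ext_def sem.simps(3) using v2 assms ds by simp
qed

lemma push_same_spec:
  assumes "vr s 7 = m" "vr s 30 = d" "d < hn" "vr s 35 = k" "vr s 34 = l" "l \<le> m"
  shows "\<exists>row. ar (sem push_same s) = (ar s)(2 := (ar s 2)(Suc d := row)) \<and> row 2 = k \<and> row 3 = l \<and>
     (\<forall>j<l. row (4 + j) = ar s 2 d (4 + j))"
    "vr (sem push_same s) = (vr s)(40 := m, 30 := Suc d, 31 := 1)"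
proof -
  have ds: "Suc d < S" "Suc d < 2 ^ w" using assms rows sizes cols by linarith+
  let ?s1 = "sem (frame (Var 35) (Var 34)) s"
  have s1: "ar ?s1 = (ar s)(2 := (ar s 2)(Suc d := (ar s 2 (Suc d))(2 := k, 3 := l)))" "vr ?s1 = vr s"
    using assms ds by (simp_all add: frame_def)
  have s2: "ar (sem copyI ?s1) = (ar ?s1)(2 := (ar ?s1 2)(Suc d := (\<lambda>j. if 4 \<le> j \<and> j < 4 + m then ar ?s1 2 d j else ar ?s1 2 (Suc d) j)))"
    using assms s1 by (intro copyI_spec) simp_all
  have v2: "vr (sem copyI ?s1) = (vr s)(40 := m)"
  proof
    fix y show "vr (sem copyI ?s1) y = ((vr s)(40 := m)) y"
    proof (cases "y = 40")
      case True then show ?thesis using assms s1 by (simp add: copyI_def)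
    next
      case False then show ?thesis using vr_frame[of y copyI ?s1] s1 by (simp add: copyI_def)
    qed
  qed
  let ?row = "\<lambda>j. if 4 \<le> j \<and> j < 4 + m then ar ?s1 2 d j else ar ?s1 2 (Suc d) j"
  have 3: "ar (sem push_same s) = (ar s)(2 := (ar s 2)(Suc d := ?row))"
    unfolding push_same_def sem.simps(3) using v2 s2 s1 assms ds by simp
  have "(\<forall>j<l. ?row (4 + j) = ar s 2 d (4 + j)) \<and> ?row 2 = k \<and> ?row 3 = l"
    using s1 assms(6) by simp
  then show "\<exists>row. ar (sem push_same s) = (ar s)(2 := (ar s 2)(Suc d := row)) \<and> row 2 = k \<and> row 3 = l \<and>
     (\<forall>j<l. row (4 + j) = ar s 2 d (4 + j))" using 3 by blast
  show "vr (sem push_same s) = (vr s)(40 := m, 30 := Suc d, 31 := 1)"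
    unfolding push_same_def sem.simps(3) using v2 assms ds by simp
qed

lemma push_single_spec:
  assumes "vr s 30 = d" "d < hn" "vr s 35 = k" "vr s 34 = l" "l \<le> k" "k \<le> m" "vr s 37 = x"
  shows "\<exists>row. ar (sem push_single s) = (ar s)(2 := (ar s 2)(Suc d := row)) \<and> row 2 = k - l \<and> row 3 = 1 \<and> row 4 = x"
    "vr (sem push_single s) = (vr s)(30 := Suc d, 31 := 1)"
proof -
  have ds: "Suc d < S" "Suc d < 2 ^ w" "k < 2 ^ w" using assms rows sizes cols by linarith+
  let ?row = "(ar s 2 (Suc d))(2 := k - l, 3 := 1, 4 := x)"
  have "ar (sem push_single s) = (ar s)(2 := (ar s 2)(Suc d := ?row))"
    using assms ds by (simp add: push_single_def frame_def binop_sub)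
  then show "\<exists>row. ar (sem push_single s) = (ar s)(2 := (ar s 2)(Suc d := row)) \<and> row 2 = k - l \<and> row 3 = 1 \<and> row 4 = x"
    by (intro exI[of _ ?row]) simp
  show "vr (sem push_single s) = (vr s)(30 := Suc d, 31 := 1)"
    using assms ds by (simp add: push_single_def frame_def)
qed

lemma down_scan:
  assumes o: "ok0 s0" and R: "Rdown s0 stk I k U s" and I: "okI I U" and km: "k \<le> m" and le: "length I \<le> k"
  defines "s1 \<equiv> setv 36 0 (setv 34 (length I) (setv 35 k s))"
  shows "sem load_frame s = setv 34 (length I) (setv 35 k s)"
    "ar (sem scan s1) = ar s" "\<And>x. x \<notin> {27, 36, 37, 38, 39, 40, 41, 42} \<Longrightarrow> vr (sem scan s1) x = vr s1 x"
    "vr (sem scan s1) 36 = 0 \<Longrightarrow> \<forall>u\<in>set I. set (nb u) \<inter> U = {}"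
    "vr (sem scan s1) 36 \<noteq> 0 \<Longrightarrow> \<exists>x u. vr (sem scan s1) 36 = Suc x \<and> x \<in> U \<and> x < hn \<and> u \<in> set I \<and> x \<in> set (nb u)"
proof -
  let ?d = "length stk"
  have bs: "base s0 stk U s" using R by (simp add: Rdown_def)
  have p: "params s" "ar s 3 4 = dg 1" using same_params o bs by (simp_all add: base_def)
  have d: "?d \<le> hn" "?d < S" "?d < 2 ^ w" using bs rows sizes by (auto simp: base_def)
  show "sem load_frame s = setv 34 (length I) (setv 35 k s)" using R d bs by (simp add: load_frame_def Rdown_def base_def)
  have "ar (sem scan s1) a = ar s1 a" for a by (rule ar_frame) (simp add: scan_def load_nbrs_def)
  then show "ar (sem scan s1) = ar s" by (auto simp: s1_def)
  show "vr (sem scan s1) x = vr s1 x" if "x \<notin> {27, 36, 37, 38, 39, 40, 41, 42}" for x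
    using that by (intro vr_frame) (simp add: scan_def load_nbrs_def)
  have s1: "params s1" "vr s1 30 = ?d" "vr s1 34 = length I" "frow s1 ?d I" "marked s1 U" "vr s1 36 = 0"
    using p R bs by (simp_all add: s1_def params_def frow_def marked_def Rdown_def base_def)
  note sc = scan_spec[OF s1(1,2) d(1) s1(3,4) _ _ s1(5,6)]
  have lI: "length I \<le> m" "set I \<subseteq> {..<hn}" using le km I by (simp_all add: okI_def)
  show "vr (sem scan s1) 36 = 0 \<Longrightarrow> \<forall>u\<in>set I. set (nb u) \<inter> U = {}" using sc(1) lI by blast
  assume "vr (sem scan s1) 36 \<noteq> 0"
  with sc(2)[OF lI] show "\<exists>x u. vr (sem scan s1) 36 = Suc x \<and> x \<in> U \<and> x < hn \<and> u \<in> set I \<and> x \<in> set (nb u)"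
    by (metis Suc_pred gr0I diff_Suc_1 minus_nat.diff_0 One_nat_def)
qed

lemma step_expand:
  assumes o: "ok0 s0" and R: "Rdown s0 stk I k U s" and I: "okI I U" and km: "k \<le> m" and le: "length I \<le> k"
    and ne: "\<exists>u\<in>set I. set (nb u) \<inter> U \<noteq> {}"
  shows "\<exists>s' x. runs step_prog s (costA + 1) s' \<and> x \<in> U \<and> (\<exists>u\<in>set I. x \<in> set (nb u)) \<and>
     Rdown s0 (stk @ [(I, k, x, 0, 0)]) (I @ [x]) k (U - {x}) s'"
proof -
  let ?d = "length stk"
  have bs: "base s0 stk U s" using R by (simp add: Rdown_def)
  have p: "params s" "ar s 3 4 = dg 1" using same_params o bs by (simp_all add: base_def)
  define s1 where "s1 = setv 36 0 (setv 34 (length I) (setv 35 k s))"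
  note ds = down_scan[OF o R I km le, folded s1_def]
  obtain x u where x: "vr (sem scan s1) 36 = Suc x" "x \<in> U" "x < hn" "u \<in> set I" "x \<in> set (nb u)"
    using ds(4,5) ne by blast
  have finU: "finite U" using bs finite_subset by (auto simp: base_def)
  \<comment> \<open>The vertex x is still in U, so the bound on depth plus \<open>card U\<close>
    leaves room for one more frame.\<close>
  have dlt: "?d < hn"
  proof -
    have "0 < card U" using finU x(2) card_gt_0_iff by blast
    then show ?thesis using bs by (auto simp: base_def)
  qed
  have d: "?d < S" "?d < 2 ^ w" "Suc ?d < 2 ^ w" "x < S" "Suc x < 2 ^ w" using dlt x(3) rows sizes by linarith+
  let ?s3 = "setv 37 x (sem scan s1)"
  let ?s4 = "seta 2 ?d 1 0 (seta 2 ?d 0 x (seta 4 0 x 1 ?s3))"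
  have v3: "vr ?s3 30 = ?d" "vr ?s3 34 = length I" "vr ?s3 35 = k" "vr ?s3 7 = m" "vr ?s3 33 = 0" "vr ?s3 31 = 1"
    using ds(3) R bs p by (simp_all add: s1_def Rdown_def base_def params_def)
  have down: "sem down s = sem push_ext ?s4"
    unfolding down_def sem.simps(3) ds(1) using le x(1) v3 d by (simp add: s1_def[symmetric] binop_sub)
  have v4: "vr ?s4 = vr ?s3" "ar ?s4 = (ar s)(4 := (ar s 4)(0 := (ar s 4 0)(x := 1)), 2 := (ar s 2)(?d := (ar s 2 ?d)(0 := x, 1 := 0)))"
    using ds(2) by simp_all
  have lI: "length I \<le> m" using le km by simp
  obtain row where row: "ar (sem push_ext ?s4) = (ar ?s4)(2 := (ar ?s4 2)(Suc ?d := row))" "row 2 = k" "row 3 = Suc (length I)"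
    "\<forall>j<length I. row (4 + j) = ar ?s4 2 ?d (4 + j)" "row (4 + length I) = x"
    and v5: "vr (sem push_ext ?s4) = (vr ?s4)(40 := m, 30 := Suc ?d, 31 := 1)"
    using push_ext_spec[of ?s4 ?d k "length I" x] v4 v3 dlt lI by auto
  let ?t = "sem push_ext ?s4"
  have t: "ar ?t = (ar s)(4 := (ar s 4)(0 := (ar s 4 0)(x := 1)), 2 := (ar s 2)(?d := (ar s 2 ?d)(0 := x, 1 := 0), Suc ?d := row))"
    using row(1) ds(2) by simp
  have sz: "Suc (Suc ?d) < 2 ^ w" using dlt sizes by linarith
  have A: "sem stepA s = setv 32 1 ?t"
  proof (rule stepA_down[OF _ down])
    show "vr s 31 = 1" using R by (simp add: Rdown_def)
    show "vr ?t 30 = Suc ?d" "vr ?t 31 = 1" using v5 by simp_all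
  qed (use sz in simp_all)
  have v: "vr ?t 33 = 0" using v5 v4 v3 by simp
  let ?U = "U - {x}" and ?fr = "(I, k, x, 0, 0)"
  have sm: "same s0 (setv 32 1 ?t)" 
  proof -
    have "\<forall>r\<in>{4..9}. ar (setv 32 1 ?t) 3 r = ar s 3 r" unfolding setv_simps t by simp
    then show ?thesis using same_stepA[of s0 s] bs unfolding A base_def by blast
  qed
  have fI: "\<forall>j<length I. ar s 2 ?d (4 + j) = I ! j" using R by (simp add: Rdown_def frow_def)
  have fr: "frame_ok (setv 32 1 ?t) i ((stk @ [?fr]) ! i)" if "i < Suc ?d" for i
  proof (cases "i < ?d")
    case True
    then have "frame_ok s i (stk ! i)" using bs by (simp add: base_def)
    then have "frame_ok (setv 32 1 ?t) i (stk ! i)"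
      by (rule frame_ok_cong) (unfold setv_simps t, use True in simp_all)
    then show ?thesis using True by (simp add: nth_append)
  next
    case False
    then have "i = ?d" using that by simp
    then show ?thesis unfolding frame_ok_def frow_def setv_simps t using fI R by (simp add: Rdown_def)
  qed
  have cU: "Suc (card ?U) = card U" using card_Suc_Diff1[OF finU x(2)] .
  have "base s0 (stk @ [?fr]) ?U (setv 32 1 ?t)"
    unfolding base_def
  proof (intro conjI)
    show "canon (setv 32 1 ?t)" unfolding canon_def setv_simps t using bs by (simp add: base_def canon_def)
    show "marked (setv 32 1 ?t) ?U" unfolding marked_def setv_simps t using bs by (auto simp: base_def marked_def)
    show "\<forall>i<length (stk @ [?fr]). frame_ok (setv 32 1 ?t) i ((stk @ [?fr]) ! i)" using fr by simp
    show "length (stk @ [?fr]) + card ?U \<le> hn" using cU bs by (simp add: base_def)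
  qed (use sm v v5 bs in \<open>auto simp: base_def\<close>)
  moreover have "frow (setv 32 1 ?t) (Suc ?d) (I @ [x])"
    unfolding frow_def setv_simps t using row(4,5) ds(2) fI by (auto simp: nth_append less_Suc_eq)
  ultimately have "Rdown s0 (stk @ [?fr]) (I @ [x]) k ?U (setv 32 1 ?t)"
    unfolding Rdown_def setv_simps t using row v5 by simp
  moreover have "runs step_prog s (costA + 1) (setv 32 1 ?t)"
    unfolding A[symmetric] by (rule runs_step0[OF p(1)]) (unfold A, use v in simp)
  ultimately show ?thesis using x by blast
qed

lemma same_upd: "same s0 s \<Longrightarrow> x \<notin> {0..<20} \<Longrightarrow> x < 60 \<Longrightarrow> same s0 (setv x v s)"
  by (auto simp: same_def)

lemma up_load:
  assumes "vr s 30 = Suc d" "d < hn" "frame_ok s d (I, k, x, ph, a)"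
  shows "sem (Asg 30 (Bin Sub (Var 30) (Num 1)) ;; load_frame ;; Asg 37 (Arr 2 (Var 30) (Num 0)) ;;
     Asg 36 (Arr 2 (Var 30) (Num 1))) s =
     setv 36 ph (setv 37 x (setv 34 (length I) (setv 35 k (setv 30 d s))))"
proof -
  have "d < S" "d < 2 ^ w" "Suc d < 2 ^ w" using assms(2) rows sizes by linarith+
  then show ?thesis using assms by (simp add: load_frame_def frame_ok_def binop_sub)
qed

lemma base_snoc: "base s0 (stk @ [fr]) U s \<Longrightarrow> length stk < hn \<and> frame_ok s (length stk) fr \<and>
    (\<forall>i<length stk. frame_ok s i (stk ! i))"
  by (auto simp: base_def nth_append split: if_splits)

lemma baseI:
  assumes "base s0 stk0 U0 s" "ar s3 = (ar s)(2 := A2, 3 := A3, 4 := A4)" "\<forall>r\<in>{4..9}. A3 r = ar s 3 r"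
    "\<forall>r. \<exists>x. A3 r = dg x" "s3 = sem stepA s" "vr s3 33 = 0" "vr s3 30 = length stk"
    "\<And>i. i < length stk \<Longrightarrow> frame_ok s3 i (stk ! i)"
    "\<forall>y<hn. A4 0 y = (if y \<in> U then 0 else 1)" "length stk + card U \<le> hn" "U \<subseteq> {..<hn}"
  shows "base s0 stk U s3"
proof -
  have "same s0 s3" using same_stepA[of s0 s] assms(1-3,5) by (auto simp: base_def)
  then show ?thesis using assms by (auto simp: base_def canon_def marked_def)
qed

lemma step_up0:
  assumes o: "ok0 s0" and R: "Rup s0 (stk @ [(I, k, x, 0, a0)]) r U s" and I: "length I \<le> k" and km: "k \<le> m"
  shows "\<exists>s'. runs step_prog s (costA + 1) s' \<and> Rdown s0 (stk @ [(I, k, x, 1, r)]) I k U s'"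
proof -
  let ?d = "length stk" and ?fr = "(I, k, x, 0, a0)" and ?fr' = "(I, k, x, 1, r)"
  have bs: "base s0 (stk @ [?fr]) U s" using R by (simp add: Rup_def)
  have p: "params s" "ar s 3 4 = dg 1" using same_params o bs by (simp_all add: base_def)
  have fr: "?d < hn" "frame_ok s ?d ?fr" "\<forall>i<?d. frame_ok s i (stk ! i)" using base_snoc[OF bs] by auto
  have d: "?d < S" "?d < 2 ^ w" "16 + ?d < S" "16 + ?d < 2 ^ w" "Suc (Suc ?d) < 2 ^ w" using fr(1) rows sizes by linarith+
  have m: "length I \<le> m" using I km by simp
  define s1 where "s1 = setv 36 0 (setv 37 x (setv 34 (length I) (setv 35 k (setv 30 ?d s))))"
  have ld: "sem (Asg 30 (Bin Sub (Var 30) (Num 1)) ;; load_frame ;; Asg 37 (Arr 2 (Var 30) (Num 0)) ;;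
     Asg 36 (Arr 2 (Var 30) (Num 1))) s = s1"
    using up_load[OF _ fr(1,2)] bs by (simp add: base_def s1_def)
  let ?s2 = "sem (bclear (Num 16 \<oplus> Var 30)) s1"
  let ?s3 = "sem (bmac (Num 16 \<oplus> Var 30) (Num 10) (Num 4)) ?s2"
  let ?s4 = "seta 2 ?d 1 1 ?s3"
  let ?t = "sem push_same ?s4"
  obtain y where y: "ar s 3 (16 + ?d) = dg y" using canonD[of s "16 + ?d"] bs by (auto simp: base_def)
  have r10: "ar s 3 10 = dg r" using R by (simp add: Rup_def)
  have a2: "ar ?s2 = (ar s)(3 := (ar s 3)(16 + ?d := dg 0))"
    using bclear_spec[of s1 "Num 16 \<oplus> Var 30" "16 + ?d" y] p y d by (simp add: params_def s1_def)
  have v3: "vr ?s3 v = vr s1 v" if "v < 20 \<or> 26 < v" for v using that by (auto simp: vr_bclear vr_bmac)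
  have a3: "ar ?s3 = (ar s)(3 := (ar s 3)(16 + ?d := dg r))"
    using bmac_spec[of ?s2 "Num 16 \<oplus> Var 30" "16 + ?d" "Num 10" 10 "Num 4" 4 0 r 1] a2 p r10 d rows
    by (simp add: params_def s1_def vr_bclear)
  have v4: "vr ?s4 30 = ?d" "vr ?s4 34 = length I" "vr ?s4 35 = k" "vr ?s4 7 = m" "vr ?s4 33 = 0"
    using v3 p bs by (simp_all add: s1_def params_def base_def)
  have a4: "ar ?s4 = (ar s)(3 := (ar s 3)(16 + ?d := dg r), 2 := (ar s 2)(?d := (ar s 2 ?d)(1 := 1)))"
    using a3 by simp
  obtain row where row: "ar ?t = (ar ?s4)(2 := (ar ?s4 2)(Suc ?d := row))" "row 2 = k" "row 3 = length I"
    "\<forall>j<length I. row (4 + j) = ar ?s4 2 ?d (4 + j)" and v5: "vr ?t = (vr ?s4)(40 := m, 30 := Suc ?d, 31 := 1)"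
    using push_same_spec[of ?s4 ?d k "length I"] v4 fr(1) m by auto
  have up: "sem up s = ?t"
  proof -
    have "sem up s = sem (Cond (Var 36) (Num 1)
       (bclear (Num 16 \<oplus> Var 30) ;; bmac (Num 16 \<oplus> Var 30) (Num 10) (Num 4) ;;
        Put 2 (Var 30) (Num 1) (Num 1) ;; push_same)
       (Cond (Var 36) (Num 2)
          (bmac (Num 16 \<oplus> Var 30) (Num 10) (Num 4) ;; Put 2 (Var 30) (Num 1) (Num 2) ;; push_single)
          (solve ;; Put 4 (Num 0) (Var 37) (Num 0)))) s1"
      unfolding up_def ld[symmetric] by simp
    also have "\<dots> = ?t" using v4 d by (simp add: s1_def[symmetric]) (simp add: s1_def)
    finally show ?thesis .
  qed
  have t: "ar ?t = (ar s)(2 := (ar s 2)(?d := (ar s 2 ?d)(1 := 1), Suc ?d := row), 3 := (ar s 3)(16 + ?d := dg r), 4 := ar s 4)"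
    unfolding row(1) a4 by (auto simp: fun_eq_iff)
  have A: "setv 32 1 ?t = sem stepA s"
  proof (rule stepA_up[OF _ up])
    show "vr s 31 = 0" using R by (simp add: Rup_def)
    show "vr ?t 30 = Suc ?d" "vr ?t 31 = 1" using v5 by simp_all
  qed (use d in simp_all)
  have fI: "\<forall>j<length I. ar s 2 ?d (4 + j) = I ! j" using fr(2) by (simp add: frame_ok_def frow_def)
  have F: "frame_ok (setv 32 1 ?t) i ((stk @ [?fr']) ! i)" if "i < length (stk @ [?fr'])" for i
  proof (cases "i < ?d")
    case True
    have "frame_ok (setv 32 1 ?t) i (stk ! i)"
    proof (rule frame_ok_cong[of s])
      show "frame_ok s i (stk ! i)" using fr(3) True by blast
    qed (unfold setv_simps t, use True in simp_all)
    then show ?thesis using True by (simp add: nth_append)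
  next
    case False
    then have "i = ?d" using that by simp
    then show ?thesis unfolding frame_ok_def frow_def setv_simps t using fr(2) by (simp add: frame_ok_def frow_def)
  qed
  have "base s0 (stk @ [?fr']) U (setv 32 1 ?t)"
  proof (rule baseI[OF bs _ _ _ A])
    show "\<forall>y<hn. ar s 4 0 y = (if y \<in> U then 0 else 1)" using bs by (simp add: base_def marked_def)
    show "\<forall>q. \<exists>z. ((ar s 3)(16 + ?d := dg (r))) q = dg z" using bs by (auto simp: base_def canon_def)
    show "length (stk @ [?fr']) + card U \<le> hn" "U \<subseteq> {..<hn}" using bs by (simp_all add: base_def)
    show "ar (setv 32 1 ?t) = (ar s)(2 := (ar s 2)(?d := (ar s 2 ?d)(1 := 1), Suc ?d := row), 3 := (ar s 3)(16 + ?d := dg (r)), 4 := ar s 4)"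
      by (simp only: setv_simps t)
    show "frame_ok (setv 32 1 ?t) i ((stk @ [?fr']) ! i)" if "i < length (stk @ [?fr'])" for i using F that .
  qed (use v5 v4 in simp_all)
  moreover have "frow (setv 32 1 ?t) (Suc ?d) I" unfolding frow_def setv_simps t using row(4) a3 fI by simp
  ultimately have "Rdown s0 (stk @ [?fr']) I k U (setv 32 1 ?t)"
    unfolding Rdown_def setv_simps t using row(2,3) v5 by simp
  moreover have "runs step_prog s (costA + 1) (setv 32 1 ?t)"
    unfolding A by (rule runs_step0[OF p(1)]) (unfold A[symmetric], use v5 v4 in simp)
  ultimately show ?thesis by blast
qed

lemma step_up1:
  assumes o: "ok0 s0" and R: "Rup s0 (stk @ [(I, k, x, 1, a)]) r U s" and I: "length I \<le> k" and km: "k \<le> m"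
  shows "\<exists>s'. runs step_prog s (costA + 1) s' \<and> Rdown s0 (stk @ [(I, k, x, 2, a + r)]) [x] (k - length I) U s'"
proof -
  let ?d = "length stk" and ?fr = "(I, k, x, 1, a)" and ?fr' = "(I, k, x, 2, a + r)"
  have bs: "base s0 (stk @ [?fr]) U s" using R by (simp add: Rup_def)
  have p: "params s" "ar s 3 4 = dg 1" using same_params o bs by (simp_all add: base_def)
  have fr: "?d < hn" "frame_ok s ?d ?fr" "\<forall>i<?d. frame_ok s i (stk ! i)" using base_snoc[OF bs] by auto
  have d: "?d < S" "?d < 2 ^ w" "16 + ?d < S" "16 + ?d < 2 ^ w" "Suc (Suc ?d) < 2 ^ w" using fr(1) rows sizes by linarith+
  define s1 where "s1 = setv 36 1 (setv 37 x (setv 34 (length I) (setv 35 k (setv 30 ?d s))))"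
  have ld: "sem (Asg 30 (Bin Sub (Var 30) (Num 1)) ;; load_frame ;; Asg 37 (Arr 2 (Var 30) (Num 0)) ;;
     Asg 36 (Arr 2 (Var 30) (Num 1))) s = s1"
    using up_load[OF _ fr(1,2)] bs by (simp add: base_def s1_def)
  let ?s3 = "sem (bmac (Num 16 \<oplus> Var 30) (Num 10) (Num 4)) s1"
  let ?s4 = "seta 2 ?d 1 2 ?s3"
  let ?t = "sem push_single ?s4"
  have y: "ar s 3 (16 + ?d) = dg a" using fr(2) by (simp add: frame_ok_def)
  have r10: "ar s 3 10 = dg r" using R by (simp add: Rup_def)
  have v3: "vr ?s3 v = vr s1 v" if "v < 20 \<or> 26 < v" for v using that by (simp add: vr_bmac)
  have a3: "ar ?s3 = (ar s)(3 := (ar s 3)(16 + ?d := dg (a + r)))"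
    using bmac_spec[of s1 "Num 16 \<oplus> Var 30" "16 + ?d" "Num 10" 10 "Num 4" 4 a r 1] p r10 d rows y
    by (simp add: params_def s1_def)
  have v4: "vr ?s4 30 = ?d" "vr ?s4 34 = length I" "vr ?s4 35 = k" "vr ?s4 37 = x" "vr ?s4 33 = 0"
    using v3 p bs by (simp_all add: s1_def params_def base_def)
  have a4: "ar ?s4 = (ar s)(3 := (ar s 3)(16 + ?d := dg (a + r)), 2 := (ar s 2)(?d := (ar s 2 ?d)(1 := 2)))"
    using a3 by simp
  obtain row where row: "ar ?t = (ar ?s4)(2 := (ar ?s4 2)(Suc ?d := row))" "row 2 = k - length I" "row 3 = 1"
    "row 4 = x" and v5: "vr ?t = (vr ?s4)(30 := Suc ?d, 31 := 1)"
    using push_single_spec[of ?s4 ?d k "length I" x] v4 fr(1) I km by auto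
  have up: "sem up s = ?t"
  proof -
    have "sem up s = sem (Cond (Var 36) (Num 1)
       (bclear (Num 16 \<oplus> Var 30) ;; bmac (Num 16 \<oplus> Var 30) (Num 10) (Num 4) ;;
        Put 2 (Var 30) (Num 1) (Num 1) ;; push_same)
       (Cond (Var 36) (Num 2)
          (bmac (Num 16 \<oplus> Var 30) (Num 10) (Num 4) ;; Put 2 (Var 30) (Num 1) (Num 2) ;; push_single)
          (solve ;; Put 4 (Num 0) (Var 37) (Num 0)))) s1"
      unfolding up_def ld[symmetric] by simp
    also have "\<dots> = ?t" using v4 d by (simp add: s1_def[symmetric]) (simp add: s1_def)
    finally show ?thesis .
  qed
  have t: "ar ?t = (ar s)(2 := (ar s 2)(?d := (ar s 2 ?d)(1 := 2), Suc ?d := row), 3 := (ar s 3)(16 + ?d := dg (a + r)), 4 := ar s 4)"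
    unfolding row(1) a4 by (auto simp: fun_eq_iff)
  have A: "setv 32 1 ?t = sem stepA s"
  proof (rule stepA_up[OF _ up])
    show "vr s 31 = 0" using R by (simp add: Rup_def)
    show "vr ?t 30 = Suc ?d" "vr ?t 31 = 1" using v5 by simp_all
  qed (use d in simp_all)
  have F: "frame_ok (setv 32 1 ?t) i ((stk @ [?fr']) ! i)" if "i < length (stk @ [?fr'])" for i
  proof (cases "i < ?d")
    case True
    have "frame_ok (setv 32 1 ?t) i (stk ! i)"
    proof (rule frame_ok_cong[of s])
      show "frame_ok s i (stk ! i)" using fr(3) True by blast
    qed (unfold setv_simps t, use True in simp_all)
    then show ?thesis using True by (simp add: nth_append)
  next
    case False
    then have "i = ?d" using that by simp
    then show ?thesis unfolding frame_ok_def frow_def setv_simps t using fr(2) by (simp add: frame_ok_def frow_def)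
  qed
  have "base s0 (stk @ [?fr']) U (setv 32 1 ?t)"
  proof (rule baseI[OF bs _ _ _ A])
    show "\<forall>y<hn. ar s 4 0 y = (if y \<in> U then 0 else 1)" using bs by (simp add: base_def marked_def)
    show "\<forall>q. \<exists>z. ((ar s 3)(16 + ?d := dg (a + r))) q = dg z" using bs by (auto simp: base_def canon_def)
    show "length (stk @ [?fr']) + card U \<le> hn" "U \<subseteq> {..<hn}" using bs by (simp_all add: base_def)
    show "ar (setv 32 1 ?t) = (ar s)(2 := (ar s 2)(?d := (ar s 2 ?d)(1 := 2), Suc ?d := row), 3 := (ar s 3)(16 + ?d := dg (a + r)), 4 := ar s 4)"
      by (simp only: setv_simps t)
    show "frame_ok (setv 32 1 ?t) i ((stk @ [?fr']) ! i)" if "i < length (stk @ [?fr'])" for i using F that .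
  qed (use v5 v4 in simp_all)
  moreover have "frow (setv 32 1 ?t) (Suc ?d) [x]" unfolding frow_def setv_simps t using row(4) by simp
  ultimately have "Rdown s0 (stk @ [?fr']) [x] (k - length I) U (setv 32 1 ?t)"
    unfolding Rdown_def setv_simps t using row(2,3) v5 by simp
  moreover have "runs step_prog s (costA + 1) (setv 32 1 ?t)"
    unfolding A by (rule runs_step0[OF p(1)]) (unfold A[symmetric], use v5 v4 in simp)
  ultimately show ?thesis by blast
qed

lemma step_up2:
  assumes o: "ok0 s0" and R: "Rup s0 (stk @ [(I, k, x, 2, a)]) r U s" and x: "x < hn" "x \<notin> U"
  shows "\<exists>s'. runs step_prog s (costA + 1) s' \<and> Rup s0 stk (\<Sum>i<m+1. r ^ i * a) (insert x U) s'"
proof -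
  let ?d = "length stk" and ?fr = "(I, k, x, 2, a)" and ?v = "\<Sum>i<m+1. r ^ i * a"
  have bs: "base s0 (stk @ [?fr]) U s" using R by (simp add: Rup_def)
  have p: "params s" "ar s 3 4 = dg 1" using same_params o bs by (simp_all add: base_def)
  have fr: "?d < hn" "frame_ok s ?d ?fr" "\<forall>i<?d. frame_ok s i (stk ! i)" using base_snoc[OF bs] by auto
  have d: "?d < S" "?d < 2 ^ w" "16 + ?d < S" "16 + ?d < 2 ^ w" "Suc (Suc ?d) < 2 ^ w" "x < S" using fr(1) x(1) rows sizes by linarith+
  define s1 where "s1 = setv 36 2 (setv 37 x (setv 34 (length I) (setv 35 k (setv 30 ?d s))))"
  have ld: "sem (Asg 30 (Bin Sub (Var 30) (Num 1)) ;; load_frame ;; Asg 37 (Arr 2 (Var 30) (Num 0)) ;;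
     Asg 36 (Arr 2 (Var 30) (Num 1))) s = s1"
    using up_load[OF _ fr(1,2)] bs by (simp add: base_def s1_def)
  let ?s2 = "sem solve s1"
  have y: "ar s 3 (16 + ?d) = dg a" using fr(2) by (simp add: frame_ok_def)
  have r10: "ar s 3 10 = dg r" using R by (simp add: Rup_def)
  have cs1: "canon s1" using bs by (simp add: base_def canon_def s1_def)
  obtain c e where a2: "ar ?s2 = (ar s1)(3 := (ar s1 3)(10 := dg ?v, 11 := dg c, 12 := dg e))"
    using solve_spec[of s1 ?d r a] p r10 y fr(1) cs1 by (auto simp: params_def s1_def)
  have v2: "vr ?s2 v = vr s1 v" if "26 < v" "v \<noteq> 43" for v
    using that by (intro vr_frame) (auto simp: solve_def block_defs)
  let ?t = "seta 4 0 x 0 ?s2"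
  have up: "sem up s = ?t"
  proof -
    have "sem up s = sem (Cond (Var 36) (Num 1)
       (bclear (Num 16 \<oplus> Var 30) ;; bmac (Num 16 \<oplus> Var 30) (Num 10) (Num 4) ;;
        Put 2 (Var 30) (Num 1) (Num 1) ;; push_same)
       (Cond (Var 36) (Num 2)
          (bmac (Num 16 \<oplus> Var 30) (Num 10) (Num 4) ;; Put 2 (Var 30) (Num 1) (Num 2) ;; push_single)
          (solve ;; Put 4 (Num 0) (Var 37) (Num 0)))) s1"
      unfolding up_def ld[symmetric] by simp
    also have "\<dots> = ?t" using v2 d by (simp add: s1_def[symmetric]) (simp add: s1_def)
    finally show ?thesis .
  qed
  have v: "vr ?t 30 = ?d" "vr ?t 31 = 0" "vr ?t 33 = 0" using v2 bs R by (simp_all add: s1_def base_def Rup_def)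
  have t: "ar ?t = (ar s)(2 := ar s 2, 3 := (ar s 3)(10 := dg ?v, 11 := dg c, 12 := dg e), 4 := (ar s 4)(0 := (ar s 4 0)(x := 0)))"
    using a2 by (auto simp: fun_eq_iff s1_def)
  let ?t' = "setv 32 (if stk = [] then 0 else 1) ?t"
  have A: "?t' = sem stepA s"
  proof (rule stepA_up[OF _ up v(1,2)])
    show "vr s 31 = 0" using R by (simp add: Rup_def)
  qed (use d in simp_all)
  have F: "frame_ok ?t' i (stk ! i)" if "i < ?d" for i
  proof (rule frame_ok_cong[of s])
    show "frame_ok s i (stk ! i)" using fr(3) that by blast
  qed (unfold setv_simps t, use that in simp_all)
  have U: "U \<subseteq> {..<hn}" "finite U" using bs finite_subset by (auto simp: base_def)
  then have cU: "card (insert x U) = Suc (card U)" using x(2) by simp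
  have "base s0 stk (insert x U) ?t'"
  proof (rule baseI[OF bs _ _ _ A, where ?A2.0 = "ar s 2" and ?A3.0 = "(ar s 3)(10 := dg ?v, 11 := dg c, 12 := dg e)"
        and ?A4.0 = "(ar s 4)(0 := (ar s 4 0)(x := 0))"])
    show "\<forall>y<hn. ((ar s 4)(0 := (ar s 4 0)(x := 0))) 0 y = (if y \<in> insert x U then 0 else 1)"
      using bs by (simp add: base_def marked_def)
    show "\<forall>q. \<exists>z. ((ar s 3)(10 := dg ?v, 11 := dg c, 12 := dg e)) q = dg z"
      using bs by (auto simp: base_def canon_def)
    show "length stk + card (insert x U) \<le> hn" using cU bs by (simp add: base_def)
    show "ar ?t' = (ar s)(2 := ar s 2, 3 := (ar s 3)(10 := dg ?v, 11 := dg c, 12 := dg e), 4 := (ar s 4)(0 := (ar s 4 0)(x := 0)))"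
      by (simp only: setv_simps t)
    show "insert x U \<subseteq> {..<hn}" using U x by simp
  qed (use v F in auto)
  then have "Rup s0 stk ?v (insert x U) ?t'" unfolding Rup_def setv_simps t using v by simp
  moreover have "runs step_prog s (costA + 1) ?t'"
    unfolding A by (rule runs_step0[OF p(1)]) (unfold A[symmetric], use v in simp)
  ultimately show ?thesis by blast
qed

end


section \<open>Counting maps on a connected list by backtracking\<close>

locale pattern = host +
  fixes hadj :: "nat \<Rightarrow> nat \<Rightarrow> bool" and hdeg :: "nat \<Rightarrow> nat" and X :: "nat set"
  assumes hadj_sym: "hadj x y \<Longrightarrow> hadj y x" and X_sub: "X \<subseteq> {..<m}"
    and hdeg_eq: "x < m \<Longrightarrow> hdeg x = card {y \<in> {..<m}. hadj x y}"
begin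

lemma adj_symm: "adj u v \<Longrightarrow> adj v u" using nb_sym by (auto simp: adj_def)

lemma adj_irr: "\<not> adj u u" using nb_irr by (auto simp: adj_def)

definition ideg :: "nat list \<Rightarrow> nat \<Rightarrow> nat" where "ideg I j = card {v \<in> set I. adj (I ! j) v}"

text \<open>The degree of a vertex inside I is known before any image is chosen, so the degree
  condition is tested when the vertex is placed and prunes the search at once.\<close>

definition compat :: "nat list \<Rightarrow> nat list \<Rightarrow> nat \<Rightarrow> bool" where
  "compat I \<sigma> y \<longleftrightarrow> y \<in> X \<and> hdeg y = ideg I (length \<sigma>) \<and>
     (\<forall>i<length \<sigma>. adj (I ! i) (I ! length \<sigma>) \<longrightarrow> hadj (\<sigma> ! i) y)"

definition valid :: "nat list \<Rightarrow> nat list \<Rightarrow> bool" where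
  "valid I \<sigma> \<longleftrightarrow> (\<forall>j<length \<sigma>. compat I (take j \<sigma>) (\<sigma> ! j))"

lemma valid_Nil [simp]: "valid I []" by (simp add: valid_def)

lemma valid_snoc: "valid I (\<sigma> @ [y]) \<longleftrightarrow> valid I \<sigma> \<and> compat I \<sigma> y"
  by (auto simp: valid_def nth_append less_Suc_eq)

lemma valid_append: "valid I (\<sigma> @ \<tau>) \<Longrightarrow> valid I \<sigma>"
proof (induction \<tau> rule: rev_induct)
  case (snoc y \<tau>) then show ?case using valid_snoc[of I "\<sigma> @ \<tau>" y] by simp
qed simp

primrec next_count :: "nat list \<Rightarrow> nat \<Rightarrow> nat list \<Rightarrow> nat" where
  "next_count I 0 \<sigma> = 1"
| "next_count I (Suc k) \<sigma> = (\<Sum>y<m. if compat I \<sigma> y then next_count I k (\<sigma> @ [y]) else 0)"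

lemma next_count_card:
  "valid I \<sigma> \<Longrightarrow> finite {\<tau>. length \<tau> = k \<and> valid I (\<sigma> @ \<tau>)} \<and> next_count I k \<sigma> = card {\<tau>. length \<tau> = k \<and> valid I (\<sigma> @ \<tau>)}"
proof (induction k arbitrary: \<sigma>)
  case 0
  have "{\<tau>. length \<tau> = 0 \<and> valid I (\<sigma> @ \<tau>)} = {[]}" using 0 by auto
  then show ?case by simp
next
  case (Suc k)
  let ?A = "\<lambda>y. if compat I \<sigma> y then (#) y ` {\<tau>. length \<tau> = k \<and> valid I ((\<sigma> @ [y]) @ \<tau>)} else {}"
  have eq: "{\<tau>. length \<tau> = Suc k \<and> valid I (\<sigma> @ \<tau>)} = (\<Union>y\<in>{..<m}. ?A y)"
  proof (intro set_eqI iffI)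
    fix \<tau> assume "\<tau> \<in> {\<tau>. length \<tau> = Suc k \<and> valid I (\<sigma> @ \<tau>)}"
    then obtain y \<tau>' where t: "\<tau> = y # \<tau>'" "length \<tau>' = k" "valid I ((\<sigma> @ [y]) @ \<tau>')" by (cases \<tau>) auto
    then have "compat I \<sigma> y" using valid_append[OF t(3)] valid_snoc by blast
    then show "\<tau> \<in> (\<Union>y\<in>{..<m}. ?A y)" using t X_sub by (auto simp: compat_def)
  next
    fix \<tau> assume "\<tau> \<in> (\<Union>y\<in>{..<m}. ?A y)"
    then show "\<tau> \<in> {\<tau>. length \<tau> = Suc k \<and> valid I (\<sigma> @ \<tau>)}" by (auto split: if_splits)
  qed
  have fin: "finite (?A y) \<and> card (?A y) = (if compat I \<sigma> y then next_count I k (\<sigma> @ [y]) else 0)" for y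
    using Suc.IH[of "\<sigma> @ [y]"] Suc.prems valid_snoc by (simp add: card_image)
  have "card (\<Union>y\<in>{..<m}. ?A y) = (\<Sum>y<m. card (?A y))"
  proof (rule card_UN_disjoint)
    show "\<forall>y\<in>{..<m}. finite (?A y)" using fin by blast
  qed auto
  also have "\<dots> = next_count I (Suc k) \<sigma>" unfolding next_count.simps using fin by (intro sum.cong refl) blast
  finally have "card (\<Union>y\<in>{..<m}. ?A y) = next_count I (Suc k) \<sigma>" .
  moreover have "finite (\<Union>y\<in>{..<m}. ?A y)" using fin by (intro finite_UN_I) auto
  ultimately show ?case unfolding eq by simp
qed

lemma valid_iff:
  "valid I \<sigma> \<longleftrightarrow> (\<forall>j<length \<sigma>. \<sigma> ! j \<in> X \<and> hdeg (\<sigma> ! j) = ideg I j \<and>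
      (\<forall>i<j. adj (I ! i) (I ! j) \<longrightarrow> hadj (\<sigma> ! i) (\<sigma> ! j)))"
  by (auto simp: valid_def compat_def)

lemma hw_next_count:
  assumes "distinct I" "set I \<subseteq> {..<hn}"
  shows "hw adj hadj hdeg X (set I) = next_count I (length I) []"
proof -
  let ?V = "{\<tau>. length \<tau> = length I \<and> valid I \<tau>}"
  let ?g = "\<lambda>\<tau> u. if u \<in> set I then \<tau> ! (THE i. i < length I \<and> I ! i = u) else undefined"
  have idx: "(THE i. i < length I \<and> I ! i = I ! j) = j" if "j < length I" for j
    using that assms(1) nth_eq_iff_index_eq by (intro the_equality) auto
  have "bij_betw (\<lambda>f. map f I) (locmaps adj hadj hdeg X (set I)) ?V"
  proof (rule bij_betw_byWitness[where f' = ?g])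
    show "\<forall>f\<in>locmaps adj hadj hdeg X (set I). ?g (map f I) = f"
    proof
      fix f assume f: "f \<in> locmaps adj hadj hdeg X (set I)"
      show "?g (map f I) = f"
      proof
        fix u show "?g (map f I) u = f u"
        proof (cases "u \<in> set I")
          case True
          then obtain j where "j < length I" "u = I ! j" by (auto simp: in_set_conv_nth)
          then show ?thesis using idx by simp
        next
          case False then show ?thesis using f by (auto simp: locmaps_def PiE_def extensional_def)
        qed
      qed
    qed
    show "\<forall>\<tau>\<in>?V. map (?g \<tau>) I = \<tau>" by (auto intro!: nth_equalityI simp: idx)
    show "(\<lambda>f. map f I) ` locmaps adj hadj hdeg X (set I) \<subseteq> ?V"
      by (auto simp: locmaps_def valid_iff ideg_def)
    show "?g ` ?V \<subseteq> locmaps adj hadj hdeg X (set I)"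
    proof
      fix f assume "f \<in> ?g ` ?V"
      then obtain \<tau> where t: "f = ?g \<tau>" "length \<tau> = length I" "valid I \<tau>" by blast
      have fj: "f (I ! j) = \<tau> ! j" if "j < length I" for j unfolding t(1) using idx that by simp
      have "f \<in> set I \<rightarrow>\<^sub>E X"
      proof (rule PiE_I)
        fix u assume "u \<in> set I"
        then obtain j where "j < length I" "u = I ! j" by (auto simp: in_set_conv_nth)
        then show "f u \<in> X" using fj t by (simp add: valid_iff)
      qed (simp add: t(1))
      moreover have "hadj (f u) (f v)" if uv: "u \<in> set I" "v \<in> set I" "adj u v" for u v
      proof -
        obtain i j where ij: "i < length I" "u = I ! i" "j < length I" "v = I ! j" using uv by (auto simp: in_set_conv_nth)
        consider "i < j" | "j < i" | "i = j" by linarith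
        then show ?thesis
        proof cases
          case 1 then show ?thesis using t ij uv(3) fj by (simp add: valid_iff)
        next
          case 2 then show ?thesis using t ij adj_symm[OF uv(3)] fj hadj_sym by (simp add: valid_iff)
        next
          case 3 then show ?thesis using uv(3) ij adj_irr by simp
        qed
      qed
      moreover have "card {v \<in> set I. adj u v} = hdeg (f u)" if "u \<in> set I" for u
      proof -
        obtain i where "i < length I" "u = I ! i" using \<open>u \<in> _\<close> by (auto simp: in_set_conv_nth)
        then show ?thesis using t fj by (simp add: valid_iff ideg_def)
      qed
      ultimately show "f \<in> locmaps adj hadj hdeg X (set I)" by (simp add: locmaps_def)
    qed
  qed
  then show ?thesis unfolding hw_def using next_count_card[of I "[]" "length I"] by (simp add: bij_betw_same_card)
qed

text \<open>The recursion extends a list only by a neighbour of one of its members, so this order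
  comes for free.\<close>

definition connected_list :: "nat list \<Rightarrow> bool" where
  "connected_list I \<longleftrightarrow> (\<forall>j<length I. 0 < j \<longrightarrow> (\<exists>i<j. adj (I ! i) (I ! j)))"

text \<open>The next vertex is adjacent to an earlier \<open>I ! i\<close>, so its image is a
  neighbour of \<open>\<sigma> ! i\<close>. The degree of \<open>\<sigma> ! i\<close> in the pattern
  equals the degree of \<open>I ! i\<close> inside I, which the host bounds by D. Matching degrees
  thus also limits the branching of the search.\<close>

lemma compat_few:
  assumes c: "connected_list I" "set I \<subseteq> {..<hn}" and s: "valid I \<sigma>" "\<sigma> \<noteq> []" "length \<sigma> < length I"
  shows "card {y. y < m \<and> compat I \<sigma> y} \<le> D"
proof -
  let ?j = "length \<sigma>"
  obtain i where i: "i < ?j" "adj (I ! i) (I ! ?j)" using c s by (auto simp: connected_list_def)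
  have "\<sigma> ! i \<in> X" "hdeg (\<sigma> ! i) = ideg I i" using s(1) i(1) by (auto simp: valid_iff)
  then have h: "card {y \<in> {..<m}. hadj (\<sigma> ! i) y} = ideg I i" using hdeg_eq X_sub by auto
  have "card {y. y < m \<and> compat I \<sigma> y} \<le> card {y \<in> {..<m}. hadj (\<sigma> ! i) y}"
    using i by (intro card_mono) (auto simp: compat_def)
  also have "\<dots> \<le> D"
  proof -
    have Ii: "I ! i < hn" using i(2) by (simp add: adj_def)
    have "ideg I i \<le> card (set (nb (I ! i)))" unfolding ideg_def by (intro card_mono) (auto simp: adj_def)
    also have "\<dots> \<le> length (nb (I ! i))" by (rule card_length)
    finally show ?thesis using h nb_len[OF Ii] by simp
  qed
  finally show ?thesis .
qed

definition okpat :: "st \<Rightarrow> bool" where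
  "okpat s \<longleftrightarrow> (\<forall>x<m. \<forall>y<m. ar s 5 x y = (if hadj x y then 1 else 0)) \<and> (\<forall>x<m. ar s 6 0 x = hdeg x) \<and>
     (\<forall>x<m. ar s 7 0 x = (if x \<in> X then 1 else 0))"

text \<open>The state of the search: the images of the first vertices are fixed, the next candidate is y.\<close>

definition search :: "st \<Rightarrow> nat list \<Rightarrow> nat \<Rightarrow> nat list \<Rightarrow> nat \<Rightarrow> nat \<Rightarrow> st \<Rightarrow> bool" where
  "search t0 I p \<sigma> y c t \<longleftrightarrow> (\<forall>x. x < 20 \<or> 60 \<le> x \<or> x \<in> {30, 31, 32, 34} \<longrightarrow> vr t x = vr t0 x) \<and>
     (\<forall>a. a \<noteq> 3 \<and> a \<noteq> 8 \<longrightarrow> ar t a = ar t0 a) \<and> ar t 3 = (ar t0 3)(10 := dg (c * p)) \<and>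
     vr t 33 = 1 \<and> vr t 50 = length \<sigma> \<and> (\<forall>i<length \<sigma>. ar t 8 0 i = \<sigma> ! i) \<and> ar t 8 0 (length \<sigma>) = y"

definition leaf_tables :: "st \<Rightarrow> nat list \<Rightarrow> nat \<Rightarrow> bool" where
  "leaf_tables t I p \<longleftrightarrow> params t \<and> okpat t \<and> vr t 34 = length I \<and> ar t 3 3 = dg p \<and> ar t 3 4 = dg 1 \<and>
     (\<forall>i<m. \<forall>j<m. i < length I \<longrightarrow> j < length I \<longrightarrow> ar t 9 i j = (if adj (I ! i) (I ! j) then 1 else 0)) \<and>
     (\<forall>i<length I. ar t 10 0 i = ideg I i)"

lemma dfs_compat:
  assumes t0: "leaf_tables t0 I p" and I: "length I \<le> m" and t: "search t0 I p \<sigma> y c t"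
    and l: "length \<sigma> < length I" "\<forall>i<length \<sigma>. \<sigma> ! i < m" and y: "y < m"
  defines "u \<equiv> sem (Asg 51 (Arr 8 (Num 0) (Var 50)) ;; Asg 52 (Num 1) ;;
     Cond (Arr 7 (Num 0) (Var 51)) (Num 1) (Asg 52 (Num 0)) skip ;;
     Cond (Arr 6 (Num 0) (Var 51)) (Arr 10 (Num 0) (Var 50)) (Asg 52 (Num 0)) skip ;;
     Cond (Arr 10 (Num 0) (Var 50)) (Arr 6 (Num 0) (Var 51)) (Asg 52 (Num 0)) skip ;;
     For 40 7 (Cond (Var 40) (Var 50)
       (Cond (Arr 5 (Arr 8 (Num 0) (Var 40)) (Var 51)) (Arr 9 (Var 40) (Var 50)) (Asg 52 (Num 0)) skip) skip)) t"
  shows "vr u 52 = (if compat I \<sigma> y then 1 else 0)" "ar u = ar t" "\<And>x. x \<notin> {27, 40, 51, 52} \<Longrightarrow> vr u x = vr t x"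
    "vr u 51 = y"
proof -
  let ?j = "length \<sigma>"
  have bd: "?j < S" "?j < m" "y < S" "\<And>i. i < m \<Longrightarrow> i mod S = i" using l I y cols by simp_all
  define B where "B \<longleftrightarrow> y \<in> X \<and> hdeg y = ideg I ?j"
  have tab: "ar t 7 0 y = (if y \<in> X then 1 else 0)" "ar t 6 0 y = hdeg y" "ar t 10 0 ?j = ideg I ?j"
    "\<And>x. x < m \<Longrightarrow> ar t 5 x y = (if hadj x y then 1 else 0)" "vr t 7 = m" "ar t 8 0 ?j = y" "vr t 50 = ?j"
    "\<And>i. i < ?j \<Longrightarrow> ar t 9 i ?j = (if adj (I ! i) (I ! ?j) then 1 else 0)" "\<And>i. i < ?j \<Longrightarrow> ar t 8 0 i = \<sigma> ! i"
    using t0 t y l bd(2) by (simp_all add: leaf_tables_def search_def okpat_def params_def)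
  show "ar u = ar t"
  proof
    fix a show "ar u a = ar t a" unfolding u_def by (rule ar_frame) simp
  qed
  show "vr u x = vr t x" if "x \<notin> {27, 40, 51, 52}" for x unfolding u_def by (rule vr_frame) (use that in simp)
  let ?c = "Cond (Var 40) (Var 50)
       (Cond (Arr 5 (Arr 8 (Num 0) (Var 40)) (Var 51)) (Arr 9 (Var 40) (Var 50)) (Asg 52 (Num 0)) skip) skip"
  define t1 where "t1 = sem (Asg 51 (Arr 8 (Num 0) (Var 50)) ;; Asg 52 (Num 1) ;;
     Cond (Arr 7 (Num 0) (Var 51)) (Num 1) (Asg 52 (Num 0)) skip ;;
     Cond (Arr 6 (Num 0) (Var 51)) (Arr 10 (Num 0) (Var 50)) (Asg 52 (Num 0)) skip ;;
     Cond (Arr 10 (Num 0) (Var 50)) (Arr 6 (Num 0) (Var 51)) (Asg 52 (Num 0)) skip) t"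
  have u: "u = setv 40 (vr t1 7) (floop (\<lambda>k s. sem ?c (setv 40 k s)) (vr t1 7) t1)"
    by (simp only: u_def t1_def sem.simps)
  have t1: "ar t1 = ar t" "vr t1 52 = (if B then 1 else 0)" "vr t1 51 = y" "vr t1 50 = ?j" "vr t1 7 = m"
    using tab(1,2,3,5,6,7) bd(1,3) unfolding t1_def B_def
    by (cases "y \<in> X"; cases rule: linorder_cases[of "hdeg y" "ideg I ?j"]; simp)+
  define J where "J k s \<longleftrightarrow> ar s = ar t \<and> vr s 51 = y \<and> vr s 50 = ?j \<and>
     vr s 52 = (if B \<and> (\<forall>i<k. i < ?j \<longrightarrow> adj (I ! i) (I ! ?j) \<longrightarrow> hadj (\<sigma> ! i) y) then 1 else 0)" for k and s :: st
  have "J m (floop (\<lambda>k s. sem ?c (setv 40 k s)) m t1)"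
  proof (rule floop_inv[where P = J])
    show "J 0 t1" using t1 by (simp add: J_def)
  next
    fix k s assume k: "k < m" and J: "J k s"
    show "J (Suc k) (sem ?c (setv 40 k s))"
    proof (cases "k < ?j")
      case False then show ?thesis using J by (auto simp: J_def less_Suc_eq)
    next
      case True
      have "sem ?c (setv 40 k s) = (if adj (I ! k) (I ! ?j) \<and> \<not> hadj (\<sigma> ! k) y then setv 52 0 (setv 40 k s) else setv 27 0 (setv 40 k s))"
        using J True tab(4)[of "\<sigma> ! k"] tab(8,9)[OF True] l(2) bd by (simp add: J_def)
      then show ?thesis using J True by (auto simp: J_def less_Suc_eq)
    qed
  qed
  then have Jm: "vr u 52 = (if B \<and> (\<forall>i<m. i < ?j \<longrightarrow> adj (I ! i) (I ! ?j) \<longrightarrow> hadj (\<sigma> ! i) y) then 1 else 0)" "vr u 51 = y"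
    unfolding u t1(5) by (simp_all add: J_def)
  show "vr u 51 = y" by fact
  have "(B \<and> (\<forall>i<m. i < ?j \<longrightarrow> adj (I ! i) (I ! ?j) \<longrightarrow> hadj (\<sigma> ! i) y)) = compat I \<sigma> y"
    using bd(2) by (auto simp: compat_def B_def)
  then show "vr u 52 = (if compat I \<sigma> y then 1 else 0)" unfolding Jm(1) by simp
qed

text \<open>Separates the tests of \<open>dfs\<close> from the move that follows them, so that
  \<open>dfs_compat\<close> applies to the tests as one block.\<close>

lemma sem_guarded:
  "sem (Asg x e ;; Cond a a' (c1 ;; c2 ;; c3 ;; c4 ;; c5 ;; post) c) t =
    (if ev (setv x (ev t e) t) a < ev (setv x (ev t e) t) a' then sem post (sem (Asg x e ;; c1 ;; c2 ;; c3 ;; c4 ;; c5) t)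
     else sem c (setv x (ev t e) t))"
  by simp

text \<open>The five moves of the search: reject, count a complete map, descend, backtrack,
  stop.\<close>

lemma dfs_sem:
  assumes t0: "leaf_tables t0 I p" and I: "length I \<le> m" and t: "search t0 I p \<sigma> y c t"
    and l: "length \<sigma> < length I" "\<forall>i<length \<sigma>. \<sigma> ! i < m" and y: "y \<le> m"
  shows "y < m \<Longrightarrow> \<not> compat I \<sigma> y \<Longrightarrow> search t0 I p \<sigma> (Suc y) c (sem dfs t)"
    "y < m \<Longrightarrow> compat I \<sigma> y \<Longrightarrow> Suc (length \<sigma>) = length I \<Longrightarrow> search t0 I p \<sigma> (Suc y) (Suc c) (sem dfs t)"
    "y < m \<Longrightarrow> compat I \<sigma> y \<Longrightarrow> Suc (length \<sigma>) < length I \<Longrightarrow> search t0 I p (\<sigma> @ [y]) 0 c (sem dfs t)"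
    "y = m \<Longrightarrow> \<sigma> = \<sigma>' @ [y'] \<Longrightarrow> search t0 I p \<sigma>' (Suc y') c (sem dfs t)"
    "y = m \<Longrightarrow> \<sigma> = [] \<Longrightarrow> vr (sem dfs t) = (vr t)(51 := m, 33 := 0) \<and> ar (sem dfs t) = ar t"
proof -
  let ?j = "length \<sigma>"
  have bd: "?j < S" "?j < m" "Suc ?j < S" "Suc ?j < 2 ^ w" "Suc y < 2 ^ w" "y < S" using l I y cols sizes by simp_all
  have tab: "ar t 8 0 ?j = y" "vr t 50 = ?j" "vr t 7 = m" "vr t 34 = length I" "vr t 8 = L" "vr t 9 = b"
    using t t0 by (simp_all add: leaf_tables_def search_def params_def)
  let ?pre = "Asg 51 (Arr 8 (Num 0) (Var 50)) ;; Asg 52 (Num 1) ;;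
     Cond (Arr 7 (Num 0) (Var 51)) (Num 1) (Asg 52 (Num 0)) skip ;;
     Cond (Arr 6 (Num 0) (Var 51)) (Arr 10 (Num 0) (Var 50)) (Asg 52 (Num 0)) skip ;;
     Cond (Arr 10 (Num 0) (Var 50)) (Arr 6 (Num 0) (Var 51)) (Asg 52 (Num 0)) skip ;;
     For 40 7 (Cond (Var 40) (Var 50)
       (Cond (Arr 5 (Arr 8 (Num 0) (Var 40)) (Var 51)) (Arr 9 (Var 40) (Var 50)) (Asg 52 (Num 0)) skip) skip)"
  let ?post = "Cond (Num 0) (Var 52)
       (Cond (Var 50 \<oplus> Num 1) (Var 34)
          (Asg 50 (Var 50 \<oplus> Num 1) ;; Put 8 (Num 0) (Var 50) (Num 0))
          (bmac (Num 10) (Num 3) (Num 4) ;; Put 8 (Num 0) (Var 50) (Var 51 \<oplus> Num 1)))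
       (Put 8 (Num 0) (Var 50) (Var 51 \<oplus> Num 1))"
  define u where "u = sem ?pre t"
  have cond: "ev (setv 51 y t) (Var 51) = y" "ev (setv 51 y t) (Var 7) = m" using tab by simp_all
  have e51: "ev t (Arr 8 (Num 0) (Var 50)) = y" using tab bd by simp
  {
    assume ym: "y < m"
    have sd: "sem dfs t = sem ?post u"
      unfolding dfs_def sem_guarded e51 cond u_def using ym by (simp only: if_True)
    note c = dfs_compat[OF t0 I t l ym, folded u_def]
    have uv: "vr u 50 = ?j" "vr u 34 = length I" "vr u 8 = L" "vr u 9 = b" using c(3) tab by simp_all
    have su: "search t0 I p \<sigma> y c u" using t c(2,3) by (simp add: search_def)
    show "\<not> compat I \<sigma> y \<Longrightarrow> search t0 I p \<sigma> (Suc y) c (sem dfs t)"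
    proof -
      assume "\<not> compat I \<sigma> y"
      then have "sem dfs t = seta 8 0 ?j (Suc y) u" unfolding sd using c(1,4) uv bd by simp
      then show ?thesis using su by (simp add: search_def)
    qed
    show "search t0 I p (\<sigma> @ [y]) 0 c (sem dfs t)" if "compat I \<sigma> y" "Suc ?j < length I"
    proof -
      have "sem dfs t = seta 8 0 (Suc ?j) 0 (setv 50 (Suc ?j) u)" unfolding sd using c(1,4) uv bd that by simp
      then show ?thesis using su by (auto simp: search_def nth_append less_Suc_eq)
    qed
    show "search t0 I p \<sigma> (Suc y) (Suc c) (sem dfs t)" if "compat I \<sigma> y" "Suc ?j = length I"
    proof -
      let ?v = "sem (bmac (Num 10) (Num 3) (Num 4)) u"
      have vv: "vr ?v x = vr u x" if "x < 20 \<or> 26 < x" for x using that by (simp add: vr_bmac)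
      have a: "ar ?v = (ar u)(3 := (ar u 3)(10 := dg (c * p + p)))"
        using bmac_spec[of u "Num 10" 10 "Num 3" 3 "Num 4" 4 "c * p" p 1] su t0 uv rows
        by (simp add: search_def leaf_tables_def)
      have "sem dfs t = seta 8 0 ?j (Suc y) ?v" unfolding sd using c(1,4) uv bd that by (simp add: vr_bmac)
      then show ?thesis using su a vv by (auto simp: search_def fun_eq_iff add.commute)
    qed
  }
  {
    assume ym: "y = m"
    show "search t0 I p \<sigma>' (Suc y') c (sem dfs t)" if s: "\<sigma> = \<sigma>' @ [y']"
    proof -
      have y': "y' < m" "y' < 2 ^ w" "Suc y' < 2 ^ w" using l(2) s sizes by (auto simp: nth_append)
      have "ar t 8 0 (length \<sigma>') = y'" using t s by (auto simp: search_def nth_append)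
      then have "sem dfs t = seta 8 0 (length \<sigma>') (Suc y') (setv 50 (length \<sigma>') (setv 51 m t))"
        using tab bd s ym y' by (simp add: dfs_def binop_sub)
      then show ?thesis using t s by (auto simp: search_def nth_append)
    qed
    show "vr (sem dfs t) = (vr t)(51 := m, 33 := 0) \<and> ar (sem dfs t) = ar t" if "\<sigma> = []"
      using tab bd ym that by (simp add: dfs_def)
  }
qed

end


section \<open>Running time of the backtracking search\<close>

context pattern
begin

text \<open>Moves spent below a node with k vertices left: m candidates are tried, at most D open a
  subtree, and leaving a subtree costs one more move.\<close>

primrec dtime :: "nat \<Rightarrow> nat" where
  "dtime 0 = 0"
| "dtime (Suc k) = m + D * (1 + dtime k)"

lemma dtime_bound: "dtime k + 1 \<le> (m + 1) * (k + 1) * D ^ k"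
proof (induction k)
  case (Suc k)
  have "dtime (Suc k) + 1 = (m + 1) + D * (dtime k + 1)" by simp
  also have "\<dots> \<le> (m + 1) + D * ((m + 1) * (k + 1) * D ^ k)" using Suc by (intro add_left_mono mult_le_mono2)
  also have "\<dots> = (m + 1) + (m + 1) * (k + 1) * D ^ Suc k" by (simp only: power_Suc mult.left_commute mult.assoc)
  also have "\<dots> \<le> (m + 1) * D ^ Suc k + (m + 1) * (k + 1) * D ^ Suc k" 
    using mult_le_mono2[OF one_le_power[OF D1, of "Suc k"], of "m + 1"] by (intro add_right_mono) (simp only: mult_1_right)
  also have "\<dots> = (m + 1) * (Suc k + 1) * D ^ Suc k" by (simp only: distrib_right distrib_left add_Suc mult_Suc mult_Suc_right Suc_eq_plus1 mult_1_right)
  finally show ?case .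
qed simp

lemma search_step:
  assumes "leaf_tables t0 I p" "search t0 I p \<sigma> y c t"
  shows "loopto 33 (Do dfs) t (costF + 2) (sem dfs t)" "runs (Do dfs) t costF (sem dfs t)"
proof -
  have "params t" using assms by (simp add: leaf_tables_def search_def params_def)
  then show r: "runs (Do dfs) t costF (sem dfs t)" by (intro runs_Do okc_dfs cb_dfs)
  show "loopto 33 (Do dfs) t (costF + 2) (sem dfs t)"
    by (rule loopto_step[OF _ _ r]) (use assms in \<open>simp_all add: search_def\<close>)
qed

text \<open>The cost e of a subtree and the number of compatible candidates are kept abstract
  because the root behaves differently: it may have m images, every deeper level at most D.\<close>

lemma dfs_level:
  assumes t0: "leaf_tables t0 I p" and I: "length I \<le> m" and s: "length \<sigma> + Suc k = length I" "valid I \<sigma>"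
    and child: "\<And>y c t. 0 < k \<Longrightarrow> compat I \<sigma> y \<Longrightarrow> search t0 I p (\<sigma> @ [y]) 0 c t \<Longrightarrow>
      \<exists>t'. loopto 33 (Do dfs) t (e * (costF + 2)) t' \<and> search t0 I p (\<sigma> @ [y]) m (c + next_count I k (\<sigma> @ [y])) t'"
    and y: "y \<le> m" "search t0 I p \<sigma> y c t"
  shows "\<exists>t'. loopto 33 (Do dfs) t ((m - y + card {y'. y \<le> y' \<and> y' < m \<and> compat I \<sigma> y'} * (1 + e)) * (costF + 2)) t' \<and>
     search t0 I p \<sigma> m (c + (\<Sum>y'\<in>{y..<m}. if compat I \<sigma> y' then next_count I k (\<sigma> @ [y']) else 0)) t'"
  using y
proof (induction "m - y" arbitrary: y c t)
  case 0
  then have "y = m" by simp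
  then show ?case using 0 loopto_refl[of 33 "Do dfs" t] by (intro exI[of _ t]) (simp add: loopto_mono[OF loopto_refl])
next
  case (Suc d)
  let ?N = "\<lambda>y'. if compat I \<sigma> y' then next_count I k (\<sigma> @ [y']) else 0"
  let ?K = "\<lambda>y. {y'. y \<le> y' \<and> y' < m \<and> compat I \<sigma> y'}"
  have y: "y < m" "y \<le> m" using Suc.hyps(2) by auto
  have l: "length \<sigma> < length I" "\<forall>i<length \<sigma>. \<sigma> ! i < m"
    using s X_sub by (auto simp: valid_iff)
  note sem = dfs_sem[OF t0 I Suc.prems(2) l y(2)]
  note st = search_step(1)[OF t0]
  have sumN: "(\<Sum>y'\<in>{y..<m}. ?N y') = ?N y + (\<Sum>y'\<in>{Suc y..<m}. ?N y')" using y by (simp add: sum.atLeast_Suc_lessThan)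
  have my: "m - y = Suc (m - Suc y)" "d = m - Suc y" using Suc.hyps(2) by auto
  show ?case
  proof (cases "compat I \<sigma> y")
    case False
    then have K: "?K y = ?K (Suc y)" using Suc_leI le_antisym by (auto simp: le_less)
    obtain t' where t': "loopto 33 (Do dfs) (sem dfs t) ((m - Suc y + card (?K (Suc y)) * (1 + e)) * (costF + 2)) t'"
      "search t0 I p \<sigma> m (c + (\<Sum>y'\<in>{Suc y..<m}. ?N y')) t'"
      using Suc.hyps(1)[OF my(2) _ sem(1)[OF y(1) False]] y(1) by auto
    show ?thesis
    proof (intro exI conjI)
      show "loopto 33 (Do dfs) t ((m - y + card (?K y) * (1 + e)) * (costF + 2)) t'"
        by (rule loopto_mono[OF loopto_trans[OF st[OF Suc.prems(2)] t'(1)]]) (simp add: my(1) K)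
      show "search t0 I p \<sigma> m (c + (\<Sum>y'\<in>{y..<m}. ?N y')) t'" using t'(2) sumN False by simp
    qed
  next
    case True
    have "?K y = insert y (?K (Suc y))" using True y by auto
    then have K: "card (?K y) = Suc (card (?K (Suc y)))" by simp
    have "\<exists>t1. loopto 33 (Do dfs) t ((1 + (1 + e)) * (costF + 2)) t1 \<and> search t0 I p \<sigma> (Suc y) (c + ?N y) t1"
    proof (cases "k = 0")
      case k: True
      then have "search t0 I p \<sigma> (Suc y) (Suc c) (sem dfs t)" using sem(2)[OF y(1) True] s by simp
      moreover have "loopto 33 (Do dfs) t ((1 + (1 + e)) * (costF + 2)) (sem dfs t)"
        by (rule loopto_mono[OF st[OF Suc.prems(2)]]) simp
      ultimately show ?thesis using True k by auto
    next
      case k: False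
      then have s1: "search t0 I p (\<sigma> @ [y]) 0 c (sem dfs t)" using sem(3)[OF y(1) True] s by simp
      obtain t1 where t1: "loopto 33 (Do dfs) (sem dfs t) (e * (costF + 2)) t1"
        "search t0 I p (\<sigma> @ [y]) m (c + next_count I k (\<sigma> @ [y])) t1" using child[OF _ True s1] k by auto
      have "search t0 I p \<sigma> (Suc y) (c + next_count I k (\<sigma> @ [y])) (sem dfs t1)"
        using dfs_sem(4)[OF t0 I t1(2)] s k l y by (simp add: nth_append less_Suc_eq)
      moreover have "loopto 33 (Do dfs) t ((1 + (1 + e)) * (costF + 2)) (sem dfs t1)"
        by (rule loopto_mono[OF loopto_trans[OF st[OF Suc.prems(2)] loopto_trans[OF t1(1) st[OF t1(2)]]]]) simp
      ultimately show ?thesis using True by auto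
    qed
    then obtain t1 where t1: "loopto 33 (Do dfs) t ((1 + (1 + e)) * (costF + 2)) t1" "search t0 I p \<sigma> (Suc y) (c + ?N y) t1"
      by blast
    obtain t' where t': "loopto 33 (Do dfs) t1 ((m - Suc y + card (?K (Suc y)) * (1 + e)) * (costF + 2)) t'"
      "search t0 I p \<sigma> m (c + ?N y + (\<Sum>y'\<in>{Suc y..<m}. ?N y')) t'"
      using Suc.hyps(1)[OF my(2) _ t1(2)] y(1) by auto
    show ?thesis
    proof (intro exI conjI)
      show "loopto 33 (Do dfs) t ((m - y + card (?K y) * (1 + e)) * (costF + 2)) t'"
      proof (rule loopto_mono[OF loopto_trans[OF t1(1) t'(1)]])
        have "(1 + (1 + e)) + (m - Suc y + card (?K (Suc y)) * (1 + e)) \<le> m - y + card (?K y) * (1 + e)"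
          unfolding K my(1) by simp
        then show "(1 + (1 + e)) * (costF + 2) + (m - Suc y + card (?K (Suc y)) * (1 + e)) * (costF + 2) \<le>
          (m - y + card (?K y) * (1 + e)) * (costF + 2)"
          unfolding distrib_right[symmetric] by (rule mult_le_mono1)
      qed
      show "search t0 I p \<sigma> m (c + (\<Sum>y'\<in>{y..<m}. ?N y')) t'" using t'(2) sumN by (simp add: add.assoc)
    qed
  qed
qed

text \<open>A non-empty \<sigma> supplies the earlier neighbour on which \<open>compat_few\<close>
  rests; the root is left to \<open>dfs_run\<close>.\<close>

lemma dfs_subtree:
  assumes t0: "leaf_tables t0 I p" and I: "length I \<le> m" "connected_list I" "set I \<subseteq> {..<hn}"
  shows "length \<sigma> + k = length I \<Longrightarrow> 0 < k \<Longrightarrow> \<sigma> \<noteq> [] \<Longrightarrow> valid I \<sigma> \<Longrightarrow> search t0 I p \<sigma> 0 c t \<Longrightarrow>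
    \<exists>t'. loopto 33 (Do dfs) t (dtime k * (costF + 2)) t' \<and> search t0 I p \<sigma> m (c + next_count I k \<sigma>) t'"
proof (induction k arbitrary: \<sigma> c t)
  case (Suc k)
  have "\<exists>t'. loopto 33 (Do dfs) t (dtime k * (costF + 2)) t' \<and> search t0 I p (\<sigma> @ [y]) m (c + next_count I k (\<sigma> @ [y])) t'"
    if "0 < k" "compat I \<sigma> y" "search t0 I p (\<sigma> @ [y]) 0 c t" for y c t
    using Suc.IH[of "\<sigma> @ [y]" c t] that Suc.prems valid_snoc by simp
  from dfs_level[OF t0 I(1) Suc.prems(1,4) this le0 Suc.prems(5)]
  obtain t' where t': "loopto 33 (Do dfs) t ((m - 0 + card {y'. 0 \<le> y' \<and> y' < m \<and> compat I \<sigma> y'} * (1 + dtime k)) * (costF + 2)) t'"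
    "search t0 I p \<sigma> m (c + (\<Sum>y'\<in>{0..<m}. if compat I \<sigma> y' then next_count I k (\<sigma> @ [y']) else 0)) t'" by blast
  have "card {y'. 0 \<le> y' \<and> y' < m \<and> compat I \<sigma> y'} \<le> D"
    using compat_few[OF I(2,3) Suc.prems(4,3)] Suc.prems(1) by simp
  then have "m - 0 + card {y'. 0 \<le> y' \<and> y' < m \<and> compat I \<sigma> y'} * (1 + dtime k) \<le> dtime (Suc k)"
    unfolding dtime.simps by (intro add_mono mult_le_mono1) simp_all
  then have "loopto 33 (Do dfs) t (dtime (Suc k) * (costF + 2)) t'"
    by (intro loopto_mono[OF t'(1)] mult_le_mono1)
  then show ?case using t'(2) by (auto simp: lessThan_atLeast0)
qed simp

text \<open>The cube stems from up to m images for the root times the factor (m + 1) m of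
  \<open>dtime_bound\<close>; the final 1 is the failing test of the loop.\<close>

definition leafT :: nat where "leafT = (m + 1) ^ 3 * D ^ m * (costF + 2) + 1"

lemma dfs_run:
  assumes t0: "leaf_tables t0 I p" and I: "length I \<le> m" "connected_list I" "set I \<subseteq> {..<hn}" "I \<noteq> []"
    and t: "search t0 I p [] 0 0 t0"
  shows "\<exists>t' u. runs (While 33 (Do dfs)) t0 leafT u \<and> search t0 I p [] m (next_count I (length I) []) t' \<and>
     vr u = (vr t')(51 := m, 33 := 0) \<and> ar u = ar t'"
proof -
  obtain k where k: "length I = Suc k" using I(4) by (cases I) auto
  have ch: "\<exists>t'. loopto 33 (Do dfs) t (dtime k * (costF + 2)) t' \<and> search t0 I p ([] @ [y]) m (c + next_count I k ([] @ [y])) t'"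
    if "0 < k" "compat I [] y" "search t0 I p ([] @ [y]) 0 c t" for y c t
    using dfs_subtree[OF t0 I(1-3), of "[] @ [y]" k c t] that k valid_snoc[of I "[]" y] by simp
  from dfs_level[OF t0 I(1) _ valid_Nil ch le0 t] k
  obtain t' where t': "loopto 33 (Do dfs) t0 ((m - 0 + card {y'. 0 \<le> y' \<and> y' < m \<and> compat I [] y'} * (1 + dtime k)) * (costF + 2)) t'"
    "search t0 I p [] m (0 + (\<Sum>y'\<in>{0..<m}. if compat I [] y' then next_count I k ([] @ [y']) else 0)) t'" by force
  have s': "search t0 I p [] m (next_count I (length I) []) t'" using t'(2) k by (simp add: lessThan_atLeast0)
  have u: "vr (sem dfs t') = (vr t')(51 := m, 33 := 0) \<and> ar (sem dfs t') = ar t'"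
    using dfs_sem(5)[OF t0 I(1) s'] k by simp
  have "card {y'. 0 \<le> y' \<and> y' < m \<and> compat I [] y'} \<le> card {..<m}" by (intro card_mono) auto
  then have "card {y'. 0 \<le> y' \<and> y' < m \<and> compat I [] y'} * (1 + dtime k) \<le> m * ((m + 1) * (k + 1) * D ^ k)"
    using dtime_bound[of k] by (intro mult_le_mono) simp_all
  also have "\<dots> \<le> m * ((m + 1) * m * D ^ m)"
  proof -
    have "k + 1 \<le> m" using k I(1) by simp
    moreover from this have "D ^ k \<le> D ^ m" using D1 by (intro power_increasing) auto
    ultimately show ?thesis by (intro mult_le_mono2 mult_le_mono) simp_all
  qed
  finally have c: "card {y'. 0 \<le> y' \<and> y' < m \<and> compat I [] y'} * (1 + dtime k) \<le> m * ((m + 1) * m) * D ^ m"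
    by (simp only: mult.assoc)
  have "m + m * ((m + 1) * m) * D ^ m + 1 \<le> (m + 1) ^ 3 * D ^ m"
  proof -
    have "m + 1 \<le> (m + 1) * D ^ m" using mult_le_mono2[OF one_le_power[OF D1, of m], of "m + 1"] by (simp only: mult_1_right)
    moreover have "(m + 1) + m * ((m + 1) * m) \<le> (m + 1) ^ 3" by (simp add: power3_eq_cube algebra_simps)
    then have "((m + 1) + m * ((m + 1) * m)) * D ^ m \<le> (m + 1) ^ 3 * D ^ m" by (rule mult_le_mono1)
    ultimately show ?thesis by (simp only: distrib_right)
  qed
  then have "m - 0 + card {y'. 0 \<le> y' \<and> y' < m \<and> compat I [] y'} * (1 + dtime k) + 1 \<le> (m + 1) ^ 3 * D ^ m"
    using c by linarith
  then have "(m - 0 + card {y'. 0 \<le> y' \<and> y' < m \<and> compat I [] y'} * (1 + dtime k) + 1) * (costF + 2) \<le> (m + 1) ^ 3 * D ^ m * (costF + 2)"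
    by (rule mult_le_mono1)
  then have "loopto 33 (Do dfs) t0 ((m + 1) ^ 3 * D ^ m * (costF + 2)) (sem dfs t')"
    by (intro loopto_mono[OF loopto_trans[OF t'(1) search_step(1)[OF t0 s']]]) (simp only: distrib_right mult_1)
  then have "runs (While 33 (Do dfs)) t0 leafT (sem dfs t')" unfolding leafT_def
    by (rule runs_of_loopto) (simp_all add: u)
  then show ?thesis using s' u by blast
qed

lemma power_L: "b ^ L = (b ^ (m + 1)) ^ (m + 1)"
  by (simp only: L_eq power_mult)

text \<open>The search adds a representative of -z^|I| once for every map, so no separate
  multiplication by the number of maps is performed.\<close>

lemma step_leaf:
  assumes o: "ok0 s0" "okpat s0" and R: "Rdown s0 stk I k U s" and I: "okI I U" "connected_list I" "I \<noteq> []"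
    and km: "k \<le> m" and le: "length I \<le> k" and no: "\<forall>u\<in>set I. set (nb u) \<inter> U = {}"
  shows "\<exists>s'. runs step_prog s (costA + leafT) s' \<and>
     Rup s0 stk (hw adj hadj hdeg X (set I) * (b ^ L - (b ^ (m + 1)) ^ length I)) U s'"
proof -
  let ?d = "length stk" and ?p = "b ^ L - (b ^ (m + 1)) ^ length I"
  have bs: "base s0 stk U s" using R by (simp add: Rdown_def)
  have pp: "params s" "ar s 3 4 = dg 1" using same_params o bs by (simp_all add: base_def)
  define s1 where "s1 = setv 36 0 (setv 34 (length I) (setv 35 k s))"
  note ds = down_scan[OF o(1) R I(1) km le, folded s1_def]
  have z: "vr (sem scan s1) 36 = 0"
  proof (rule ccontr)
    assume "vr (sem scan s1) 36 \<noteq> 0"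
    from ds(5)[OF this] show False using no by blast
  qed
  have lI: "length I \<le> m" "set I \<subseteq> {..<hn}" "distinct I" using le km I by (simp_all add: okI_def)
  have d: "?d \<le> hn" "?d < 2 ^ w" using bs sizes by (auto simp: base_def)
  let ?q0 = "sem scan s1"
  let ?q1 = "sem leaf_adj ?q0"
  let ?q2 = "sem leaf_deg ?q1"
  let ?q3 = "sem (neg_power (Num 3) (Var 34 \<otimes> Var 12)) ?q2"
  let ?q4 = "sem (bclear (Num 10)) ?q3"
  let ?t = "setv 31 0 (setv 33 1 (seta 8 0 0 0 (setv 50 0 ?q4)))"
  have down: "sem down s = ?t"
    unfolding down_def leaf_init_def sem.simps(3) ds(1) using le z by (simp add: s1_def[symmetric])
  have vq: "vr ?q0 x = vr s1 x" "vr ?q1 x = vr s1 x" "vr ?q2 x = vr s1 x" "vr ?q3 x = vr s1 x" "vr ?q4 x = vr s1 x"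
    if "x < 20 \<or> x \<in> {30, 31, 32, 33, 34}" for x
  proof -
    show 0: "vr ?q0 x = vr s1 x" using ds(3)[of x] that by auto
    have 1: "vr ?q1 x = vr ?q0 x" using that by (intro vr_frame) (auto simp: leaf_adj_def load_nbrs_def)
    have 2: "vr ?q2 x = vr ?q1 x" using that by (intro vr_frame) (auto simp: leaf_deg_def)
    have 3: "vr ?q3 x = vr ?q2 x" using that by (intro vr_frame) (auto simp: neg_power_def)
    have 4: "vr ?q4 x = vr ?q3 x" using that by (intro vr_bclear) auto
    show "vr ?q1 x = vr s1 x" "vr ?q2 x = vr s1 x" "vr ?q3 x = vr s1 x" "vr ?q4 x = vr s1 x" using 0 1 2 3 4 by simp_all
  qed
  have s1v: "params s1" "vr s1 30 = ?d" "vr s1 34 = length I"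
    using pp bs by (simp_all add: s1_def params_def base_def)
  have p0: "params ?q0" "vr ?q0 30 = ?d" "vr ?q0 34 = length I" "frow ?q0 ?d I"
    using s1v vq(1) R ds(2) by (simp_all add: params_def Rdown_def frow_def)
  have adj9: "(I ! j \<in> set (nb (I ! i))) = adj (I ! i) (I ! j)" if "i < length I" "j < length I" for i j
    using set_lt[OF lI(2)] that by (simp add: adj_def)
  have t9: "\<forall>i<m. \<forall>j<m. ar ?q1 9 i j = (if i < length I \<and> j < length I \<and> I ! j \<in> set (nb (I ! i)) then 1 else 0)"
    using leaf_adj_spec[OF p0(1,2) d(1) p0(3,4) lI(1,2)] .
  have v7: "vr ?q1 7 = m" "vr ?q2 7 = m" using vq(2,3)[of 7] s1v by (simp_all add: params_def)
  have t10: "\<forall>i<m. ar ?q2 10 0 i = (\<Sum>j<m. ar ?q1 9 i j)"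
    by (rule leaf_deg_spec[OF v7(1)]) (simp add: t9)
  have fr1: "ar ?q1 a = ar s a" if "a \<noteq> 9" for a
    using ar_frame[of a leaf_adj ?q0] that ds(2) by (simp add: leaf_adj_def load_nbrs_def)
  have fr2: "ar ?q2 a = ar ?q1 a" if "a \<noteq> 10" for a
    using ar_frame[of a leaf_deg ?q1] that by (simp add: leaf_deg_def)
  have cn: "canon s" using bs by (simp add: base_def)
  obtain x3 where x3: "ar s 3 3 = dg x3" using canonD[OF cn] by blast
  obtain x10 where x10: "ar s 3 10 = dg x10" using canonD[OF cn] by blast
  have len: "length I * (m + 1) \<le> L" unfolding L_eq using lI(1) by (intro mult_le_mono1) simp
  have q2v: "vr ?q2 8 = L" "vr ?q2 9 = b" "vr ?q2 34 = length I" "vr ?q2 12 = m + 1" using vq(3) s1v by (simp_all add: params_def)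
  have a3: "ar ?q3 = (ar ?q2)(3 := (ar ?q2 3)(3 := dg ?p))"
  proof -
    have "ev (setv 24 3 ?q2) (Var 34 \<otimes> Var 12) = length I * (m + 1)"
      using q2v len sizes(6) by simp
    then show ?thesis
      using neg_power_spec[of ?q2 "Num 3" 3 "Var 34 \<otimes> Var 12" "length I * (m + 1)" x3] q2v len fr1 fr2 x3 rows
      by (simp only: power_mult[symmetric] mult.commute[of "m + 1"]) simp
  qed
  have a4: "ar ?q4 = (ar ?q2)(3 := (ar s 3)(3 := dg ?p, 10 := dg 0))"
  proof -
    have "ar ?q4 = (ar ?q3)(3 := (ar ?q3 3)(10 := dg 0))"
      by (rule bclear_spec[where u = x10]) (use vq(4)[of 8] s1v a3 fr1 fr2 x10 rows in \<open>simp_all add: params_def\<close>)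
    then show ?thesis using a3 fr1 fr2 by (simp add: fun_eq_iff)
  qed
  define t0 where "t0 = setv 32 (if ?d = 0 then 0 else 1) ?t"
  have A: "sem stepA s = t0" unfolding t0_def
  proof (rule stepA_down[OF _ down])
    show "vr s 31 = 1" using R by (simp add: Rdown_def)
    show "vr ?t 30 = ?d" using vq(5)[of 30] s1v by simp
    show "vr ?t 31 = 0" by simp
  qed (use d in simp_all)
  have t0a: "ar t0 = (ar ?q2)(3 := (ar s 3)(3 := dg ?p, 10 := dg 0), 8 := (ar ?q2 8)(0 := (ar ?q2 8 0)(0 := 0)))"
    unfolding t0_def using a4 by simp
  have t0v: "vr t0 x = vr s1 x" if "x < 20 \<or> x \<in> {30, 34}" for x unfolding t0_def using vq(5)[of x] that by auto
  have same0: "same s0 t0"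
  proof -
    have "\<forall>r\<in>{4..9}. ar (sem stepA s) 3 r = ar s 3 r" unfolding A t0a by simp
    then show ?thesis using same_stepA[of s0 s] bs unfolding A base_def by blast
  qed
  have "okpat t0" using o(2) same0 by (simp add: okpat_def same_def)
  moreover have "params t0" "ar t0 3 4 = dg 1" using same_params[OF o(1) same0] by auto
  moreover have "ar t0 3 3 = dg ?p" unfolding t0a by simp
  moreover have "vr t0 34 = length I" using t0v s1v by simp
  moreover have "\<forall>i<m. \<forall>j<m. i < length I \<longrightarrow> j < length I \<longrightarrow> ar t0 9 i j = (if adj (I ! i) (I ! j) then 1 else 0)"
    unfolding t0a using t9 fr2[of 9] adj9 by simp
  moreover have "\<forall>i<length I. ar t0 10 0 i = ideg I i"
  proof (intro allI impI)
    fix i assume i: "i < length I"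
    then have "ar t0 10 0 i = (\<Sum>j<m. ar ?q1 9 i j)" unfolding t0a using t10 lI(1) by simp
    also have "\<dots> = (\<Sum>j<m. if i < length I \<and> j < length I \<and> I ! j \<in> set (nb (I ! i)) then 1 else 0)"
      using t9 i lI(1) by (intro sum.cong refl) simp
    finally show "ar t0 10 0 i = ideg I i" unfolding ideg_def sum_adj_card[OF lI(3,1,2) i] .
  qed
  ultimately have tab: "leaf_tables t0 I ?p" by (simp add: leaf_tables_def)
  have "ar t0 3 = (ar t0 3)(10 := dg (0 * ?p))" unfolding t0a by (simp add: fun_eq_iff)
  moreover have "ar t0 8 0 0 = 0" unfolding t0a by simp
  moreover have "vr t0 33 = 1" "vr t0 50 = 0" unfolding t0_def by simp_all
  ultimately have sr: "search t0 I ?p [] 0 0 t0" by (simp add: search_def)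
  obtain t' u where u: "runs (While 33 (Do dfs)) t0 leafT u" "search t0 I ?p [] m (next_count I (length I) []) t'"
     "vr u = (vr t')(51 := m, 33 := 0)" "ar u = ar t'"
    using dfs_run[OF tab lI(1) I(2) lI(2) I(3) sr] by blast
  let ?h = "hw adj hadj hdeg X (set I)"
  have h: "next_count I (length I) [] = ?h" using hw_next_count[OF lI(3,2)] by simp
  have run: "runs step_prog s (costA + leafT) u"
    unfolding step_prog_def by (rule runs_Then[OF runs_Do[OF okc_stepA cb_stepA[OF pp(1)]]]) (use u(1) A in auto)
  have uv: "vr u x = vr t0 x" if "x < 20 \<or> 60 \<le> x \<or> x \<in> {30, 31, 32}" for x
    using u(2,3) that by (auto simp: search_def)
  have ua: "ar u a = ar t0 a" if "a \<noteq> 3" "a \<noteq> 8" for a using u(2,4) that by (simp add: search_def)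
  have u3: "ar u 3 = (ar s 3)(3 := dg ?p, 10 := dg (?h * ?p))"
    using u(2,4) h t0a by (simp add: search_def fun_eq_iff)
  have as: "ar u a = ar s a" if "a \<notin> {3, 8, 9, 10}" for a using ua[of a] that fr1[of a] fr2[of a] t0a by simp
  have "same s0 u"
    unfolding same_def
  proof (intro conjI ballI allI impI)
    fix x :: nat assume "x < 20 \<or> 60 \<le> x"
    then show "vr u x = vr s0 x" using uv same0 by (auto simp: same_def)
  next
    fix a :: nat assume "a \<notin> {2, 3, 4, 8, 9, 10}"
    then show "ar u a = ar s0 a" using as bs by (simp add: base_def same_def)
  next
    fix r :: nat assume r: "r \<in> {4..9}"
    then have "r \<noteq> 3" "r \<noteq> 10" by auto
    then show "ar u 3 r = ar s0 3 r" using u3 bs r by (simp add: base_def same_def)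
  qed
  moreover have "canon u" using cn u3 by (auto simp: canon_def)
  moreover have "frame_ok u i (stk ! i)" if "i < ?d" for i
  proof (rule frame_ok_cong[of s])
    show "frame_ok s i (stk ! i)" using bs that by (simp add: base_def)
    show "ar u 2 i = ar s 2 i" using as[of 2] by simp
    show "ar u 3 (16 + i) = ar s 3 (16 + i)" using u3 by simp
  qed
  moreover have "marked u U" using bs as[of 4] by (simp add: base_def marked_def)
  moreover have "vr u 30 = ?d" using uv[of 30] t0v[of 30] s1v by simp
  moreover have "vr u 33 = 0" using u(3) by simp
  ultimately have "base s0 stk U u" using bs by (simp add: base_def)
  moreover have "vr u 31 = 0" "vr u 32 = (if stk = [] then 0 else 1)" using uv by (simp_all add: t0_def)
  ultimately have "Rup s0 stk (?h * ?p) U u" using u3 by (simp add: Rup_def)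
  then show ?thesis using run by blast
qed

end


section \<open>The branching recurrence\<close>

lemma one_plus_inverse_power_le: assumes "1 \<le> d" shows "(1 + 1 / real d) ^ (d - 1) \<le> 3"
proof -
  have "(1 + 1 / real d) ^ (d - 1) \<le> (1 + 1 / real d) ^ d" using assms by (intro power_increasing) auto
  also have "\<dots> \<le> exp (1 / real d) ^ d" by (intro power_mono exp_ge_add_one_self) simp
  also have "\<dots> = exp 1" using assms by (simp add: exp_of_nat_mult[symmetric])
  also have "\<dots> \<le> 3" by (rule exp_le)
  finally show ?thesis .
qed

text \<open>The potential is y^f x^B for frontier size f and budget B. Extending I by x may add d -
  1 frontier vertices but uses up budget; deleting x shrinks the frontier; restarting at x has a
  frontier of at most d - 1 and less budget. With q = y^(d-1) \<le> 3 the sum is at most y^(f-1) (x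
  + 2 q) x^B, and x = 6 d is chosen so that x + 6 = y x.\<close>

lemma branching_bound:
  fixes y x :: real
  assumes d: "1 \<le> d" and y: "y = 1 + 1 / real d" and x: "x = 6 * real d"
    and f: "1 \<le> f" "f1 \<le> f - 1 + (d - 1)" "f3 \<le> d - 1"
  shows "y ^ f1 * x ^ B + y ^ (f - 1) * x ^ Suc B + y ^ f3 * x ^ B \<le> y ^ f * x ^ Suc B"
proof -
  have y1: "1 \<le> y" and x0: "0 \<le> x" using y x by auto
  let ?q = "y ^ (d - 1)" and ?g = "y ^ (f - 1)"
  have q: "?q \<le> 3" using one_plus_inverse_power_le[OF d] y by simp
  have g: "1 \<le> ?g" using y1 by simp
  have gq: "1 * ?q \<le> ?g * ?q" by (rule mult_right_mono[OF g]) (use y1 in simp)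
  have "y ^ f1 \<le> ?g * ?q" using power_increasing[OF f(2) y1] by (simp add: power_add)
  moreover have "y ^ f3 \<le> ?g * ?q"
    using power_increasing[OF f(3) y1] gq by linarith
  ultimately have "y ^ f1 + ?g * x + y ^ f3 \<le> ?g * (?q + x + ?q)" by (simp add: algebra_simps)
  also have "\<dots> \<le> ?g * (x + 6)" using q g by (intro mult_left_mono) auto
  also have "x + 6 = y * x" using d by (simp add: x y field_simps)
  also have "?g * (y * x) = y ^ f * x" using f(1) by (metis Suc_diff_1 less_eq_Suc_le One_nat_def mult.assoc power_Suc2)
  finally have "(y ^ f1 + ?g * x + y ^ f3) * x ^ B \<le> y ^ f * x * x ^ B" using x0 by (intro mult_right_mono) auto
  then show ?thesis by (simp add: algebra_simps)
qed

section \<open>Truncated ratios of generating functions\<close>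

context pattern
begin

text \<open>Since counts are at most (max n m)^m and both graphs have fewer than b vertices, b^(m+1)
  exceeds every coefficient that is read off; also b^L = zz^(m+1), so dropping digits truncates the
  series.\<close>

definition zz :: int where "zz = int (b ^ (m + 1))"

sublocale W: weights adj "\<lambda>T. int (hw adj hadj hdeg X T)" zz
proof
  show "adj v u" if "adj u v" for u v using adj_symm[OF that] .
  show "int (hw adj hadj hdeg X (T1 \<union> T2)) = int (hw adj hadj hdeg X T1) * int (hw adj hadj hdeg X T2)"
    if "T1 \<inter> T2 = {}" "\<And>u v. u \<in> T1 \<Longrightarrow> v \<in> T2 \<Longrightarrow> \<not> adj u v" for T1 T2
    using hw_union[of T1 T2 adj hadj hdeg X] that adj_symm by simp
qed simp

text \<open>Division-free form of r = - \<open>gsum (set I) U\<close> / \<open>gsum {} U\<close>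
  modulo zz^(k+1). The sign turns the denominator of the recursion into 1 - c. The divisibility of r
  itself is recorded because it lets a less precise c suffice.\<close>

definition spec :: "nat list \<Rightarrow> nat set \<Rightarrow> nat \<Rightarrow> nat \<Rightarrow> bool" where
  "spec I U k r \<longleftrightarrow> zz ^ length I dvd int r \<and> zz ^ (k + 1) dvd int r * W.gsum {} U + W.gsum (set I) U"

lemma spec_prune: "okI I U \<Longrightarrow> finite U \<Longrightarrow> k < length I \<Longrightarrow> spec I U k 0"
  using W.gsum_dvd[of "set I" U] distinct_card[of I] power_le_dvd[of zz "length I" "W.gsum (set I) U" "k + 1"]
  by (simp add: spec_def okI_def)

text \<open>The exact ratio is -hw z^|I|. Adding a multiple of b^L = z^(m+1) makes it a natural
  number without changing it at any precision k \<le> m.\<close>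

lemma spec_leaf:
  assumes I: "okI I U" "finite U" "length I \<le> k" "k \<le> m" and no: "\<forall>u\<in>set I. set (nb u) \<inter> U = {}"
  shows "spec I U k (hw adj hadj hdeg X (set I) * (b ^ L - (b ^ (m + 1)) ^ length I))"
proof -
  let ?h = "hw adj hadj hdeg X (set I)" and ?s = "length I"
  have "(b ^ (m + 1)) ^ ?s \<le> b ^ L" unfolding power_L using I(3,4) b_pos by (intro power_increasing) auto
  then have r: "int (?h * (b ^ L - (b ^ (m + 1)) ^ ?s)) = int ?h * (zz ^ (m + 1) - zz ^ ?s)"
    by (simp add: of_nat_diff power_L zz_def)
  have "zz ^ ?s dvd zz ^ (m + 1) - zz ^ ?s" using I(3,4) by (intro dvd_diff le_imp_power_dvd) auto
  moreover have "W.gsum (set I) U = int ?h * zz ^ ?s * W.gsum {} U"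
  proof -
    have "card (set I) = ?s" using I(1) distinct_card by (auto simp: okI_def)
    moreover have "\<not> adj u v" if "u \<in> set I" "v \<in> U" for u v using no that by (auto simp: adj_def)
    ultimately show ?thesis using W.gsum_leaf[of "set I" U] I(1,2) by (simp add: okI_def)
  qed
  then have "int ?h * (zz ^ (m + 1) - zz ^ ?s) * W.gsum {} U + W.gsum (set I) U = zz ^ (m + 1) * (int ?h * W.gsum {} U)"
    by (simp add: algebra_simps)
  moreover have "zz ^ (k + 1) dvd zz ^ (m + 1)" using I(4) by (intro le_imp_power_dvd) simp
  ultimately show ?thesis unfolding spec_def r by (simp only: dvd_mult dvd_mult2 simp_thms)
qed

text \<open>Splitting numerator and denominator at x gives the ratio (r1 + r2) / (1 - c). As z
  divides c, the series may stop after c^m. As z^|I| divides r1 + r2, an error of order z^(k-|I|+1)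
  in c is harmless, which is why the third call has budget k - |I|.\<close>

lemma spec_branch:
  assumes fin: "finite U" "x \<in> U" "k \<le> m" "length I \<le> k"
    and s1: "spec (I @ [x]) (U - {x}) k r1" and s2: "spec I (U - {x}) k r2" and s3: "spec [x] (U - {x}) (k - length I) c"
  shows "spec I U k (\<Sum>i<m+1. c ^ i * (r1 + r2))"
proof -
  let ?r = "\<Sum>i<m+1. c ^ i * (r1 + r2)" and ?E' = "W.gsum {} (U - {x})" and ?s = "length I" and ?c = "int c"
  define q where "q = int (r1 + r2)"
  have "zz ^ ?s dvd int r1" using s1 by (auto simp: spec_def intro: power_le_dvd)
  then have a: "zz ^ ?s dvd q" using s2 by (simp add: spec_def q_def)
  define R where "R = int ?r"
  have Rsum: "R = (\<Sum>i<m+1. ?c ^ i) * q" unfolding R_def q_def by (simp only: of_nat_sum of_nat_mult of_nat_power sum_distrib_right)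
  then have r: "zz ^ ?s dvd R" using a by (simp only: dvd_mult)
  have "R * (1 - ?c) = q * (1 - ?c ^ (m + 1))"
  proof -
    have "(\<Sum>i<m+1. ?c ^ i) * (1 - ?c) = 1 - ?c ^ (m + 1)"
      using one_diff_power_eq[of ?c "m + 1"] by (simp only: mult.commute)
    then show ?thesis using Rsum by (metis mult.assoc mult.commute)
  qed
  then have rc: "R = q - q * ?c ^ (m + 1) + R * ?c" unfolding right_diff_distrib by (simp only: mult_1_right diff_eq_eq)
  have E: "W.gsum {} U = W.gsum {x} (U - {x}) + ?E'" using W.gsum_branch[OF fin(1,2), of "{}"] by simp
  have Q: "W.gsum (set I) U = W.gsum (set (I @ [x])) (U - {x}) + W.gsum (set I) (U - {x})"
    using W.gsum_branch[OF fin(1,2), of "set I"] by simp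
  have c1: "zz ^ (m + 1) dvd ?c ^ (m + 1)" using s3 by (intro dvd_power_same) (simp add: spec_def)
  have "R * W.gsum {} U = R * (?c * ?E' + W.gsum {x} (U - {x})) + (R - R * ?c) * ?E'"
    unfolding E by (simp add: algebra_simps)
  also have "R - R * ?c = q - q * ?c ^ (m + 1)" using rc by linarith
  finally have "R * W.gsum {} U + W.gsum (set I) U =
      R * (?c * ?E' + W.gsum {x} (U - {x})) - ?c ^ (m + 1) * (q * ?E') +
      ((int r1 * ?E' + W.gsum (set (I @ [x])) (U - {x})) + (int r2 * ?E' + W.gsum (set I) (U - {x})))"
    unfolding Q q_def by (simp add: algebra_simps)
  moreover have "zz ^ (k + 1) dvd R * (?c * ?E' + W.gsum {x} (U - {x}))"
  proof -
    have "zz ^ ?s * zz ^ (k - ?s + 1) dvd R * (?c * ?E' + W.gsum {x} (U - {x}))"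
      using r s3 by (intro mult_dvd_mono) (simp_all add: spec_def)
    moreover have "zz ^ (k + 1) = zz ^ ?s * zz ^ (k - ?s + 1)" using fin(4) by (subst power_add[symmetric]) simp
    ultimately show ?thesis by metis
  qed
  moreover have "zz ^ (k + 1) dvd ?c ^ (m + 1) * (q * ?E')"
    using c1 fin(3) by (intro dvd_mult2) (metis add_le_mono1 le_imp_power_dvd dvd_trans)
  ultimately show ?thesis unfolding spec_def R_def[symmetric] using r s1 s2 by (simp only: spec_def dvd_add dvd_diff simp_thms)
qed

text \<open>The frontier: the vertices on which a call with these arguments may branch.\<close>

definition front :: "nat list \<Rightarrow> nat set \<Rightarrow> nat" where
  "front I U = card {v \<in> U. \<exists>u\<in>set I. v \<in> set (nb u)}"

definition costS :: nat where "costS = costA + leafT + 2"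

definition yy :: real where "yy = 1 + 1 / real D"
definition xx :: real where "xx = 6 * real D"

lemma step_loop: "vr s 32 = 1 \<Longrightarrow> runs step_prog s t s' \<Longrightarrow> t \<le> costA + leafT \<Longrightarrow> loopto 32 step_prog s costS s'"
  by (rule loopto_mono[OF loopto_step]) (auto simp: costS_def)

text \<open>The vertex x was reached from u, and u has left the vertex set: one of the at most D
  neighbours of x is used up.\<close>

lemma single_degree: assumes "x < hn" "u < hn" "x \<in> set (nb u)" "u \<notin> V" shows "card {v \<in> V. v \<in> set (nb x)} \<le> D - 1"
proof -
  have "u \<in> set (nb x)" using nb_sym assms by blast
  then have "{v \<in> V. v \<in> set (nb x)} \<subseteq> set (nb x) - {u}" using assms by auto
  then have "card {v \<in> V. v \<in> set (nb x)} \<le> card (set (nb x) - {u})" by (intro card_mono) auto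
  also have "\<dots> = card (set (nb x)) - 1" using \<open>u \<in> set (nb x)\<close> by simp
  also have "\<dots> \<le> D - 1" using card_length[of "nb x"] nb_len[OF assms(1)] by linarith
  finally show ?thesis .
qed

lemma yx_ge1: "1 \<le> yy" "1 \<le> xx" using D1 by (auto simp: yy_def xx_def)

text \<open>All three subcalls work on U - {x}, so the induction is on \<open>card U\<close>. The
  added 2 absorbs the four steps of the call itself: 4 + t1 + t2 + t3 + 2 is the sum of the three ti
  + 2. The factor 3 is then what a call of a single step needs.\<close>

theorem rec_run:
  assumes o: "ok0 s0" "okpat s0"
  shows "Rdown s0 stk I k U s \<Longrightarrow> okI I U \<Longrightarrow> connected_list I \<Longrightarrow> I \<noteq> [] \<Longrightarrow> k \<le> m \<Longrightarrow>
    \<exists>s' r t. loopto 32 step_prog s (t * costS) s' \<and> Rup s0 stk r U s' \<and> spec I U k r \<and>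
      real t + 2 \<le> 3 * yy ^ front I U * xx ^ (k + 1 - length I)"
proof (induction "card U" arbitrary: stk I k U s rule: less_induct)
  case (less U stk I k s)
  have small: "real 1 + 2 \<le> 3 * yy ^ f * xx ^ e" for f e
    using mult_mono[of 1 "yy ^ f" 1 "xx ^ e"] yx_ge1 by simp
  note R = less.prems(1) and I = less.prems(2) and cn = less.prems(3) and ne = less.prems(4) and km = less.prems(5)
  have bs: "base s0 stk U s" and r32: "vr s 32 = 1" using R by (simp_all add: Rdown_def)
  have U: "U \<subseteq> {..<hn}" "finite U" using bs finite_subset by (auto simp: base_def)
  have leafT: "1 \<le> leafT" by (simp add: leafT_def)
  show ?case
  proof (cases "k < length I")
    case True
    obtain s' where s': "runs step_prog s (costA + 1) s'" "Rup s0 stk 0 U s'" using step_prune[OF o(1) R I km True] by blast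
    have "loopto 32 step_prog s (1 * costS) s'" using step_loop[OF r32 s'(1)] leafT by simp
    then show ?thesis using s'(2) spec_prune[OF I U(2) True] small by blast
  next
    case False
    then have le: "length I \<le> k" by simp
    show ?thesis
    proof (cases "\<exists>u\<in>set I. set (nb u) \<inter> U \<noteq> {}")
      case False
      then have no: "\<forall>u\<in>set I. set (nb u) \<inter> U = {}" by blast
      obtain s' where s': "runs step_prog s (costA + leafT) s'"
        "Rup s0 stk (hw adj hadj hdeg X (set I) * (b ^ L - (b ^ (m + 1)) ^ length I)) U s'"
        using step_leaf[OF o R I cn ne km le no] by blast
      have "loopto 32 step_prog s (1 * costS) s'" using step_loop[OF r32 s'(1)] by simp
      then show ?thesis using s'(2) spec_leaf[OF I U(2) le km no] small by blast
    next
      case True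
      let ?V = "\<lambda>x. U - {x}"
      obtain s1 x u where s1: "runs step_prog s (costA + 1) s1" "x \<in> U" "u \<in> set I" "x \<in> set (nb u)"
        "Rdown s0 (stk @ [(I, k, x, 0, 0)]) (I @ [x]) k (?V x) s1"
        using step_expand[OF o(1) R I km le True] by blast
      have xu: "x < hn" "u < hn" "u \<notin> U" "x \<notin> set I" "adj u x" using s1 U I by (auto simp: okI_def adj_def)
      have cV: "card (?V x) < card U" using U(2) s1(2) by (rule card_Diff1_less)
      have I1: "okI (I @ [x]) (?V x)" using I xu le km by (auto simp: okI_def)
      have c1: "connected_list (I @ [x])"
        unfolding connected_list_def
      proof (intro allI impI)
        fix j assume j: "j < length (I @ [x])" "0 < j"
        show "\<exists>i<j. adj ((I @ [x]) ! i) ((I @ [x]) ! j)"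
        proof (cases "j < length I")
          case True
          then obtain i where "i < j" "adj (I ! i) (I ! j)" using cn j by (auto simp: connected_list_def)
          then show ?thesis using True by (intro exI[of _ i]) (simp add: nth_append)
        next
          case False
          then have "j = length I" using j by simp
          moreover obtain i where "i < length I" "u = I ! i" using s1(3) by (auto simp: in_set_conv_nth)
          ultimately show ?thesis using xu(5) by (intro exI[of _ i]) (simp add: nth_append)
        qed
      qed
      have I2: "okI I (?V x)" using I by (auto simp: okI_def)
      have I3: "okI [x] (?V x)" using xu km by (auto simp: okI_def)
      have c3: "connected_list [x]" by (simp add: connected_list_def)
      have L1: "loopto 32 step_prog s costS s1" using step_loop[OF r32 s1(1)] leafT by simp
      obtain s2 r1 t1 where s2: "loopto 32 step_prog s1 (t1 * costS) s2" "Rup s0 (stk @ [(I, k, x, 0, 0)]) r1 (?V x) s2"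
        "spec (I @ [x]) (?V x) k r1" "real t1 + 2 \<le> 3 * yy ^ front (I @ [x]) (?V x) * xx ^ (k + 1 - length (I @ [x]))"
        using less.hyps[OF cV s1(5) I1 c1 _ km] by blast
      obtain s3 where s3: "runs step_prog s2 (costA + 1) s3" "Rdown s0 (stk @ [(I, k, x, 1, r1)]) I k (?V x) s3"
        using step_up0[OF o(1) s2(2) le km] by blast
      have L3: "loopto 32 step_prog s2 costS s3" using step_loop[OF _ s3(1)] leafT s2(2) by (simp add: Rup_def)
      obtain s4 r2 t2 where s4: "loopto 32 step_prog s3 (t2 * costS) s4" "Rup s0 (stk @ [(I, k, x, 1, r1)]) r2 (?V x) s4"
        "spec I (?V x) k r2" "real t2 + 2 \<le> 3 * yy ^ front I (?V x) * xx ^ (k + 1 - length I)"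
        using less.hyps[OF cV s3(2) I2 cn ne km] by blast
      obtain s5 where s5: "runs step_prog s4 (costA + 1) s5" "Rdown s0 (stk @ [(I, k, x, 2, r1 + r2)]) [x] (k - length I) (?V x) s5"
        using step_up1[OF o(1) s4(2) le km] by blast
      have L5: "loopto 32 step_prog s4 costS s5" using step_loop[OF _ s5(1)] leafT s4(2) by (simp add: Rup_def)
      have k3: "k - length I \<le> m" using km by simp
      obtain s6 r3 t3 where s6: "loopto 32 step_prog s5 (t3 * costS) s6" "Rup s0 (stk @ [(I, k, x, 2, r1 + r2)]) r3 (?V x) s6"
        "spec [x] (?V x) (k - length I) r3" "real t3 + 2 \<le> 3 * yy ^ front [x] (?V x) * xx ^ (k - length I + 1 - length [x])"
        using less.hyps[OF cV s5(2) I3 c3 _ k3] by blast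
      have xV: "x \<notin> ?V x" "insert x (?V x) = U" using s1(2) by auto
      let ?r = "\<Sum>i<m+1. r3 ^ i * (r1 + r2)"
      obtain s7 where s7: "runs step_prog s6 (costA + 1) s7" "Rup s0 stk ?r U s7"
        using step_up2[OF o(1) s6(2) xu(1) xV(1)] xV(2) by metis
      have L7: "loopto 32 step_prog s6 costS s7" using step_loop[OF _ s7(1)] leafT s6(2) by (simp add: Rup_def)
      let ?t = "4 + t1 + t2 + t3"
      have "loopto 32 step_prog s (?t * costS) s7"
        by (rule loopto_mono[OF loopto_trans[OF L1 loopto_trans[OF s2(1) loopto_trans[OF L3 loopto_trans[OF s4(1)
            loopto_trans[OF L5 loopto_trans[OF s6(1) L7]]]]]]]) (simp add: algebra_simps)
      moreover have "spec I U k ?r" by (rule spec_branch[OF U(2) s1(2) km le s2(3) s4(3) s6(3)])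
      moreover have "real ?t + 2 \<le> 3 * yy ^ front I U * xx ^ (k + 1 - length I)"
      proof -
        \<comment> \<open>The extension and the restart both have one unit of budget less than the
          call, whatever the length of I.\<close>
        obtain B where B: "k + 1 - length I = Suc B" "k + 1 - length (I @ [x]) = B" "k - length I + 1 - length [x] = B"
          using le by (cases "k + 1 - length I") auto
        let ?N = "{v \<in> U. \<exists>u\<in>set I. v \<in> set (nb u)}"
        have N: "finite ?N" "x \<in> ?N" using U(2) s1 by auto
        have N2: "{v \<in> ?V x. \<exists>u\<in>set I. v \<in> set (nb u)} = ?N - {x}" by auto
        have f: "1 \<le> front I U" 
        proof -
          have "0 < card ?N" using N card_gt_0_iff by blast
          then show ?thesis by (simp add: front_def)
        qed
        have f2: "front I (?V x) = front I U - 1" unfolding front_def N2 using N by simp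
        have f3: "front [x] (?V x) \<le> D - 1" unfolding front_def using single_degree[OF xu(1,2) s1(4), of "?V x"] xu(3) by simp
        have f1: "front (I @ [x]) (?V x) \<le> front I U - 1 + (D - 1)"
        proof -
          have "{v \<in> ?V x. \<exists>u\<in>set (I @ [x]). v \<in> set (nb u)} =
            {v \<in> ?V x. \<exists>u\<in>set I. v \<in> set (nb u)} \<union> {v \<in> ?V x. \<exists>u\<in>set [x]. v \<in> set (nb u)}" by auto
          then have "front (I @ [x]) (?V x) = card ({v \<in> ?V x. \<exists>u\<in>set I. v \<in> set (nb u)} \<union> {v \<in> ?V x. \<exists>u\<in>set [x]. v \<in> set (nb u)})"
            unfolding front_def by (rule arg_cong)
          also have "\<dots> \<le> front I (?V x) + front [x] (?V x)" unfolding front_def by (rule card_Un_le)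
          finally have "front (I @ [x]) (?V x) \<le> front I (?V x) + front [x] (?V x)" .
          then show ?thesis using f2 f3 by linarith
        qed
        have "real ?t + 2 = (real t1 + 2) + (real t2 + 2) + (real t3 + 2)" by simp
        also have "\<dots> \<le> 3 * (yy ^ front (I @ [x]) (?V x) * xx ^ B + yy ^ (front I U - 1) * xx ^ Suc B + yy ^ front [x] (?V x) * xx ^ B)"
          using s2(4) s4(4) s6(4) unfolding B f2 by simp
        also have "\<dots> \<le> 3 * (yy ^ front I U * xx ^ Suc B)"
          using branching_bound[OF D1 yy_def xx_def f f1 f3, of B] by simp
        finally show ?thesis unfolding B by simp
      qed
      ultimately show ?thesis using s7(2) by blast
    qed
  qed
qed

end


section \<open>The product over start vertices and the loop over X\<close>

definition x_begin :: com where
  "x_begin = bclear (Num 6) ;; bmac (Num 6) (Num 4) (Num 4) ;; Asg 60 (Num 0) ;;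
     Cond (Num 0) (Var 5) (Asg 61 (Num 1)) (Asg 61 (Num 0))"

text \<open>Marks of earlier start vertices are never taken back within the product, so that U
  consists of the vertices after vertex 60.\<close>

definition v_begin :: com where
  "v_begin = Put 4 (Num 0) (Var 60) (Num 1) ;; Put 2 (Num 0) (Num 2) (Var 7) ;; Put 2 (Num 0) (Num 3) (Num 1) ;;
     Put 2 (Num 0) (Num 4) (Var 60) ;; Asg 30 (Num 0) ;; Asg 31 (Num 1) ;; Asg 32 (Num 1) ;; Asg 33 (Num 0)"

text \<open>Multiplies row 6 by 1 - r: row 5 holds b^L - 1, which stands for -1.\<close>

definition v_end :: com where
  "v_end = bclear (Num 11) ;; bmac (Num 11) (Num 10) (Num 6) ;; bmac (Num 6) (Num 11) (Num 5) ;;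
     Asg 60 (Var 60 \<oplus> Num 1) ;; Cond (Var 60) (Var 5) (Asg 61 (Num 1)) (Asg 61 (Num 0))"

text \<open>The sign of inclusion-exclusion is the parity of the number of elements missing from X,
  counted in 64.\<close>

definition x_sign :: com where
  "x_sign = Asg 64 (Num 0) ;; For 66 7 (Cond (Num 0) (Arr 7 (Num 0) (Var 66)) skip (Asg 64 (Var 64 \<oplus> Num 1))) ;;
     Cond (Num 0) (Bin Mod (Var 64) (Num 2)) (bmac (Num 7) (Num 6) (Num 5)) (bmac (Num 7) (Num 6) (Num 4))"

definition x_unmark :: com where "x_unmark = For 67 5 (Put 4 (Num 0) (Var 67) (Num 0))"

text \<open>Binary increment with carry 63. A carry out of the last bit ends the loop and leaves the
  counter at zero, ready for another run.\<close>

definition x_next :: com where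
  "x_next = Asg 63 (Num 1) ;; For 66 7 (Cond (Num 0) (Var 63)
       (Cond (Num 0) (Arr 7 (Num 0) (Var 66)) (Put 7 (Num 0) (Var 66) (Num 0))
          (Put 7 (Num 0) (Var 66) (Num 1) ;; Asg 63 (Num 0))) skip) ;;
     Cond (Num 0) (Var 63) (Asg 62 (Num 0)) (Asg 62 (Num 1))"

definition x_end :: com where "x_end = x_sign ;; x_unmark ;; x_next"

definition v_prog :: prog where "v_prog = While 61 (Do v_begin \<then> rec_prog \<then> Do v_end)"

definition main_prog :: prog where "main_prog = While 62 (Do x_begin \<then> v_prog \<then> Do x_end)"

lemmas outer_defs = x_begin_def v_begin_def v_end_def x_sign_def x_unmark_def x_next_def x_end_def

lemma okc_outer: "okc x_begin" "okc v_begin" "okc v_end" "okc x_end"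
  unfolding okc_def outer_defs block_defs by simp_all

lemma nest_outer: "nest (\<lambda>p. p = 5) x_begin = 0" "nest (\<lambda>p. p = 5) v_begin = 0" "nest (\<lambda>p. p = 5) v_end = 0"
    "nest (\<lambda>p. p = 5) x_end = 1"
  unfolding outer_defs block_defs by simp_all

lemma lvars_outer: "set (lvars x_begin) \<subseteq> {5, 7, 8}" "set (lvars v_begin) \<subseteq> {5, 7, 8}" "set (lvars v_end) \<subseteq> {5, 7, 8}"
    "set (lvars x_end) \<subseteq> {5, 7, 8}"
  unfolding outer_defs block_defs by simp_all

context host
begin

definition costO :: "com \<Rightarrow> nat" where
  "costO c = csize c * L ^ nest (\<lambda>p. \<not> p = 5) c * max 1 hn ^ nest (\<lambda>p. p = 5) c"

lemma cb_outer: "params s \<Longrightarrow> set (lvars c) \<subseteq> {5, 7, 8} \<Longrightarrow> cb (vr s) c \<le> costO c"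
  unfolding costO_def by (rule cb_bound[where R = "\<lambda>p. p = 5"]) (use L1 m_le_L in \<open>auto simp: params_def\<close>)

definition okn :: "st \<Rightarrow> bool" where
  "okn s \<longleftrightarrow> params s \<and> canon s \<and> ar s 3 4 = dg 1 \<and> ar s 3 5 = dg (b ^ L - 1)"

end

context pattern
begin

text \<open>The 9 is the factor 3 of \<open>rec_run\<close> times the 3 by which
  \<open>yx_bound\<close> estimates the frontier of the start vertex.\<close>

definition vT :: nat where
  "vT = costO v_begin + (9 * (6 * D) ^ m * costS + 1) + costO v_end"

definition xT0 :: nat where "xT0 = costO x_begin + (hn * (vT + 2) + 1)"

definition keeps :: "st \<Rightarrow> st \<Rightarrow> bool" where
  "keeps s0 s \<longleftrightarrow> (\<forall>x. x < 20 \<or> 62 \<le> x \<longrightarrow> vr s x = vr s0 x) \<and>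
     (\<forall>a. a \<notin> {2, 3, 4, 8, 9, 10} \<longrightarrow> ar s a = ar s0 a) \<and> (\<forall>r\<in>{4, 5, 7, 8, 9}. ar s 3 r = ar s0 3 r)"

definition Vst :: "st \<Rightarrow> nat \<Rightarrow> nat \<Rightarrow> st \<Rightarrow> bool" where
  "Vst s0 i e s \<longleftrightarrow> keeps s0 s \<and> canon s \<and> vr s 60 = i \<and> vr s 61 = (if i < hn then 1 else 0) \<and>
     ar s 3 6 = dg e \<and> marked s {i..<hn}"

lemma yx_bound: "yy ^ f * xx ^ m \<le> 3 * real ((6 * D) ^ m)" if "f \<le> D"
proof -
  have "yy ^ f \<le> yy ^ D" using that yx_ge1 by (intro power_increasing) auto
  also have "\<dots> \<le> exp (1 / real D) ^ D" unfolding yy_def by (intro power_mono exp_ge_add_one_self) simp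
  also have "\<dots> = exp 1" using D1 by (simp add: exp_of_nat_mult[symmetric])
  also have "\<dots> \<le> 3" by (rule exp_le)
  finally show ?thesis using yx_ge1 by (simp add: xx_def mult_right_mono)
qed

text \<open>Splitting at vertex i gives \<open>gsum {} {i..<hn}\<close> = (1 - r)
  \<open>gsum {} {Suc i..<hn}\<close> up to precision m. The products therefore telescope, and e is
  the part already split off.\<close>

lemma x_loop_step:
  assumes o: "okn s0" "okpat s0" and V: "Vst s0 i e s" and i: "i < hn"
    and e: "zz ^ (m + 1) dvd int e * W.gsum {} {i..<hn} - W.gsum {} {..<hn}"
  shows "\<exists>s' e'. runs (Do v_begin \<then> rec_prog \<then> Do v_end) s vT s' \<and> Vst s0 (Suc i) e' s' \<and>
     zz ^ (m + 1) dvd int e' * W.gsum {} {Suc i..<hn} - W.gsum {} {..<hn}"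
proof -
  have p: "params s" "ar s 3 4 = dg 1" "ar s 3 5 = dg (b ^ L - 1)" "okpat s" "canon s"
    using o V by (simp_all add: okn_def Vst_def keeps_def params_def okpat_def)
  have iS: "i < S" "i < 2 ^ w" "Suc i < 2 ^ w" using i rows sizes by linarith+
  let ?s1 = "setv 33 0 (setv 32 1 (setv 31 1 (setv 30 0 (seta 2 0 4 i (seta 2 0 3 1 (seta 2 0 2 m (seta 4 0 i 1 s)))))))"
  have s1: "sem v_begin s = ?s1" using V p iS by (simp add: v_begin_def Vst_def params_def)
  have R: "Rdown ?s1 [] [i] m {Suc i..<hn} ?s1"
    using V p i by (auto simp: Rdown_def base_def same_def canon_def marked_def frow_def Vst_def)
  have okI: "okI [i] {Suc i..<hn}" using i by (auto simp: okI_def)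
  have o1: "ok0 ?s1" "okpat ?s1" using p by (simp_all add: ok0_def params_def okpat_def)
  obtain s2 r t where s2: "loopto 32 step_prog ?s1 (t * costS) s2" "Rup ?s1 [] r {Suc i..<hn} s2"
    "spec [i] {Suc i..<hn} m r" "real t + 2 \<le> 3 * yy ^ front [i] {Suc i..<hn} * xx ^ (m + 1 - length [i])"
    using rec_run[OF o1 R okI _ _ order_refl] by (auto simp: connected_list_def)
  have "front [i] {Suc i..<hn} \<le> card (set (nb i))" unfolding front_def by (intro card_mono) auto
  then have "front [i] {Suc i..<hn} \<le> D" using card_length[of "nb i"] nb_len[OF i] by linarith
  from yx_bound[OF this] s2(4) have "real t \<le> real (9 * (6 * D) ^ m)" by simp
  then have tt: "t \<le> 9 * (6 * D) ^ m" by (simp only: of_nat_le_iff)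
  have "runs rec_prog ?s1 (t * costS + 1) s2" unfolding rec_prog_def
    by (rule runs_of_loopto[OF s2(1)]) (use s2(2) in \<open>simp_all add: Rup_def\<close>)
  then have run2: "runs rec_prog ?s1 (9 * (6 * D) ^ m * costS + 1) s2"
    by (rule runs_mono) (use tt in simp)
  have b2: "base ?s1 [] {Suc i..<hn} s2" "ar s2 3 10 = dg r" using s2(2) by (simp_all add: Rup_def)
  then have sm: "same ?s1 s2" "canon s2" "marked s2 {Suc i..<hn}" by (simp_all add: base_def)
  have s2v: "vr s2 8 = L" "vr s2 9 = b" "vr s2 5 = hn" "vr s2 60 = i" "params s2"
    using sm(1) p V by (simp_all add: same_def params_def Vst_def)
  have s2a: "ar s2 3 4 = dg 1" "ar s2 3 5 = dg (b ^ L - 1)" "ar s2 3 6 = dg e"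
    using sm(1) p V by (simp_all add: same_def Vst_def)
  obtain x where x: "ar s2 3 11 = dg x" using canonD[OF sm(2)] by blast
  let ?q1 = "sem (bclear (Num 11)) s2"
  let ?q2 = "sem (bmac (Num 11) (Num 10) (Num 6)) ?q1"
  let ?q3 = "sem (bmac (Num 6) (Num 11) (Num 5)) ?q2"
  let ?e = "e + (r * e) * (b ^ L - 1)"
  have a1: "ar ?q1 = (ar s2)(3 := (ar s2 3)(11 := dg 0))" using s2v x rows by (intro bclear_spec) auto
  have a2: "ar ?q2 = (ar s2)(3 := (ar s2 3)(11 := dg (r * e)))"
    using bmac_spec[of ?q1 "Num 11" 11 "Num 10" 10 "Num 6" 6 0 r e] s2v s2a b2 a1 rows by (simp add: vr_bclear)
  have a3: "ar ?q3 = (ar s2)(3 := (ar s2 3)(11 := dg (r * e), 6 := dg ?e))"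
    using bmac_spec[of ?q2 "Num 6" 6 "Num 11" 11 "Num 5" 5 e "r * e" "b ^ L - 1"] s2v s2a a2 rows by (simp add: vr_bclear vr_bmac)
  let ?s3 = "setv 61 (if Suc i < hn then 1 else 0) (setv 60 (Suc i) ?q3)"
  have s3: "sem v_end s2 = ?s3" using s2v iS by (simp add: v_end_def vr_bclear vr_bmac)
  have v3: "vr ?s3 y = vr s2 y" if "y < 20 \<or> 62 \<le> y" for y using that by (auto simp: vr_bclear vr_bmac)
  have vs: "vr s2 y = vr s y" if "y < 20 \<or> 62 \<le> y" for y using sm(1) that by (auto simp: same_def)
  have as: "ar s2 a = ar s a" if "a \<notin> {2, 3, 4, 8, 9, 10}" for a using sm(1) that by (auto simp: same_def)
  have rs: "ar s2 3 q = ar s 3 q" if "q \<in> {4..9}" for q using sm(1) that by (auto simp: same_def)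
  have K: "keeps s0 s" using V by (simp add: Vst_def)
  have "Vst s0 (Suc i) ?e ?s3"
    unfolding Vst_def keeps_def
  proof (intro conjI allI impI ballI)
    fix y :: nat assume y: "y < 20 \<or> 62 \<le> y"
    have "vr s y = vr s0 y" using K y by (auto simp: keeps_def)
    then show "vr ?s3 y = vr s0 y" using v3[OF y] vs[OF y] by (simp only:)
  next
    fix a :: nat assume "a \<notin> {2, 3, 4, 8, 9, 10}"
    then show "ar ?s3 a = ar s0 a" using as K a3 by (simp add: keeps_def)
  next
    fix q :: nat assume "q \<in> {4, 5, 7, 8, 9}"
    moreover from this have "q \<in> {4..9}" by auto
    ultimately show "ar ?s3 3 q = ar s0 3 q" using rs K a3 by (auto simp: keeps_def)
  next
    show "canon ?s3" unfolding canon_def using a3 sm(2) by (auto simp: canon_def)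
    show "marked ?s3 {Suc i..<hn}" using a3 sm(3) by (simp add: marked_def)
    show "ar ?s3 3 6 = dg ?e" using a3 by simp
  qed simp_all
  moreover have "runs (Do v_begin \<then> rec_prog \<then> Do v_end) s vT ?s3"
    unfolding vT_def
  proof (rule runs_Then[OF runs_Do[OF okc_outer(2) order_refl] runs_Then[OF _ runs_Do[OF okc_outer(3) order_refl, of s2] order_refl, unfolded s3]])
    show "runs rec_prog (sem v_begin s) (9 * (6 * D) ^ m * costS + 1) s2" using run2 s1 by simp
    show "cb (vr s) v_begin + (9 * (6 * D) ^ m * costS + 1 + cb (vr s2) v_end) \<le>
      costO v_begin + (9 * (6 * D) ^ m * costS + 1) + costO v_end"
      using cb_outer[OF p(1) lvars_outer(2)] cb_outer[OF s2v(5) lvars_outer(3)] by linarith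
  qed
  moreover have "zz ^ (m + 1) dvd int ?e * W.gsum {} {Suc i..<hn} - W.gsum {} {..<hn}"
  proof -
    let ?E = "W.gsum {} {Suc i..<hn}" and ?EE = "W.gsum {} {i..<hn}"
    have bL: "1 \<le> b ^ L" using b_pos by simp
    have ie: "int ?e = int e - int r * int e + int r * int e * zz ^ (m + 1)"
    proof -
      have "int (b ^ L - 1) = zz ^ (m + 1) - 1" using bL by (simp add: of_nat_diff power_L zz_def)
      then have "int ?e = int e + int r * int e * (zz ^ (m + 1) - 1)" by (simp only: of_nat_add of_nat_mult)
      then show ?thesis by (simp only: right_diff_distrib mult_1_right)
    qed
    have sub: "{i..<hn} - {i} = {Suc i..<hn}" by auto
    have E0: "?EE = W.gsum {i} {Suc i..<hn} + ?E"
      by (rule W.gsum_branch[of "{i..<hn}" i "{}", unfolded sub]) (use i in auto)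
    have "int ?e * ?E - W.gsum {} {..<hn} = (int e * ?EE - W.gsum {} {..<hn}) - int e * (int r * ?E + W.gsum (set [i]) {Suc i..<hn}) +
       zz ^ (m + 1) * (int r * int e * ?E)"
      unfolding ie E0 by (simp add: algebra_simps)
    moreover have "zz ^ (m + 1) dvd int r * ?E + W.gsum (set [i]) {Suc i..<hn}" using s2(3) by (simp only: spec_def)
    ultimately show ?thesis using e by (simp only: dvd_add dvd_diff dvd_mult dvd_triv_left)
  qed
  ultimately show ?thesis by blast
qed

lemma x_loop:
  assumes o: "okn s0" "okpat s0" and V: "Vst s0 i e s" and i: "i \<le> hn"
    and e: "zz ^ (m + 1) dvd int e * W.gsum {} {i..<hn} - W.gsum {} {..<hn}"
  shows "\<exists>s' e'. runs v_prog s ((hn - i) * (vT + 2) + 1) s' \<and> Vst s0 hn e' s' \<and>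
     zz ^ (m + 1) dvd int e' - W.gsum {} {..<hn}"
  using V i e
proof (induction "hn - i" arbitrary: i e s)
  case 0
  then have "i = hn" by simp
  moreover have "W.gsum {} {} = 1" by (simp add: W.gsum_def)
  moreover have "runs v_prog s 1 s" unfolding v_prog_def
    by (rule runs_While0) (use 0 \<open>i = hn\<close> in \<open>simp_all add: Vst_def\<close>)
  ultimately show ?case using 0 by (intro exI[of _ s] exI[of _ e]) simp
next
  case (Suc d)
  then have i: "i < hn" "d = hn - Suc i" "hn - i = Suc (hn - Suc i)" by auto
  obtain s1 e1 where s1: "runs (Do v_begin \<then> rec_prog \<then> Do v_end) s vT s1" "Vst s0 (Suc i) e1 s1"
     "zz ^ (m + 1) dvd int e1 * W.gsum {} {Suc i..<hn} - W.gsum {} {..<hn}"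
    using x_loop_step[OF o Suc.prems(1) i(1) Suc.prems(3)] by blast
  obtain s2 e2 where s2: "runs v_prog s1 ((hn - Suc i) * (vT + 2) + 1) s2" "Vst s0 hn e2 s2" "zz ^ (m + 1) dvd int e2 - W.gsum {} {..<hn}"
    using Suc.hyps(1)[OF i(2) s1(2) _ s1(3)] i(1) by auto
  have "runs v_prog s ((hn - i) * (vT + 2) + 1) s2" unfolding v_prog_def
    by (rule runs_While1[OF _ _ s1(1) s2(1)[unfolded v_prog_def]]) (use Suc.prems(1) i in \<open>simp_all add: Vst_def\<close>)
  then show ?case using s2 by blast
qed

lemma x_run:
  assumes o: "okn s" "okpat s" and mk: "marked s {..<hn}"
  shows "\<exists>s' e. runs (Do x_begin \<then> v_prog) s xT0 s' \<and> keeps s s' \<and> canon s' \<and> ar s' 3 6 = dg e \<and>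
     zz ^ (m + 1) dvd int e - W.gsum {} {..<hn}"
proof -
  have p: "params s" "ar s 3 4 = dg 1" "canon s" using o(1) by (simp_all add: okn_def)
  obtain x where x: "ar s 3 6 = dg x" using canonD[OF p(3)] by blast
  let ?q1 = "sem (bclear (Num 6)) s"
  let ?q2 = "sem (bmac (Num 6) (Num 4) (Num 4)) ?q1"
  have a1: "ar ?q1 = (ar s)(3 := (ar s 3)(6 := dg 0))" using p x rows by (intro bclear_spec) (auto simp: params_def)
  have a2: "ar ?q2 = (ar s)(3 := (ar s 3)(6 := dg 1))"
    using bmac_spec[of ?q1 "Num 6" 6 "Num 4" 4 "Num 4" 4 0 1 1] p a1 rows by (simp add: vr_bclear params_def)
  let ?s1 = "setv 61 (if 0 < hn then 1 else 0) (setv 60 0 ?q2)"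
  have s1: "sem x_begin s = ?s1" using p by (simp add: x_begin_def vr_bclear vr_bmac params_def)
  have "Vst s 0 1 ?s1"
    unfolding Vst_def keeps_def
  proof (intro conjI allI impI ballI)
    fix y :: nat assume "y < 20 \<or> 62 \<le> y"
    then show "vr ?s1 y = vr s y" by (auto simp: vr_bclear vr_bmac)
  next
    show "canon ?s1" unfolding canon_def using a2 p(3) by (auto simp: canon_def)
    show "marked ?s1 {0..<hn}" using mk a2 by (simp add: marked_def)
    show "ar ?s1 3 6 = dg 1" using a2 by simp
  qed (use a2 in auto)
  from x_loop[OF o this le0] obtain s' e where s': "runs v_prog ?s1 (hn * (vT + 2) + 1) s'" "Vst s hn e s'"
    "zz ^ (m + 1) dvd int e - W.gsum {} {..<hn}" by (auto simp: lessThan_atLeast0)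
  have "runs (Do x_begin \<then> v_prog) s xT0 s'" unfolding xT0_def
    by (rule runs_Then[OF runs_Do[OF okc_outer(1) cb_outer[OF p(1) lvars_outer(1)]] s'(1)[folded s1] order_refl])
  then show ?thesis using s' by (auto simp: Vst_def)
qed

end

section \<open>The alternating sum over all X\<close>

text \<open>The pattern with X left open, since X changes from round to round;
  \<open>pattern_at\<close> supplies the locale for the current X.\<close>

locale pattern0 = host +
  fixes hadj :: "nat \<Rightarrow> nat \<Rightarrow> bool" and hdeg :: "nat \<Rightarrow> nat"
  assumes hadj_sym: "hadj x y \<Longrightarrow> hadj y x" and hdeg_eq: "x < m \<Longrightarrow> hdeg x = card {y \<in> {..<m}. hadj x y}"
begin

lemma pattern_at: "X \<subseteq> {..<m} \<Longrightarrow> pattern w S B inp b L m D hn hb nb hadj hdeg X"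
  by unfold_locales (use hadj_sym hdeg_eq in auto)

definition total :: "nat set \<Rightarrow> int" where
  "total X = (\<Sum>T\<in>Pow {..<hn}. int (hw adj hadj hdeg X T) * int (b ^ (m + 1)) ^ card T)"

definition htab :: "st \<Rightarrow> bool" where
  "htab s \<longleftrightarrow> (\<forall>x<m. \<forall>y<m. ar s 5 x y = (if hadj x y then 1 else 0)) \<and> (\<forall>x<m. ar s 6 0 x = hdeg x)"

definition bits :: "st \<Rightarrow> nat \<Rightarrow> bool" where
  "bits s t \<longleftrightarrow> (\<forall>x<m. ar s 7 0 x = (if x \<in> set_decode t then 1 else 0))"

definition zeros :: "nat \<Rightarrow> nat" where "zeros t = card ({..<m} - set_decode t)"

definition keepm :: "st \<Rightarrow> st \<Rightarrow> bool" where
  "keepm s0 s \<longleftrightarrow> (\<forall>x. x < 20 \<or> 68 \<le> x \<longrightarrow> vr s x = vr s0 x) \<and>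
     (\<forall>a. a \<notin> {2, 3, 4, 7, 8, 9, 10} \<longrightarrow> ar s a = ar s0 a) \<and> (\<forall>r\<in>{4, 5, 8, 9}. ar s 3 r = ar s0 3 r)"

lemma zeros_spec:
  assumes "params s" "bits s t"
  defines "u \<equiv> sem (Asg 64 (Num 0) ;; For 66 7 (Cond (Num 0) (Arr 7 (Num 0) (Var 66)) skip (Asg 64 (Var 64 \<oplus> Num 1)))) s"
  shows "vr u 64 = zeros t" "ar u = ar s"
proof -
  let ?f = "\<lambda>k s. sem (Cond (Num 0) (Arr 7 (Num 0) (Var 66)) skip (Asg 64 (Var 64 \<oplus> Num 1))) (setv 66 k s)"
  define J where "J k s' \<longleftrightarrow> ar s' = ar s \<and> vr s' 64 = card ({..<k} - set_decode t)" for k and s' :: st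
  have "J m (floop ?f m (setv 64 0 s))"
  proof (rule floop_inv[where P = J])
    show "J 0 (setv 64 0 s)" by (simp add: J_def)
  next
    fix k s' assume k: "k < m" and J: "J k s'"
    have kS: "k mod S = k" using k cols by simp
    have c: "card ({..<k} - set_decode t) \<le> k" using card_mono[of "{..<k}" "{..<k} - set_decode t"] by simp
    then have "Suc (card ({..<k} - set_decode t)) < 2 ^ w" using k sizes by linarith
    moreover have "{..<Suc k} - set_decode t = (if k \<in> set_decode t then {..<k} - set_decode t else insert k ({..<k} - set_decode t))"
      by (auto simp: less_Suc_eq)
    ultimately show "J (Suc k) (?f k s')" using J k kS assms(2) by (simp add: J_def bits_def)
  qed
  then show "vr u 64 = zeros t" "ar u = ar s" using assms(1) by (simp_all add: u_def J_def zeros_def params_def)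
qed

lemma sign_spec:
  assumes "okn s" "bits s t" "ar s 3 6 = dg e" "ar s 3 7 = dg y"
  shows "ar (sem x_sign s) = (ar s)(3 := (ar s 3)(7 := dg (y + e * (if odd (zeros t) then b ^ L - 1 else 1))))"
proof -
  let ?z = "Asg 64 (Num 0) ;; For 66 7 (Cond (Num 0) (Arr 7 (Num 0) (Var 66)) skip (Asg 64 (Var 64 \<oplus> Num 1)))"
  define u where "u = sem ?z s"
  have p: "params s" "ar s 3 4 = dg 1" "ar s 3 5 = dg (b ^ L - 1)" using assms(1) by (simp_all add: okn_def)
  note zs = zeros_spec[OF p(1) assms(2), folded u_def]
  have v: "vr u x = vr s x" if "x < 20" for x unfolding u_def by (rule vr_frame) (use that in simp)
  have uv: "vr u 8 = L" "vr u 9 = b" using v p(1) by (simp_all add: params_def)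
  have "zeros t mod 2 < 2 ^ w" using nums(3) by (rule less_trans[rotated]) simp
  then have e: "ev u (Bin Mod (Var 64) (Num 2)) = zeros t mod 2" using zs(1) by simp
  have "sem x_sign s = sem (Cond (Num 0) (Bin Mod (Var 64) (Num 2)) (bmac (Num 7) (Num 6) (Num 5)) (bmac (Num 7) (Num 6) (Num 4))) u"
    unfolding x_sign_def u_def by simp
  also have "\<dots> = (if odd (zeros t) then sem (bmac (Num 7) (Num 6) (Num 5)) u else sem (bmac (Num 7) (Num 6) (Num 4)) u)"
    unfolding sem.simps(4) e by (simp add: odd_iff_mod_2_eq_one)
  finally have sx: "sem x_sign s = (if odd (zeros t) then sem (bmac (Num 7) (Num 6) (Num 5)) u else sem (bmac (Num 7) (Num 6) (Num 4)) u)" .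
  show ?thesis
  proof (cases "odd (zeros t)")
    case True
    then show ?thesis unfolding sx using bmac_spec[of u "Num 7" 7 "Num 6" 6 "Num 5" 5 y e "b ^ L - 1"] uv zs(2) assms p rows by simp
  next
    case False
    then show ?thesis unfolding sx using bmac_spec[of u "Num 7" 7 "Num 6" 6 "Num 4" 4 y e 1] uv zs(2) assms p rows by simp
  qed
qed

lemma unmark_spec:
  assumes "params s"
  shows "marked (sem x_unmark s) {..<hn}"
proof -
  let ?f = "\<lambda>k s. sem (Put 4 (Num 0) (Var 67) (Num 0)) (setv 67 k s)"
  define J where "J k s' \<longleftrightarrow> (\<forall>y<k. ar s' 4 0 y = 0)" for k and s' :: st
  have "J hn (floop ?f hn s)"
    by (rule floop_inv[where P = J]) (use rows in \<open>auto simp: J_def less_Suc_eq\<close>)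
  then show ?thesis using assms by (simp add: x_unmark_def J_def marked_def params_def)
qed

lemma next_spec:
  assumes p: "params s" and bt: "bits s t" and t: "t < 2 ^ m"
  shows "bits (sem x_next s) (Suc t)" "vr (sem x_next s) 62 = (if Suc t < 2 ^ m then 1 else 0)"
proof -
  let ?b = "Cond (Num 0) (Var 63)
       (Cond (Num 0) (Arr 7 (Num 0) (Var 66)) (Put 7 (Num 0) (Var 66) (Num 0))
          (Put 7 (Num 0) (Var 66) (Num 1) ;; Asg 63 (Num 0))) skip"
  let ?f = "\<lambda>k s. sem ?b (setv 66 k s)"
  \<comment> \<open>Below position k the bits are already those of t + 1, above it still those of t;
    the carry is the difference of the two quotients by 2^k.\<close>
  define J where "J k s' \<longleftrightarrow> vr s' 63 \<le> 1 \<and> Suc t div 2 ^ k = t div 2 ^ k + vr s' 63 \<and>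
     (\<forall>x<m. ar s' 7 0 x = (if x \<in> set_decode (if x < k then Suc t else t) then 1 else 0))" for k and s' :: st
  have J: "J m (floop ?f m (setv 63 1 s))"
  proof (rule floop_inv[where P = J])
    show "J 0 (setv 63 1 s)" using bt by (simp add: J_def bits_def)
  next
    fix k s' assume k: "k < m" and J: "J k s'"
    have kS: "k mod S = k" using k cols by simp
    let ?c = "vr s' 63"
    have c: "?c = 0 \<or> ?c = 1" and d: "Suc t div 2 ^ k = t div 2 ^ k + ?c" using J by (auto simp: J_def)
    have bit: "ar s' 7 0 k = (if odd (t div 2 ^ k) then 1 else 0)" using J k by (simp add: J_def set_decode_def)
    have nb: "k \<in> set_decode (Suc t) \<longleftrightarrow> odd (t div 2 ^ k + ?c)" by (simp add: set_decode_def d)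
    have d2: "Suc t div 2 ^ Suc k = (t div 2 ^ k + ?c) div 2" "t div 2 ^ Suc k = t div 2 ^ k div 2"
      using d by (simp_all add: div_mult2_eq[symmetric] mult.commute) (metis div_mult2_eq mult.commute d)+
    show "J (Suc k) (?f k s')"
    proof (cases "?c = 0")
      case True
      then have "?f k s' = setv 27 0 (setv 66 k s')" by simp
      moreover have "k \<in> set_decode (Suc t) \<longleftrightarrow> k \<in> set_decode t" using nb True by (simp add: set_decode_def)
      ultimately show ?thesis using J d2 True by (auto simp: J_def less_Suc_eq)
    next
      case False
      then have c1: "?c = 1" using c by simp
      show ?thesis
      proof (cases "odd (t div 2 ^ k)")
        case True
        then have "?f k s' = seta 7 0 k 0 (setv 66 k s')" using c1 bit kS by simp
        moreover have "Suc t div 2 ^ Suc k = t div 2 ^ Suc k + 1" unfolding d2 c1 using True by (auto elim!: oddE)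
        moreover have "k \<notin> set_decode (Suc t)" using nb c1 True by simp
        ultimately show ?thesis using J c1 by (auto simp: J_def less_Suc_eq simp del: power_Suc)
      next
        case e: False
        then have "?f k s' = setv 63 0 (seta 7 0 k 1 (setv 66 k s'))" using c1 bit kS by simp
        moreover have "Suc t div 2 ^ Suc k = t div 2 ^ Suc k" unfolding d2 c1 using e by (auto elim!: evenE)
        moreover have "k \<in> set_decode (Suc t)" using nb c1 e by simp
        ultimately show ?thesis using J c1 by (auto simp: J_def less_Suc_eq simp del: power_Suc)
      qed
    qed
  qed
  let ?u = "setv 66 m (floop ?f m (setv 63 1 s))"
  have sx: "sem x_next s = (if 0 < vr ?u 63 then setv 62 0 ?u else setv 62 1 ?u)"
    using p by (simp add: x_next_def params_def)
  have J2: "\<forall>x<m. ar ?u 7 0 x = (if x \<in> set_decode (Suc t) then 1 else 0)" "vr ?u 63 \<le> 1" "Suc t div 2 ^ m = vr ?u 63"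
    using J t by (simp_all add: J_def)
  show "bits (sem x_next s) (Suc t)" unfolding sx using J2(1) by (simp add: bits_def)
  have "Suc t < 2 ^ m \<longleftrightarrow> vr ?u 63 = 0" using J2(3) by (metis div_eq_0_iff div_less power_not_zero zero_neq_numeral)
  then show "vr (sem x_next s) 62 = (if Suc t < 2 ^ m then 1 else 0)" unfolding sx by auto
qed

text \<open>The cost \<open>xT0\<close> of the product plus that of \<open>x_end\<close>, written
  out because no X is fixed here; the cost is the same for every X.\<close>

definition xT :: nat where
  "xT = costO x_begin + (hn * ((costO v_begin + (9 * (6 * D) ^ m * (costA + ((m + 1) ^ 3 * D ^ m * (costF + 2) + 1) + 2) + 1) + costO v_end) + 2) + 1) + costO x_end"

definition mainT :: nat where "mainT = 2 ^ m * (xT + 2) + 1"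

definition Mst :: "st \<Rightarrow> nat \<Rightarrow> nat \<Rightarrow> st \<Rightarrow> bool" where
  "Mst s0 t y s \<longleftrightarrow> keepm s0 s \<and> canon s \<and> bits s t \<and> marked s {..<hn} \<and> ar s 3 7 = dg y \<and>
     vr s 62 = (if t < 2 ^ m then 1 else 0)"

lemma decode_sub: "t < 2 ^ m \<Longrightarrow> set_decode t \<subseteq> {..<m}"
proof
  fix x assume t: "t < 2 ^ m" "x \<in> set_decode t"
  then have "t div 2 ^ x \<noteq> 0" by (auto simp: set_decode_def elim: oddE)
  then have "2 ^ x \<le> t" by (simp add: div_eq_0_iff)
  then have "(2::nat) ^ x < 2 ^ m" using t by linarith
  then show "x \<in> {..<m}" by simp
qed

lemma main_step:
  assumes o: "okn s0" "htab s0" and M: "Mst s0 t y s" and t: "t < 2 ^ m"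
  shows "\<exists>s' y'. runs (Do x_begin \<then> v_prog \<then> Do x_end) s xT s' \<and> Mst s0 (Suc t) y' s' \<and>
    int (b ^ (m + 1)) ^ (m + 1) dvd int y' - (int y + (-1) ^ zeros t * total (set_decode t))"
proof -
  let ?X = "set_decode t"
  interpret P: pattern w S B inp b L m D hn hb nb hadj hdeg ?X using pattern_at[OF decode_sub[OF t]] .
  have K: "keepm s0 s" "canon s" "bits s t" "marked s {..<hn}" "ar s 3 7 = dg y" using M by (simp_all add: Mst_def)
  have os: "okn s" using o(1) K by (simp add: okn_def keepm_def params_def)
  have op: "P.okpat s" using o(2) K by (simp add: P.okpat_def htab_def keepm_def bits_def)
  obtain s1 e where s1: "runs (Do x_begin \<then> v_prog) s P.xT0 s1" "P.keeps s s1" "canon s1" "ar s1 3 6 = dg e"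
    "P.zz ^ (m + 1) dvd int e - P.W.gsum {} {..<hn}" using P.x_run[OF os op K(4)] by blast
  have tot: "P.W.gsum {} {..<hn} = total ?X" by (subst P.W.gsum_def) (simp only: total_def P.zz_def Un_empty_left)
  have os1: "okn s1" using os s1(2,3) by (simp add: okn_def P.keeps_def params_def)
  have p1: "params s1" using os1 by (simp add: okn_def)
  have b1: "bits s1 t" using K(3) s1(2) by (simp add: bits_def P.keeps_def)
  have y1: "ar s1 3 7 = dg y" using K(5) s1(2) by (simp add: P.keeps_def)
  \<comment> \<open>The sign as a residue modulo b^L, with b^L - 1 for -1.\<close>
  define g where "g = (if odd (zeros t) then b ^ L - 1 else 1)"
  let ?u = "sem x_sign s1"
  let ?v = "sem x_unmark ?u"
  let ?s2 = "sem x_next ?v"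
  have su: "ar ?u = (ar s1)(3 := (ar s1 3)(7 := dg (y + e * g)))" unfolding g_def by (rule sign_spec[OF os1 b1 s1(4) y1])
  have fu: "vr ?u x = vr s1 x" if "x < 20 \<or> 68 \<le> x" for x
    by (rule vr_frame) (use that in \<open>auto simp: x_sign_def bmac_def addmul_def\<close>)
  have fv: "vr ?v x = vr ?u x" if "x \<noteq> 67" for x by (rule vr_frame) (use that in \<open>simp add: x_unmark_def\<close>)
  have fs: "vr ?s2 x = vr ?v x" if "x < 20 \<or> 68 \<le> x" for x by (rule vr_frame) (use that in \<open>auto simp: x_next_def\<close>)
  have av: "ar ?v a = ar ?u a" if "a \<noteq> 4" for a by (rule ar_frame) (use that in \<open>simp add: x_unmark_def\<close>)
  have as: "ar ?s2 a = ar ?v a" if "a \<noteq> 7" for a by (rule ar_frame) (use that in \<open>simp add: x_next_def\<close>)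
  have pu: "params ?u" "params ?v" using p1 fu fv by (simp_all add: params_def)
  have mv: "marked ?v {..<hn}" by (rule unmark_spec[OF pu(1)])
  have bv: "bits ?v t" using b1 av[of 7] su by (simp add: bits_def)
  note nx = next_spec[OF pu(2) bv t]
  have a3: "ar ?s2 3 = (ar s1 3)(7 := dg (y + e * g))" using as[of 3] av[of 3] su by simp
  have "Mst s0 (Suc t) (y + e * g) ?s2"
    unfolding Mst_def keepm_def
  proof (intro conjI allI impI ballI)
    fix x :: nat assume x: "x < 20 \<or> 68 \<le> x"
    have "vr s1 x = vr s x" using s1(2) x by (auto simp: P.keeps_def)
    moreover have "vr s x = vr s0 x" using K(1) x by (auto simp: keepm_def)
    moreover have "x \<noteq> 67" using x by auto
    ultimately show "vr ?s2 x = vr s0 x" using fs[OF x] fv[of x] fu[OF x] by simp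
  next
    fix a :: nat assume a: "a \<notin> {2, 3, 4, 7, 8, 9, 10}"
    then have "ar ?s2 a = ar s1 a" using as[of a] av[of a] su by simp
    moreover have "ar s1 a = ar s a" using s1(2) a by (auto simp: P.keeps_def)
    moreover have "ar s a = ar s0 a" using K(1) a by (auto simp: keepm_def)
    ultimately show "ar ?s2 a = ar s0 a" by simp
  next
    fix r :: nat assume r: "r \<in> {4, 5, 8, 9}"
    have "ar s1 3 r = ar s 3 r" using s1(2) r by (auto simp: P.keeps_def)
    moreover have "ar s 3 r = ar s0 3 r" using K(1) r by (auto simp: keepm_def)
    ultimately show "ar ?s2 3 r = ar s0 3 r" using a3 r by auto
  next
    show "canon ?s2" unfolding canon_def a3 using s1(3) by (auto simp: canon_def)
    show "marked ?s2 {..<hn}" using mv as[of 4] by (simp add: marked_def)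
  qed (use nx a3 in simp_all)
  moreover have "runs (Do x_begin \<then> v_prog \<then> Do x_end) s xT ?s2"
  proof -
    obtain sa ta tb where q: "runs (Do x_begin) s ta sa" "runs v_prog sa tb s1" "ta + tb \<le> P.xT0"
      using s1(1) by (auto elim: runs.cases)
    have x: "runs (Do x_end) s1 (costO x_end) ?s2"
      using runs_Do[OF okc_outer(4) cb_outer[OF p1 lvars_outer(4)]] by (simp add: x_end_def)
    have "P.xT0 + costO x_end = xT"
      unfolding xT_def P.xT0_def P.vT_def P.costS_def P.leafT_def ..
    then show ?thesis using q(3) by (intro runs_Then[OF q(1) runs_Then[OF q(2) x order_refl]]) simp
  qed
  moreover have "int (b ^ (m + 1)) ^ (m + 1) dvd int (y + e * g) - (int y + (-1) ^ zeros t * total ?X)"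
  proof -
    define z where "z = int (b ^ (m + 1)) ^ (m + 1)"
    have de: "z dvd int e - total ?X" using s1(5) unfolding tot unfolding P.zz_def z_def .
    have bz: "int (b ^ L - 1) = z - 1" using b_pos by (simp add: of_nat_diff P.power_L z_def)
    show ?thesis unfolding z_def[symmetric]
    proof (cases "odd (zeros t)")
      case True
      then have "int g = z - 1" unfolding g_def using bz by simp
      then have zg: "z = int g + 1" by simp
      have "int (y + e * g) - (int y + (-1) ^ zeros t * total ?X) = z * int e - (int e - total ?X)"
        using True unfolding of_nat_add of_nat_mult zg by (simp add: algebra_simps)
      then show "z dvd int (y + e * g) - (int y + (-1) ^ zeros t * total ?X)" using de by (simp only: dvd_diff dvd_triv_left)
    next
      case False
      then have "int (y + e * g) - (int y + (-1) ^ zeros t * total ?X) = int e - total ?X"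
        by (simp add: g_def)
      then show "z dvd int (y + e * g) - (int y + (-1) ^ zeros t * total ?X)" using de by (simp only:)
    qed
  qed
  ultimately show ?thesis by blast
qed

lemma main_loop:
  assumes o: "okn s0" "htab s0" and M: "Mst s0 t y s" and t: "t \<le> 2 ^ m"
    and d: "int (b ^ (m + 1)) ^ (m + 1) dvd int y - (\<Sum>t'<t. (-1) ^ zeros t' * total (set_decode t'))"
  shows "\<exists>s' y'. runs main_prog s ((2 ^ m - t) * (xT + 2) + 1) s' \<and> Mst s0 (2 ^ m) y' s' \<and>
    int (b ^ (m + 1)) ^ (m + 1) dvd int y' - (\<Sum>t'<2 ^ m. (-1) ^ zeros t' * total (set_decode t'))"
  using M t d
proof (induction "2 ^ m - t" arbitrary: t y s)
  case 0
  then have t: "t = 2 ^ m" by simp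
  have "runs main_prog s 1 s" unfolding main_prog_def
    by (rule runs_While0) (use 0 t in \<open>simp_all add: Mst_def\<close>)
  then show ?case using 0 t by (intro exI[of _ s] exI[of _ y]) simp
next
  case (Suc k)
  let ?z = "int (b ^ (m + 1)) ^ (m + 1)" and ?S = "\<lambda>t. \<Sum>t'<t. (-1) ^ zeros t' * total (set_decode t')"
  have t: "t < 2 ^ m" "k = 2 ^ m - Suc t" "2 ^ m - t = Suc (2 ^ m - Suc t)" using Suc.hyps(2) by auto
  obtain s1 y1 where s1: "runs (Do x_begin \<then> v_prog \<then> Do x_end) s xT s1" "Mst s0 (Suc t) y1 s1"
     "?z dvd int y1 - (int y + (-1) ^ zeros t * total (set_decode t))"
    using main_step[OF o Suc.prems(1) t(1)] by blast
  have "int y1 - ?S (Suc t) = (int y1 - (int y + (-1) ^ zeros t * total (set_decode t))) + (int y - ?S t)" by simp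
  then have d1: "?z dvd int y1 - ?S (Suc t)" using s1(3) Suc.prems(3) by (simp only: dvd_add)
  obtain s2 y2 where s2: "runs main_prog s1 ((2 ^ m - Suc t) * (xT + 2) + 1) s2" "Mst s0 (2 ^ m) y2 s2" "?z dvd int y2 - ?S (2 ^ m)"
    using Suc.hyps(1)[OF t(2) s1(2) _ d1] t(1) by auto
  have "runs main_prog s ((2 ^ m - t) * (xT + 2) + 1) s2" unfolding main_prog_def
    by (rule runs_While1[OF _ _ s1(1) s2(1)[unfolded main_prog_def]]) (use Suc.prems(1) t in \<open>simp_all add: Mst_def\<close>)
  then show ?case using s2 by blast
qed

theorem main_run:
  assumes o: "okn s" "htab s" and i: "bits s 0" "marked s {..<hn}" "ar s 3 7 = dg 0" "vr s 62 = 1"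
  shows "\<exists>s' y. runs main_prog s mainT s' \<and> keepm s s' \<and> canon s' \<and> bits s' 0 \<and> marked s' {..<hn} \<and> vr s' 62 = 0 \<and>
    ar s' 3 7 = dg y \<and> int (b ^ (m + 1)) ^ (m + 1) dvd int y - int (emb adj hadj {..<m} {..<hn}) * int (b ^ (m + 1)) ^ m"
proof -
  let ?z = "int (b ^ (m + 1))"
  have "Mst s 0 0 s" using o i by (simp add: Mst_def keepm_def okn_def)
  from main_loop[OF o this] obtain s' y where s': "runs main_prog s mainT s'" "Mst s (2 ^ m) y s'"
    "?z ^ (m + 1) dvd int y - (\<Sum>t'<2 ^ m. (-1) ^ zeros t' * total (set_decode t'))" by (auto simp: mainT_def)
  obtain q where q: "(\<Sum>X\<in>Pow {..<m}. (-1) ^ card ({..<m} - X) * total X) =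
     int (emb adj hadj {..<m} {..<hn}) * ?z ^ m + q * ?z ^ Suc m"
    using inclusion_exclusion_emb[of "{..<m}" "{..<hn}" hdeg hadj adj ?z] hdeg_eq unfolding total_def by auto
  have "(\<Sum>t'<2 ^ m. (-1) ^ zeros t' * total (set_decode t')) = (\<Sum>X\<in>Pow {..<m}. (-1) ^ card ({..<m} - X) * total X)"
    unfolding sum_Pow_set_decode zeros_def ..
  then have "int y - int (emb adj hadj {..<m} {..<hn}) * ?z ^ m =
     (int y - (\<Sum>t'<2 ^ m. (-1) ^ zeros t' * total (set_decode t'))) + ?z ^ (m + 1) * q" using q by simp
  then have "?z ^ (m + 1) dvd int y - int (emb adj hadj {..<m} {..<hn}) * ?z ^ m"
    using s'(3) by (simp only: dvd_add dvd_triv_left)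
  \<comment> \<open>The counter value 2^m has no bit below m, so after the last round the table of
    bits is that of 0 again and the second run can start from it.\<close>
  moreover have "x \<notin> set_decode (2 ^ m)" if "x < m" for x
    using that by (simp add: set_decode_def power_diff[symmetric])
  then have "bits s' 0" using s'(2) by (simp add: Mst_def bits_def)
  ultimately show ?thesis using s' by (auto simp: Mst_def)
qed

end


section \<open>Tables, falling factorials, exact division and output\<close>

text \<open>Only used while H is the host, so that rows and columns both range over m; variable 17
  becomes the maximum degree of H on the way.\<close>

definition htable :: com where
  "htable = For 40 7 (Asg 37 (Var 40) ;; load_nbrs ;; Put 6 (Num 0) (Var 40) (Var 39) ;;
     Cond (Var 17) (Var 39) (Asg 17 (Var 39)) skip ;;
     For 41 7 (Cond (Var 41) (Var 39) (Asg 42 nbr ;; Put 5 (Var 40) (Var 42) (Num 1)) skip))"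

definition maxdeg :: com where
  "maxdeg = For 40 18 (Asg 37 (Var 40) ;; load_nbrs ;; Cond (Var 16) (Var 39) (Asg 16 (Var 39)) skip)"

text \<open>The product of e - i over i < m. For i \<ge> e the factor row stays cleared, in
  agreement with truncated subtraction.\<close>

definition falling :: "exp \<Rightarrow> exp \<Rightarrow> com" where
  "falling r e = Put 3 r (Num 0) (Num 1) ;; For 43 7 (bclear (Num 11) ;;
     Cond (Var 43) e (Put 3 (Num 11) (Num 0) (Bin Sub e (Var 43))) skip ;;
     bclear (Num 12) ;; bmac (Num 12) r (Num 11) ;; bclear r ;; bmac r (Num 12) (Num 4))"

text \<open>The digits of row 7 from position m (m + 1) on form the coefficient of z^m, as z is
  worth m + 1 digits.\<close>

definition save :: "exp \<Rightarrow> com" where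
  "save r = For 45 12 (Put 3 r (Var 45) (Arr 3 (Num 7) (Var 7 \<otimes> Var 12 \<oplus> Var 45)))"

text \<open>Counted from the leading position m downwards, the order in which division and Horner's
  scheme consume digits.\<close>

definition digit :: "exp \<Rightarrow> exp" where "digit r = Arr 3 r (Bin Sub (Var 7) (Var 74))"

definition rem_row :: "exp \<Rightarrow> com" where
  "rem_row r = Asg 73 (Num 0) ;; For 74 12 (Asg 73 (Bin Mod (Var 73 \<otimes> Var 9 \<oplus> digit r) (Var 75)))"

definition div_row :: "exp \<Rightarrow> com" where
  "div_row r = Asg 73 (Num 0) ;; For 74 12 (Asg 76 (Var 73 \<otimes> Var 9 \<oplus> digit r) ;;
     Put 3 r (Bin Sub (Var 7) (Var 74)) (Bin Div (Var 76) (Var 75)) ;; Asg 73 (Bin Mod (Var 76) (Var 75)))"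

text \<open>The denominator divides m!, so it can be removed by dividing both rows by 2, ..., m as
  often as possible. Only division by a single digit is needed, never division of long
  numbers.\<close>

definition cancel :: com where
  "cancel = For 71 7 (Asg 75 (Var 71 \<oplus> Num 1) ;;
     For 72 8 (rem_row (Num 9) ;; Cond (Num 0) (Var 73) skip (div_row (Num 9) ;; div_row (Num 8))))"

text \<open>Converts from base b to base 2^w by Horner's scheme: the output is repeatedly multiplied
  by b. Variable 13 holds 2^w / b, so the carry out of a word y times b is y divided by it.\<close>

definition emit :: com where
  "emit = For 74 12 (Asg 76 (digit (Num 8)) ;;
     For 77 12 (Asg 78 (Arr 11 (Num 0) (Var 77)) ;;
       Put 11 (Num 0) (Var 77) (Var 78 \<otimes> Var 9 \<oplus> Var 76) ;; Asg 76 (Bin Div (Var 78) (Var 13))))"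

context host
begin

lemma htable_spec:
  assumes s: "vr s 5 = hn" "vr s 6 = hb" "vr s 7 = m" "hn = m" "vr s 17 = 0"
    and z: "\<forall>i<m. \<forall>j<m. ar s 5 i j = 0"
  shows "\<forall>i<m. \<forall>j<m. ar (sem htable s) 5 i j = (if j \<in> set (nb i) then 1 else 0)"
    "\<forall>i<m. ar (sem htable s) 6 0 i = length (nb i)" "\<forall>i<m. length (nb i) \<le> vr (sem htable s) 17"
    "vr (sem htable s) 17 = 0 \<or> (\<exists>i<m. vr (sem htable s) 17 = length (nb i))"
proof -
  let ?i = "Cond (Var 41) (Var 39) (Asg 42 nbr ;; Put 5 (Var 40) (Var 42) (Num 1)) skip"
  let ?f = "\<lambda>k s. sem (Asg 37 (Var 40) ;; load_nbrs ;; Put 6 (Num 0) (Var 40) (Var 39) ;;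
     Cond (Var 17) (Var 39) (Asg 17 (Var 39)) skip ;; For 41 7 ?i) (setv 40 k s)"
  let ?g = "\<lambda>e s. sem ?i (setv 41 e s)"
  define C where "C t \<longleftrightarrow> vr t 5 = hn \<and> vr t 6 = hb \<and> vr t 7 = m" for t :: st
  define J where "J k t \<longleftrightarrow> C t \<and> (\<forall>i<m. \<forall>j<m. ar t 5 i j = (if i < k \<and> j \<in> set (nb i) then 1 else 0)) \<and>
     (\<forall>i<k. ar t 6 0 i = length (nb i) \<and> length (nb i) \<le> vr t 17) \<and>
     (vr t 17 = 0 \<or> (\<exists>i<m. vr t 17 = length (nb i)))" for k and t :: st
  have "J m (floop ?f m s)"
  proof (rule floop_inv[where P = J])
    show "J 0 s" using s z by (simp add: J_def C_def)
  next
    fix k t assume k: "k < m" and J: "J k t"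
    have kh: "k < hn" "k mod S = k" using k s(4) cols by simp_all
    have lk: "length (nb k) \<le> m"
      using card_mono[OF _ nb_in[OF kh(1)]] distinct_card[OF nb_distinct[OF kh(1)]] s(4) by simp
    define u where "u = sem (Asg 37 (Var 40) ;; load_nbrs ;; Put 6 (Num 0) (Var 40) (Var 39) ;;
     Cond (Var 17) (Var 39) (Asg 17 (Var 39)) skip) (setv 40 k t)"
    have fu: "?f k t = sem (For 41 7 ?i) u" by (simp add: u_def)
    have ld: "sem load_nbrs (setv 37 k (setv 40 k t)) = setv 39 (length (nb k)) (setv 38 (inp (hb + 1 + k)) (setv 37 k (setv 40 k t)))"
      using J kh by (intro load_nbrs_spec) (simp_all add: J_def C_def)
    have u: "ar u 5 = ar t 5" "ar u 6 = (ar t 6)(0 := (ar t 6 0)(k := length (nb k)))" "C u" "vr u 40 = k"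
      "vr u 39 = length (nb k)" "vr u 38 = inp (hb + 1 + k)" "vr u 17 = max (vr t 17) (length (nb k))"
      using J kh by (simp_all add: u_def ld J_def C_def max_def)
    define P where "P e t' \<longleftrightarrow> C t' \<and> vr t' 40 = k \<and> vr t' 39 = length (nb k) \<and> vr t' 38 = inp (hb + 1 + k) \<and>
      vr t' 17 = vr u 17 \<and> ar t' 6 = ar u 6 \<and>
      (\<forall>i<m. \<forall>j<m. ar t' 5 i j = (if (i < k \<and> j \<in> set (nb i)) \<or> (i = k \<and> (\<exists>e'<e. e' < length (nb k) \<and> nb k ! e' = j)) then 1 else 0))"
      for e and t' :: st
    have P: "P m (floop ?g m u)"
    proof (rule floop_inv[where P = P])
      show "P 0 u" using u J by (simp add: P_def J_def)
    next
      fix e t' assume e: "e < m" and P: "P e t'"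
      show "P (Suc e) (?g e t')"
      proof (cases "e < length (nb k)")
        case False
        then have "?g e t' = setv 27 0 (setv 41 e t')" using P by (simp add: P_def)
        moreover have "(\<exists>e'<Suc e. e' < length (nb k) \<and> nb k ! e' = j) = (\<exists>e'<e. e' < length (nb k) \<and> nb k ! e' = j)" for j
          using False by (auto simp: less_Suc_eq)
        ultimately show ?thesis using P by (simp add: P_def C_def)
      next
        case True
        have ne: "ev (setv 41 e t') nbr = nb k ! e" "nb k ! e < hn"
          using nbr_spec[of "setv 41 e t'" k e] P kh True by (simp_all add: P_def C_def)
        then have "nb k ! e mod S = nb k ! e" using rows by simp
        then have "?g e t' = seta 5 k (nb k ! e) 1 (setv 42 (nb k ! e) (setv 41 e t'))"
          using P True ne kh by (simp add: P_def)
        moreover have "(\<exists>e'<Suc e. e' < length (nb k) \<and> nb k ! e' = j) = (j = nb k ! e \<or> (\<exists>e'<e. e' < length (nb k) \<and> nb k ! e' = j))" for j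
          using True by (auto simp: less_Suc_eq)
        ultimately show ?thesis using P by (auto simp: P_def C_def)
      qed
    qed
    have sem41: "?f k t = setv 41 m (floop ?g m u)" unfolding fu using u(3) by (simp add: C_def)
    have ex: "(\<exists>e'<m. e' < length (nb k) \<and> nb k ! e' = j) = (j \<in> set (nb k))" for j
      using lk by (auto simp: in_set_conv_nth intro: less_le_trans)
    show "J (Suc k) (?f k t)"
      unfolding J_def
    proof (intro conjI)
      show "C (?f k t)" using P sem41 by (simp add: P_def C_def)
      show "\<forall>i<m. \<forall>j<m. ar (?f k t) 5 i j = (if i < Suc k \<and> j \<in> set (nb i) then 1 else 0)"
        unfolding sem41 using P by (auto simp: P_def ex less_Suc_eq)
      have v17: "vr (?f k t) 17 = max (vr t 17) (length (nb k))" unfolding sem41 using P u(7) by (simp add: P_def)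
      show "\<forall>i<Suc k. ar (?f k t) 6 0 i = length (nb i) \<and> length (nb i) \<le> vr (?f k t) 17"
        unfolding v17 using P u(2) J unfolding sem41 by (auto simp: P_def J_def less_Suc_eq max_def le_max_iff_disj)
      show "vr (?f k t) 17 = 0 \<or> (\<exists>i<m. vr (?f k t) 17 = length (nb i))" unfolding v17 using J k by (auto simp: J_def max_def)
    qed
  qed
  moreover have "sem htable s = setv 40 m (floop ?f m s)" using s(3) by (simp only: htable_def sem.simps(5))
  ultimately show "\<forall>i<m. \<forall>j<m. ar (sem htable s) 5 i j = (if j \<in> set (nb i) then 1 else 0)"
    "\<forall>i<m. ar (sem htable s) 6 0 i = length (nb i)" "\<forall>i<m. length (nb i) \<le> vr (sem htable s) 17"
    "vr (sem htable s) 17 = 0 \<or> (\<exists>i<m. vr (sem htable s) 17 = length (nb i))"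
    by (simp_all add: J_def)
qed

lemma maxdeg_spec:
  assumes s: "vr s 6 = hb" "vr s 18 = l" "l \<le> hn" "vr s 16 = 0"
  shows "\<forall>i<l. length (nb i) \<le> vr (sem maxdeg s) 16" "vr (sem maxdeg s) 16 = 0 \<or> (\<exists>i<l. vr (sem maxdeg s) 16 = length (nb i))"
proof -
  let ?f = "\<lambda>k s. sem (Asg 37 (Var 40) ;; load_nbrs ;; Cond (Var 16) (Var 39) (Asg 16 (Var 39)) skip) (setv 40 k s)"
  define J where "J k t \<longleftrightarrow> vr t 6 = hb \<and> (\<forall>i<k. length (nb i) \<le> vr t 16) \<and>
     (vr t 16 = 0 \<or> (\<exists>i<l. vr t 16 = length (nb i)))" for k and t :: st
  have "J l (floop ?f l s)"
  proof (rule floop_inv[where P = J])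
    show "J 0 s" using s by (simp add: J_def)
  next
    fix k t assume k: "k < l" and J: "J k t"
    have ld: "sem load_nbrs (setv 37 k (setv 40 k t)) = setv 39 (length (nb k)) (setv 38 (inp (hb + 1 + k)) (setv 37 k (setv 40 k t)))"
      using J k s(3) by (intro load_nbrs_spec) (simp_all add: J_def)
    show "J (Suc k) (?f k t)" using J k by (auto simp: J_def ld less_Suc_eq)
  qed
  then show "\<forall>i<l. length (nb i) \<le> vr (sem maxdeg s) 16" "vr (sem maxdeg s) 16 = 0 \<or> (\<exists>i<l. vr (sem maxdeg s) 16 = length (nb i))"
    using s(2) by (simp_all add: maxdeg_def J_def)
qed

lemma dg_small: "x < b \<Longrightarrow> (dg 0)(0 := x) = dg x"
proof
  fix j assume x: "x < b"
  show "((dg 0)(0 := x)) j = dg x j"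
  proof (cases "j = 0")
    case False
    then have "b ^ 1 \<le> b ^ j" using b_pos by (intro power_increasing) auto
    then have "x < b ^ j" using x by simp
    then show ?thesis using False by (simp add: dig_def)
  qed (use x L1 in \<open>simp add: dig_def\<close>)
qed

lemma falling_spec:
  assumes v: "vr s 7 = m" "vr s 8 = L" "vr s 9 = b" and x: "x < 20" "vr s x = l" "l < b"
    and r: "r \<in> {8, 9}" "ar s 3 r = dg 0" "ar s 3 4 = dg 1" "canon s"
  shows "\<exists>c e. ar (sem (falling (Num r) (Var x)) s) = (ar s)(3 := (ar s 3)(r := dg (\<Prod>i<m. l - i), 11 := dg c, 12 := dg e))"
proof -
  let ?c = "Cond (Var 43) (Var x) (Put 3 (Num 11) (Num 0) (Bin Sub (Var x) (Var 43))) skip"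
  let ?f = "\<lambda>k s. sem (bclear (Num 11) ;; ?c ;; bclear (Num 12) ;; bmac (Num 12) (Num r) (Num 11) ;; bclear (Num r) ;; bmac (Num r) (Num 12) (Num 4)) (setv 43 k s)"
  let ?P = "\<lambda>k. \<Prod>i<k. l - i"
  have rr: "r mod 2 ^ w = r" "r mod S = r" "r < S" "r \<noteq> 11" "r \<noteq> 12" "r \<noteq> 4" using r(1) rows by auto
  define J where "J k t \<longleftrightarrow> vr t 8 = L \<and> vr t 9 = b \<and> vr t x = l \<and>
    (\<exists>c e. ar t = (ar s)(3 := (ar s 3)(r := dg (?P k), 11 := dg c, 12 := dg e)))" for k and t :: st
  let ?s0 = "seta 3 r 0 1 s"
  obtain c0 where c0: "ar s 3 11 = dg c0" using canonD[OF r(4)] by blast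
  obtain e0 where e0: "ar s 3 12 = dg e0" using canonD[OF r(4)] by blast
  have "J m (floop ?f m ?s0)"
  proof (rule floop_inv[where P = J])
    have "(dg 0)(0 := 1) = dg 1" using b2 by (intro dg_small) simp
    then have "ar ?s0 = (ar s)(3 := (ar s 3)(r := dg 1))" using r(2) by simp
    also have "(ar s 3)(r := dg 1) = (ar s 3)(r := dg 1, 11 := dg c0, 12 := dg e0)"
      by (rule ext) (use c0 e0 rr in auto)
    finally have "ar ?s0 = (ar s)(3 := (ar s 3)(r := dg 1, 11 := dg c0, 12 := dg e0))" .
    then show "J 0 ?s0" using v x unfolding J_def by auto
  next
    fix k t0 assume k: "k < m" and "J k t0"
    then obtain c e where t0: "vr t0 8 = L" "vr t0 9 = b" "vr t0 x = l"
      "ar t0 = (ar s)(3 := (ar s 3)(r := dg (?P k), 11 := dg c, 12 := dg e))" by (auto simp: J_def)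
    let ?t = "setv 43 k t0"
    let ?t1 = "sem (bclear (Num 11)) ?t"
    define tt where "tt = sem ?c ?t1"
    let ?t2 = "tt"
    let ?t3 = "sem (bclear (Num 12)) ?t2"
    let ?t4 = "sem (bmac (Num 12) (Num r) (Num 11)) ?t3"
    let ?t5 = "sem (bclear (Num r)) ?t4"
    let ?t6 = "sem (bmac (Num r) (Num 12) (Num 4)) ?t5"
    have fr: "vr ?t1 y = vr ?t y" "vr ?t2 y = vr ?t y" "vr ?t3 y = vr ?t y" "vr ?t4 y = vr ?t y" "vr ?t5 y = vr ?t y"
      "vr ?t6 y = vr ?t y" if "y < 20 \<or> y = 43" for y
    proof -
      show 1: "vr ?t1 y = vr ?t y" using that by (intro vr_bclear) auto
      have 2: "vr ?t2 y = vr ?t1 y" unfolding tt_def using that by (intro vr_frame) auto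
      have 3: "vr ?t3 y = vr ?t2 y" using that by (intro vr_bclear) auto
      have 4: "vr ?t4 y = vr ?t3 y" using that by (intro vr_bmac) auto
      have 5: "vr ?t5 y = vr ?t4 y" using that by (intro vr_bclear) auto
      have 6: "vr ?t6 y = vr ?t5 y" using that by (intro vr_bmac) auto
      show "vr ?t2 y = vr ?t y" "vr ?t3 y = vr ?t y" "vr ?t4 y = vr ?t y" "vr ?t5 y = vr ?t y" "vr ?t6 y = vr ?t y"
        using 1 2 3 4 5 6 by simp_all
    qed
    have v8: "vr ?t 8 = L" "vr ?t 9 = b" "vr ?t x = l" "vr ?t 43 = k" using t0 x(1) by simp_all
    have a1: "ar ?t1 = (ar s)(3 := (ar s 3)(r := dg (?P k), 11 := dg 0, 12 := dg e))"
      using bclear_spec[of ?t "Num 11" 11 c] t0 v8 rows rr by (auto simp: fun_eq_iff)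
    have a2: "ar ?t2 = (ar s)(3 := (ar s 3)(r := dg (?P k), 11 := dg (l - k), 12 := dg e))"
    proof (cases "k < l")
      case True
      have lw: "l < 2 ^ w" using x(3) sizes(8) by linarith
      have t2: "?t2 = seta 3 11 0 (l - k) ?t1" using fr(1)[of x] fr(1)[of 43] v8 x(1) True lw by (simp add: tt_def binop_sub)
      have D: "(dg 0)(0 := l - k) = dg (l - k)" using x(3) by (intro dg_small) linarith
      have x11: "ar ?t1 3 11 = dg 0" unfolding a1 by simp
      have "ar ?t2 = (ar ?t1)(3 := (ar ?t1 3)(11 := dg (l - k)))" unfolding t2 seta_simps x11 D ..
      then show ?thesis unfolding a1 by (auto simp: fun_eq_iff)
    next
      case False
      then have "?t2 = setv 27 0 ?t1" using fr(1)[of x] fr(1)[of 43] v8 x(1) by (simp add: tt_def)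
      then show ?thesis using a1 False by simp
    qed
    have a3: "ar ?t3 = (ar s)(3 := (ar s 3)(r := dg (?P k), 11 := dg (l - k), 12 := dg 0))"
      using bclear_spec[of ?t2 "Num 12" 12 e] fr(2)[of 8] a2 v8 rows rr by (auto simp: fun_eq_iff)
    have a4: "ar ?t4 = (ar s)(3 := (ar s 3)(r := dg (?P k), 11 := dg (l - k), 12 := dg (?P k * (l - k))))"
      using bmac_spec[of ?t3 "Num 12" 12 "Num r" r "Num 11" 11 0 "?P k" "l - k"] fr(3)[of 8] fr(3)[of 9] a3 v8 rows rr
      by (auto simp: fun_eq_iff)
    have a5: "ar ?t5 = (ar s)(3 := (ar s 3)(r := dg 0, 11 := dg (l - k), 12 := dg (?P k * (l - k))))"
      using bclear_spec[of ?t4 "Num r" r "?P k"] fr(4)[of 8] a4 v8 rows rr by (auto simp: fun_eq_iff)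
    have a6: "ar ?t6 = (ar s)(3 := (ar s 3)(r := dg (?P k * (l - k)), 11 := dg (l - k), 12 := dg (?P k * (l - k))))"
      using bmac_spec[of ?t5 "Num r" r "Num 12" 12 "Num 4" 4 0 "?P k * (l - k)" 1] fr(5)[of 8] fr(5)[of 9] a5 v8 rows rr r(3)
      by (auto simp: fun_eq_iff)
    have fk: "?f k t0 = ?t6" by (simp only: tt_def sem.simps(3))
    show "J (Suc k) (?f k t0)" unfolding J_def fk
    proof (intro conjI)
      show "\<exists>c e. ar ?t6 = (ar s)(3 := (ar s 3)(r := dg (?P (Suc k)), 11 := dg c, 12 := dg e))"
        using a6 by auto
    qed (use fr(6) v8 x(1) in simp_all)
  qed
  moreover have "sem (falling (Num r) (Var x)) s = setv 43 m (floop ?f m ?s0)"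
    unfolding falling_def sem.simps(3) using v(1) rr by simp
  ultimately show ?thesis by (auto simp: J_def)
qed

lemma save_spec:
  assumes v: "vr s 7 = m" "vr s 12 = m + 1" and r: "r \<in> {8, 9}" "ar s 3 r = dg 0" "ar s 3 7 = dg y"
  shows "ar (sem (save (Num r)) s) = (ar s)(3 := (ar s 3)(r := dg (y div b ^ (m * (m + 1)) mod b ^ (m + 1))))"
proof -
  let ?f = "\<lambda>k s. sem (Put 3 (Num r) (Var 45) (Arr 3 (Num 7) (Var 7 \<otimes> Var 12 \<oplus> Var 45))) (setv 45 k s)"
  let ?o = "m * (m + 1)"
  have rr: "r mod 2 ^ w = r" "r mod S = r" "r \<noteq> 7" using r(1) by auto
  have L: "L = ?o + (m + 1)" by (simp add: L_eq)
  let ?R = "\<lambda>k j. if j < k then dg y (?o + j) else 0"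
  define J where "J k t \<longleftrightarrow> vr t 7 = m \<and> vr t 12 = m + 1 \<and> ar t = (ar s)(3 := (ar s 3)(r := ?R k))" for k and t :: st
  have "J (m + 1) (floop ?f (m + 1) s)"
  proof (rule floop_inv[where P = J])
    have "?R 0 = ar s 3 r" using r(2) by (simp add: fun_eq_iff)
    then have "(ar s)(3 := (ar s 3)(r := ?R 0)) = ar s" by (simp only: fun_upd_triv)
    then show "J 0 s" using v by (simp only: J_def)
  next
    fix k t assume k: "k < m + 1" and J: "J k t"
    have "?o + k < L" using k L by linarith
    then have i: "?o + k < S" "?o + k < 2 ^ w" "?o < 2 ^ w" "k < S" using LS sizes by linarith+
    have "(?R k)(k := dg y (?o + k)) = ?R (Suc k)" by (rule ext) auto
    then show "J (Suc k) (?f k t)" using J i rr r(3) by (simp add: J_def)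
  qed
  moreover have "?R (m + 1) = dg (y div b ^ ?o mod b ^ (m + 1))"
  proof
    fix j
    show "?R (m + 1) j = dg (y div b ^ ?o mod b ^ (m + 1)) j"
    proof (cases "j < m + 1")
      case True
      have "dig b (m + 1) (y div b ^ ?o mod b ^ (m + 1)) j = dig b (m + 1) (y div b ^ ?o) j"
        by (simp only: dig_mod[OF b_pos])
      then have "y div b ^ ?o mod b ^ (m + 1) div b ^ j mod b = y div b ^ ?o div b ^ j mod b"
        using True by (simp only: dig_def if_True)
      then show ?thesis using True L by (simp add: dig_def power_add div_mult2_eq)
    next
      case False
      then have "b ^ (m + 1) \<le> b ^ j" using b_pos by (intro power_increasing) auto
      then have "y div b ^ ?o mod b ^ (m + 1) < b ^ j" using b_pos by (meson less_le_trans mod_less_divisor zero_less_power)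
      then show ?thesis using False by (simp add: dig_def)
    qed
  qed
  ultimately show ?thesis using v(2) by (simp add: save_def J_def del: One_nat_def)
qed

text \<open>One step of long division by d. The number c joins the remainder of the higher digits
  with the next digit; its quotient and remainder are the next quotient digit and the next
  remainder.\<close>

lemma div_digit:
  fixes x d i :: nat
  assumes "0 < d"
  defines "c \<equiv> x div b ^ Suc i mod d * b + x div b ^ i mod b"
  shows "x div d div b ^ i mod b = c div d" "x div b ^ i mod d = c mod d"
proof -
  define q where "q = x div b ^ i"
  define u where "u = q div b"
  have u: "u = x div b ^ Suc i" by (simp add: u_def q_def div_mult2_eq[symmetric] mult.commute)
  have c: "c = u mod d * b + q mod b" unfolding c_def u q_def ..
  have "q = u * b + q mod b" by (simp add: u_def)
  also have "\<dots> = (u div d * d + u mod d) * b + q mod b" by simp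
  also have "\<dots> = c + u div d * b * d" unfolding c by (simp only: distrib_right) simp
  finally have q: "q = c + u div d * b * d" .
  then show "x div b ^ i mod d = c mod d" unfolding q_def[symmetric] by (metis mod_mult_self1)
  have "u mod d * b + q mod b < (u mod d + 1) * b" using b_pos by simp
  also have "\<dots> \<le> d * b" using assms(1) by (intro mult_le_mono1) (simp add: Suc_leI)
  finally have "c div d < b" unfolding c by (simp add: less_mult_imp_div_less mult.commute)
  moreover have "q div d = u div d * b + c div d" using q assms(1) by (metis add.commute div_mult_self1 less_not_refl)
  moreover have "x div d div b ^ i = q div d" by (simp add: q_def div_mult2_eq[symmetric] mult.commute)
  ultimately show "x div d div b ^ i mod b = c div d" by simp
qed

definition rowpar :: "st \<Rightarrow> bool" where
  "rowpar s \<longleftrightarrow> vr s 7 = m \<and> vr s 8 = L \<and> vr s 9 = b \<and> vr s 12 = m + 1"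

lemma digit_facts:
  assumes "1 \<le> d" "d < b" "x < b ^ (m + 1)" "j < m + 1"
  shows "x div b ^ (m + 1 - j) mod d * b + x div b ^ (m - j) mod b < 2 ^ w"
    "x div b ^ (m + 1 - j) mod d * b < 2 ^ w" "dg x (m - j) = x div b ^ (m - j) mod b" "m + 1 - j = Suc (m - j)"
    "x div b ^ (m - j) mod b < b" "x div b ^ (m + 1 - j) mod d < d"
proof -
  show "x div b ^ (m - j) mod b < b" "x div b ^ (m + 1 - j) mod d < d" using b_pos assms by auto
  then have "x div b ^ (m + 1 - j) mod d * b + x div b ^ (m - j) mod b < (x div b ^ (m + 1 - j) mod d + 1) * b" by simp
  also have "\<dots> \<le> d * b" using \<open>x div b ^ (m + 1 - j) mod d < d\<close> by (intro mult_le_mono1) simp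
  also have "\<dots> \<le> b * b" using assms(2) by simp
  also have "\<dots> \<le> 2 ^ w" by (rule bb)
  finally show "x div b ^ (m + 1 - j) mod d * b + x div b ^ (m - j) mod b < 2 ^ w" .
  then show "x div b ^ (m + 1 - j) mod d * b < 2 ^ w" by linarith
  have "m - j < L" using m_le_L by linarith
  then show "dg x (m - j) = x div b ^ (m - j) mod b" by (simp add: dig_def)
qed (use assms in simp)

lemma mod_mod_word: "1 \<le> d \<Longrightarrow> d < 2 ^ w \<Longrightarrow> c mod d mod 2 ^ w = c mod (d :: nat)"
  by (rule mod_less) (rule less_trans[OF mod_less_divisor], auto)

lemma rem_row_spec:
  assumes p: "rowpar s" and r: "r \<in> {8, 9}" "ar s 3 r = dg x" "x < b ^ (m + 1)" and d: "vr s 75 = d" "1 \<le> d" "d < b"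
  shows "vr (sem (rem_row (Num r)) s) 73 = x mod d"
proof -
  let ?f = "\<lambda>k s. sem (Asg 73 (Bin Mod (Var 73 \<otimes> Var 9 \<oplus> digit (Num r)) (Var 75))) (setv 74 k s)"
  have rr: "r mod 2 ^ w = r" "r mod S = r" using r(1) by auto
  have dw: "d < 2 ^ w" using d(3) sizes(8) by linarith
  define J where "J j t \<longleftrightarrow> rowpar t \<and> ar t 3 r = dg x \<and> vr t 75 = d \<and> vr t 73 = x div b ^ (m + 1 - j) mod d" for j and t :: st
  have "J (m + 1) (floop ?f (m + 1) (setv 73 0 s))"
  proof (rule floop_inv[where P = J])
    show "J 0 (setv 73 0 s)" using p r d by (simp add: J_def rowpar_def del: power_Suc)
  next
    fix j t assume j: "j < m + 1" and J: "J j t"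
    note df = digit_facts[OF d(2,3) r(3) j]
    let ?c = "x div b ^ (m + 1 - j) mod d * b + x div b ^ (m - j) mod b"
    have mj: "m < 2 ^ w" "j \<le> m" "m - j < S" using j cols sizes by linarith+
    have "ev (setv 74 j t) (digit (Num r)) = x div b ^ (m - j) mod b"
      using J mj rr df(3) by (simp add: digit_def J_def rowpar_def binop_sub)
    then have "ev (setv 74 j t) (Bin Mod (Var 73 \<otimes> Var 9 \<oplus> digit (Num r)) (Var 75)) = ?c mod d mod 2 ^ w"
      using J df(1,2) by (simp add: J_def rowpar_def)
    also have "?c mod d mod 2 ^ w = ?c mod d" by (rule mod_mod_word[OF d(2) dw])
    also have "\<dots> = x div b ^ (m - j) mod d" using div_digit(2)[of d x "m - j"] d df(4) by simp
    finally have "?f j t = setv 73 (x div b ^ (m - j) mod d) (setv 74 j t)" by simp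
    then show "J (Suc j) (?f j t)" using J by (simp add: J_def rowpar_def)
  qed
  moreover have "sem (Asg 73 (Num 0)) s = setv 73 0 s" "vr (setv 73 0 s) 12 = m + 1" using p by (simp_all add: rowpar_def)
  then have "sem (rem_row (Num r)) s = setv 74 (m + 1) (floop ?f (m + 1) (setv 73 0 s))"
    unfolding rem_row_def sem.simps(3) sem.simps(5) by (simp_all only:)
  ultimately show ?thesis by (simp add: J_def del: floop.simps add_Suc_right One_nat_def)
qed

lemma div_row_spec:
  assumes p: "rowpar s" and r: "r \<in> {8, 9}" "ar s 3 r = dg x" "x < b ^ (m + 1)" and d: "vr s 75 = d" "1 \<le> d" "d < b"
  shows "ar (sem (div_row (Num r)) s) = (ar s)(3 := (ar s 3)(r := dg (x div d)))"
proof -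
  let ?body = "Asg 76 (Var 73 \<otimes> Var 9 \<oplus> digit (Num r)) ;;
   Put 3 (Num r) (Bin Sub (Var 7) (Var 74)) (Bin Div (Var 76) (Var 75)) ;; Asg 73 (Bin Mod (Var 76) (Var 75))"
  let ?f = "\<lambda>k s. sem ?body (setv 74 k s)"
  have rr: "r mod 2 ^ w = r" "r mod S = r" using r(1) by auto
  have dw: "d < 2 ^ w" using d(3) sizes(8) by linarith
  let ?R = "\<lambda>j i. if m + 1 - j \<le> i then dg (x div d) i else dg x i"
  define J where "J j t \<longleftrightarrow> rowpar t \<and> ar t = (ar s)(3 := (ar s 3)(r := ?R j)) \<and> vr t 75 = d \<and> vr t 73 = x div b ^ (m + 1 - j) mod d" for j and t :: st
  have "J (m + 1) (floop ?f (m + 1) (setv 73 0 s))"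
  proof (rule floop_inv[where P = J])
    have "dg (x div d) i = dg x i" if "m + 1 \<le> i" for i
    proof -
      have "b ^ (m + 1) \<le> b ^ i" using that b_pos by (intro power_increasing) auto
      then have "x < b ^ i" using r(3) by linarith
      moreover from this have "x div d < b ^ i" using div_le_dividend le_less_trans by blast
      ultimately show ?thesis by (simp add: dig_def)
    qed
    then have "?R 0 = ar s 3 r" using r(2) by auto
    then have "(ar s)(3 := (ar s 3)(r := ?R 0)) = ar s" by (simp only: fun_upd_triv)
    moreover have "x div b ^ (m + 1 - 0) mod d = 0" using r(3) by simp
    ultimately show "J 0 (setv 73 0 s)" using p d unfolding J_def by (simp add: rowpar_def)
  next
    fix j t assume j: "j < m + 1" and J: "J j t"
    note df = digit_facts[OF d(2,3) r(3) j]
    let ?c = "x div b ^ (m + 1 - j) mod d * b + x div b ^ (m - j) mod b"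
    have mj: "m < 2 ^ w" "j \<le> m" "m - j < S" "m - j < 2 ^ w" using j cols sizes by linarith+
    have "ev (setv 74 j t) (digit (Num r)) = x div b ^ (m - j) mod b"
      using J mj rr df(3,4) by (simp add: digit_def J_def rowpar_def binop_sub)
    then have e: "ev (setv 74 j t) (Var 73 \<otimes> Var 9 \<oplus> digit (Num r)) = ?c"
      using J df(1,2) by (simp add: J_def rowpar_def)
    have cd: "?c mod d mod 2 ^ w = ?c mod d" "?c div d mod 2 ^ w = ?c div d"
      by (rule mod_mod_word[OF d(2) dw], rule mod_less, rule le_less_trans[OF div_le_dividend df(1)])
    have dd: "?c div d = dg (x div d) (m - j)" "?c mod d = x div b ^ (m - j) mod d"
    proof -
      have "m - j < L" using m_le_L by linarith
      then show "?c div d = dg (x div d) (m - j)" using div_digit(1)[of d x "m - j"] d df(4) by (simp add: dig_def)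
      show "?c mod d = x div b ^ (m - j) mod d" using div_digit(2)[of d x "m - j"] d df(4) by simp
    qed
    have "?f j t = setv 73 (?c mod d) (seta 3 r (m - j) (?c div d) (setv 76 ?c (setv 74 j t)))"
      unfolding sem.simps(3) sem.simps(1)[of 76] e using J mj rr cd by (simp add: J_def rowpar_def binop_sub)
    then have f: "?f j t = setv 73 (x div b ^ (m - j) mod d) (seta 3 r (m - j) (dg (x div d) (m - j)) (setv 76 ?c (setv 74 j t)))"
      unfolding dd .
    have "(?R j)(m - j := dg (x div d) (m - j)) = ?R (Suc j)" using mj(2) by (auto simp: fun_eq_iff)
    then show "J (Suc j) (?f j t)" unfolding f using J by (simp add: J_def rowpar_def)
  qed
  moreover have "sem (Asg 73 (Num 0)) s = setv 73 0 s" "vr (setv 73 0 s) 12 = m + 1" using p by (simp_all add: rowpar_def)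
  then have "sem (div_row (Num r)) s = setv 74 (m + 1) (floop ?f (m + 1) (setv 73 0 s))"
    unfolding div_row_def sem.simps(3) sem.simps(5) by (simp_all only:)
  moreover have "(\<lambda>i. if m + 1 - (m + 1) \<le> i then dg (x div d) i else dg x i) = dg (x div d)" by simp
  ultimately show ?thesis by (simp only: J_def setv_simps)
qed

lemma fact_less: "fact m < (2::nat) ^ L"
proof -
  have "fact m \<le> m ^ m" by (metis fact_le_power of_nat_id)
  also have "\<dots> \<le> (2 ^ m) ^ m" using less_exp[of m] by (intro power_mono) auto
  also have "\<dots> = 2 ^ (m * m)" by (simp add: power_mult)
  also have "\<dots> < 2 ^ L" unfolding L_eq by (intro power_strict_increasing) auto
  finally show ?thesis .
qed

text \<open>Row 9 runs through divisors a' of a while row 8 stays q a'. If d still divided a' after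
  its L rounds, then d^L would divide a, but a \<le> m! < 2^L. In the end a' has no prime factor up
  to m and divides m!, hence is 1.\<close>

lemma cancel_spec:
  assumes p: "rowpar s" and mb: "m < b" and r: "ar s 3 8 = dg (q * a)" "ar s 3 9 = dg a" "q * a < b ^ (m + 1)" "a < b ^ (m + 1)"
    and q: "q = 0 \<or> a dvd fact m"
  shows "ar (sem cancel s) 3 8 = dg q"
proof -
  let ?in = "rem_row (Num 9) ;; Cond (Num 0) (Var 73) skip (div_row (Num 9) ;; div_row (Num 8))"
  let ?f = "\<lambda>k s. sem (Asg 75 (Var 71 \<oplus> Num 1) ;; For 72 8 ?in) (setv 71 k s)"
  let ?g = "\<lambda>k s. sem ?in (setv 72 k s)"
  define Q where "Q t a' \<longleftrightarrow> rowpar t \<and> a' dvd a \<and> a' \<le> a \<and> ar t 3 8 = dg (q * a') \<and> ar t 3 9 = dg a'" for t a'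
  have frp: "rowpar (sem ?in t)" "vr (sem ?in t) 75 = vr t 75" "vr (sem ?in t) 71 = vr t 71" if "rowpar t" for t
  proof -
    have "vr (sem ?in t) y = vr t y" if "y < 20 \<or> y = 75 \<or> y = 71" for y
      by (rule vr_frame) (use that in \<open>auto simp: rem_row_def div_row_def\<close>)
    then show "rowpar (sem ?in t)" "vr (sem ?in t) 75 = vr t 75" "vr (sem ?in t) 71 = vr t 71"
      using that by (simp_all add: rowpar_def)
  qed
  have bnd: "a' < b ^ (m + 1)" "q * a' < b ^ (m + 1)" if "a' \<le> a" for a'
    using that r(3,4) by (meson le_less_trans mult_le_mono2)+
  have inner: "\<exists>a'. Q (sem ?in t) a' \<and> a' dvd a0 \<and> a' = (if d dvd a0 then a0 div d else a0)"
    if Q: "Q t a0" and d: "vr t 75 = d" "1 \<le> d" "d \<le> m" for t a0 d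
  proof -
    have db: "d < b" using d mb by simp
    have t: "rowpar t" "a0 \<le> a" "ar t 3 8 = dg (q * a0)" "ar t 3 9 = dg a0" using Q by (simp_all add: Q_def)
    let ?u = "sem (rem_row (Num 9)) t"
    have u73: "vr ?u 73 = a0 mod d" by (rule rem_row_spec[OF t(1) _ t(4) bnd(1)[OF t(2)] d(1,2) db]) simp
    have ua: "ar ?u c = ar t c" for c by (rule ar_frame) (simp add: rem_row_def)
    have uv: "vr ?u y = vr t y" if "y < 20 \<or> y = 75 \<or> y = 71" for y by (rule vr_frame) (use that in \<open>auto simp: rem_row_def\<close>)
    have up: "rowpar ?u" "vr ?u 75 = d" using uv t(1) d by (simp_all add: rowpar_def)
    show ?thesis
    proof (cases "d dvd a0")
      case False
      then have "sem ?in t = setv 27 0 ?u" using u73 by (simp add: dvd_eq_mod_eq_0)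
      then have "Q (sem ?in t) a0" using Q up ua by (simp add: Q_def rowpar_def)
      then show ?thesis using False by auto
    next
      case True
      let ?v = "sem (div_row (Num 9)) ?u"
      have in_eq: "sem ?in t = sem (div_row (Num 8)) ?v" using u73 True by (simp add: dvd_eq_mod_eq_0)
      have av: "ar ?v = (ar t)(3 := (ar t 3)(9 := dg (a0 div d)))"
        using div_row_spec[OF up(1) _ _ bnd(1)[OF t(2)] up(2) d(2) db, of 9] t(4) ua by (auto simp: fun_eq_iff)
      have vv: "vr ?v y = vr ?u y" if "y < 20 \<or> y = 75" for y by (rule vr_frame) (use that in \<open>auto simp: div_row_def\<close>)
      have vp: "rowpar ?v" "vr ?v 75 = d" using vv up by (simp_all add: rowpar_def)
      have "ar (sem ?in t) = (ar ?v)(3 := (ar ?v 3)(8 := dg (q * a0 div d)))"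
        unfolding in_eq using div_row_spec[OF vp(1) _ _ bnd(2)[OF t(2)] vp(2) d(2) db, of 8] t(3) av by simp
      moreover have "q * a0 div d = q * (a0 div d)" using True by (simp add: div_mult_swap)
      moreover have "a0 div d dvd a" using Q True unfolding Q_def by (metis dvd_div_mult_self dvd_mult_left)
      moreover have "a0 div d \<le> a" using t(2) div_le_dividend le_trans by blast
      ultimately have "Q (sem ?in t) (a0 div d)" using frp(1)[OF t(1)] av by (simp add: Q_def)
      moreover have "a0 div d dvd a0" using True by (metis dvd_div_mult_self dvd_triv_left)
      ultimately show ?thesis using True by auto
    qed
  qed
  \<comment> \<open>The first two disjuncts keep the case q = 0 out of the loop proof: there nothing
    about a is known, but the result q a' = q holds anyway.\<close>
  define Inv where "Inv k t \<longleftrightarrow> (\<exists>a'. Q t a' \<and> (\<forall>e. 2 \<le> e \<and> e \<le> k \<longrightarrow> a = 0 \<or> \<not> a dvd fact m \<or> \<not> e dvd a'))" for k t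
  have "Inv m (floop ?f m s)"
  proof (rule floop_inv[where P = Inv])
    show "Inv 0 s" using p r unfolding Inv_def Q_def by (intro exI[of _ a]) simp
  next
    fix k t assume k: "k < m" and "Inv k t"
    then obtain a0 where a0: "Q t a0" "\<forall>e. 2 \<le> e \<and> e \<le> k \<longrightarrow> a = 0 \<or> \<not> a dvd fact m \<or> \<not> e dvd a0" by (auto simp: Inv_def)
    let ?d = "Suc k"
    let ?t = "setv 75 ?d (setv 71 k t)"
    have kw: "?d < 2 ^ w" using k sizes by linarith
    \<comment> \<open>As long as d divides the current number, every round so far has removed one
      factor d.\<close>
    define J where "J j t' \<longleftrightarrow> vr t' 75 = ?d \<and> (\<exists>a'. Q t' a' \<and> a' dvd a0 \<and> (\<not> ?d dvd a' \<or> a' * ?d ^ j dvd a))" for j and t' :: st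
    have "J L (floop ?g L ?t)"
    proof (rule floop_inv[where P = J])
      show "J 0 ?t" using a0(1) unfolding J_def Q_def by (auto simp: rowpar_def)
    next
      fix j t' assume "J j t'"
      then obtain a' where a': "vr t' 75 = ?d" "Q t' a'" "a' dvd a0" "\<not> ?d dvd a' \<or> a' * ?d ^ j dvd a" by (auto simp: J_def)
      have Q1: "Q (setv 72 j t') a'" using a'(2) by (simp add: Q_def rowpar_def)
      obtain a2 where a2: "Q (sem ?in (setv 72 j t')) a2" "a2 dvd a'" "a2 = (if ?d dvd a' then a' div ?d else a')"
        using inner[OF Q1, of ?d] a'(1) k by auto
      have "\<not> ?d dvd a2 \<or> a2 * ?d ^ Suc j dvd a"
      proof (cases "?d dvd a'")
        case True
        then have "a2 * ?d = a'" using a2(3) by (simp only: if_True dvd_div_mult_self)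
        then have "a2 * ?d ^ Suc j = a' * ?d ^ j" by (metis mult.assoc power_Suc)
        then show ?thesis using a'(4) True by simp
      qed (use a2(3) in simp)
      moreover have "vr (?g j t') 75 = ?d" using frp(2)[of "setv 72 j t'"] a'(1,2) by (simp add: Q_def rowpar_def)
      ultimately show "J (Suc j) (?g j t')" using a2 a'(3) dvd_trans unfolding J_def by blast
    qed
    then obtain a' where a': "Q (floop ?g L ?t) a'" "a' dvd a0" "\<not> ?d dvd a' \<or> a' * ?d ^ L dvd a" by (auto simp: J_def)
    have ft: "?f k t = setv 72 L (floop ?g L ?t)" using a0(1) kw by (simp add: Q_def rowpar_def)
    have "a = 0 \<or> \<not> a dvd fact m \<or> \<not> e dvd a'" if e: "2 \<le> e" "e \<le> Suc k" for e
    proof (cases "e = Suc k")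
      case False
      then have "a = 0 \<or> \<not> a dvd fact m \<or> \<not> e dvd a0" using a0(2) e by simp
      then show ?thesis using a'(2) dvd_trans by blast
    next
      case True
      show ?thesis
      proof (rule ccontr)
        assume H: "\<not> (a = 0 \<or> \<not> a dvd fact m \<or> \<not> e dvd a')"
        then have dv: "a' * ?d ^ L dvd a" using a'(3) True by simp
        have "a' \<noteq> 0" using H a'(1) by (auto simp: Q_def)
        have "(2::nat) ^ L \<le> ?d ^ L" using e True by (intro power_mono) auto
        also have "\<dots> \<le> a' * ?d ^ L" using \<open>a' \<noteq> 0\<close> by simp
        also have "\<dots> \<le> a" using dv H by (intro dvd_imp_le) auto
        also have "\<dots> \<le> fact m" using H by (intro dvd_imp_le) auto
        finally show False using fact_less by simp
      qed
    qed
    moreover have "Q (?f k t) a'" unfolding ft using a'(1) by (simp add: Q_def rowpar_def)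
    ultimately show "Inv (Suc k) (?f k t)" unfolding Inv_def by blast
  qed
  then obtain a' where a': "Q (floop ?f m s) a'" "\<forall>e. 2 \<le> e \<and> e \<le> m \<longrightarrow> a = 0 \<or> \<not> a dvd fact m \<or> \<not> e dvd a'"
    by (auto simp: Inv_def)
  have "q * a' = q"
  proof (cases "q = 0")
    case False
    then have af: "a dvd fact m" using q by simp
    then have "a \<noteq> 0" by (metis dvd_0_left_iff fact_nonzero)
    have "a' = 1"
    proof (rule ccontr)
      assume "a' \<noteq> 1"
      then obtain pr where pr: "prime pr" "pr dvd a'" using prime_factor_nat by blast
      have "pr dvd fact m" using pr(2) a'(1) af unfolding Q_def by (meson dvd_trans)
      then have "pr \<le> m" using pr(1) prime_dvd_fact_iff by blast
      moreover have "2 \<le> pr" using pr(1) by (rule prime_ge_2_nat)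
      ultimately show False using a'(2) af \<open>a \<noteq> 0\<close> pr(2) by blast
    qed
    then show ?thesis by simp
  qed simp
  moreover have "ar (floop ?f m s) 3 8 = dg (q * a')" using a'(1) by (simp only: Q_def)
  moreover have "sem cancel s = setv 71 m (floop ?f m s)"
  proof -
    have "vr s 7 = m" using p by (simp add: rowpar_def)
    then show ?thesis unfolding cancel_def sem.simps(5) by (simp only:)
  qed
  ultimately show ?thesis by (simp only: setv_simps)
qed

lemma emit_spec:
  assumes p: "rowpar s" and W: "b * vr s 13 = 2 ^ w" and r: "ar s 3 8 = dg x" "x < b ^ (m + 1)" and z: "\<forall>i<m+1. ar s 11 0 i = 0"
    and bd: "\<forall>i. ar s 11 0 i < 2 ^ w"
  shows "(\<Sum>i<m+1. ar (sem emit s) 11 0 i * (2 ^ w) ^ i) = x"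
proof -
  let ?W = "(2 :: nat) ^ w" and ?h = "vr s 13"
  let ?ib = "Asg 78 (Arr 11 (Num 0) (Var 77)) ;;
       Put 11 (Num 0) (Var 77) (Var 78 \<otimes> Var 9 \<oplus> Var 76) ;; Asg 76 (Bin Div (Var 78) (Var 13))"
  let ?f = "\<lambda>k s. sem (Asg 76 (digit (Num 8)) ;; For 77 12 ?ib) (setv 74 k s)"
  let ?g = "\<lambda>k s. sem ?ib (setv 77 k s)"
  have h0: "0 < ?h" using W by (metis gr0I mult_0_right power_not_zero zero_neq_numeral)
  define C where "C t \<longleftrightarrow> rowpar t \<and> vr t 13 = ?h \<and> ar t 3 8 = dg x \<and> (\<forall>i. ar t 11 0 i < ?W)" for t
  define S' where "S' t k = (\<Sum>i<k. ar t 11 0 i * ?W ^ i)" for t :: st and k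
  define Inv where "Inv k t \<longleftrightarrow> C t \<and> S' t (m + 1) = x div b ^ (m + 1 - k)" for k t
  have "Inv (m + 1) (floop ?f (m + 1) s)"
  proof (rule floop_inv[where P = Inv])
    show "Inv 0 s" using p r z bd by (simp add: Inv_def C_def S'_def)
  next
    fix k t assume k: "k < m + 1" and t: "Inv k t"
    have Ct: "C t" and St: "S' t (m + 1) = x div b ^ (m + 1 - k)" using t by (simp_all add: Inv_def)
    let ?c0 = "x div b ^ (m - k) mod b"
    have mj: "m < 2 ^ w" "k \<le> m" "m - k < S" using k cols sizes by linarith+
    have "m - k < L" using m_le_L by linarith
    then have "dg x (m - k) = ?c0" by (simp add: dig_def)
    then have "ev (setv 74 k t) (digit (Num 8)) = ?c0"
      using Ct mj by (simp add: digit_def C_def rowpar_def binop_sub)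
    then have a0: "sem (Asg 76 (digit (Num 8))) (setv 74 k t) = setv 76 ?c0 (setv 74 k t)" by simp
    let ?t = "setv 76 ?c0 (setv 74 k t)"
    define J where "J j t' \<longleftrightarrow> C t' \<and> vr t' 76 < b \<and> (\<forall>i\<ge>j. ar t' 11 0 i = ar t 11 0 i) \<and>
       S' t' j + vr t' 76 * ?W ^ j = ?c0 + b * S' t j" for j and t' :: st
    have J: "J (m + 1) (floop ?g (m + 1) ?t)"
    proof (rule floop_inv[where P = J])
      show "J 0 ?t" using Ct b_pos by (simp add: J_def C_def rowpar_def S'_def)
    next
      fix j t' assume j: "j < m + 1" and "J j t'"
      then have t': "C t'" "vr t' 76 < b" "\<forall>i\<ge>j. ar t' 11 0 i = ar t 11 0 i" "S' t' j + vr t' 76 * ?W ^ j = ?c0 + b * S' t j"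
        by (simp_all add: J_def)
      let ?y = "ar t 11 0 j" and ?cy = "vr t' 76"
      have y: "ar t' 11 0 j = ?y" "?y < ?W" using t' Ct by (simp_all add: C_def)
      define u where "u = ?y div ?h"
      define l where "l = ?y mod ?h * b"
      have ub: "u < b" unfolding u_def using y(2) W by (simp add: less_mult_imp_div_less mult.commute)
      have yb: "?y * b = u * ?W + l"
      proof -
        have "?y * b = (?y div ?h * ?h + ?y mod ?h) * b" by (simp only: div_mult_mod_eq)
        also have "\<dots> = u * (b * ?h) + l" by (simp only: distrib_right u_def l_def) (simp add: mult_ac)
        finally show ?thesis unfolding W .
      qed
      \<comment> \<open>The low part of y b is a multiple of b, so a carry smaller than b can be
        added without overflow.\<close>
      have lb: "l + b \<le> ?W"
      proof -
        have "l + b = (?y mod ?h + 1) * b" by (simp add: l_def)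
        also have "\<dots> \<le> ?h * b" using mod_less_divisor[OF h0, of ?y] by (intro mult_le_mono1) simp
        finally show ?thesis using W by (simp add: mult.commute)
      qed
      have lW: "l < ?W" "l + ?cy < ?W" using lb t'(2) b_pos by linarith+
      have m1: "?y * b mod ?W = l" unfolding yb using lW by simp
      have uW: "u mod ?W = u" using ub sizes(8) by simp
      have jS: "j mod S = j" using j cols by simp
      have f: "?g j t' = setv 76 u (seta 11 0 j (l + ?cy) (setv 78 ?y (setv 77 j t')))"
        using t'(1) y m1 lW jS uW u_def by (simp add: C_def rowpar_def)
      have s1: "S' (?g j t') j = S' t' j" unfolding f S'_def by (intro sum.cong) auto
      have "S' (?g j t') (Suc j) + u * ?W ^ Suc j = S' t' j + (l + ?cy) * ?W ^ j + u * ?W ^ Suc j"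
      proof -
        have a: "ar (?g j t') 11 0 j = l + ?cy" unfolding f by simp
        have "S' (?g j t') (Suc j) = S' (?g j t') j + ar (?g j t') 11 0 j * ?W ^ j" by (simp only: S'_def sum.lessThan_Suc)
        then show ?thesis unfolding s1 a by (simp only:)
      qed
      also have "\<dots> = (S' t' j + ?cy * ?W ^ j) + (u * ?W + l) * ?W ^ j" by (simp add: algebra_simps)
      also have "\<dots> = ?c0 + b * S' t j + ?y * b * ?W ^ j" unfolding t'(4) yb ..
      also have "\<dots> = ?c0 + b * S' t (Suc j)" by (simp add: S'_def algebra_simps)
      finally have fin: "S' (?g j t') (Suc j) + u * ?W ^ Suc j = ?c0 + b * S' t (Suc j)" .
      have "C (?g j t')" unfolding f using t'(1) lW by (simp add: C_def rowpar_def)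
      moreover have "vr (?g j t') 76 = u" unfolding f by simp
      moreover have "\<forall>i\<ge>Suc j. ar (?g j t') 11 0 i = ar t 11 0 i" unfolding f using t'(3) by simp
      ultimately show "J (Suc j) (?g j t')" unfolding J_def using ub fin by metis
    qed
    define v where "v = floop ?g (m + 1) ?t"
    have v12: "vr ?t 12 = m + 1" using Ct by (simp add: C_def rowpar_def)
    have fe: "?f k t = setv 77 (m + 1) v" unfolding sem.simps(3) a0 sem.simps(5) v12 v_def by (simp only:)
    have Jv: "C v" "S' v (m + 1) + vr v 76 * ?W ^ (m + 1) = ?c0 + b * S' t (m + 1)" using J by (simp_all add: J_def v_def del: floop.simps)
    have x1: "?c0 + b * S' t (m + 1) = x div b ^ (m - k)"
    proof -
      have "m + 1 - k = Suc (m - k)" using k by simp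
      then have "x div b ^ (m + 1 - k) = x div b ^ (m - k) div b" by (simp add: div_mult2_eq[symmetric] mult.commute)
      then show ?thesis unfolding St by simp
    qed
    \<comment> \<open>The leading part of x fits into m + 1 words, so no carry is left after the
      last one.\<close>
    have "x div b ^ (m - k) < ?W ^ (m + 1)"
    proof -
      have "x div b ^ (m - k) \<le> x" by (rule div_le_dividend)
      also have "x < b ^ (m + 1)" by (rule r(2))
      also have "\<dots> \<le> ?W ^ (m + 1)" using sizes(8) by (intro power_mono) auto
      finally show ?thesis .
    qed
    then have "vr v 76 * ?W ^ (m + 1) < 1 * ?W ^ (m + 1)" using Jv(2) x1 by linarith
    then have "vr v 76 = 0" by (metis less_one mult_less_cancel2)
    then have "S' v (m + 1) = x div b ^ (m - k)" using Jv(2) x1 by simp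
    then show "Inv (Suc k) (?f k t)" unfolding fe Inv_def using Jv(1) by (simp add: C_def rowpar_def S'_def)
  qed
  moreover have "sem emit s = setv 74 (m + 1) (floop ?f (m + 1) s)"
  proof -
    have "vr s 12 = m + 1" using p by (simp add: rowpar_def)
    then show ?thesis unfolding emit_def sem.simps(5) by (simp only:)
  qed
  ultimately show ?thesis by (simp add: Inv_def S'_def del: floop.simps sum.lessThan_Suc)
qed

end


section \<open>The total time of one count\<close>

definition timeK :: nat where
  "timeK = csize x_begin + csize x_end + csize v_begin + csize v_end + 9 * (csize stepA + csize dfs + 5) + 10"

definition timeE :: nat where
  "timeE = nest (\<lambda>p. \<not> p = 5) x_begin + nest (\<lambda>p. \<not> p = 5) x_end + nest (\<lambda>p. \<not> p = 5) v_begin +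
     nest (\<lambda>p. \<not> p = 5) v_end + nest (\<lambda>p. \<not> p = 10) stepA + nest (\<lambda>p. \<not> p = 10) dfs + 2"

context pattern0
begin

text \<open>The exponential factors are 2^m sets X, (6 D)^m calls per start vertex and D^m maps per
  leaf, and 2 times 6 D times D is 12 D^2 \<le> (4 D)^2. The single factor D of a step is absorbed
  by D^m, since m \<ge> 1.\<close>

lemma mainT_bound:
  assumes hn: "1 \<le> hn" and m: "1 \<le> m"
  shows "mainT \<le> timeK * L ^ timeE * (hn * (4 * D) ^ (2 * m))"
proof -
  let ?P = "L ^ timeE"
  have Lp: "L ^ e \<le> ?P" if "e \<le> timeE" for e using that L1 by (intro power_increasing) auto
  have P1: "1 \<le> ?P" using L1 by simp
  have D1': "1 \<le> D ^ m" "D \<le> D ^ m" using D1 m self_le_power[of D m] by auto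
  define Q where "Q = (6 * D) ^ m * D ^ m"
  have Q1: "1 \<le> (6 * D) ^ m" "1 \<le> Q" "D ^ m \<le> Q" using D1 by (auto simp: Q_def)
  have A: "costA \<le> csize stepA * ?P * D ^ m"
    unfolding costA_def using D1' by (intro mult_le_mono Lp) (auto simp: timeE_def)
  have F: "(m + 1) ^ 3 * D ^ m * (costF + 2) \<le> (csize dfs + 2) * ?P * D ^ m"
  proof -
    let ?e = "nest (\<lambda>p. \<not> p = 10) dfs"
    have "(m + 1) ^ 3 \<le> (m + 1) ^ 4" by (intro power_increasing) auto
    also have "\<dots> = L ^ 2" by (simp only: L_eq power2_eq_square[symmetric] power_mult[symmetric]) simp
    finally have 1: "(m + 1) ^ 3 \<le> L ^ 2" .
    have "costF + 2 \<le> csize dfs * L ^ ?e + 2 * L ^ ?e" unfolding costF_def using L1 by (intro add_left_mono) simp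
    then have "costF + 2 \<le> (csize dfs + 2) * L ^ ?e" by (simp only: distrib_right)
    then have "(m + 1) ^ 3 * (costF + 2) \<le> L ^ 2 * ((csize dfs + 2) * L ^ ?e)" using 1 by (intro mult_le_mono)
    also have "\<dots> = (csize dfs + 2) * L ^ (2 + ?e)" by (simp only: power_add mult.left_commute)
    also have "\<dots> \<le> (csize dfs + 2) * ?P" by (intro mult_le_mono2 Lp) (simp add: timeE_def)
    finally have "(m + 1) ^ 3 * (costF + 2) * D ^ m \<le> (csize dfs + 2) * ?P * D ^ m" by (rule mult_le_mono1)
    then show ?thesis by (simp only: mult.assoc mult.left_commute mult.commute)
  qed
  have PD: "1 \<le> ?P * D ^ m" using P1 D1' by simp
  define X where "X = costA + ((m + 1) ^ 3 * D ^ m * (costF + 2) + 1) + 2"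
  have "X \<le> (csize stepA + csize dfs + 5) * (?P * D ^ m)"
    unfolding X_def using A F PD by (simp only: distrib_right mult.assoc)
  then have "9 * (6 * D) ^ m * X \<le> 9 * (6 * D) ^ m * ((csize stepA + csize dfs + 5) * (?P * D ^ m))" by (rule mult_le_mono2)
  also have "\<dots> = 9 * (csize stepA + csize dfs + 5) * (?P * Q)" by (simp only: Q_def mult.assoc mult.left_commute mult.commute)
  finally have R: "9 * (6 * D) ^ m * X \<le> 9 * (csize stepA + csize dfs + 5) * (?P * Q)" .
  have PQ: "1 \<le> ?P * Q" "?P \<le> ?P * Q" using P1 Q1 by auto
  have O: "costO c \<le> csize c * (?P * Q)" if "nest (\<lambda>p. p = 5) c = 0" "nest (\<lambda>p. \<not> p = 5) c \<le> timeE" for c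
    unfolding costO_def that(1) using Lp[OF that(2)] PQ(2) by (simp add: le_trans)
  have O2: "costO x_end \<le> csize x_end * (?P * Q) * hn"
  proof -
    have "L ^ nest (\<lambda>p. \<not> p = 5) x_end \<le> ?P * Q" using Lp[of "nest (\<lambda>p. \<not> p = 5) x_end"] PQ(2) by (simp add: timeE_def le_trans)
    then show ?thesis unfolding costO_def nest_outer using hn by (intro mult_le_mono) auto
  qed
  have v: "(costO v_begin + (9 * (6 * D) ^ m * X + 1) + costO v_end) + 2 \<le>
     (csize v_begin + csize v_end + 9 * (csize stepA + csize dfs + 5) + 3) * (?P * Q)"
  proof -
    have "costO v_begin + (9 * (6 * D) ^ m * X + 1) + costO v_end + 2 = costO v_begin + costO v_end + 9 * (6 * D) ^ m * X + 3" by simp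
    also have "\<dots> \<le> csize v_begin * (?P * Q) + csize v_end * (?P * Q) + 9 * (csize stepA + csize dfs + 5) * (?P * Q) + 3 * (?P * Q)"
      using PQ(1) by (intro add_mono O R) (simp_all add: nest_outer timeE_def)
    finally show ?thesis by (simp only: distrib_right)
  qed
  have "xT + 3 \<le> timeK * (?P * Q) * hn"
  proof -
    let ?V = "(costO v_begin + (9 * (6 * D) ^ m * X + 1) + costO v_end) + 2"
    have "xT + 3 = costO x_begin + hn * ?V + costO x_end + 4" unfolding xT_def X_def by simp
    also have "\<dots> \<le> csize x_begin * (?P * Q) * hn + hn * ((csize v_begin + csize v_end + 9 * (csize stepA + csize dfs + 5) + 3) * (?P * Q)) +
       csize x_end * (?P * Q) * hn + 4 * (?P * Q) * hn"
    proof (intro add_mono)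
      show "costO x_begin \<le> csize x_begin * (?P * Q) * hn"
      proof (rule order_trans)
        show "costO x_begin \<le> csize x_begin * (?P * Q)" by (rule O) (simp_all add: nest_outer timeE_def)
        show "csize x_begin * (?P * Q) \<le> csize x_begin * (?P * Q) * hn" using mult_le_mono2[OF hn] by simp
      qed
      show "hn * ?V \<le> hn * ((csize v_begin + csize v_end + 9 * (csize stepA + csize dfs + 5) + 3) * (?P * Q))"
        using v by (rule mult_le_mono2)
      show "4 \<le> 4 * (?P * Q) * hn" using PQ(1) hn by simp
    qed (rule O2)
    also have "\<dots> = (csize x_begin + (csize v_begin + csize v_end + 9 * (csize stepA + csize dfs + 5) + 3) + csize x_end + 4) * ((?P * Q) * hn)"
      by (simp only: distrib_right mult.assoc mult.left_commute[of hn] mult.commute[of hn])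
    also have "\<dots> \<le> timeK * ((?P * Q) * hn)" by (intro mult_le_mono1) (simp add: timeK_def)
    finally show ?thesis by (simp only: mult.assoc)
  qed
  then have "2 ^ m * (xT + 3) \<le> 2 ^ m * (timeK * (?P * Q) * hn)" by (rule mult_le_mono2)
  moreover have "mainT \<le> 2 ^ m * (xT + 3)" unfolding mainT_def by (simp add: distrib_left)
  moreover have "2 ^ m * Q \<le> (4 * D) ^ (2 * m)"
  proof -
    have "2 ^ m * Q = (2 * (6 * D * D)) ^ m" by (simp only: Q_def power_mult_distrib mult.assoc)
    also have "\<dots> \<le> ((4 * D) ^ 2) ^ m" by (intro power_mono) (simp_all add: power2_eq_square)
    finally show ?thesis by (simp only: power_mult)
  qed
  then have "timeK * ?P * hn * (2 ^ m * Q) \<le> timeK * ?P * hn * (4 * D) ^ (2 * m)" by (rule mult_le_mono2)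
  ultimately show ?thesis by (simp only: mult.assoc mult.left_commute mult.commute)
qed

end

section \<open>The layout of the input\<close>

lemma length_encode: "length (encode A) = length A + 2 + length (concat A)"
  by (simp add: encode_def)

lemma encode_0: "encode A ! 0 = length A" by (simp add: encode_def)

lemma encode_offset: "v \<le> length A \<Longrightarrow> encode A ! Suc v = length (concat (take v A))"
  by (simp add: encode_def nth_append del: upt_Suc)

lemma encode_entry: "e < length (concat A) \<Longrightarrow> encode A ! (length A + 2 + e) = concat A ! e"
  by (simp add: encode_def nth_append del: upt_Suc)

lemma concat_entry:
  assumes "u < length A"
  shows "length (concat (take (Suc u) A)) = length (concat (take u A)) + length (A ! u)"
    "length (concat (take u A)) + length (A ! u) \<le> length (concat A)"
    "e < length (A ! u) \<Longrightarrow> concat A ! (length (concat (take u A)) + e) = A ! u ! e"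
proof -
  have A: "concat A = concat (take u A) @ A ! u @ concat (drop (Suc u) A)"
    using arg_cong[OF id_take_nth_drop[OF assms], of concat] by simp
  show "length (concat (take (Suc u) A)) = length (concat (take u A)) + length (A ! u)"
    using assms by (simp add: take_Suc_conv_app_nth)
  show "length (concat (take u A)) + length (A ! u) \<le> length (concat A)" unfolding A by simp
  show "e < length (A ! u) \<Longrightarrow> concat A ! (length (concat (take u A)) + e) = A ! u ! e" unfolding A by (simp add: nth_append)
qed

text \<open>Variable 18 becomes n if a search can be necessary, and 0 if G has no edge, m = 0 or n <
  m. It bounds the only loop over the vertices of G during the preparation. Whether G has edges is
  seen from its last offset alone, because for \<Delta> = 0 and m > 0 there is no time to read the
  lists.\<close>

definition init1 :: com where
  "init1 = Asg 4 (Inp (Num 0)) ;; Asg 14 (Inp (Var 4 \<oplus> Num 1)) ;; Asg 11 (Var 4 \<oplus> Num 2 \<oplus> Var 14) ;;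
     Asg 7 (Inp (Var 11)) ;; Asg 15 (Inp (Var 11 \<oplus> Var 7 \<oplus> Num 1)) ;; Asg 12 (Var 7 \<oplus> Num 1) ;;
     Asg 8 (Var 12 \<otimes> Var 12) ;; Asg 19 (Bin Div (Var 0) (Num 2)) ;; Asg 9 (Bin Shl (Num 1) (Var 19)) ;;
     Asg 13 (Bin Shl (Num 1) (Bin Sub (Var 0) (Var 19))) ;; Asg 18 (Var 4) ;;
     Cond (Var 14) (Num 1) (Asg 18 (Num 0)) skip ;; Cond (Var 7) (Num 1) (Asg 18 (Num 0)) skip ;;
     Cond (Var 4) (Var 7) (Asg 18 (Num 0)) skip ;;
     Asg 6 (Var 11) ;; Asg 5 (Var 7)"

text \<open>Variable 68 tells whether the two counts are run. If not, rows 8 and 9 already hold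
  numerator and denominator: the falling factorials of n and m when 18 is 0 and H has no edge, and
  otherwise twice 0, the answer being 0.\<close>

definition init2 :: com where
  "init2 = htable ;; Asg 6 (Num 0) ;; Asg 5 (Var 4) ;; maxdeg ;;
     Cond (Num 0) (Var 16) (Asg 10 (Var 16)) (Asg 10 (Num 1)) ;; Put 3 (Num 4) (Num 0) (Num 1) ;;
     neg_power (Num 5) (Num 0) ;; Asg 68 (Num 0) ;;
     Cond (Num 0) (Var 18) (Cond (Var 16) (Var 17) skip (Asg 68 (Num 1)))
       (Cond (Var 15) (Num 1) (falling (Num 8) (Var 4) ;; falling (Num 9) (Var 7)) skip) ;;
     Asg 62 (Var 68)"

text \<open>Secures the result for G, clears the accumulator and makes H the host.\<close>

definition mid :: com where
  "mid = Cond (Num 0) (Var 68) (save (Num 8)) skip ;; bclear (Num 7) ;; Asg 6 (Var 11) ;; Asg 5 (Var 7) ;; Asg 62 (Var 68)"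

definition final :: com where
  "final = Cond (Num 0) (Var 68) (save (Num 9)) skip ;; cancel ;; emit"

definition whole :: prog where
  "whole = Do init1 \<then> Do init2 \<then> main_prog \<then> Do mid \<then> main_prog \<then> Do final"

lemmas init_defs = init1_def init2_def mid_def final_def htable_def maxdeg_def falling_def save_def digit_def
  rem_row_def div_row_def cancel_def emit_def

lemma okc_init: "okc init1" "okc init2" "okc mid" "okc final"
  unfolding okc_def init_defs block_defs by simp_all

lemma lvars_init: "set (lvars init1) = {}" "set (lvars init2) \<subseteq> {7, 8, 18}" "set (lvars mid) \<subseteq> {7, 8, 12}"
    "set (lvars final) \<subseteq> {7, 8, 12}"
  unfolding init_defs block_defs by simp_all

lemma nest_init: "nest (\<lambda>p. p = 18) init2 = 1"
  unfolding init_defs block_defs by simp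

text \<open>Finds the total input length N from the last offsets of the two encodings and puts N^3
  into registers 2 and 3, on which all compiled addresses depend. Register 102 is still 0 and serves
  as the address of the first cell.\<close>

definition prefix_code :: program where
  "prefix_code = [Load 101 102, Const 103 1, Op Add 104 101 103, Load 105 104, Op Add 106 104 103, Op Add 106 106 105,
     Load 107 106, Op Add 108 106 107, Op Add 108 108 103, Load 109 108, Op Add 110 108 103, Op Add 110 110 109,
     Op Mul 2 110 110, Op Mul 2 2 110, Op Or 3 2 2]"

text \<open>Row 0 of array 11 starts at address S + 11 S S; the output has m + 1 words.\<close>

definition suffix_code :: program where
  "suffix_code = [Const 100 11, Op Mul 100 100 2, Op Mul 100 100 2, Op Add 0 100 3, Op Or 1 12 12]"

definition machine :: program where
  "machine = prefix_code @ lang.pcode whole (length prefix_code) @ suffix_code"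


section \<open>Both graphs as hosts of the same memory\<close>

text \<open>The input region is padded with zeros to S cells, so that one number serves as its size
  and as the side of the arrays.\<close>

locale job = big w S S inp b L for w S :: nat and inp b L +
  fixes G H :: "nat graph" and As Bs :: "nat list list" and n m N hh :: nat
  assumes simple: "simple_graph G" "simple_graph H" and lists: "adjacency_lists G As" "adjacency_lists H Bs"
    and n: "length As = n" and m: "length Bs = m" and N: "length (encode As @ encode Bs) = N"
    and inp: "\<And>a. inp a = (if a < N then (encode As @ encode Bs) ! a else 0)"
    and S: "S = N ^ 3" and L: "L = (m + 1) * (m + 1)" and b: "b = 2 ^ (w div 2)" and Nb: "N ^ 4 \<le> b" and Nw: "N ^ 9 \<le> 2 ^ w"
    and hh: "hh = length (encode As)"
begin

lemma N_eq: "N = n + 2 + length (concat As) + (m + 2 + length (concat Bs))" "hh = n + 2 + length (concat As)"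
  "N = hh + length (encode Bs)"
  using N hh by (simp_all add: length_encode n m)

lemma S_large: "16 * N \<le> S" "N \<le> S" "4 \<le> N"
proof -
  show 4: "4 \<le> N" using N_eq by simp
  then have "4 * 4 * N \<le> N * N * N" by (intro mult_le_mono) auto
  then show "16 * N \<le> S" by (simp add: S eval_nat_numeral)
  then show "N \<le> S" using 4 by linarith
qed

lemma w_large: "18 \<le> w"
proof (rule ccontr)
  assume "\<not> 18 \<le> w"
  then have "(2 :: nat) ^ w < 2 ^ 18" by (intro power_strict_increasing) auto
  moreover have "(4 :: nat) ^ 9 \<le> N ^ 9" using S_large(3) by (intro power_mono) auto
  ultimately show False using Nw by simp
qed

lemma S_w: "S < 2 ^ w" using cell_bound(7)[of 0 0 0] S_pos by simp

lemma N_b: "N < b"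
proof -
  have "N * 4 ^ 3 \<le> N * N ^ 3" using S_large(3) by (intro mult_le_mono power_mono) auto
  also have "\<dots> = N ^ 4" by (simp add: eval_nat_numeral)
  finally have "N * 64 \<le> N ^ 4" by simp
  then show ?thesis using Nb S_large(3) by linarith
qed

text \<open>Treats G (empty \<open>pre\<close>) and H (empty \<open>post\<close>) at once: only the
  offset of the encoding within the input differs.\<close>

lemma host_at:
  assumes x: "encode As @ encode Bs = pre @ encode A @ post" and g: "simple_graph K" "adjacency_lists K A"
    and d: "\<forall>u<length A. length (A ! u) \<le> D" "1 \<le> D" "D < 2 ^ w"
  shows "host w S S inp b L m D (length A) (length pre) ((!) A)"
proof -
  have len: "N = length pre + length (encode A) + length post" using N unfolding x by simp
  have i: "inp (length pre + i) = encode A ! i" if "i < length (encode A)" for i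
    using that len by (simp add: inp x nth_append)
  have nb: "distinct (A ! u)" "set (A ! u) = nbrs K u" if "u < length A" for u using g(2) that by (auto simp: adjacency_lists_def)
  have e: "v < length A" "u \<noteq> v" if "{v, u} \<in> edges K" for u v
    using g that by (auto simp: adjacency_lists_def simple_graph_def card_insert_if)
  have le: "length A + 2 + length pre + length (concat A) \<le> N" using len length_encode[of A] by simp
  have m': "m + 4 \<le> N" using N_eq by simp
  have off: "inp (length pre + 1 + u) = length (concat (take u A))" if "u \<le> length A" for u
    using i[of "Suc u"] that encode_offset[of u A] length_encode[of A] by simp
  show ?thesis
  proof unfold_locales
    show "L = (m + 1) * (m + 1)" by (rule L)
    show "length A + 17 \<le> S" "m + 6 \<le> S" "length pre + 2 + length A \<le> S" using le m' S_large by linarith+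
    show "D < 2 ^ w" "1 \<le> D" by fact+
    fix u assume u: "u < length A"
    show "length (A ! u) \<le> D" using d u by blast
    show "set (A ! u) \<subseteq> {..<length A}" using nb(2)[OF u] e by (auto simp: nbrs_def)
    show "inp (length pre + 2 + u) = inp (length pre + 1 + u) + length (A ! u)"
      using off[of u] off[of "Suc u"] concat_entry(1)[OF u] u by simp
    show "length pre + length A + 2 + inp (length pre + 1 + u) + length (A ! u) \<le> S"
      using off[of u] concat_entry(2)[OF u] u le S_large(2) by linarith
    show "inp (length pre + length A + 2 + inp (length pre + 1 + u) + e) = A ! u ! e" if "e < length (A ! u)" for e
    proof -
      let ?o = "length (concat (take u A))"
      have "?o + e < length (concat A)" using concat_entry(2)[OF u] that by linarith
      then have "inp (length pre + (length A + 2 + (?o + e))) = concat A ! (?o + e)"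
        using i[of "length A + 2 + (?o + e)"] encode_entry[of "?o + e" A] length_encode[of A] by simp
      also have "\<dots> = A ! u ! e" by (rule concat_entry(3)[OF u that])
      finally show ?thesis using off[of u] u by (simp add: add_ac)
    qed
    show "u \<in> set (A ! v)" if "v \<in> set (A ! u)" for v
      using that nb(2)[OF u] e[of v u] nb(2)[of v] by (auto simp: nbrs_def insert_commute)
    show "u \<notin> set (A ! u)" using nb(2)[OF u] e(2)[of u u] by (auto simp: nbrs_def)
    show "distinct (A ! u)" by (rule nb(1)[OF u])
  qed
qed

lemma verts: "verts G = {..<n}" "verts H = {..<m}" "finite (verts G)" "finite (verts H)"
  using lists n m by (auto simp: adjacency_lists_def)

lemma As_nb: "u < n \<Longrightarrow> distinct (As ! u)" "u < n \<Longrightarrow> set (As ! u) = nbrs G u"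
    "u < m \<Longrightarrow> distinct (Bs ! u)" "u < m \<Longrightarrow> set (Bs ! u) = nbrs H u"
  using lists n m by (auto simp: adjacency_lists_def)

lemma gadj_As: "u < n \<and> v < n \<and> v \<in> set (As ! u) \<longleftrightarrow> gadj G u v"
  using As_nb(2)[of u] simple(1) verts by (auto simp: nbrs_def gadj_def simple_graph_def insert_commute)

lemma gadj_Bs: "u < m \<and> v < m \<and> v \<in> set (Bs ! u) \<longleftrightarrow> gadj H u v"
  using As_nb(4)[of u] simple(2) verts by (auto simp: nbrs_def gadj_def simple_graph_def insert_commute)

lemma len_less: "u < n \<Longrightarrow> length (As ! u) < n + 1" "u < m \<Longrightarrow> length (Bs ! u) < m + 1"
proof -
  assume "u < n"
  then have "set (As ! u) \<subseteq> {..<n}" "distinct (As ! u)" using gadj_As[of u] As_nb[of u] simple verts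
    by (auto simp: nbrs_def simple_graph_def)
  then show "length (As ! u) < n + 1" using card_mono[of "{..<n}" "set (As ! u)"] by (simp add: distinct_card)
next
  assume "u < m"
  then have "set (Bs ! u) \<subseteq> {..<m}" "distinct (Bs ! u)" using As_nb[of u] simple verts
    by (auto simp: nbrs_def simple_graph_def)
  then show "length (Bs ! u) < m + 1" using card_mono[of "{..<m}" "set (Bs ! u)"] by (simp add: distinct_card)
qed

lemma hosts:
  assumes "1 \<le> D" "D < 2 ^ w"
  shows "\<forall>u<n. length (As ! u) \<le> D \<Longrightarrow> host w S S inp b L m D n 0 ((!) As)"
    "\<forall>u<m. length (Bs ! u) \<le> D \<Longrightarrow> host w S S inp b L m D m hh ((!) Bs)"
  using host_at[of "[]" As "encode Bs" G D] host_at[of "encode As" Bs "[]" H D] simple lists n m hh assms by simp_all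

lemma patterns:
  assumes "host w S S inp b L m D k hb nb"
  shows "pattern0 w S S inp b L m D k hb nb (gadj H) (\<lambda>x. length (Bs ! x))"
proof -
  interpret host w S S inp b L m D k hb nb by fact
  show ?thesis
  proof unfold_locales
    show "length (Bs ! x) = card {y \<in> {..<m}. gadj H x y}" if "x < m" for x
    proof -
      have "{y \<in> {..<m}. gadj H x y} = set (Bs ! x)" using that As_nb(4)[of x] simple(2) verts
        by (auto simp: nbrs_def simple_graph_def gadj_def insert_commute)
      then show ?thesis using As_nb(3)[OF that] by (simp add: distinct_card)
    qed
  qed (rule gadj_sym)
qed

text \<open>The input length is a crude degree bound. It makes the specifications of the auxiliary
  blocks available before the actual D is known, and independently of whether a search is
  run.\<close>

lemma base_hosts: "host w S S inp b L m N n 0 ((!) As)" "host w S S inp b L m N m hh ((!) Bs)"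
proof -
  have "1 \<le> N" "N < 2 ^ w" "n + 1 \<le> N" "m + 1 \<le> N" using N_eq N_b L_bound(3) by linarith+
  then show "host w S S inp b L m N n 0 ((!) As)" "host w S S inp b L m N m hh ((!) Bs)"
    by (intro hosts; use len_less in \<open>fastforce\<close>)+
qed

definition s0 :: st where
  "s0 = \<lparr>vr = (\<lambda>x. if x = 0 then w else if x = 2 \<or> x = 3 then S else 0), ar = (\<lambda>_ _ _. 0)\<rparr>"

definition l18 :: nat where "l18 = (if concat As \<noteq> [] \<and> 1 \<le> m \<and> m \<le> n then n else 0)"

lemma init1_spec:
  defines "s \<equiv> sem init1 s0"
  shows "vr s 4 = n" "vr s 5 = m" "vr s 6 = hh" "vr s 7 = m" "vr s 8 = L" "vr s 9 = b" "vr s 11 = hh" "vr s 12 = m + 1"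
    "b * vr s 13 = 2 ^ w" "vr s 15 = length (concat Bs)" "vr s 16 = 0" "vr s 17 = 0" "vr s 18 = l18" "ar s = (\<lambda>_ _ _. 0)"
proof -
  interpret R: host w S S inp b L m N m hh "(!) Bs" by (rule base_hosts)
  have Nw': "N < 2 ^ w" "S < 2 ^ w" using N_b L_bound(3) S_w by linarith+
  have i0: "inp 0 = n" using S_large(3) by (simp add: inp nth_append encode_0 length_encode n)
  have i1: "inp (n + 1) = length (concat As)" using N_eq encode_offset[of n As] by (simp add: inp nth_append length_encode n)
  have ih: "inp (hh + i) = encode Bs ! i" if "i < length (encode Bs)" for i
    using that N_eq(3) by (simp add: inp nth_append hh)
  have i2: "inp hh = m" using ih[of 0] encode_0[of Bs] m by (simp add: length_encode)
  have i3: "inp (hh + m + 1) = length (concat Bs)" using ih[of "m + 1"] encode_offset[of m Bs] m by (simp add: length_encode)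
  have Sle: "n + 1 < S" "hh < S" "hh + m + 1 < S" "n + 2 < S" using N_eq S_large by linarith+
  have wle: "n + 1 < 2 ^ w" "hh < 2 ^ w" "hh + m + 1 < 2 ^ w" "n + 2 < 2 ^ w" "m + 1 < 2 ^ w" "hh + m < 2 ^ w" "w < 2 ^ w"
    "w div 2 < 2 ^ w" using Sle Nw' less_exp[of w] by linarith+
  have Lw: "(m + 1) * (m + 1) < 2 ^ w" using L_bound(2) by (simp add: L)
  have sh: "binop_val w Shl (Suc 0) (w div 2) = b" "binop_val w Shl (Suc 0) (w - w div 2) = 2 ^ (w - w div 2)"
    using w_large by (auto simp: binop_val.simps push_bit_eq_mult b take_bit_nat_eq_self)
  have sub: "binop_val w Sub w (w div 2) = w - w div 2" using wle by (intro binop_sub) auto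
  have mods: "Suc n mod 2 ^ w = Suc n" "Suc n mod S = Suc n" "hh mod S = hh" "(hh + m) mod 2 ^ w = hh + m"
    "Suc (hh + m) mod 2 ^ w = Suc (hh + m)" "Suc (hh + m) mod S = Suc (hh + m)" "Suc (Suc n) mod 2 ^ w = Suc (Suc n)"
    "Suc m mod 2 ^ w = Suc m" "(w div 2) mod 2 ^ w = w div 2" "L mod 2 ^ w = L" "hh mod 2 ^ w = hh"
    using Sle wle L_bound(2) by simp_all
  have LS': "Suc (m + (m + m * m)) mod 2 ^ w = L" using mods(10) by (simp add: L)
  have h: "Suc (Suc (n + length (concat As))) mod 2 ^ w = hh" using mods(11) N_eq(2) by simp
  let ?t1 = "setv 4 n s0"
  let ?t2 = "setv 14 (length (concat As)) ?t1"
  let ?t3 = "setv 11 hh ?t2"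
  let ?t4 = "setv 7 m ?t3"
  let ?t5 = "setv 15 (length (concat Bs)) ?t4"
  let ?t6 = "setv 12 (m + 1) ?t5"
  let ?t7 = "setv 8 L ?t6"
  let ?t8 = "setv 19 (w div 2) ?t7"
  let ?t9 = "setv 9 b ?t8"
  let ?t10 = "setv 13 (2 ^ (w - w div 2)) ?t9"
  let ?t = "setv 18 n ?t10"
  have v0: "vr s0 0 = w" "vr s0 16 = 0" "vr s0 17 = 0" "ar s0 = (\<lambda>_ _ _. 0)" by (simp_all add: s0_def)
  have e: "ev s0 (Inp (Num 0)) = n" "ev ?t1 (Inp (Var 4 \<oplus> Num 1)) = length (concat As)"
    "ev ?t2 (Var 4 \<oplus> Num 2 \<oplus> Var 14) = hh" "ev ?t3 (Inp (Var 11)) = m" "ev ?t4 (Inp (Var 11 \<oplus> Var 7 \<oplus> Num 1)) = length (concat Bs)"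
    "ev ?t5 (Var 7 \<oplus> Num 1) = m + 1" "ev ?t6 (Var 12 \<otimes> Var 12) = L" "ev ?t7 (Bin Div (Var 0) (Num 2)) = w div 2"
    "ev ?t8 (Bin Shl (Num 1) (Var 19)) = b" "ev ?t9 (Bin Shl (Num 1) (Bin Sub (Var 0) (Var 19))) = 2 ^ (w - w div 2)"
    "ev ?t10 (Var 4) = n"
    using i0 i1 i2 i3 mods h LS' sh sub v0 by (simp_all add: L)
  define t where "t = sem (Asg 4 (Inp (Num 0)) ;; Asg 14 (Inp (Var 4 \<oplus> Num 1)) ;; Asg 11 (Var 4 \<oplus> Num 2 \<oplus> Var 14) ;;
     Asg 7 (Inp (Var 11)) ;; Asg 15 (Inp (Var 11 \<oplus> Var 7 \<oplus> Num 1)) ;; Asg 12 (Var 7 \<oplus> Num 1) ;;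
     Asg 8 (Var 12 \<otimes> Var 12) ;; Asg 19 (Bin Div (Var 0) (Num 2)) ;; Asg 9 (Bin Shl (Num 1) (Var 19)) ;;
     Asg 13 (Bin Shl (Num 1) (Bin Sub (Var 0) (Var 19))) ;; Asg 18 (Var 4)) s0"
  have t: "t = ?t" unfolding t_def by (simp only: sem.simps(1,3) e)
  let ?c = "Cond (Var 14) (Num 1) (Asg 18 (Num 0)) skip ;; Cond (Var 7) (Num 1) (Asg 18 (Num 0)) skip ;;
     Cond (Var 4) (Var 7) (Asg 18 (Num 0)) skip"
  define u where "u = sem ?c t"
  have s: "s = sem (Asg 6 (Var 11) ;; Asg 5 (Var 7)) u" by (simp only: s_def init1_def t_def u_def sem.simps(3))
  have ux: "vr u x = vr t x" if "x \<noteq> 18" "x \<noteq> 27" for x unfolding u_def by (rule vr_frame) (use that in simp)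
  have ua: "ar u = (\<lambda>_ _ _. 0)"
  proof -
    have "ar u a = ar t a" for a unfolding u_def by (rule ar_frame) simp
    then show ?thesis by (simp add: t v0 fun_eq_iff)
  qed
  have tv: "vr t 14 = length (concat As)" "vr t 7 = m" "vr t 4 = n" "vr t 18 = n" unfolding t by simp_all
  have u18: "vr u 18 = l18"
  proof -
    have "vr u 18 = (if n < m \<or> m < 1 \<or> length (concat As) < 1 then 0 else n)"
      unfolding u_def sem.simps(3,4) by (simp add: tv)
    then show ?thesis by (simp add: l18_def not_less Suc_le_eq)
  qed
  have pw: "b * 2 ^ (w - w div 2) = 2 ^ w" by (simp add: b power_add[symmetric])
  show "vr s 4 = n" "vr s 5 = m" "vr s 6 = hh" "vr s 7 = m" "vr s 8 = L" "vr s 9 = b" "vr s 11 = hh" "vr s 12 = m + 1"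
    "b * vr s 13 = 2 ^ w" "vr s 15 = length (concat Bs)" "vr s 16 = 0" "vr s 17 = 0" "vr s 18 = l18" "ar s = (\<lambda>_ _ _. 0)"
    by (simp_all add: s ux ua u18 t v0 pw)
qed

section \<open>Instances answered without a search\<close>

lemma dg0: "dg 0 = (\<lambda>_. 0)" by (simp add: dig_def fun_eq_iff)

text \<open>If G has no edge, or m = 0, or n < m, no m-subset of G spans an edge, so all of them are
  copies of the edgeless H and their number is n choose m. It is kept as a quotient of falling
  factorials to share the final division.\<close>

lemma ind_edgeless:
  assumes "concat Bs = []" "concat As = [] \<or> m = 0 \<or> n < m"
  shows "(\<Prod>i<m. n - i) = ind H G * (\<Prod>i<m. m - i)" "(\<Prod>i<m. m - i) = fact m"
proof -
  have f: "(\<Prod>i<k. k - i) = fact k" for k :: nat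
    unfolding fact_prod_rev by (simp add: atLeast0LessThan)
  show "(\<Prod>i<m. m - i) = fact m" by (rule f)
  have bn: "(\<Prod>i<m. n - i) = fact m * (n choose m)"
  proof (cases "m \<le> n")
    case True
    have "k \<le> n \<Longrightarrow> (\<Prod>i<k. n - i) * fact (n - k) = fact n" for k
    proof (induction k)
      case (Suc k)
      then have "n - k = Suc (n - Suc k)" by simp
      then have "(fact (n - k) :: nat) = (n - k) * fact (n - Suc k)" by (metis fact_Suc of_nat_id)
      then show ?case using Suc by (simp add: mult_ac)
    qed simp
    from this[OF True] have "(\<Prod>i<m. n - i) * fact (n - m) = fact n" .
    then have "(\<Prod>i<m. n - i) * fact (n - m) = fact m * (n choose m) * fact (n - m)"
      using binomial_fact_lemma[OF True] by (simp add: mult_ac)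
    then show ?thesis by simp
  next
    case False
    then have "(\<Prod>i<m. n - i) = 0" by (intro prod_zero) auto
    moreover have "n choose m = 0" using False by simp
    ultimately show ?thesis by (simp only: mult_0_right)
  qed
  have eH: "\<not> gadj H u v" for u v
  proof
    assume "gadj H u v"
    then have "u < m" "v \<in> set (Bs ! u)" using gadj_Bs[of u v] by auto
    moreover have "Bs ! u \<in> set Bs" using m calculation by simp
    ultimately show False using assms(1) unfolding concat_eq_Nil_conv by fastforce
  qed
  have iso: "isomorphic (induced_subgraph G T) H \<longleftrightarrow> card T = m" if T: "T \<subseteq> verts G" for T
  proof
    assume "isomorphic (induced_subgraph G T) H"
    then show "card T = m" using verts by (auto simp: isomorphic_def induced_subgraph_def dest: bij_betw_same_card)
  next
    assume c: "card T = m"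
    have fT: "finite T" using T verts finite_subset by metis
    then obtain f where f: "bij_betw f T {..<m}" using c finite_same_card_bij[of T "{..<m}"] by auto
    have "\<not> gadj G u v" if "u \<in> T" "v \<in> T" for u v
    proof
      assume "gadj G u v"
      then have u: "u < n" "v \<in> set (As ! u)" using gadj_As[of u v] by auto
      then have "As ! u \<in> set As" "As ! u \<noteq> []" using n by auto
      then have "concat As \<noteq> []" unfolding concat_eq_Nil_conv by blast
      moreover have "m \<noteq> 0" using card_0_eq[OF fT] c that(1) by auto
      moreover have "m \<le> n" using card_mono[OF verts(3) T] c verts by simp
      ultimately show False using assms(2) by simp
    qed
    then show "isomorphic (induced_subgraph G T) H" using f eH verts
      by (auto simp: isomorphic_def induced_subgraph_def gadj_def intro!: exI[of _ f])
  qed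
  then have "{T. T \<subseteq> verts G \<and> isomorphic (induced_subgraph G T) H} = {T. T \<subseteq> verts G \<and> card T = m}" by blast
  then have "ind H G = n choose m" using n_subsets[OF verts(3), of m] verts by (simp add: ind_def)
  then show "(\<Prod>i<m. n - i) = ind H G * (\<Prod>i<m. m - i)" unfolding bn f by simp
qed

text \<open>In a copy of H the neighbours of u are the images of neighbours of the preimage of u in
  G, of which there are too few; and for n < m there is no room for a copy.\<close>

lemma ind_zero:
  assumes "gadj H u v" "\<forall>i<n. length (As ! i) < length (Bs ! u) \<or> n < m"
  shows "ind H G = 0"
proof -
  have False if T: "T \<subseteq> verts G" and iso: "isomorphic (induced_subgraph G T) H" for T
  proof -
    obtain f where f: "bij_betw f T {..<m}" "\<And>u v. u \<in> T \<Longrightarrow> v \<in> T \<Longrightarrow> gadj G u v \<longleftrightarrow> gadj H (f u) (f v)"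
      using iso verts by (auto simp: isomorphic_def induced_subgraph_def gadj_def)
    have "card T = m" using bij_betw_same_card[OF f(1)] by simp
    then have mn: "m \<le> n" using card_mono[OF verts(3) T] verts by simp
    have u: "u < m" using gadj_Bs[of u v] assms(1) by blast
    then obtain x where x: "x \<in> T" "f x = u" using f(1) by (metis bij_betw_def imageE lessThan_iff)
    have xn: "x < n" using x T verts by auto
    have "set (Bs ! u) \<subseteq> f ` set (As ! x)"
    proof
      fix y assume y: "y \<in> set (Bs ! u)"
      then have "y < m" "gadj H u y" using gadj_Bs[of u y] As_nb(4)[OF u] simple(2) verts
        by (auto simp: nbrs_def simple_graph_def gadj_def insert_commute)
      then obtain z where z: "z \<in> T" "f z = y" using f(1) by (metis bij_betw_def imageE lessThan_iff)
      then have "gadj G x z" using f(2)[OF x(1) z(1)] x \<open>gadj H u y\<close> by simp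
      then show "y \<in> f ` set (As ! x)" using gadj_As[of x z] z by blast
    qed
    then have "card (set (Bs ! u)) \<le> card (set (As ! x))" by (rule surj_card_le[rotated]) simp
    then show False using assms(2) xn mn As_nb(1)[OF xn] As_nb(3)[OF u] by (auto simp: distinct_card)
  qed
  then have "{T. T \<subseteq> verts G \<and> isomorphic (induced_subgraph G T) H} = {}" by blast
  then show ?thesis by (simp only: ind_def card.empty)
qed

end


text \<open>All that is known is a congruence, and the cofactor may be negative. Division and
  remainder over the integers round downwards, so they recover Y in either case.\<close>

lemma top_digit:
  assumes "int Z ^ (k + 1) dvd int y - int Y * int Z ^ k" "Y < Z"
  shows "y div Z ^ k mod Z = Y"
proof -
  obtain c where "int y - int Y * int Z ^ k = int Z ^ (k + 1) * c" using assms(1) by blast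
  then have "int y = (int Y + int Z * c) * int Z ^ k" by (simp add: algebra_simps)
  then have "int y div int Z ^ k = int Y + int Z * c" using assms(2) by simp
  then have "int y div int Z ^ k mod int Z = int Y mod int Z" by (simp only: mod_mult_self2)
  then have "int (y div Z ^ k mod Z) = int Y" using assms(2) by (simp add: zdiv_int zmod_int)
  then show ?thesis by simp
qed

section \<open>From the two counts to the answer\<close>

context job
begin

definition ready :: "nat \<Rightarrow> st \<Rightarrow> bool" where
  "ready D t \<longleftrightarrow> vr t 5 = n \<and> vr t 6 = 0 \<and> vr t 7 = m \<and> vr t 8 = L \<and> vr t 9 = b \<and> vr t 10 = D \<and> vr t 11 = hh \<and>
     vr t 12 = m + 1 \<and> b * vr t 13 = 2 ^ w \<and> vr t 62 = vr t 68 \<and>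
     (\<forall>x<m. \<forall>y<m. ar t 5 x y = (if gadj H x y then 1 else 0)) \<and> (\<forall>x<m. ar t 6 0 x = length (Bs ! x)) \<and>
     ar t 4 = (\<lambda>_ _. 0) \<and> ar t 7 = (\<lambda>_ _. 0) \<and> ar t 11 = (\<lambda>_ _. 0) \<and> (\<forall>r. \<exists>x. ar t 3 r = dg x) \<and>
     ar t 3 4 = dg 1 \<and> ar t 3 5 = dg (b ^ L - 1) \<and> ar t 3 7 = dg 0 \<and> 1 \<le> D \<and> D < 2 ^ w"

text \<open>When the answer is 0 the number a is arbitrary, in particular it may be 0; this admits
  the instances in which both rows are simply left at 0.\<close>

definition quotient :: "nat \<Rightarrow> st \<Rightarrow> bool" where
  "quotient a t \<longleftrightarrow> ar t 3 8 = dg (ind H G * a) \<and> ar t 3 9 = dg a \<and> ind H G * a < b ^ (m + 1) \<and> a < b ^ (m + 1) \<and>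
     (ind H G = 0 \<or> a dvd fact m)"

text \<open>D is 1 or a degree that occurs in G. Together with the existence of an edge this gives D
  \<le> \<Delta> later, although the program never sees \<Delta>.\<close>

definition active :: "nat \<Rightarrow> st \<Rightarrow> bool" where
  "active D t \<longleftrightarrow> vr t 68 = 1 \<and> m \<le> n \<and> 1 \<le> m \<and> (\<exists>u<n. As ! u \<noteq> []) \<and> (\<forall>u<n. length (As ! u) \<le> D) \<and>
     (\<forall>u<m. length (Bs ! u) \<le> D) \<and> (D = 1 \<or> (\<exists>u<n. D = length (As ! u))) \<and> ar t 3 8 = dg 0 \<and> ar t 3 9 = dg 0"

lemma power_bound: "k < b \<Longrightarrow> k ^ m < b ^ (m + 1)"
proof -
  assume "k < b"
  then have "k ^ m \<le> b ^ m" by (intro power_mono) auto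
  also have "\<dots> < b ^ (m + 1)" using b2 by (intro power_strict_increasing) auto
  finally show ?thesis .
qed

lemma nm_b: "n < b" "m < b" using N_b N_eq by linarith+

lemma prod_bound: "k < b \<Longrightarrow> (\<Prod>i<m. k - i) < b ^ (m + 1)"
proof -
  assume k: "k < b"
  have "(\<Prod>i<m. k - i) \<le> (\<Prod>i<m. k)" by (intro prod_mono) auto
  also have "\<dots> = k ^ m" by simp
  also have "\<dots> < b ^ (m + 1)" by (rule power_bound[OF k])
  finally show ?thesis .
qed

lemma init2_spec: "\<exists>D. ready D (sem init2 (sem init1 s0)) \<and>
    ((\<exists>a. vr (sem init2 (sem init1 s0)) 68 = 0 \<and> quotient a (sem init2 (sem init1 s0))) \<or> active D (sem init2 (sem init1 s0)))"
proof -
  interpret R: host w S S inp b L m N m hh "(!) Bs" by (rule base_hosts)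
  interpret A: host w S S inp b L m N n 0 "(!) As" by (rule base_hosts)
  define s where "s = sem init1 s0"
  note i = init1_spec[folded s_def]
  have l18: "l18 \<le> n" by (simp add: l18_def)
  define s2 where "s2 = sem htable s"
  have z: "\<forall>i<m. \<forall>j<m. ar s 5 i j = 0" by (simp add: i(14))
  note h = R.htable_spec[OF i(2) i(3) i(4) refl i(12) z, folded s2_def]
  have w2: "vr s2 x = vr s x" if "x \<in> {4,7,8,9,11,12,13,15,16,18}" for x
    unfolding s2_def by (rule vr_frame) (use that in \<open>auto simp: htable_def block_defs\<close>)
  have a2: "ar s2 a = (\<lambda>_ _. 0)" if "a \<noteq> 5" "a \<noteq> 6" for a
  proof -
    have "ar s2 a = ar s a" unfolding s2_def by (rule ar_frame) (use that in \<open>auto simp: htable_def block_defs\<close>)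
    then show ?thesis by (simp add: i(14))
  qed
  define s3 where "s3 = setv 5 n (setv 6 0 s2)"
  define s4 where "s4 = sem maxdeg s3"
  have v3: "vr s3 6 = 0" "vr s3 18 = l18" "vr s3 16 = 0" using w2 i by (simp_all add: s3_def)
  note g = A.maxdeg_spec[OF v3(1,2) l18 v3(3), folded s4_def]
  have w4: "vr s4 x = vr s3 x" if "x \<in> {4,5,6,7,8,9,11,12,13,15,17,18}" for x
    unfolding s4_def by (rule vr_frame) (use that in \<open>auto simp: maxdeg_def block_defs\<close>)
  have a4: "ar s4 a = ar s2 a" for a
  proof -
    have "ar s4 a = ar s3 a" unfolding s4_def by (rule ar_frame) (simp add: maxdeg_def block_defs)
    then show ?thesis by (simp add: s3_def)
  qed
  define D where "D = max 1 (vr s4 16)"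
  have Dw: "1 \<le> D" "D < 2 ^ w" "D = 1 \<or> (\<exists>u<l18. D = length (As ! u))"
  proof -
    have "vr s4 16 \<le> N" using g(2)
    proof
      assume "\<exists>k<l18. vr s4 16 = length (As ! k)"
      then obtain k where k: "k < l18" "vr s4 16 = length (As ! k)" by blast
      then have "k < n" using l18 by simp
      then show ?thesis using len_less(1)[of k] k N_eq(1) by simp
    qed simp
    then show "D < 2 ^ w" using N_b L_bound(3) S_large(3) by (simp add: D_def)
    show "1 \<le> D" by (simp add: D_def)
    show "D = 1 \<or> (\<exists>u<l18. D = length (As ! u))" using g(2) by (auto simp: D_def max_def)
  qed
  define s5 where "s5 = setv 10 D s4"
  have s5: "sem (Cond (Num 0) (Var 16) (Asg 10 (Var 16)) (Asg 10 (Num 1))) s4 = s5"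
    by (cases "vr s4 16 = 0") (auto simp: s5_def D_def max_def)
  define s6 where "s6 = seta 3 4 0 1 s5"
  have s6: "sem (Put 3 (Num 4) (Num 0) (Num 1)) s5 = s6" by (simp add: s6_def)
  have a53: "ar s5 3 = (\<lambda>_ _. 0)" by (simp add: s5_def a4 a2)
  have d1: "(\<lambda>_. 0)(0 := 1) = dg 1" using A.dg_small[of 1] b2 unfolding dg0 by simp
  have a6: "ar s6 3 r = (if r = 4 then dg 1 else dg 0)" "a \<noteq> 3 \<Longrightarrow> ar s6 a = ar s2 a" for r a
    using d1 unfolding dg0 by (simp_all add: s6_def a53) (simp_all add: s5_def a4)
  define s7 where "s7 = sem (neg_power (Num 5) (Num 0)) s6"
  have v6: "vr s6 8 = L" "vr s6 9 = b" using w4 w2 i by (simp_all add: s6_def s5_def s3_def)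
  have a7: "ar s7 = (ar s6)(3 := (ar s6 3)(5 := dg (b ^ L - b ^ 0)))" unfolding s7_def
    by (rule A.neg_power_spec[OF v6, where x = 0]) (use a6(1)[of 5] A.rows in auto)
  have w7: "vr s7 x = vr s6 x" if "x \<in> {4,5,6,7,8,9,10,11,12,13,15,16,17,18}" for x
    unfolding s7_def by (rule vr_frame) (use that in \<open>auto simp: block_defs\<close>)
  define s8 where "s8 = setv 68 0 s7"
  have a8: "ar s8 3 r = (if r = 4 then dg 1 else if r = 5 then dg (b ^ L - 1) else dg 0)" "a \<noteq> 3 \<Longrightarrow> ar s8 a = ar s2 a" for r a
    using a6(2)[of a] by (simp_all add: s8_def a7 a6(1))
  have c8: "A.canon s8" unfolding A.canon_def using a8(1) by metis
  have w8: "vr s8 4 = n" "vr s8 5 = n" "vr s8 6 = 0" "vr s8 7 = m" "vr s8 8 = L" "vr s8 9 = b" "vr s8 10 = D" "vr s8 11 = hh"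
     "vr s8 12 = m + 1" "b * vr s8 13 = 2 ^ w" "vr s8 15 = length (concat Bs)" "vr s8 18 = l18" "vr s8 68 = 0"
     "vr s8 16 = vr s4 16" "vr s8 17 = vr s2 17"
    using w7 w4 w2 i by (simp_all add: s8_def s6_def s5_def s3_def)
  let ?X = "Cond (Var 16) (Var 17) skip (Asg 68 (Num 1))"
  let ?Y = "Cond (Var 15) (Num 1) (falling (Num 8) (Var 4) ;; falling (Num 9) (Var 7)) skip"
  define s9 where "s9 = sem (Cond (Num 0) (Var 18) ?X ?Y) s8"
  define t where "t = setv 62 (vr s9 68) s9"
  have t: "sem init2 (sem init1 s0) = t"
    unfolding init2_def sem.simps(3) s_def[symmetric] s2_def[symmetric] sem.simps(1)[of 6 "Num 0"] sem.simps(1)[of 5 "Var 4"]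
  proof -
    have "setv 5 (ev (setv 6 (ev s2 (Num 0)) s2) (Var 4)) (setv 6 (ev s2 (Num 0)) s2) = s3" using w2 i by (simp add: s3_def)
    moreover have "sem (Asg 68 (Num 0)) s7 = s8" "sem (Asg 62 (Var 68)) s9 = t" by (simp_all add: s8_def t_def)
    ultimately show "sem (Asg 62 (Var 68)) (sem (Cond (Num 0) (Var 18) ?X ?Y) (sem (Asg 68 (Num 0)) (sem (neg_power (Num 5) (Num 0))
       (sem (Put 3 (Num 4) (Num 0) (Num 1)) (sem (Cond (Num 0) (Var 16) (Asg 10 (Var 16)) (Asg 10 (Num 1))) (sem maxdeg
       (setv 5 (ev (setv 6 (ev s2 (Num 0)) s2) (Var 4)) (setv 6 (ev s2 (Num 0)) s2)))))))) = t"
      by (simp only: s4_def[symmetric] s5 s6 s7_def[symmetric] s9_def[symmetric])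
  qed
  have w9: "vr s9 x = vr s8 x" if "x \<in> {5..13}" for x
    unfolding s9_def by (rule vr_frame) (use that in \<open>auto simp: falling_def block_defs\<close>)
  have a9: "ar s9 a = ar s2 a" if "a \<noteq> 3" for a
  proof -
    have "ar s9 a = ar s8 a" unfolding s9_def by (rule ar_frame) (use that in \<open>auto simp: falling_def block_defs\<close>)
    then show ?thesis using a8(2)[OF that] by simp
  qed
  have ready: "ready D t" if "\<forall>r. \<exists>x. ar s9 3 r = dg x" "\<forall>r\<in>{4, 5, 7}. ar s9 3 r = ar s8 3 r"
  proof -
    have "ar s9 5 x y = (if gadj H x y then 1 else 0)" if "x < m" "y < m" for x y
      using h(1) a9[of 5] gadj_Bs[of x y] that by auto
    moreover have "ar s9 6 0 x = length (Bs ! x)" if "x < m" for x using h(2) a9[of 6] that by simp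
    ultimately show ?thesis unfolding ready_def using that Dw w9 w8 a9 a2 a8(1) by (simp add: t_def)
  qed
  have quot0: "quotient 0 t" if "ind H G = 0" "ar s9 = ar s8" using that a8(1) b2 by (simp add: quotient_def t_def)
  have ready0: "ready D t" if "ar s9 = ar s8" using ready c8 that unfolding A.canon_def by simp
  \<comment> \<open>\<open>fall\<close> is the quotient of falling factorials. In
    \<open>none\<close> H has an edge, while G has none or too few vertices; in \<open>deg\<close>
    some degree of H exceeds all degrees of G; both have answer 0. Only \<open>act\<close> leads to
    a search.\<close>
  consider (fall) "l18 = 0" "concat Bs = []" | (none) "l18 = 0" "concat Bs \<noteq> []" | (deg) "0 < l18" "vr s8 16 < vr s8 17" |
    (act) "0 < l18" "vr s8 17 \<le> vr s8 16" by linarith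
  then show ?thesis unfolding t
  proof cases
    case fall
    define u where "u = sem (falling (Num 8) (Var 4)) s8"
    have s9: "s9 = sem (falling (Num 9) (Var 7)) u" using fall w8 by (simp add: s9_def u_def)
    obtain c e where u: "ar u = (ar s8)(3 := (ar s8 3)(8 := dg (\<Prod>i<m. n - i), 11 := dg c, 12 := dg e))"
      using A.falling_spec[of s8 4 n 8, folded u_def] w8 nm_b c8 a8(1) by auto
    have wu: "vr u x = vr s8 x" if "x \<in> {7, 8, 9}" for x
      unfolding u_def by (rule vr_frame) (use that in \<open>auto simp: falling_def block_defs\<close>)
    have cu: "A.canon u" unfolding A.canon_def u using c8 by (auto simp: A.canon_def)
    obtain c' e' where v: "ar s9 = (ar u)(3 := (ar u 3)(9 := dg (\<Prod>i<m. m - i), 11 := dg c', 12 := dg e'))"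
      using A.falling_spec[of u 7 m 9, folded s9] wu w8 nm_b cu a8(1) by (auto simp: u)
    have "ready D t" by (rule ready) (use c8 in \<open>auto simp: v u A.canon_def\<close>)
    moreover have "quotient (fact m) t"
    proof -
      have "concat As = [] \<or> m = 0 \<or> n < m" using fall(1) by (auto simp: l18_def split: if_splits)
      note f = ind_edgeless[OF fall(2) this]
      have "ar t 3 8 = dg (\<Prod>i<m. n - i)" "ar t 3 9 = dg (\<Prod>i<m. m - i)" by (simp_all add: t_def v u)
      then show ?thesis unfolding quotient_def using prod_bound[OF nm_b(1)] prod_bound[OF nm_b(2)] unfolding f by simp
    qed
    moreover have "vr t 68 = 0"
    proof -
      have "vr s9 68 = vr u 68" unfolding s9 by (rule vr_frame) (simp add: falling_def block_defs)
      also have "vr u 68 = vr s8 68" unfolding u_def by (rule vr_frame) (simp add: falling_def block_defs)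
      finally show ?thesis using w8 by (simp add: t_def)
    qed
    ultimately show "\<exists>D. ready D t \<and> ((\<exists>a. vr t 68 = 0 \<and> quotient a t) \<or> active D t)" by blast
  next
    case none
    have s9: "s9 = setv 27 0 s8" using none w8 by (auto simp: s9_def less_Suc_eq_0_disj)
    obtain l where l: "l \<in> set Bs" "l \<noteq> []" using none(2) unfolding concat_eq_Nil_conv by blast
    obtain u where u: "u < m" "Bs ! u = l" using l(1) m by (auto simp: in_set_conv_nth)
    define v where "v = hd l"
    have uv: "u < m" "v \<in> set (Bs ! u)" using l(2) u by (simp_all add: v_def)
    then have "gadj H u v" using As_nb(4)[of u] by (simp add: nbrs_def gadj_def insert_commute)
    moreover have "length (As ! i) < length (Bs ! u) \<or> n < m" if "i < n" for i
    proof -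
      have "concat As = [] \<or> n < m" using none(1) uv(1) by (auto simp: l18_def split: if_splits)
      moreover have "As ! i \<in> set As" "0 < length (Bs ! u)" using that uv n by auto
      ultimately show ?thesis unfolding concat_eq_Nil_conv by auto
    qed
    ultimately have "ind H G = 0" using ind_zero by blast
    then show "\<exists>D. ready D t \<and> ((\<exists>a. vr t 68 = 0 \<and> quotient a t) \<or> active D t)" using quot0 ready0 s9 w8 by (auto simp: t_def)
  next
    case deg
    have s9: "s9 = setv 27 0 s8" using deg w8 by (simp add: s9_def)
    have ln: "l18 = n" using deg(1) by (simp add: l18_def split: if_splits)
    obtain u where u: "u < m" "vr s8 17 = length (Bs ! u)" using h(4) deg(2) w8 by auto
    then obtain v where "v \<in> set (Bs ! u)" using deg(2) by (cases "Bs ! u") auto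
    then have "gadj H u v" using As_nb(4)[OF u(1)] by (simp add: nbrs_def gadj_def insert_commute)
    moreover have "length (As ! i) < length (Bs ! u)" if "i < n" for i
    proof -
      have "length (As ! i) \<le> vr s4 16" using g(1) that ln by simp
      then show ?thesis using deg(2) u w8 by linarith
    qed
    ultimately have "ind H G = 0" using ind_zero by blast
    then show "\<exists>D. ready D t \<and> ((\<exists>a. vr t 68 = 0 \<and> quotient a t) \<or> active D t)" using quot0 ready0 s9 w8 by (auto simp: t_def)
  next
    case act
    have s9: "s9 = setv 68 1 s8" using act w8 by (simp add: s9_def)
    have ln: "l18 = n" "concat As \<noteq> []" "1 \<le> m" "m \<le> n" using act(1) by (simp_all add: l18_def split: if_splits)
    have "\<exists>u<n. As ! u \<noteq> []" using ln(2) n by (fastforce simp: concat_eq_Nil_conv in_set_conv_nth)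
    moreover have "\<forall>u<n. length (As ! u) \<le> D" using g(1) ln(1) by (auto simp: D_def max_def intro: le_trans)
    moreover have "\<forall>u<m. length (Bs ! u) \<le> D"
    proof (intro allI impI)
      fix u assume "u < m"
      then have "length (Bs ! u) \<le> vr s4 16" using h(3) act(2) w8 by (metis le_trans)
      then show "length (Bs ! u) \<le> D" by (simp add: D_def)
    qed
    ultimately have "active D t" unfolding active_def using ln Dw(3) a8(1) by (simp add: t_def s9)
    then show "\<exists>D. ready D t \<and> ((\<exists>a. vr t 68 = 0 \<and> quotient a t) \<or> active D t)" using ready0 s9 by auto
  qed
qed

lemma final_spec:
  assumes v: "vr s 7 = m" "vr s 8 = L" "vr s 9 = b" "vr s 12 = m + 1" "b * vr s 13 = 2 ^ w" and q: "quotient a s"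
    and z: "ar s 11 = (\<lambda>_ _. 0)"
  shows "(\<Sum>i<m+1. ar (sem (cancel ;; emit) s) 11 0 i * (2 ^ w) ^ i) = ind H G" "vr (sem (cancel ;; emit) s) 12 = m + 1"
proof -
  interpret R: host w S S inp b L m N m hh "(!) Bs" by (rule base_hosts)
  define u where "u = sem cancel s"
  have r: "R.rowpar s" using v by (simp add: R.rowpar_def)
  have q': "ar s 3 8 = dg (ind H G * a)" "ar s 3 9 = dg a" "ind H G * a < b ^ (m + 1)" "a < b ^ (m + 1)" "ind H G = 0 \<or> a dvd fact m"
    using q by (simp_all add: quotient_def)
  have 8: "ar u 3 8 = dg (ind H G)" unfolding u_def by (rule R.cancel_spec[OF r nm_b(2) q'])
  have wu: "vr u x = vr s x" if "x \<in> {7, 8, 9, 12, 13}" for x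
    unfolding u_def by (rule vr_frame) (use that in \<open>auto simp: init_defs block_defs\<close>)
  have au: "ar u 11 = ar s 11" unfolding u_def by (rule ar_frame) (simp add: init_defs block_defs)
  have ru: "R.rowpar u" using v wu by (simp add: R.rowpar_def)
  have lt: "ind H G < b ^ (m + 1)"
  proof (cases "ind H G = 0")
    case False
    then have "a \<noteq> 0" using q'(5) by (cases "a = 0") auto
    then have "ind H G * 1 \<le> ind H G * a" by (intro mult_le_mono) auto
    then show ?thesis using q'(3) by linarith
  qed (use b2 in simp)
  have "(\<Sum>i<m+1. ar (sem emit u) 11 0 i * (2 ^ w) ^ i) = ind H G"
    by (rule R.emit_spec[OF ru _ 8 lt]) (use v wu au z in simp_all)
  then show "(\<Sum>i<m+1. ar (sem (cancel ;; emit) s) 11 0 i * (2 ^ w) ^ i) = ind H G" by (simp add: u_def)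
  have "vr (sem emit u) 12 = vr u 12" by (rule vr_frame) (simp add: init_defs)
  then show "vr (sem (cancel ;; emit) s) 12 = m + 1" using wu[of 12] v by (simp add: u_def)
qed

end


section \<open>The complete run and its time\<close>

definition totE :: nat where
  "totE = timeE + nest (\<lambda>p. \<not> p = 18) init2 + nest (\<lambda>p. \<not> p = 18) mid + nest (\<lambda>p. \<not> p = 18) final"

text \<open>The 20 pays for the instructions of \<open>prefix_code\<close> and
  \<open>suffix_code\<close>.\<close>

definition totK :: nat where
  "totK = csize init1 + csize init2 + csize mid + csize final + 2 * (timeK + 1) + 20"

context job
begin

text \<open>The part between preparation and output, stated alike for instances with and without a
  search: without one, both occurrences of \<open>main_prog\<close> stop at their first
  test.\<close>

definition middle :: "nat \<Rightarrow> st \<Rightarrow> bool" where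
  "middle T t \<longleftrightarrow> (\<exists>t1 t2. runs main_prog t T t1 \<and> runs main_prog (sem mid t1) T t2 \<and>
     (\<forall>x\<in>{7, 8, 9, 12, 13}. vr t1 x = vr t x \<and> vr t2 x = vr t x) \<and>
     (\<Sum>i<m+1. ar (sem final t2) 11 0 i * (2 ^ w) ^ i) = ind H G \<and> vr (sem final t2) 12 = m + 1)"

lemma idle_middle:
  assumes r: "ready D t" and z: "vr t 68 = 0" and q: "quotient a t"
  shows "middle 1 t"
proof -
  interpret R: host w S S inp b L m N m hh "(!) Bs" by (rule base_hosts)
  have v: "vr t 7 = m" "vr t 8 = L" "vr t 9 = b" "vr t 12 = m + 1" "b * vr t 13 = 2 ^ w" "vr t 62 = 0"
    "ar t 11 = (\<lambda>_ _. 0)" "ar t 3 7 = dg 0" using r z by (simp_all add: ready_def)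
  have 1: "runs main_prog t 1 t" unfolding main_prog_def by (rule runs_While0) (use v in simp_all)
  define t' where "t' = setv 27 0 t"
  define u where "u = sem (bclear (Num 7)) t'"
  have au: "ar u = (ar t')(3 := (ar t' 3)(7 := dg 0))" unfolding u_def
    by (rule R.bclear_spec[of _ _ 7 0]) (use v R.rows in \<open>simp_all add: t'_def\<close>)
  have vu: "vr u x = vr t' x" if "x \<in> {7, 8, 9, 11, 12, 13, 68}" for x
    unfolding u_def by (rule vr_frame) (use that in \<open>auto simp: block_defs\<close>)
  define u1 where "u1 = sem mid t"
  have u1: "u1 = setv 62 (vr u 68) (setv 5 (vr u 7) (setv 6 (vr u 11) u))"
  proof -
    have "sem (Cond (Num 0) (Var 68) (save (Num 8)) skip) t = t'" using z by (simp add: t'_def)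
    then have "u1 = sem (Asg 6 (Var 11) ;; Asg 5 (Var 7) ;; Asg 62 (Var 68)) u" by (simp only: u1_def mid_def sem.simps(3) u_def)
    then show ?thesis by simp
  qed
  have w1: "vr u1 x = vr t x" if "x \<in> {7, 8, 9, 12, 13, 68}" for x using vu[of x] that by (auto simp: u1 t'_def)
  have 2: "runs main_prog u1 1 u1" unfolding main_prog_def
    by (rule runs_While0) (use vu z in \<open>simp_all add: u1 t'_def\<close>)
  define u2 where "u2 = setv 27 0 u1"
  have f: "sem final u1 = sem (cancel ;; emit) u2" using w1[of 68] z by (simp add: final_def u2_def)
  have "quotient a u2" using q by (simp add: quotient_def u2_def u1 au t'_def)
  moreover have "ar u2 11 = (\<lambda>_ _. 0)" using v by (simp add: u2_def u1 au t'_def)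
  ultimately have f12: "(\<Sum>i<m+1. ar (sem final u1) 11 0 i * (2 ^ w) ^ i) = ind H G" "vr (sem final u1) 12 = m + 1"
    unfolding f using v w1 by (intro final_spec; simp add: u2_def)+
  have 3: "\<forall>x\<in>{7, 8, 9, 12, 13}. vr t x = vr t x \<and> vr u1 x = vr t x"
  proof (intro ballI conjI refl)
    fix x :: nat assume "x \<in> {7, 8, 9, 12, 13}"
    then show "vr u1 x = vr t x" by (intro w1) auto
  qed
  have 4: "runs main_prog (sem mid t) 1 u1" using 2 by (simp only: u1_def)
  show ?thesis unfolding middle_def
    by (rule exI[of _ t], rule exI[of _ u1], rule conjI[OF 1 conjI[OF 4 conjI[OF 3 conjI[OF f12(1) f12(2)]]]])
qed

text \<open>The run on G yields \<open>ind H G\<close> times the number of automorphisms of H, the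
  run on H that number alone. Since m \<le> n, the time for G also covers the run on H.\<close>

lemma active_middle:
  assumes r: "ready D t" and a: "active D t"
  shows "middle (timeK * L ^ timeE * (n * (4 * D) ^ (2 * m))) t"
proof -
  have D: "1 \<le> D" "D < 2 ^ w" using r by (simp_all add: ready_def)
  have ac: "vr t 68 = 1" "m \<le> n" "1 \<le> m" "\<forall>u<n. length (As ! u) \<le> D" "\<forall>u<m. length (Bs ! u) \<le> D" "ar t 3 8 = dg 0" "ar t 3 9 = dg 0"
    using a by (simp_all add: active_def)
  interpret A: pattern0 w S S inp b L m D n 0 "(!) As" "gadj H" "\<lambda>x. length (Bs ! x)"
    by (rule patterns[OF hosts(1)[OF D ac(4)]])
  interpret R: pattern0 w S S inp b L m D m hh "(!) Bs" "gadj H" "\<lambda>x. length (Bs ! x)"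
    by (rule patterns[OF hosts(2)[OF D ac(5)]])
  let ?T = "timeK * L ^ timeE * (n * (4 * D) ^ (2 * m))"
  have TA: "A.mainT \<le> ?T" using A.mainT_bound ac(2,3) by simp
  have TR: "R.mainT \<le> ?T"
  proof -
    have "R.mainT \<le> timeK * L ^ timeE * (m * (4 * D) ^ (2 * m))" using R.mainT_bound ac(3) by simp
    also have "\<dots> \<le> ?T" using ac(2) by (intro mult_le_mono) auto
    finally show ?thesis .
  qed
  have adj: "A.adj = gadj G" "R.adj = gadj H"
    using gadj_As gadj_Bs by (simp_all add: fun_eq_iff A.adj_def R.adj_def)
  let ?Y = "emb (gadj G) (gadj H) {..<m} {..<n}" and ?a = "card (isos (gadj H) (gadj H) {..<m} {..<m})"
  have Y: "?Y = ind H G * ?a" "emb (gadj H) (gadj H) {..<m} {..<m} = ?a"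
    using emb_ind[OF verts(3), of H] emb_self[of "{..<m}" "gadj H"] verts by simp_all
  have bd: "?Y < b ^ (m + 1)" "?a < b ^ (m + 1)"
    using emb_le[of "{..<n}" "{..<m}" "gadj G" "gadj H"] emb_le[of "{..<m}" "{..<m}" "gadj H" "gadj H"]
      power_bound[OF nm_b(1)] power_bound[OF nm_b(2)] unfolding Y(2) by auto
  have pw: "(b ^ (m + 1)) ^ m = b ^ (m * (m + 1))" by (simp only: power_mult[symmetric] mult.commute)
  have tv: "vr t 5 = n" "vr t 6 = 0" "vr t 7 = m" "vr t 8 = L" "vr t 9 = b" "vr t 10 = D" "vr t 11 = hh" "vr t 12 = m + 1"
     "b * vr t 13 = 2 ^ w" "vr t 62 = 1" and ta: "\<forall>x<m. \<forall>y<m. ar t 5 x y = (if gadj H x y then 1 else 0)"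
     "\<forall>x<m. ar t 6 0 x = length (Bs ! x)" "ar t 4 = (\<lambda>_ _. 0)" "ar t 7 = (\<lambda>_ _. 0)" "ar t 11 = (\<lambda>_ _. 0)"
     "\<forall>r. \<exists>x. ar t 3 r = dg x" "ar t 3 4 = dg 1" "ar t 3 5 = dg (b ^ L - 1)" "ar t 3 7 = dg 0"
    using r ac(1) by (simp_all add: ready_def)
  have "\<exists>s' y. runs main_prog t A.mainT s' \<and> A.keepm t s' \<and> A.canon s' \<and> A.bits s' 0 \<and> A.marked s' {..<n} \<and>
      vr s' 62 = 0 \<and> ar s' 3 7 = dg y \<and>
      int (b ^ (m + 1)) ^ (m + 1) dvd int y - int (emb A.adj (gadj H) {..<m} {..<n}) * int (b ^ (m + 1)) ^ m"
    by (rule A.main_run) (use tv ta in \<open>simp_all add: A.okn_def A.params_def A.canon_def A.htab_def A.bits_def A.marked_def\<close>)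
  then obtain t1 y where t1: "runs main_prog t A.mainT t1" "A.keepm t t1" "A.canon t1" "A.bits t1 0" "A.marked t1 {..<n}"
     "ar t1 3 7 = dg y" "int (b ^ (m + 1)) ^ (m + 1) dvd int y - int ?Y * int (b ^ (m + 1)) ^ m"
    unfolding adj by blast
  have y: "y div b ^ (m * (m + 1)) mod b ^ (m + 1) = ?Y" using top_digit[OF t1(7) bd(1)] unfolding pw .
  have k1: "vr t1 x = vr t x" if "x < 20 \<or> 68 \<le> x" for x using t1(2) that unfolding A.keepm_def by blast
  have ka1: "ar t1 5 = ar t 5" "ar t1 6 = ar t 6" "ar t1 11 = ar t 11" "ar t1 3 4 = ar t 3 4" "ar t1 3 5 = ar t 3 5"
    "ar t1 3 8 = ar t 3 8" "ar t1 3 9 = ar t 3 9" using t1(2) by (simp_all add: A.keepm_def)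
  define v1 where "v1 = sem (save (Num 8)) t1"
  have a1: "ar v1 = (ar t1)(3 := (ar t1 3)(8 := dg ?Y))" unfolding v1_def y[symmetric]
    by (rule A.save_spec) (use k1[of 7] k1[of 12] tv ka1 ac t1 in simp_all)
  have w1: "vr v1 x = vr t x" if "x \<in> {5..13} \<or> x = 68" for x
  proof -
    have "vr v1 x = vr t1 x" unfolding v1_def by (rule vr_frame) (use that in \<open>auto simp: save_def\<close>)
    then show ?thesis using k1[of x] that by auto
  qed
  define v2 where "v2 = sem (bclear (Num 7)) v1"
  have a2: "ar v2 = (ar v1)(3 := (ar v1 3)(7 := dg 0))" unfolding v2_def
    by (rule A.bclear_spec[of _ _ 7 y]) (use w1[of 8] tv t1 A.rows in \<open>simp_all add: a1\<close>)
  have w2: "vr v2 x = vr t x" if "x \<in> {5..13} \<or> x = 68" for x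
  proof -
    have "vr v2 x = vr v1 x" unfolding v2_def by (rule vr_frame) (use that in \<open>auto simp: block_defs\<close>)
    then show ?thesis using w1[of x] that by auto
  qed
  define u where "u = sem mid t1"
  have u: "u = setv 62 1 (setv 5 m (setv 6 hh v2))"
    using k1[of 68] ac(1) w2 tv by (simp add: u_def mid_def v1_def[symmetric] v2_def[symmetric])
  have wu: "vr u x = vr t x" if "x \<in> {7..13} \<or> x = 68" for x using that w2[of x] by (auto simp: u)
  have au: "ar u = (ar t1)(3 := (ar t1 3)(8 := dg ?Y, 7 := dg 0))" by (simp add: u a2 a1)
  have "\<exists>x. ((ar t1 3)(8 := dg ?Y, 7 := dg 0)) r = dg x" for r
    using t1(3) unfolding A.canon_def by (metis fun_upd_apply)
  then have cu: "R.canon u" unfolding R.canon_def au fun_upd_same by blast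
  have "\<exists>s' y. runs main_prog u R.mainT s' \<and> R.keepm u s' \<and> R.canon s' \<and> R.bits s' 0 \<and> R.marked s' {..<m} \<and>
      vr s' 62 = 0 \<and> ar s' 3 7 = dg y \<and>
      int (b ^ (m + 1)) ^ (m + 1) dvd int y - int (emb R.adj (gadj H) {..<m} {..<m}) * int (b ^ (m + 1)) ^ m"
  proof (rule R.main_run)
    show "R.okn u" unfolding R.okn_def R.params_def using cu wu tv ta ka1 by (simp add: au) (simp add: u)
    show "R.htab u" unfolding R.htab_def using ta ka1 by (simp add: au)
    show "R.bits u 0" using t1(4) by (simp add: A.bits_def au)
    show "R.marked u {..<m}" using t1(5) ac(2) by (simp add: A.marked_def R.marked_def au)
    show "ar u 3 7 = dg 0" by (simp add: au)
    show "vr u 62 = 1" by (simp add: u)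
  qed
  then obtain t2 y2 where t2: "runs main_prog u R.mainT t2" "R.keepm u t2" "ar t2 3 7 = dg y2"
     "int (b ^ (m + 1)) ^ (m + 1) dvd int y2 - int ?a * int (b ^ (m + 1)) ^ m"
    unfolding adj Y(2) by blast
  have y2: "y2 div b ^ (m * (m + 1)) mod b ^ (m + 1) = ?a" using top_digit[OF t2(4) bd(2)] unfolding pw .
  have k2: "vr t2 x = vr u x" if "x < 20 \<or> 68 \<le> x" for x using t2(2) that unfolding R.keepm_def by blast
  have ka2: "ar t2 11 = ar u 11" "ar t2 3 8 = ar u 3 8" "ar t2 3 9 = ar u 3 9" using t2(2) by (simp_all add: R.keepm_def)
  define v where "v = sem (save (Num 9)) t2"
  have av: "ar v = (ar t2)(3 := (ar t2 3)(9 := dg ?a))" unfolding v_def y2[symmetric]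
    by (rule R.save_spec) (use k2[of 7] k2[of 12] wu[of 7] wu[of 12] tv ka1 ka2 ac t2 au in simp_all)
  have wv: "vr v x = vr t x" if "x \<in> {7, 8, 9, 12, 13}" for x
  proof -
    have "vr v x = vr t2 x" unfolding v_def by (rule vr_frame) (use that in \<open>auto simp: save_def\<close>)
    then show ?thesis using k2[of x] wu[of x] that by auto
  qed
  have f: "sem final t2 = sem (cancel ;; emit) v" using k2[of 68] wu[of 68] ac(1) by (simp add: final_def v_def)
  have "?a dvd fact m" using card_isos_dvd_fact[of "{..<m}" "gadj H"] by simp
  then have "quotient ?a v" unfolding quotient_def Y(1)[symmetric] using bd ka2 by (simp add: av au)
  moreover have "ar v 11 = (\<lambda>_ _. 0)" using ka1 ka2 ta by (simp add: av au)
  ultimately have "(\<Sum>i<m+1. ar (sem final t2) 11 0 i * (2 ^ w) ^ i) = ind H G" "vr (sem final t2) 12 = m + 1"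
    unfolding f using tv wv by (intro final_spec; simp)+
  moreover have "\<forall>x\<in>{7, 8, 9, 12, 13}. vr t1 x = vr t x \<and> vr t2 x = vr t x" using k1 k2 wu by auto
  ultimately show ?thesis unfolding middle_def
    using runs_mono[OF t1(1) TA] runs_mono[OF t2(1) TR] u_def by (intro exI[of _ t1] exI[of _ t2]) auto
qed

lemma whole_runs:
  assumes deg: "\<forall>u<n. length (As ! u) \<le> \<Delta>"
  shows "\<exists>s'. runs whole s0 ((totK - 20) * (L ^ totE * (n * (4 * \<Delta>) ^ (2 * m) + 2 ^ (10 * m)))) s' \<and> vr s' 12 = m + 1 \<and>
     (\<Sum>i<m+1. ar s' 11 0 i * (2 ^ w) ^ i) = ind H G"
proof -
  \<comment> \<open>The second summand makes X at least 1, so everything polynomial in m is paid for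
    even when n or \<Delta> is 0.\<close>
  define X where "X = n * (4 * \<Delta>) ^ (2 * m) + 2 ^ (10 * m)"
  define Q where "Q = L ^ totE * X"
  have "1 \<le> (2 :: nat) ^ (10 * m)" by simp
  then have X1: "1 \<le> X" unfolding X_def by linarith
  have Lp: "L ^ e \<le> L ^ totE" if "e \<le> totE" for e using that L1 by (intro power_increasing) auto
  have Q: "L ^ e \<le> Q" if "e \<le> totE" for e using Lp[OF that] X1 by (metis Q_def mult_le_mono mult.right_neutral)
  have Q1: "1 \<le> Q" using Q[of 0] by simp
  \<comment> \<open>An edge of G forces \<Delta> \<ge> 1; only then may the preparation scan all n
    vertices.\<close>
  have nX: "n \<le> X" if "u < n" "As ! u \<noteq> []" for u
  proof -
    have "1 \<le> \<Delta>" using deg that by (metis One_nat_def Suc_leI le_trans length_greater_0_conv)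
    then have "1 \<le> (4 * \<Delta>) ^ (2 * m)" by simp
    then have "n * 1 \<le> n * (4 * \<Delta>) ^ (2 * m)" by (rule mult_le_mono2)
    then show ?thesis unfolding X_def by linarith
  qed
  define s1 where "s1 = sem init1 s0"
  define t where "t = sem init2 s1"
  note i = init1_spec[folded s1_def]
  obtain D where D: "ready D t" "(\<exists>a. vr t 68 = 0 \<and> quotient a t) \<or> active D t" using init2_spec unfolding t_def s1_def by blast
  have "middle ((timeK + 1) * Q) t"
  proof -
    have M: "middle T' t" if middle: "middle T t" and le: "T \<le> T'" for T T'
    proof -
      obtain t1 t2 where x: "runs main_prog t T t1" "runs main_prog (sem mid t1) T t2" and
        y: "(\<forall>x\<in>{7, 8, 9, 12, 13}. vr t1 x = vr t x \<and> vr t2 x = vr t x) \<and>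
          (\<Sum>i<m+1. ar (sem final t2) 11 0 i * (2 ^ w) ^ i) = ind H G \<and> vr (sem final t2) 12 = m + 1"
        using middle unfolding middle_def by blast
      show ?thesis unfolding middle_def
        by (rule exI[of _ t1], rule exI[of _ t2], rule conjI[OF runs_mono[OF x(1) le] conjI[OF runs_mono[OF x(2) le] y]])
    qed
    show ?thesis
    proof (cases "active D t")
      case True
      obtain u where u: "u < n" "As ! u \<noteq> []" using True by (auto simp: active_def)
      then have "1 \<le> \<Delta>" using deg by (metis One_nat_def Suc_leI le_trans length_greater_0_conv)
      then have "D \<le> \<Delta>" using True deg by (auto simp: active_def)
      then have "n * (4 * D) ^ (2 * m) \<le> n * (4 * \<Delta>) ^ (2 * m)" by (intro mult_le_mono power_mono) auto
      also have "\<dots> \<le> X" by (simp add: X_def)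
      finally have "timeK * L ^ timeE * (n * (4 * D) ^ (2 * m)) \<le> timeK * L ^ totE * X"
        by (intro mult_le_mono Lp) (simp_all add: totE_def)
      also have "\<dots> \<le> (timeK + 1) * Q" by (simp add: Q_def mult.assoc)
      finally show ?thesis by (rule M[OF active_middle[OF D(1) True]])
    next
      case False
      then obtain a where "vr t 68 = 0" "quotient a t" using D(2) by blast
      from M[OF idle_middle[OF D(1) this], of "(timeK + 1) * Q"] show ?thesis using Q1 by simp
    qed
  qed
  then obtain t1 t2 where mt: "runs main_prog t ((timeK + 1) * Q) t1" "runs main_prog (sem mid t1) ((timeK + 1) * Q) t2"
     "\<forall>x\<in>{7, 8, 9, 12, 13}. vr t1 x = vr t x \<and> vr t2 x = vr t x"
     "(\<Sum>i<m+1. ar (sem final t2) 11 0 i * (2 ^ w) ^ i) = ind H G" "vr (sem final t2) 12 = m + 1"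
    unfolding middle_def by blast
  have mL: "m \<le> L" "m + 1 \<le> L" by (simp_all add: L)
  have lv: "cb (vr s) c \<le> csize c * Q" if "set (lvars c) \<subseteq> {7, 8, 12}" "vr s 7 = m" "vr s 8 = L" "vr s 12 = m + 1"
     "nest (\<lambda>p. \<not> p = 18) c \<le> totE" for s c
  proof -
    have "cb (vr s) c \<le> csize c * L ^ nest (\<lambda>p. \<not> p = 18) c * 1 ^ nest (\<lambda>p. p = 18) c"
    proof (rule cb_bound[OF L1])
      show "\<forall>p\<in>set (lvars c). vr s p \<le> (if p = 18 then 1 else L)" using that mL by auto
    qed simp
    also have "\<dots> \<le> csize c * Q" using Q[OF that(5)] by simp
    finally show ?thesis .
  qed
  have tv: "vr t 7 = m" "vr t 8 = L" "vr t 12 = m + 1" using D(1) by (simp_all add: ready_def)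
  have c1: "cb (vr s0) init1 \<le> csize init1 * Q"
  proof -
    have "cb (vr s0) init1 \<le> csize init1 * 1 ^ nest (\<lambda>p. \<not> p = 18) init1 * 1 ^ nest (\<lambda>p. p = 18) init1"
      by (rule cb_bound) (simp_all add: lvars_init)
    then have "cb (vr s0) init1 \<le> csize init1 * 1" by simp
    also have "csize init1 * 1 \<le> csize init1 * Q" by (rule mult_le_mono2[OF Q1])
    finally show ?thesis .
  qed
  have c2: "cb (vr s1) init2 \<le> csize init2 * Q"
  proof -
    have g: "max 1 l18 \<le> X"
    proof (cases "l18 = 0")
      case False
      then have "l18 = n" "concat As \<noteq> []" by (auto simp: l18_def split: if_splits)
      moreover from this(2) obtain u where "u < n" "As ! u \<noteq> []" using n by (fastforce simp: in_set_conv_nth)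
      ultimately show ?thesis using nX X1 by simp
    qed (use X1 in simp)
    have "cb (vr s1) init2 \<le> csize init2 * L ^ nest (\<lambda>p. \<not> p = 18) init2 * (max 1 l18) ^ nest (\<lambda>p. p = 18) init2"
    proof (rule cb_bound[OF L1])
      show "\<forall>p\<in>set (lvars init2). vr s1 p \<le> (if p = 18 then max 1 l18 else L)" using lvars_init(2) i mL by auto
    qed simp
    also have "\<dots> = csize init2 * (L ^ nest (\<lambda>p. \<not> p = 18) init2 * max 1 l18)" by (simp only: nest_init power_one_right mult.assoc)
    also have "\<dots> \<le> csize init2 * Q" unfolding Q_def
      by (intro mult_le_mono2 mult_le_mono Lp g) (simp add: totE_def)
    finally show ?thesis .
  qed
  have c3: "cb (vr t1) mid \<le> csize mid * Q" using mt(3) tv lvars_init(3) by (intro lv) (simp_all add: totE_def)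
  have c4: "cb (vr t2) final \<le> csize final * Q" using mt(3) tv lvars_init(4) by (intro lv) (simp_all add: totE_def)
  have tot: "csize init1 * Q + (csize init2 * Q + ((timeK + 1) * Q + (csize mid * Q + ((timeK + 1) * Q + csize final * Q)))) \<le> (totK - 20) * Q"
    by (simp add: totK_def distrib_right)
  have "runs whole s0 ((totK - 20) * Q) (sem final t2)"
    unfolding whole_def
    by (rule runs_Then[OF runs_Do[OF okc_init(1) c1, folded s1_def] runs_Then[OF runs_Do[OF okc_init(2) c2, folded t_def]
       runs_Then[OF mt(1) runs_Then[OF runs_Do[OF okc_init(3) c3] runs_Then[OF mt(2) runs_Do[OF okc_init(4) c4]
         order_refl] order_refl] order_refl] order_refl] tot])
  then show ?thesis using mt(4,5) unfolding Q_def X_def by blast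
qed

section \<open>The machine program on the encoded input\<close>

lemma inp_facts: "inp 0 = n" "inp (Suc n) = length (concat As)" "inp hh = m" "inp (Suc (hh + m)) = length (concat Bs)"
proof -
  have ih: "inp (hh + i) = encode Bs ! i" if "i < length (encode Bs)" for i
    using that N_eq(3) by (simp add: inp nth_append hh)
  show "inp 0 = n" using S_large(3) by (simp add: inp nth_append encode_0 length_encode n)
  show "inp (Suc n) = length (concat As)" using N_eq encode_offset[of n As] by (simp add: inp nth_append length_encode n)
  show "inp hh = m" using ih[of 0] encode_0[of Bs] m by (simp add: length_encode)
  show "inp (Suc (hh + m)) = length (concat Bs)" using ih[of "m + 1"] encode_offset[of m Bs] m by (simp add: length_encode)
qed

lemma prefix_rel:
  defines "c \<equiv> fold (exec w) prefix_code (initial w (encode As @ encode Bs))"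
  shows "rel s0 c"
proof -
  let ?th = "length (concat Bs)"
  have mm: "initial w (encode As @ encode Bs) = \<lparr>pc = 0, reg = (\<lambda>r. if r = 0 then w else 0), mem = inp\<rparr>"
  proof -
    have "(\<lambda>a. if a < length (encode As @ encode Bs) then (encode As @ encode Bs) ! a else 0) = inp" by (rule ext) (simp only: N inp)
    then show ?thesis unfolding initial_def by (simp only:)
  qed
  have Nw': "N < 2 ^ w" using N_b L_bound(3) by linarith
  have NN: "N * N \<le> S" using S_large(3) by (simp add: S eval_nat_numeral)
  have SN: "N * N * N = S" by (simp add: S eval_nat_numeral)
  have tb: "take_bit w 1 = (1 :: nat)" "take_bit w (Suc 0) = Suc 0"
    using L_bound(3) b2 by (intro take_bit_nat_eq_self; linarith)+
  have w0: "0 < w" using w_large by simp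
  have lt: "Suc n < 2 ^ w" "Suc (Suc n) < 2 ^ w" "hh < 2 ^ w" "hh + m < 2 ^ w" "Suc (hh + m) < 2 ^ w" "Suc (Suc (hh + m)) < 2 ^ w"
    "N * N < 2 ^ w" using Nw' N_eq(1,2) NN S_w by linarith+
  have eq: "Suc (Suc (n + length (concat As))) = hh" "Suc (Suc (hh + m + ?th)) = N" using N_eq(1,2) by linarith+
  have h1: "Suc (Suc (n + length (concat As))) mod 2 ^ w = hh" unfolding eq by (rule mod_less[OF lt(3)])
  have h2: "Suc (Suc (hh + m + ?th)) mod 2 ^ w = N" unfolding eq by (rule mod_less[OF Nw'])
  have h3: "N * N * N mod 2 ^ w = S" unfolding SN by (rule mod_less[OF S_w])
  have orS: "binop_val w Or S S = S" unfolding binop_val.simps(7) or.idem by (rule take_bit_nat_eq_self[OF S_w])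
  note mods = mod_less[OF lt(1)] mod_less[OF lt(2)] h1 mod_less[OF lt(4)] mod_less[OF lt(5)] mod_less[OF lt(6)] h2 mod_less[OF lt(7)] h3
  let ?C = "\<lambda>k r. \<lparr>pc = k, reg = r, mem = inp\<rparr>"
  let ?r0 = "\<lambda>r :: nat. if r = 0 then w else 0"
  let ?r1 = "?r0(101 := n)"
  let ?r2 = "?r1(103 := Suc 0)"
  let ?r3 = "?r2(104 := Suc n)"
  let ?r4 = "?r3(105 := length (concat As))"
  let ?r5 = "?r4(106 := Suc (Suc n))"
  let ?r6 = "?r5(106 := hh)"
  let ?r7 = "?r6(107 := m)"
  let ?r8 = "?r7(108 := hh + m)"
  let ?r9 = "?r8(108 := Suc (hh + m))"
  let ?ra = "?r9(109 := ?th)"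
  let ?rb = "?ra(110 := Suc (Suc (hh + m)))"
  let ?rc = "?rb(110 := N)"
  let ?rd = "?rc(2 := N * N)"
  let ?re = "?rd(2 := S)"
  let ?rf = "?re(3 := S)"
  have e: "exec w (Load 101 102) (?C 0 ?r0) = ?C 1 ?r1" "exec w (Const 103 1) (?C 1 ?r1) = ?C 2 ?r2"
    "exec w (Op Add 104 101 103) (?C 2 ?r2) = ?C 3 ?r3" "exec w (Load 105 104) (?C 3 ?r3) = ?C 4 ?r4"
    "exec w (Op Add 106 104 103) (?C 4 ?r4) = ?C 5 ?r5" "exec w (Op Add 106 106 105) (?C 5 ?r5) = ?C 6 ?r6"
    "exec w (Load 107 106) (?C 6 ?r6) = ?C 7 ?r7" "exec w (Op Add 108 106 107) (?C 7 ?r7) = ?C 8 ?r8"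
    "exec w (Op Add 108 108 103) (?C 8 ?r8) = ?C 9 ?r9" "exec w (Load 109 108) (?C 9 ?r9) = ?C 10 ?ra"
    "exec w (Op Add 110 108 103) (?C 10 ?ra) = ?C 11 ?rb" "exec w (Op Add 110 110 109) (?C 11 ?rb) = ?C 12 ?rc"
    "exec w (Op Mul 2 110 110) (?C 12 ?rc) = ?C 13 ?rd" "exec w (Op Mul 2 2 110) (?C 13 ?rd) = ?C 14 ?re"
    "exec w (Op Or 3 2 2) (?C 14 ?re) = ?C 15 ?rf"
    by (simp_all add: inp_facts mods tb orS w0)
  have c: "c = ?C 15 ?rf" unfolding c_def mm prefix_code_def by (simp only: fold_simps e)
  have "reg c x = vr s0 x" if "x < 100" for x using that by (auto simp: c s0_def)
  moreover have "mem c = inp" by (simp add: c)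
  moreover have "inp (S + k) = 0" for k using S_large(2) by (simp add: inp)
  moreover have "bnd s0" using S_w less_exp[of w] by (simp add: bnd_def s0_def)
  ultimately show ?thesis by (simp add: rel_def) (simp add: s0_def)
qed

lemma machine_correct:
  assumes r: "runs whole s0 T s'" and v: "vr s' 12 = m + 1" and o: "(\<Sum>i<m+1. ar s' 11 0 i * (2 ^ w) ^ i) = ind H G"
    and T: "T + 20 \<le> T'"
  shows "computes_within w machine (encode As @ encode Bs) T' (ind H G)"
proof -
  let ?c0 = "initial w (encode As @ encode Bs)" and ?l = "length prefix_code"
  let ?p = "pcode whole ?l"
  have sg: "seg machine 0 prefix_code" "seg machine ?l ?p" "seg machine (?l + length ?p) suffix_code"
  proof -
    have "seg machine 0 (prefix_code @ ?p @ suffix_code)" unfolding seg_def machine_def by (intro exI[of _ "[]"]) simp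
    then show "seg machine 0 prefix_code" "seg machine ?l ?p" "seg machine (?l + length ?p) suffix_code"
      unfolding seg_append by simp_all
  qed
  define c1 where "c1 = fold (exec w) prefix_code ?c0"
  have s1: "(step w machine ^^ ?l) ?c0 = c1" "pc c1 = ?l"
  proof -
    have st: "list_all straight prefix_code" "pc ?c0 = 0" by (simp_all add: prefix_code_def initial_def)
    from steps_straight[OF sg(1) st(2,1), of w] show "(step w machine ^^ ?l) ?c0 = c1" "pc c1 = ?l" unfolding c1_def by simp_all
  qed
  have l: "?l = 15" "length suffix_code = 5" by (simp_all add: prefix_code_def suffix_code_def)
  obtain c2 where c2: "reach machine c1 T c2" "rel s' c2" "pc c2 = ?l + length ?p"
    using pcode_correct[OF r prefix_rel[folded c1_def]] sg(2) s1(2) by auto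
  define c3 where "c3 = fold (exec w) suffix_code c2"
  have s3: "(step w machine ^^ 5) c2 = c3" "pc c3 = ?l + length ?p + 5"
  proof -
    have "list_all straight suffix_code" by (simp add: suffix_code_def)
    from steps_straight[OF sg(3) c2(3) this, of w] show "(step w machine ^^ 5) c2 = c3" "pc c3 = ?l + length ?p + 5"
      unfolding l(2) c3_def by blast+
  qed
  have "reach machine ?c0 15 c1" using s1(1) l(1) unfolding reach_def by auto
  moreover have "reach machine c2 5 c3" using s3(1) unfolding reach_def by auto
  ultimately have "reach machine ?c0 (15 + T + 5) c3" using c2(1) reach_trans by metis
  then have "reach machine ?c0 T' c3" by (rule reach_mono) (use T in simp)
  then obtain t where t: "t \<le> T'" "(step w machine ^^ t) ?c0 = c3" unfolding reach_def by blast
  have h: "halted machine c3" using s3(2) l by (simp add: halted_def machine_def)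
  \<comment> \<open>A halted configuration is a fixed point, so stopping early still gives the right
    configuration after exactly T' steps.\<close>
  have "(step w machine ^^ k) c3 = c3" for k by (induction k) (simp_all add: step_def h)
  then have e: "(step w machine ^^ T') ?c0 = c3" using t pow_append[of t w machine ?c0 c3 "T' - t" c3] by simp
  have rg: "reg c2 2 = S" "reg c2 3 = S" "reg c2 12 = m + 1" using c2(2) v by (simp_all add: rel_def)
  have mS: "m + 1 < S" using S_large N_eq by linarith
  have w': "11 * S < 2 ^ w" "11 * S * S < 2 ^ w" "11 * S * S + S < 2 ^ w" "Suc m < 2 ^ w"
    using cell_bound(1,3,4)[of 11 0 0] S_pos mS S_w by simp_all
  have tb: "take_bit w 11 = (11 :: nat)" "take_bit w (Suc m) = Suc m"
  proof -
    have "(2 :: nat) ^ 18 \<le> 2 ^ w" using w_large by (intro power_increasing) auto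
    then have "(11 :: nat) < 2 ^ w" by simp
    then show "take_bit w 11 = (11 :: nat)" by (rule take_bit_nat_eq_self)
    show "take_bit w (Suc m) = Suc m" using w'(4) by (rule take_bit_nat_eq_self)
  qed
  have r3: "reg c3 0 = 11 * S * S + S" "reg c3 1 = m + 1" "mem c3 = mem c2"
    unfolding c3_def suffix_code_def using rg w' by (simp_all add: tb binop_val.simps(7))
  have me: "mem c2 (11 * S * S + S + i) = ar s' 11 0 i" if "i < m + 1" for i
  proof -
    have q: "\<forall>a<20. \<forall>i<S. \<forall>j<S. mem c2 (S + ((a * S + i) * S + j)) = ar s' a i j" using c2(2) by (simp add: rel_def)
    have "mem c2 (S + ((11 * S + 0) * S + i)) = ar s' 11 0 i" by (rule q[rule_format]) (use that mS S_pos in simp_all)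
    then show ?thesis by (simp add: add_ac)
  qed
  have "output_value w c3 = (\<Sum>i<m+1. ar s' 11 0 i * (2 ^ w) ^ i)"
    unfolding output_value_def r3 by (intro sum.cong) (use me in \<open>simp_all add: power_mult\<close>)
  then show ?thesis unfolding computes_within_def Let_def e using h o by simp
qed

end

text \<open>Vertices, offsets and lengths are all smaller than the encoding is long; hence every
  input number fits into a word.\<close>

lemma encode_le:
  assumes "simple_graph K" "adjacency_lists K A" "x \<in> set (encode A)"
  shows "x < length (encode A)"
proof -
  have p: "length (concat (take v A)) \<le> length (concat A)" for v
    by (metis append_take_drop_id concat_append le_add1 length_append)
  have q: "x < length A" if "l \<in> set A" "x \<in> set l" for l
  proof -
    obtain v where "v < length A" "l = A ! v" using \<open>l \<in> set A\<close> by (auto simp: in_set_conv_nth)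
    then have "{x, v} \<in> edges K" using assms(2) that(2) by (auto simp: adjacency_lists_def nbrs_def)
    then have "x \<in> verts K" using assms(1) by (auto simp: simple_graph_def)
    then show ?thesis using assms(2) by (simp add: adjacency_lists_def)
  qed
  have "x = length A \<or> (\<exists>v. x = length (concat (take v A))) \<or> (\<exists>l\<in>set A. x \<in> set l)"
    using assms(3) by (auto simp: encode_def simp del: upt_Suc)
  then show ?thesis unfolding length_encode
  proof (elim disjE exE bexE)
    fix v assume "x = length (concat (take v A))"
    then show "x < length A + 2 + length (concat A)" using p[of v] by linarith
  next
    fix l assume "l \<in> set A" "x \<in> set l"
    then have "x < length A" by (rule q)
    then show "x < length A + 2 + length (concat A)" by linarith
  qed simp
qed

theorem theorem1p1:
  "\<exists>(P :: program) (\<kappa> :: nat) (C :: nat) (d :: nat). 0 < \<kappa> \<and>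
     (\<forall>(G :: nat graph) (H :: nat graph) A B (n :: nat) (m :: nat) (\<Delta> :: nat) (w :: nat).
        simple_graph G \<longrightarrow> card (verts G) = n \<longrightarrow> max_degree_at_most G \<Delta> \<longrightarrow>
        simple_graph H \<longrightarrow> card (verts H) = m \<longrightarrow>
        adjacency_lists G A \<longrightarrow> adjacency_lists H B \<longrightarrow>
        real \<kappa> * log 2 (real (length (encode A @ encode B))) \<le> real w \<longrightarrow>
        computes_within w P (encode A @ encode B)
          (C * (m + 1) ^ d * (n * (4 * \<Delta>) ^ (2 * m) + 2 ^ (10 * m)))
          (ind H G))"
\<comment> \<open>The 9 gives N^9 \<le> 2^w for input length N. Twenty arrays of side N^3 and the
  input region take at most 21 N^6 cells, which is below N^9 because N \<ge> 4. The exponent is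
  doubled since loops are measured by L = (m + 1)^2.\<close>
proof (rule exI[of _ machine], rule exI[of _ "9 :: nat"], rule exI[of _ totK], rule exI[of _ "2 * totE"], intro conjI allI impI)
  fix G H :: "nat graph" and As Bs and n m \<Delta> w :: nat
  assume G: "simple_graph G" "card (verts G) = n" "max_degree_at_most G \<Delta>" and H: "simple_graph H" "card (verts H) = m"
    and a: "adjacency_lists G As" "adjacency_lists H Bs" and w: "real 9 * log 2 (real (length (encode As @ encode Bs))) \<le> real w"
  define N where "N = length (encode As @ encode Bs)"
  have n: "length As = n" "length Bs = m" using G H a by (auto simp: adjacency_lists_def)
  have N: "N = n + 2 + length (concat As) + (m + 2 + length (concat Bs))" by (simp add: N_def length_encode n)
  have Nw: "N ^ 9 \<le> 2 ^ w"
  proof -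
    have N0: "0 < N" using N by simp
    have "9 * log 2 (real N) \<le> real w" using w unfolding N_def by (simp only: of_nat_numeral)
    then have "log 2 (real N ^ 9) \<le> real w" using log_nat_power[of "real N" 2 9] N0 by simp
    then have "real N ^ 9 \<le> 2 powr real w" using N0 log_le_iff[of 2 "real N ^ 9" "real w"] by simp
    then have "real (N ^ 9) \<le> real (2 ^ w)" by (simp add: powr_realpow)
    then show ?thesis by (simp only: of_nat_le_iff)
  qed
  define inp where "inp = (\<lambda>a. if a < N then (encode As @ encode Bs) ! a else 0)"
  have N4: "4 \<le> N" using N by simp
  have N3: "64 \<le> N ^ 3" using power_mono[OF N4, of 3] by simp
  have Nle: "N * 1 \<le> N * N ^ 8" using N4 by (intro mult_le_mono2) simp
  have "N * N ^ 8 = N ^ 9" using power_Suc[of N 8] by simp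
  then have N_w: "N \<le> 2 ^ w" using Nle Nw by linarith
  \<comment> \<open>Halving an odd word length loses up to a factor 2 in b^2; one of the nine
    factors N makes up for it: otherwise 2^w \<le> 2 b^2 \<le> 2 N^8 < N^9.\<close>
  have Nb: "N ^ 4 \<le> 2 ^ (w div 2)"
  proof (rule ccontr)
    assume "\<not> N ^ 4 \<le> 2 ^ (w div 2)"
    then have "2 ^ (w div 2) * 2 ^ (w div 2) \<le> N ^ 4 * N ^ 4" by (intro mult_le_mono) auto
    then have 1: "2 * (2 ^ (w div 2) * 2 ^ (w div 2)) \<le> 2 * (N ^ 4 * N ^ 4)" by (rule mult_le_mono2)
    have "(2 :: nat) ^ w \<le> 2 ^ (1 + (w div 2 + w div 2))" by (intro power_increasing) auto
    also have "\<dots> = 2 * (2 ^ (w div 2) * 2 ^ (w div 2))" by (simp only: power_add power_one_right)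
    also note 1
    also have "2 * (N ^ 4 * N ^ 4) < N * (N ^ 4 * N ^ 4)" using N4 by (intro mult_strict_right_mono) auto
    also have "\<dots> = N ^ 9" using power_Suc[of N 8] by (simp add: power_add[symmetric])
    finally show False using Nw by simp
  qed
  have mN: "m + 1 \<le> N" using N by simp
  interpret job w "N ^ 3" inp "2 ^ (w div 2)" "(m + 1) * (m + 1)" G H As Bs n m N "length (encode As)"
  proof unfold_locales
    show "0 < N ^ 3" using N4 by simp
    show "\<forall>a<N ^ 3. inp a < 2 ^ w"
    proof (intro allI impI)
      fix a' assume "a' < N ^ 3"
      have "inp a' < N"
      proof (cases "a' < N")
        case True
        then have "(encode As @ encode Bs) ! a' \<in> set (encode As) \<union> set (encode Bs)"
          using nth_mem[of a' "encode As @ encode Bs"] by (simp add: N_def)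
        then show ?thesis using True encode_le[OF G(1) a(1)] encode_le[OF H(1) a(2)] by (fastforce simp: inp_def N_def)
      qed (use N4 in \<open>simp add: inp_def\<close>)
      then show "inp a' < 2 ^ w" using N_w by linarith
    qed
    show "N ^ 3 + 20 * N ^ 3 * N ^ 3 \<le> 2 ^ w"
    proof -
      have gen: "q + 20 * q * q \<le> 21 * (q * q)" if "1 \<le> q" for q :: nat
        using mult_le_mono2[OF that, of q] by (simp add: mult.assoc)
      have "1 \<le> N ^ 3" using N3 by linarith
      then have "N ^ 3 + 20 * N ^ 3 * N ^ 3 \<le> 21 * (N ^ 3 * N ^ 3)" by (rule gen)
      also have "\<dots> \<le> N ^ 3 * (N ^ 3 * N ^ 3)" using N3 by (intro mult_le_mono1) linarith
      also have "\<dots> = N ^ 9" by (simp only: power_add[symmetric]) simp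
      finally show ?thesis using Nw by simp
    qed
    show "2 \<le> (2 :: nat) ^ (w div 2)"
    proof -
      have "(4 :: nat) ^ 4 \<le> N ^ 4" using N4 by (intro power_mono) auto
      then show ?thesis using Nb by simp
    qed
    show "2 ^ (w div 2) * 2 ^ (w div 2) \<le> (2 :: nat) ^ w"
      unfolding power_add[symmetric] by (intro power_increasing) auto
    show "1 \<le> (m + 1) * (m + 1)" by simp
    have "(m + 1) * (m + 1) \<le> N * N" using mN by (intro mult_le_mono)
    also have "\<dots> \<le> N ^ 3" using N4 by (simp add: eval_nat_numeral)
    finally show "(m + 1) * (m + 1) \<le> N ^ 3" .
    show "inp a' = (if a' < N then (encode As @ encode Bs) ! a' else 0)" for a' by (simp add: inp_def)
  qed (use G H a n N_def Nb Nw N4 in simp_all)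
  have "\<forall>u<n. length (As ! u) \<le> \<Delta>"
  proof (intro allI impI)
    fix u assume "u < n"
    then have u: "u \<in> verts G" "distinct (As ! u)" "set (As ! u) = nbrs G u" using a(1) n by (auto simp: adjacency_lists_def)
    have "card (nbrs G u) \<le> \<Delta>" using G(3) u(1) by (simp add: max_degree_at_most_def)
    then show "length (As ! u) \<le> \<Delta>" using distinct_card[OF u(2)] u(3) by simp
  qed
  then obtain s' where s': "runs whole s0 ((totK - 20) * (((m + 1) * (m + 1)) ^ totE * (n * (4 * \<Delta>) ^ (2 * m) + 2 ^ (10 * m)))) s'"
     "vr s' 12 = m + 1" "(\<Sum>i<m+1. ar s' 11 0 i * (2 ^ w) ^ i) = ind H G"
    using whole_runs by blast
  show "computes_within w machine (encode As @ encode Bs) (totK * (m + 1) ^ (2 * totE) * (n * (4 * \<Delta>) ^ (2 * m) + 2 ^ (10 * m))) (ind H G)"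
  proof (rule machine_correct[OF s'])
    let ?Y = "n * (4 * \<Delta>) ^ (2 * m) + 2 ^ (10 * m)"
    let ?Q = "(m + 1) ^ (2 * totE) * ?Y"
    have A: "((m + 1) * (m + 1)) ^ totE = (m + 1) ^ (2 * totE)" by (simp only: power_mult power2_eq_square)
    have B: "1 \<le> ?Q" by (simp add: Suc_le_eq)
    have D: "totK - 20 + 20 = totK" by (simp add: totK_def)
    have C: "totK * ?Q = (totK - 20) * ?Q + 20 * ?Q" using distrib_right[of "totK - 20" 20 ?Q] unfolding D .
    have E: "20 \<le> 20 * ?Q" using mult_le_mono2[OF B, of 20] by (simp only: mult_1_right)
    have "(totK - 20) * (((m + 1) * (m + 1)) ^ totE * ?Y) + 20 = (totK - 20) * ?Q + 20" by (simp only: A)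
    also have "\<dots> \<le> (totK - 20) * ?Q + 20 * ?Q" by (rule add_left_mono[OF E])
    also have "\<dots> = totK * (m + 1) ^ (2 * totE) * ?Y" unfolding C[symmetric] by (simp only: mult.assoc)
    finally show "(totK - 20) * (((m + 1) * (m + 1)) ^ totE * ?Y) + 20 \<le> totK * (m + 1) ^ (2 * totE) * ?Y" .
  qed
qed simp

end
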